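(* Let $m$ be a positive integer, $G_1$ a non-abelian finite subgroup of $\mathrm{SL}_2(k)$ and $G = (2m,2m;G_1,G_1)=\mu_{2m}G_1<\mathrm{GL}_2(k)$. Then $H^2(G,k^* )\simeq \mathrm{Hom}(\mu_m,(G_1/\langle \widehat{-1} \rangle)^{\vee})$. Let $\eta \in \mathrm{Hom}(\mu_m,(G_1/\langle \widehat{-1} \rangle)^{\vee})$ and let $\chi = \eta(\zeta_m)$, considered as a character of $G_1$, of order $e$ say. Let $H = \ker \chi$ and let $g_1 \in G_1$ be an element with $\chi(g_1) = \zeta_e$ and $g_1^e = \widehat{-1}$. Then $$\mathrm{McK}_\eta(G) = (\mathbb{Z}\times\Delta_H)^{ev}/\langle [+2m/e] \times \rho\rangle$$ where $\rho$ is the outer automorphism of $\Delta_H$ induced by conjugation by $g_1$.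
   Context: $k$ is an algebraically closed field of characteristic zero, $\mu_m$ is the group of $m$-th roots of unity in $k$, and $\zeta_m$ is a chosen generator of $\mu_m$, the choices being compatible: $\zeta_{mn}^n=\zeta_m$. $M^\vee=\mathrm{Hom}(M,k^* )$. $\widehat\zeta$ denotes the scalar matrix with entry $\zeta$; note $\widehat{-1}\in G_1$. McKay quivers: for a group $F$ and representation $V$, $\mathrm{McK}(F,V)$ has vertices the irreducible representations and the number of arrows $\lambda\to\lambda'$ is the multiplicity of $\lambda'$ in $\lambda\otimes V$. For $G<\mathrm{GL}_2(k)$ finite, $V=k^2$ its natural representation, and $\eta\in H^2(G,k^* )$ with associated central extension $1\to k^*\to\widetilde G\to G\to1$, $\mathrm{McK}_\eta(G)$ is the full subquiver of $\mathrm{McK}(\widetilde G,V)$ on the irreducible $\widetilde G$-modules on which $k^*$ acts by scalar multiplication. Identification of $\eta$: the element of $H^2(G,k^* )$ corresponding to a homomorphism $\mu_m\to(G_1/\langle\widehat{-1}\rangle)^\vee$ sending $\zeta_m$ to $\chi$ is the class of the central extension $\widetilde G=\langle k^*\times G_1,\widetilde\zeta\mid\widetilde\zeta^{\,m}=(1,\widehat{-1}),\ \widetilde\zeta(\alpha,g)=(\alpha\chi(g),g)\widetilde\zeta\ (\alpha\in k^*, g\in G_1)\rangle$, where $\widetilde\zeta$ maps to $\widehat{\zeta_{2m}}\in G$. For a finite subgroup $H<\mathrm{SL}_2(k)$ containing $\widehat{-1}$, $\Delta_H=\mathrm{McK}(H,k^2)$ (the double of an extended Dynkin quiver). $\mathbb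 Z$ denotes the quiver with vertices $j\in\mathbb Z$ and arrows $j\to j+1$, and $[+a]$ its translation automorphism $j\mapsto j+a$. The product quiver $Q_1\times Q_2$ has vertices the pairs of vertices and arrows the pairs of arrows. A vertex $\lambda$ of $\Delta_H$ is even if $\widehat{-1}$ acts trivially on $\lambda$ and odd otherwise; $(\mathbb Z\times\Delta_H)^{ev}$ is the full subquiver of $\mathbb Z\times\Delta_H$ on the vertices $(j,\lambda)$ where $j$ and $\lambda$ have the same parity. An element $g$ normalising $H$ induces an automorphism of $\Delta_H$ by precomposing representations of $H$ with conjugation by $g$. Equality of quivers means isomorphism. *)

theory Defs
  imports
    "HOL-Algebra.Elementary_Groups"
    "HOL-Algebra.Generated_Groups"
    "HOL-Algebra.Multiplicative_Group"
    "Jordan_Normal_Form.VS_Connect"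
    "Graph_Theory.Graph_Theory"
begin

section \<open>Linear groups, roots of unity, character groups\<close>

abbreviation kstar :: "'k::field monoid" where
  "kstar \<equiv> units_of class_ring"

definition GL :: "nat \<Rightarrow> 'k::field mat monoid" where
  "GL n = units_of (ring_mat TYPE('k) n ())"

definition SL :: "nat \<Rightarrow> 'k::field mat set" where
  "SL n = {A \<in> carrier (GL n). det A = 1}"

definition scalar :: "'k::field \<Rightarrow> 'k mat" where
  "scalar a = a \<cdot>\<^sub>m 1\<^sub>m 2"

definition lin_group :: "'k::field mat set \<Rightarrow> 'k mat monoid" where
  "lin_group H = (GL 2)\<lparr>carrier := H\<rparr>"

definition roots_group :: "nat \<Rightarrow> 'k::field monoid" where
  "roots_group m = kstar\<lparr>carrier := {x. x ^ m = 1}\<rparr>"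

definition compatible_generators :: "(nat \<Rightarrow> 'k::field) \<Rightarrow> bool" where
  "compatible_generators \<zeta> \<longleftrightarrow>
     (\<forall>n>0. generate kstar {\<zeta> n} = carrier (roots_group n)) \<and>
     (\<forall>m>0. \<forall>n>0. \<zeta> (m * n) ^ n = \<zeta> m)"

definition Hom_group :: "('a, 'x) monoid_scheme \<Rightarrow> ('b, 'y) monoid_scheme \<Rightarrow> ('a \<Rightarrow> 'b) monoid" where
  "Hom_group A B =
     \<lparr>carrier = hom A B \<inter> extensional (carrier A),
      monoid.mult = (\<lambda>f g. \<lambda>x\<in>carrier A. f x \<otimes>\<^bsub>B\<^esub> g x),
      one = (\<lambda>x\<in>carrier A. \<one>\<^bsub>B\<^esub>)\<rparr>"

abbreviation dual_group :: "('a, 'x) monoid_scheme \<Rightarrow> ('a \<Rightarrow> 'k::field) monoid" where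
  "dual_group M \<equiv> Hom_group M kstar"

text \<open>The group \<open>(2m,2m;G\<^sub>1,G\<^sub>1) = \<mu>\<^bsub>2m\<^esub> G\<^sub>1\<close>.\<close>

definition mu_G1 :: "nat \<Rightarrow> 'k::field mat set \<Rightarrow> 'k mat set" where
  "mu_G1 m G1 = {a \<cdot>\<^sub>m g | a g. a \<in> carrier (roots_group (2 * m)) \<and> g \<in> G1}"


section \<open>Second cohomology with trivial coefficients in the multiplicative group\<close>

definition cocycle_group :: "('a, 'x) monoid_scheme \<Rightarrow> ('a \<times> 'a \<Rightarrow> 'k::field) monoid" where
  "cocycle_group G =
     \<lparr>carrier = {c \<in> (carrier G \<times> carrier G) \<rightarrow>\<^sub>E carrier kstar.
        \<forall>x\<in>carrier G. \<forall>y\<in>carrier G. \<forall>z\<in>carrier G.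
          c (x, y) * c (x \<otimes>\<^bsub>G\<^esub> y, z) = c (y, z) * c (x, y \<otimes>\<^bsub>G\<^esub> z)},
      monoid.mult = (\<lambda>c d. \<lambda>p\<in>carrier G \<times> carrier G. c p * d p),
      one = (\<lambda>p\<in>carrier G \<times> carrier G. 1)\<rparr>"

definition coboundaries :: "('a, 'x) monoid_scheme \<Rightarrow> ('a \<times> 'a \<Rightarrow> 'k::field) set" where
  "coboundaries G =
     {(\<lambda>(x, y)\<in>carrier G \<times> carrier G. f x * f y / f (x \<otimes>\<^bsub>G\<^esub> y)) | f.
        f \<in> carrier G \<rightarrow> carrier kstar}"

definition H2 :: "('a, 'x) monoid_scheme \<Rightarrow> ('a \<times> 'a \<Rightarrow> 'k::field) set monoid" where
  "H2 G = cocycle_group G Mod coboundaries G"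

definition central_extension ::
    "('a, 'x) monoid_scheme \<Rightarrow> ('e, 'y) monoid_scheme \<Rightarrow> ('k::field \<Rightarrow> 'e) \<Rightarrow> ('e \<Rightarrow> 'a) \<Rightarrow> bool" where
  "central_extension G E \<iota> \<pi> \<longleftrightarrow>
     group E \<and> \<iota> \<in> mon kstar E \<and> \<pi> \<in> epi E G \<and>
     \<iota> ` carrier kstar = kernel E G \<pi> \<and>
     (\<forall>a\<in>carrier kstar. \<forall>x\<in>carrier E. \<iota> a \<otimes>\<^bsub>E\<^esub> x = x \<otimes>\<^bsub>E\<^esub> \<iota> a)"

text \<open>The cocycles obtained from all set-theoretic sections \<open>s\<close> form one coset of the
  coboundaries, i.e. an element of \<open>H2 G\<close>.\<close>

definition extension_class ::
    "('a, 'x) monoid_scheme \<Rightarrow> ('e, 'y) monoid_scheme \<Rightarrow> ('k::field \<Rightarrow> 'e) \<Rightarrow> ('e \<Rightarrow> 'a)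
       \<Rightarrow> ('a \<times> 'a \<Rightarrow> 'k) set" where
  "extension_class G E \<iota> \<pi> =
     {c \<in> carrier (cocycle_group G). \<exists>s \<in> carrier G \<rightarrow> carrier E.
        (\<forall>x\<in>carrier G. \<pi> (s x) = x) \<and>
        (\<forall>x\<in>carrier G. \<forall>y\<in>carrier G. s x \<otimes>\<^bsub>E\<^esub> s y = \<iota> (c (x, y)) \<otimes>\<^bsub>E\<^esub> s (x \<otimes>\<^bsub>G\<^esub> y))}"


section \<open>The central extension attached to a character\<close>

definition minus_one_group :: "'k::field mat set" where
  "minus_one_group = generate (GL 2) {scalar (- 1)}"

text \<open>\<open>\<eta>(\<zeta>\<^sub>m)\<close>, a character of \<open>G\<^sub>1/\<langle>-1\<rangle>\<close>, considered as a character of \<open>G\<^sub>1\<close>.\<close>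

definition character_of ::
    "(nat \<Rightarrow> 'k::field) \<Rightarrow> nat \<Rightarrow> 'k mat set \<Rightarrow> ('k \<Rightarrow> 'k mat set \<Rightarrow> 'k) \<Rightarrow> 'k mat \<Rightarrow> 'k" where
  "character_of \<zeta> m G1 \<eta> = (\<lambda>g\<in>G1. \<eta> (\<zeta> m) (minus_one_group #>\<^bsub>lin_group G1\<^esub> g))"

text \<open>The group generated by \<open>k\<^sup>* \<times> G\<^sub>1\<close> and an element \<open>z\<close> subject to
  \<open>z (\<alpha>,g) = (\<alpha> \<chi>(g), g) z\<close> is the semidirect product of \<open>k\<^sup>* \<times> G\<^sub>1\<close> by the
  infinite cyclic group generated by \<open>z\<close>; the triple \<open>(\<alpha>, g, i)\<close> stands for \<open>(\<alpha>,g) z\<^sup>i\<close>.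
  Imposing \<open>z\<^sup>m = (1,-1)\<close> amounts to dividing by the normal closure of
  \<open>z\<^sup>m (1,-1)\<^sup>-\<^sup>1\<close>.\<close>

definition semidirect :: "('k::field mat \<Rightarrow> 'k) \<Rightarrow> 'k mat set \<Rightarrow> ('k \<times> 'k mat \<times> int) monoid" where
  "semidirect \<chi> G1 =
     \<lparr>carrier = carrier kstar \<times> G1 \<times> UNIV,
      monoid.mult = (\<lambda>(a, g, i) (b, h, j). (a * b * \<chi> h powi i, g * h, i + j)),
      one = (1, 1\<^sub>m 2, 0)\<rparr>"

definition normal_closure :: "('a, 'x) monoid_scheme \<Rightarrow> 'a set \<Rightarrow> 'a set" where
  "normal_closure G R = \<Inter> {N. N \<lhd> G \<and> R \<subseteq> N}"

definition relators :: "nat \<Rightarrow> ('k::field mat \<Rightarrow> 'k) \<Rightarrow> 'k mat set \<Rightarrow> ('k \<times> 'k mat \<times> int) set" where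
  "relators m \<chi> G1 = normal_closure (semidirect \<chi> G1)
     {(1, 1\<^sub>m 2, int m) \<otimes>\<^bsub>semidirect \<chi> G1\<^esub> inv\<^bsub>semidirect \<chi> G1\<^esub> (1, scalar (- 1), 0)}"

definition ext_group ::
    "nat \<Rightarrow> ('k::field mat \<Rightarrow> 'k) \<Rightarrow> 'k mat set \<Rightarrow> ('k \<times> 'k mat \<times> int) set monoid" where
  "ext_group m \<chi> G1 = semidirect \<chi> G1 Mod relators m \<chi> G1"

definition ext_incl ::
    "nat \<Rightarrow> ('k::field mat \<Rightarrow> 'k) \<Rightarrow> 'k mat set \<Rightarrow> 'k \<Rightarrow> ('k \<times> 'k mat \<times> int) set" where
  "ext_incl m \<chi> G1 a = relators m \<chi> G1 #>\<^bsub>semidirect \<chi> G1\<^esub> (a, 1\<^sub>m 2, 0)"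

text \<open>On a coset, \<open>(\<alpha>,g) z\<^sup>i \<mapsto> \<zeta>\<^bsub>2m\<^esub>\<^sup>i g\<close> is constant.\<close>

definition ext_proj ::
    "(nat \<Rightarrow> 'k::field) \<Rightarrow> nat \<Rightarrow> ('k \<times> 'k mat \<times> int) set \<Rightarrow> 'k mat" where
  "ext_proj \<zeta> m X = the_elem ((\<lambda>(a, g, i). (\<zeta> (2 * m) powi i) \<cdot>\<^sub>m g) ` X)"

definition class_of_hom ::
    "(nat \<Rightarrow> 'k::field) \<Rightarrow> nat \<Rightarrow> 'k mat set \<Rightarrow> ('k \<Rightarrow> 'k mat set \<Rightarrow> 'k)
       \<Rightarrow> ('k mat \<times> 'k mat \<Rightarrow> 'k) set" where
  "class_of_hom \<zeta> m G1 \<eta> =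
     (let \<chi> = character_of \<zeta> m G1 \<eta> in
      extension_class (lin_group (mu_G1 m G1))
        (ext_group m \<chi> G1) (ext_incl m \<chi> G1) (ext_proj \<zeta> m))"


section \<open>Matrix representations\<close>

text \<open>A representation on \<open>k\<^sup>n\<close> is a pair \<open>(n, \<sigma>)\<close>; values of \<open>\<sigma>\<close> outside the carrier of
  the group are irrelevant.\<close>

type_synonym ('g, 'k) rep = "nat \<times> ('g \<Rightarrow> 'k mat)"

definition reps :: "('g, 'x) monoid_scheme \<Rightarrow> ('g, 'k::field) rep set" where
  "reps F = {(n, \<sigma>). \<sigma> \<in> hom F (GL n)}"

definition rep_iso :: "('g, 'x) monoid_scheme \<Rightarrow> ('g, 'k::field) rep \<Rightarrow> ('g, 'k) rep \<Rightarrow> bool" where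
  "rep_iso F = (\<lambda>(n, \<sigma>) (n', \<tau>). n = n' \<and>
     (\<exists>P\<in>carrier (GL n). \<forall>g\<in>carrier F. P * \<sigma> g = \<tau> g * P))"

definition irreducible_rep :: "('g, 'x) monoid_scheme \<Rightarrow> ('g, 'k::field) rep \<Rightarrow> bool" where
  "irreducible_rep F = (\<lambda>(n, \<sigma>). (n, \<sigma>) \<in> reps F \<and> n > 0 \<and>
     (\<forall>W. subspace class_ring W (module_vec TYPE('k) n) \<longrightarrow>
        (\<forall>g\<in>carrier F. \<forall>w\<in>W. \<sigma> g *\<^sub>v w \<in> W) \<longrightarrow> W = {0\<^sub>v n} \<or> W = carrier_vec n))"

definition iso_class :: "('g, 'x) monoid_scheme \<Rightarrow> ('g, 'k::field) rep \<Rightarrow> ('g, 'k) rep set" where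
  "iso_class F L = {M \<in> reps F. rep_iso F L M}"

definition Irr :: "('g, 'x) monoid_scheme \<Rightarrow> ('g, 'k::field) rep set set" where
  "Irr F = iso_class F ` {L. irreducible_rep F L}"

definition kronecker :: "'k::field mat \<Rightarrow> 'k mat \<Rightarrow> 'k mat" where
  "kronecker A B = mat (dim_row A * dim_row B) (dim_col A * dim_col B)
     (\<lambda>(i, j). A $$ (i div dim_row B, j div dim_col B) * B $$ (i mod dim_row B, j mod dim_col B))"

definition tensor_rep :: "('g, 'k::field) rep \<Rightarrow> ('g, 'k) rep \<Rightarrow> ('g, 'k) rep" where
  "tensor_rep = (\<lambda>(n, \<sigma>) (n', \<tau>). (n * n', \<lambda>g. kronecker (\<sigma> g) (\<tau> g)))"

definition direct_sum_rep :: "('g, 'k::field) rep list \<Rightarrow> ('g, 'k) rep" where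
  "direct_sum_rep Ls = (sum_list (map fst Ls), \<lambda>g. diag_block_mat (map (\<lambda>L. snd L g) Ls))"

text \<open>The number of summands of type \<open>\<phi>\<close> in a decomposition of \<open>W\<close> into irreducibles. It is
  well defined for the completely reducible representations \<open>W\<close> to which it is applied.\<close>

definition multiplicity_in ::
    "('g, 'x) monoid_scheme \<Rightarrow> ('g, 'k::field) rep set \<Rightarrow> ('g, 'k) rep \<Rightarrow> nat" where
  "multiplicity_in F \<phi> W = (THE r. \<exists>Ls. (\<forall>L\<in>set Ls. irreducible_rep F L) \<and>
     rep_iso F W (direct_sum_rep Ls) \<and> r = length (filter (\<lambda>L. L \<in> \<phi>) Ls))"


section \<open>Quivers\<close>

text \<open>Quivers are \<open>pre_digraph\<close>s; the \<open>tail\<close> of an arrow is its source. The arrows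
  \<open>\<phi> \<rightarrow> \<psi>\<close> of a McKay quiver are numbered \<open>(\<phi>, \<psi>, i)\<close>, \<open>i = 0, 1, \<dots>\<close>. Only
  finite-dimensional modules occur; irreducible modules on which the kernel \<open>k\<^sup>*\<close> of a central
  extension of a finite group acts by scalar multiplication are automatically of this kind.\<close>

type_synonym ('g, 'k) mckay_arrow = "('g, 'k) rep set \<times> ('g, 'k) rep set \<times> nat"

definition McK ::
    "('g, 'x) monoid_scheme \<Rightarrow> ('g, 'k::field) rep \<Rightarrow> (('g, 'k) rep set, ('g, 'k) mckay_arrow) pre_digraph" where
  "McK F V =
     \<lparr>verts = Irr F,
      arcs = {(\<phi>, \<psi>, i). \<phi> \<in> Irr F \<and> \<psi> \<in> Irr F \<and>
                (\<exists>L\<in>\<phi>. i < multiplicity_in F \<psi> (tensor_rep L V))},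
      tail = (\<lambda>(\<phi>, \<psi>, i). \<phi>),
      head = (\<lambda>(\<phi>, \<psi>, i). \<psi>)\<rparr>"

text \<open>For a central extension \<open>E\<close> of a subgroup of \<open>GL\<^sub>2(k)\<close> by \<open>k\<^sup>*\<close>, the group \<open>E\<close> acts on the
  natural representation through \<open>\<pi>\<close>.\<close>

definition twisted_McK ::
    "('e, 'x) monoid_scheme \<Rightarrow> ('k::field \<Rightarrow> 'e) \<Rightarrow> ('e \<Rightarrow> 'k mat)
       \<Rightarrow> (('e, 'k) rep set, ('e, 'k) mckay_arrow) pre_digraph" where
  "twisted_McK E \<iota> \<pi> = McK E (2, \<pi>) \<restriction>
     {\<phi> \<in> Irr E. \<forall>(n, \<sigma>)\<in>\<phi>. \<forall>a\<in>carrier kstar. \<sigma> (\<iota> a) = a \<cdot>\<^sub>m 1\<^sub>m n}"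

definition Delta :: "'k::field mat set \<Rightarrow> (('k mat, 'k) rep set, ('k mat, 'k) mckay_arrow) pre_digraph" where
  "Delta H = McK (lin_group H) (2, \<lambda>h. h)"

definition even_vertex :: "('k::field mat, 'k) rep set \<Rightarrow> bool" where
  "even_vertex \<phi> \<longleftrightarrow> (\<forall>(n, \<sigma>)\<in>\<phi>. \<sigma> (scalar (- 1)) = 1\<^sub>m n)"

text \<open>The arrow \<open>j \<rightarrow> j+1\<close> of the quiver \<open>\<int>\<close> is named \<open>j\<close>.\<close>

definition Z_quiver :: "(int, int) pre_digraph" where
  "Z_quiver = \<lparr>verts = UNIV, arcs = UNIV, tail = (\<lambda>j. j), head = (\<lambda>j. j + 1)\<rparr>"

definition prod_quiver :: "('a, 'b) pre_digraph \<Rightarrow> ('c, 'd) pre_digraph \<Rightarrow> ('a \<times> 'c, 'b \<times> 'd) pre_digraph" where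
  "prod_quiver Q R =
     \<lparr>verts = verts Q \<times> verts R, arcs = arcs Q \<times> arcs R,
      tail = map_prod (tail Q) (tail R), head = map_prod (head Q) (head R)\<rparr>"

definition Z_Delta_ev ::
    "'k::field mat set \<Rightarrow> (int \<times> ('k mat, 'k) rep set, int \<times> ('k mat, 'k) mckay_arrow) pre_digraph" where
  "Z_Delta_ev H = prod_quiver Z_quiver (Delta H) \<restriction>
     {(j, \<phi>). \<phi> \<in> verts (Delta H) \<and> (even j \<longleftrightarrow> even_vertex \<phi>)}"

text \<open>The automorphism of \<open>Delta H\<close> given by precomposition with conjugation by \<open>g\<close>, which is read as
  \<open>h \<mapsto> g\<^sup>-\<^sup>1 h g\<close>. On arrows it preserves the numbering of parallel arrows; this involves no choice
  unless \<open>H\<close> is generated by \<open>-1\<close>, since otherwise \<open>Delta H\<close> has no parallel arrows.\<close>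

definition conj_verts ::
    "'k::field mat set \<Rightarrow> 'k mat \<Rightarrow> ('k mat, 'k) rep set \<Rightarrow> ('k mat, 'k) rep set" where
  "conj_verts H g \<phi> =
     (\<Union>(n, \<sigma>)\<in>\<phi>. iso_class (lin_group H) (n, \<lambda>h. \<sigma> (inv\<^bsub>GL 2\<^esub> g * h * g)))"

definition conj_arcs ::
    "'k::field mat set \<Rightarrow> 'k mat \<Rightarrow> ('k mat, 'k) mckay_arrow \<Rightarrow> ('k mat, 'k) mckay_arrow" where
  "conj_arcs H g = (\<lambda>(\<phi>, \<psi>, i). (conj_verts H g \<phi>, conj_verts H g \<psi>, i))"

definition shift :: "int \<Rightarrow> int \<Rightarrow> int" where
  "shift a j = j + a"

text \<open>Orbits on \<open>A\<close> of the cyclic group generated by \<open>f\<close>, for \<open>f\<close> restricting to a bijection of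
  \<open>A\<close>.\<close>

definition cyclic_orbit :: "'a set \<Rightarrow> ('a \<Rightarrow> 'a) \<Rightarrow> 'a \<Rightarrow> 'a set" where
  "cyclic_orbit A f x = {y \<in> A. \<exists>n. (f ^^ n) x = y \<or> (f ^^ n) y = x}"

text \<open>The quotient by the group generated by an automorphism \<open>(f, f')\<close>: vertices and arrows are the
  orbits. As \<open>f\<close> and \<open>f'\<close> are compatible with \<open>tail\<close> and \<open>head\<close>, the image under \<open>tail\<close> of an orbit
  of arrows is an orbit of vertices; likewise for \<open>head\<close>.\<close>

definition quotient_quiver ::
    "('a, 'b) pre_digraph \<Rightarrow> ('a \<Rightarrow> 'a) \<Rightarrow> ('b \<Rightarrow> 'b) \<Rightarrow> ('a set, 'b set) pre_digraph" where
  "quotient_quiver Q f f' =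
     \<lparr>verts = cyclic_orbit (verts Q) f ` verts Q, arcs = cyclic_orbit (arcs Q) f' ` arcs Q,
      tail = image (tail Q), head = image (head Q)\<rparr>"

end

theory Submission
  imports Defs "Jordan_Normal_Form.Char_Poly" "HOL-Algebra.Sylow" "HOL-Algebra.Group_Action"
begin

text \<open>
Let \<open>E\<close> be a central extension of \<open>G = \<mu>\<^bsub>2m\<^esub> G\<^sub>1\<close> by \<open>k\<^sup>*\<close>. It splits over \<open>G\<^sub>1\<close> because \<open>H\<^sup>2(G\<^sub>1, k\<^sup>*) = 0\<close>
(\<open>SL2_extension_retraction\<close>): by transfer it suffices to split it over Sylow subgroups, which in \<open>SL\<^sub>2\<close> are cyclic or
generalised quaternion, and there lifts of the generators can be rescaled to satisfy the relations. Conjugation with a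
lift \<open>z\<close> of \<open>\<zeta>\<^bsub>2m\<^esub>\<close> changes the splitting by a character \<open>\<chi>\<close> of \<open>G\<^sub>1\<close>. Rescaling \<open>z\<close> so that \<open>z\<^sup>m\<close> is the lift of
\<open>-1\<close> shows \<open>\<chi>\<^sup>m = 1\<close> and \<open>\<chi>(-1) = 1\<close>, and that \<open>E\<close> has the cocycle \<open>(\<zeta>\<^bsub>2m\<^esub>\<^sup>i g, \<zeta>\<^bsub>2m\<^esub>\<^sup>j h) \<mapsto> \<chi>(h)\<^sup>i\<close>.
Conversely \<open>\<chi>\<close> is read off from the commutators of \<open>z\<close>, which gives the isomorphism \<open>class_of_hom_iso\<close>.

For the quiver, let \<open>H\<close> be the kernel of \<open>\<chi>\<close>. The preimage of \<open>\<mu>\<^bsub>2m\<^esub> H\<close> in \<open>E\<close> is \<open>k\<^sup>* \<times> \<mu>\<^bsub>2m\<^esub> H\<close>. Its irreducible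
representations on which \<open>k\<^sup>*\<close> acts by scalars are given by an irreducible representation \<open>l\<close> of \<open>H\<close> and a residue
\<open>j\<close> modulo \<open>2m\<close> of the same parity, with \<open>z\<close> acting by \<open>\<zeta>\<^bsub>2m\<^esub>\<^sup>j\<close>. Conjugation with \<open>g\<^sub>1\<close> turns \<open>l\<close> into \<open>\<rho> l\<close> and adds
\<open>2m/e\<close> to \<open>j\<close>, because \<open>\<chi>(g\<^sub>1) = \<zeta>\<^sub>e\<close>; its \<open>e\<close>-th power is the shift by \<open>2m\<close>. As the powers of \<open>g\<^sub>1\<close> represent the cosets
of \<open>H\<close> in \<open>G\<^sub>1\<close>, Frobenius reciprocity (\<open>frobenius\<close>, evaluated in \<open>ip_lift\<close>) shows that the representations induced to
\<open>E\<close> are irreducible, that they exhaust the vertices of the quiver (\<open>II_exhaust\<close>), and that two of them are isomorphic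
exactly when the pairs lie in one orbit of \<open>[+2m/e] \<times> \<rho>\<close>. Tensoring with the natural representation raises \<open>j\<close> by one
and acts on \<open>l\<close> as over \<open>H\<close> (\<open>II_mult\<close>), so the arrows correspond as well.

All multiplicities are computed with characters. The letters \<open>ch\<close>, \<open>ze\<close>, \<open>io\<close> and \<open>pj\<close> stand for \<open>\<chi>\<close>, \<open>\<zeta>\<close>, \<open>\<iota>\<close> and \<open>\<pi>\<close>.
\<close>

abbreviation I2 where "I2 \<equiv> 1\<^sub>m 2"

section \<open>Matrices\<close>

lemma carrier_GL: "carrier (GL n) = {A : carrier_mat n n. det A ~= (0::'k::field)}"
proof -
 have "A : carrier_mat n n & det A ~= 0"
  if "A : Units (ring_mat TYPE('k) n ())" for A
  using that unit_imp_det_non_zero[OF that] by (auto simp: Units_def ring_mat_def)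
 thus ?thesis
  by (auto simp: GL_def units_of_def intro: det_non_zero_imp_unit)
qed

lemma mult_GL [simp]: "A \<otimes>\<^bsub>GL n\<^esub> B = A * B"
 by (simp add: GL_def units_of_def ring_mat_def)

lemma one_GL [simp]: "\<one>\<^bsub>GL n\<^esub> = 1\<^sub>m n"
 by (simp add: GL_def units_of_def ring_mat_def)

lemma group_GL: "group (GL n::'k::field mat monoid)"
proof -
 interpret ring "ring_mat TYPE('k) n ()" by (rule ring_mat)
 show ?thesis unfolding GL_def by (rule units_group)
qed

lemma GL_carrier_mat: "A : carrier (GL n) ==> A : carrier_mat n n"
 by (simp add: carrier_GL)

lemma GL_inverse:
 assumes "P : carrier (GL n)"
 obtains Q where "Q : carrier (GL n)" "P * Q = 1\<^sub>m n" "Q * P = 1\<^sub>m n"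
 using group.l_inv_ex[OF group_GL assms] group.r_inv[OF group_GL assms]
  group.l_inv[OF group_GL assms] group.inv_closed[OF group_GL assms] by auto

lemma GL_I:
 assumes "P : carrier_mat n n" "Q : carrier_mat n n" "P * Q = 1\<^sub>m n"
 shows "P : carrier (GL n)"
proof -
 have "det P * det Q = 1" using assms det_mult[of P n Q] by simp
 thus ?thesis using assms by (auto simp: carrier_GL)
qed

lemma mult_mat_entry:
 assumes "A : carrier_mat a b" "B : carrier_mat b c" "i < a" "j < c"
 shows "(A * B) $$ (i,j) = (\<Sum>k<b. A $$ (i,k) * B $$ (k,j))"
 using assms by (auto simp: scalar_prod_def lessThan_atLeast0 intro!: sum.cong)

lemma mult_vec_entry:
 assumes "A : carrier_mat a b" "v : carrier_vec b" "i < a"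
 shows "(A *\<^sub>v v) $ i = (\<Sum>k<b. A $$ (i,k) * v $ k)"
 using assms by (auto simp: scalar_prod_def lessThan_atLeast0 intro!: sum.cong)

definition trace::"'a::comm_monoid_add mat => 'a" where
 "trace A = (\<Sum>i<dim_row A. A $$ (i,i))"

lemma trace_mult_comm:
 assumes "A : carrier_mat a b" "B : carrier_mat b (a::nat)"
 shows "trace (A * B) = trace (B * A::'k::comm_ring_1 mat)"
proof -
 have "trace (A * B) = (\<Sum>i<a. \<Sum>k<b. A $$ (i,k) * B $$ (k,i))"
  using assms by (simp add: trace_def mult_mat_entry[OF assms] del: index_mult_mat(1))
 also have "... = (\<Sum>k<b. \<Sum>i<a. B $$ (k,i) * A $$ (i,k))"
  by (subst sum.swap) (simp add: mult.commute)
 also have "... = trace (B * A)"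
  using assms by (simp add: trace_def mult_mat_entry[OF assms(2,1)] del: index_mult_mat(1))
 finally show ?thesis .
qed

lemma trace_conj:
 assumes "P : carrier (GL n)" "A : carrier_mat n n" "B : carrier_mat n n" "P * A = B * P"
 shows "trace A = trace (B::'k::field mat)"
proof -
 obtain Q where Q: "Q : carrier (GL n)" "P * Q = 1\<^sub>m n" "Q * P = 1\<^sub>m n"
  using GL_inverse[OF assms(1)] .
 note c = GL_carrier_mat[OF assms(1)] GL_carrier_mat[OF Q(1)] assms(2,3)
 have "B = B * (P * Q)" using Q c by simp
 also have "... = (P * A) * Q" using c by (simp add: assms(4) assoc_mult_mat[of _ n n _ n _ n])
 finally have "trace B = trace ((P * A) * Q)" by simp
 also have "... = trace (Q * (P * A))" using c by (intro trace_mult_comm[of _ n n]) auto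
 also have "Q * (P * A) = A" using c Q
  by (simp add: assoc_mult_mat[of _ n n _ n _ n,symmetric])
 finally show ?thesis ..
qed

lemma trace_one [simp]: "trace (1\<^sub>m n::'k::semiring_1 mat) = of_nat n"
 by (simp add: trace_def)

lemma trace_smult: "A : carrier_mat n n ==> trace (c \<cdot>\<^sub>m A) = c * trace (A::'k::semiring_0 mat)"
 by (auto simp: trace_def sum_distrib_left intro!: sum.cong)

lemma sum_div_mod:
 "(\<Sum>k<a*b. f (k div b) (k mod b)) = (\<Sum>i<a. \<Sum>j<(b::nat). f i j::'a::comm_monoid_add)"
proof -
 have "(\<Sum>j\<in>{i*b..<i*b+b}. f (j div b) (j mod b)) = (\<Sum>j<b. f i j)" for i
  by (rule sum.reindex_bij_witness[of _ "%j. i*b+j" "%j. j - i*b"])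
    (auto simp: div_nat_eqI mult.commute le_mod_geq less_diff_conv2
     simp flip: modulo_nat_def minus_div_mult_eq_mod)
 thus ?thesis by (simp add: sum.nat_group[symmetric])
qed

lemma kronecker_carrier [simp]:
 "A : carrier_mat a b ==> B : carrier_mat c d ==> kronecker A B : carrier_mat (a*c) (b*d)"
 by (auto simp: kronecker_def)

lemma div_lt: "k < a * b ==> k div b < (a::nat)" and mod_lt: "k < a * b ==> k mod b < (b::nat)"
 by (auto simp: less_mult_imp_div_less intro!: mod_less_divisor gr_zeroI)

lemma kronecker_mult:
 assumes "A : carrier_mat a b" "C : carrier_mat b c" "B : carrier_mat a' b'" "D : carrier_mat b' c'"
 shows "kronecker A B * kronecker C D = kronecker (A * C) (B * (D::'k::field mat))"
proof (rule eq_matI)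
 note cs = assms
 fix i j assume "i < dim_row (kronecker (A * C) (B * D))" "j < dim_col (kronecker (A * C) (B * D))"
 hence ij: "i < a * a'" "j < c * c'" using cs by (auto simp: kronecker_def)
 note dm = div_lt[OF ij(1)] div_lt[OF ij(2)] mod_lt[OF ij(1)] mod_lt[OF ij(2)]
 have "(kronecker A B * kronecker C D) $$ (i,j)
   = (\<Sum>k<b*b'. kronecker A B $$ (i,k) * kronecker C D $$ (k,j))"
  by (rule mult_mat_entry[of _ "a*a'" "b*b'" _ "c*c'"]) (use cs ij in auto)
 also have "... = (\<Sum>k<b*b'. (A $$ (i div a',k div b') * C $$ (k div b',j div c'))
    * (B $$ (i mod a',k mod b') * D $$ (k mod b',j mod c')))"
  using cs ij by (auto simp: kronecker_def intro!: sum.cong)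
 also have "... = (\<Sum>k<b. \<Sum>l<b'. (A $$ (i div a',k) * C $$ (k,j div c'))
    * (B $$ (i mod a',l) * D $$ (l,j mod c')))"
  by (rule sum_div_mod)
 also have "... = (\<Sum>k<b. A $$ (i div a',k) * C $$ (k,j div c'))
    * (\<Sum>l<b'. B $$ (i mod a',l) * D $$ (l,j mod c'))"
  by (rule sum_product[symmetric])
 also have "... = (A * C) $$ (i div a',j div c') * (B * D) $$ (i mod a',j mod c')"
  using dm by (simp add: mult_mat_entry[OF cs(1,2)] mult_mat_entry[OF cs(3,4)] del: index_mult_mat(1))
 also have "... = kronecker (A * C) (B * D) $$ (i,j)"
  using cs ij by (auto simp: kronecker_def)
 finally show "(kronecker A B * kronecker C D) $$ (i,j) = kronecker (A * C) (B * D) $$ (i,j)" .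
qed (use assms in "auto simp: kronecker_def")

lemma kronecker_one: "kronecker (1\<^sub>m a) (1\<^sub>m b) = (1\<^sub>m (a * b)::'k::field mat)"
proof (rule eq_matI)
 fix i j assume "i < dim_row (1\<^sub>m (a * b)::'k mat)" "j < dim_col (1\<^sub>m (a * b)::'k mat)"
 hence ij: "i < a * b" "j < a * b" by auto
 have "i = j \<longleftrightarrow> i div b = j div b & i mod b = j mod b" by (metis div_mult_mod_eq)
 thus "kronecker (1\<^sub>m a) (1\<^sub>m b) $$ (i,j) = (1\<^sub>m (a * b)::'k mat) $$ (i,j)"
  using ij by (auto simp: kronecker_def div_lt mod_lt)
qed (auto simp: kronecker_def)

lemma kronecker_smult_left: "kronecker (c \<cdot>\<^sub>m A) B = c \<cdot>\<^sub>m kronecker A (B::'k::field mat)"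
 by (rule eq_matI) (auto simp: kronecker_def div_lt mod_lt)

lemma trace_kronecker:
 assumes "A : carrier_mat a a" "B : carrier_mat b b"
 shows "trace (kronecker A B) = trace A * trace (B::'k::field mat)"
proof -
 have "trace (kronecker A B) = (\<Sum>k<a*b. A $$ (k div b,k div b) * B $$ (k mod b,k mod b))"
  using assms by (simp add: trace_def kronecker_def)
 also have "... = (\<Sum>i<a. \<Sum>j<b. A $$ (i,i) * B $$ (j,j))" by (rule sum_div_mod)
 also have "... = trace A * trace B" using assms by (simp add: trace_def sum_product)
 finally show ?thesis .
qed

lemma four_block_mat_eqD:
 assumes "four_block_mat A B C D = four_block_mat A' B' C' D'"
  "A : carrier_mat a a" "A' : carrier_mat a a" "D : carrier_mat d d" "D' : carrier_mat d d"
  "B : carrier_mat a d" "B' : carrier_mat a d" "C : carrier_mat d a" "C' : carrier_mat d a"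
 shows "A = A'" "B = B'" "C = C'" "D = D'"
proof -
 let ?M = "four_block_mat A B C D" let ?M' = "four_block_mat A' B' C' D'"
 have e: "?M $$ ij = ?M' $$ ij" for ij using assms(1) by simp
 show "A = A'"
  by (rule eq_matI,use e[of "(i,j)" for i j] assms(2-) in auto) (metis (no_types,lifting) carrier_matD index_mat_four_block(1) trans_less_add1)
 show "B = B'"
 proof (rule eq_matI)
  fix i j assume "i < dim_row B'" "j < dim_col B'"
  thus "B $$ (i,j) = B' $$ (i,j)" using e[of "(i,j + a)"] assms(2-) by auto
 qed (use assms in auto)
 show "C = C'"
 proof (rule eq_matI)
  fix i j assume "i < dim_row C'" "j < dim_col C'"
  thus "C $$ (i,j) = C' $$ (i,j)" using e[of "(i + a,j)"] assms(2-) by auto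
 qed (use assms in auto)
 show "D = D'"
 proof (rule eq_matI)
  fix i j assume "i < dim_row D'" "j < dim_col D'"
  thus "D $$ (i,j) = D' $$ (i,j)" using e[of "(i + a,j + a)"] assms(2-) by auto
 qed (use assms in auto)
qed

lemma trace_four_block:
 assumes "A : carrier_mat a a" "D : carrier_mat d d"
 shows "trace (four_block_mat A B C D) = trace A + trace (D::'k::comm_monoid_add mat)"
proof -
 have s: "{..<a+d} = {..<a} \<union> (%i. i + a) ` {..<d}"
 proof -
  have "x : (%i. i + a) ` {..<d}" if "x < a + d" "~x < a" for x
   using that by (intro image_eqI[of _ _ "x - a"]) auto
  thus ?thesis by fastforce
 qed
 have "(\<Sum>i<a+d. four_block_mat A B C D $$ (i,i))
   = (\<Sum>i<a. four_block_mat A B C D $$ (i,i))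
   + (\<Sum>i\<in>(%i. i + a) ` {..<d}. four_block_mat A B C D $$ (i,i))"
  unfolding s by (rule sum.union_disjoint) auto
 also have "(\<Sum>i\<in>(%i. i + a) ` {..<d}. four_block_mat A B C D $$ (i,i))
   = (\<Sum>i<d. four_block_mat A B C D $$ (i + a,i + a))"
  by (subst sum.reindex) (auto simp: inj_on_def)
 finally show ?thesis using assms by (simp add: trace_def)
qed

lemma trace_diag_block:
 assumes "!!A. A : set As ==> square_mat A"
 shows "trace (diag_block_mat As) = (\<Sum>A\<leftarrow>As. trace (A::'k::comm_monoid_add mat))"
 using assms
proof (induction As)
 case Nil
 thus ?case by (simp add: trace_def)
next
 case (Cons A As)
 have "square_mat (diag_block_mat As)"
  by (rule diag_block_mat_square,rule ballI,rule Cons.prems,rule list.set_intros(2))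
 hence "diag_block_mat As : carrier_mat (dim_row (diag_block_mat As)) (dim_row (diag_block_mat As))"
  unfolding square_mat.simps by (intro carrier_matI refl)
 moreover have "square_mat A" by (rule Cons.prems,rule list.set_intros(1))
 hence "A : carrier_mat (dim_row A) (dim_row A)"
  unfolding square_mat.simps by (intro carrier_matI refl)
 ultimately have "trace (diag_block_mat (A # As)) = trace A + trace (diag_block_mat As)"
  unfolding diag_block_mat.simps Let_def by (rule trace_four_block[rotated])
 moreover have "trace (diag_block_mat As) = (\<Sum>A\<leftarrow>As. trace A)"
  by (rule Cons.IH) (rule Cons.prems,rule list.set_intros(2))
 ultimately show ?case by simp
qed

lemma smult_one_four_block:
 "c \<cdot>\<^sub>m 1\<^sub>m (a + b) = four_block_mat (c \<cdot>\<^sub>m 1\<^sub>m a) (0\<^sub>m a b) (0\<^sub>m b a) (c \<cdot>\<^sub>m (1\<^sub>m b::'k::semiring_1 mat))"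
 by (rule eq_matI) auto

lemma diag_block_mat_eq_smult_one:
 assumes "!!A. A : set As ==> square_mat A"
  and "diag_block_mat As = c \<cdot>\<^sub>m (1\<^sub>m (sum_list (map dim_row As))::'k::comm_ring_1 mat)"
  and "A : set As"
 shows "A = c \<cdot>\<^sub>m 1\<^sub>m (dim_row A)"
 using assms
proof (induction As)
 case (Cons B As)
 let ?D = "diag_block_mat As" let ?d = "sum_list (map dim_row As)"
 have sq: "square_mat ?D"
  by (rule diag_block_mat_square,rule ballI,rule Cons.prems(1),rule list.set_intros(2))
 have D: "?D : carrier_mat ?d ?d"
  using sq[unfolded square_mat.simps] dim_diag_block_mat(1)[of As] by (intro carrier_matI) metis+
 have "square_mat B" by (rule Cons.prems(1),rule list.set_intros(1))
 hence dr: "dim_col B = dim_row B" unfolding square_mat.simps .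
 hence B: "B : carrier_mat (dim_row B) (dim_row B)" by (intro carrier_matI refl)
 have "four_block_mat B (0\<^sub>m (dim_row B) ?d) (0\<^sub>m ?d (dim_row B)) ?D
   = four_block_mat (c \<cdot>\<^sub>m 1\<^sub>m (dim_row B)) (0\<^sub>m (dim_row B) ?d) (0\<^sub>m ?d (dim_row B)) (c \<cdot>\<^sub>m 1\<^sub>m ?d)"
  using Cons.prems(2) D dr by (simp add: Let_def smult_one_four_block[symmetric])
 note e = four_block_mat_eqD[OF this B _ D]
 have "B = c \<cdot>\<^sub>m 1\<^sub>m (dim_row B)" "?D = c \<cdot>\<^sub>m 1\<^sub>m ?d" by (rule e; simp)+
 thus ?case using Cons.IH[OF Cons.prems(1)] Cons.prems(3) by (metis list.set_intros(2) set_ConsD)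
qed simp

section \<open>Subspaces and block triangular form\<close>

lemma subspaceI:
 assumes "W <= carrier_vec n" "0\<^sub>v n : W" "!!v w. v : W ==> w : W ==> v + w : W"
  "!!c v. v : W ==> c \<cdot>\<^sub>v v : W"
 shows "VectorSpace.subspace class_ring W (module_vec TYPE('k::field) n)"
proof -
 interpret vec_space "TYPE('k)" n .
 show ?thesis
  by (unfold_locales) (use assms in "auto simp: module_vec_simps")
qed

lemma subspaceD:
 assumes "VectorSpace.subspace class_ring W (module_vec TYPE('k::field) n)"
 shows "W <= carrier_vec n" "0\<^sub>v n : W" "!!v w. v : W ==> w : W ==> v + w : W"
  "!!c v. v : W ==> c \<cdot>\<^sub>v v : W"
proof -
 interpret submodule class_ring W "module_vec TYPE('k) n"
  using assms by (simp add: VectorSpace.subspace_def)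
 show "W <= carrier_vec n" "0\<^sub>v n : W" "!!v w. v : W ==> w : W ==> v + w : W"
  "!!c v. v : W ==> c \<cdot>\<^sub>v v : W"
  using subset zero_closed m_closed smult_closed by (auto simp: module_vec_simps)
qed

lemma mult_zero_vec: "A : carrier_mat a n ==> A *\<^sub>v 0\<^sub>v n = (0\<^sub>v a::'k::field vec)"
 by (intro eq_vecI) (auto simp: scalar_prod_def)

lemma mult_unit_vec:
 assumes "A : carrier_mat a n" "j < n"
 shows "A *\<^sub>v unit_vec n j = (col A j::'k::field vec)"
 using assms by (intro eq_vecI) auto

text \<open>Take \<open>P\<close> with as many leading columns in \<open>W\<close> as possible: a vector of \<open>W\<close> with a nonzero coordinate beyond
these could replace one of the other columns.\<close>

lemma subspace_adapted_basis:
 fixes W::"'k::field vec set"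
 assumes W: "VectorSpace.subspace class_ring W (module_vec TYPE('k) n)"
 obtains P d where "P : carrier (GL n)" "d <= n" "!!j. j < d ==> col P j : W"
  "!!u i. u : carrier_vec n ==> P *\<^sub>v u : W ==> d <= i ==> i < n ==> u $ i = 0"
proof -
 define good where "good d \<longleftrightarrow> d <= n & (EX P:carrier (GL n). ALL j<d. col P j : W)" for d
 have "good 0"
  unfolding good_def by (intro conjI bexI[of _ "1\<^sub>m n"]) (auto simp: carrier_GL)
 moreover have bd: "!!d. good d ==> d <= n" unfolding good_def by blast
 ultimately have g: "good (Greatest good)" and mx: "!!d. good d ==> d <= Greatest good"
  using GreatestI_nat[of good 0 n] Greatest_le_nat[of good _ n] by blast+
 define d where "d = Greatest good"
 from g obtain P where P: "P : carrier (GL n)" "!!j. j < d ==> col P j : W" and dn: "d <= n"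
  unfolding good_def d_def by blast
 note Pc = GL_carrier_mat[OF P(1)]
 have "u $ i = 0" if u: "u : carrier_vec n" "P *\<^sub>v u : W" and i: "d <= i" "i < n" for u i
 proof (rule ccontr)
  assume ui: "u $ i ~= 0"
  define tau where "tau r = (if r = d then i else if r = i then d else r)" for r
  have tt: "tau (tau r) = r" for r by (simp add: tau_def)
  have tn: "r < n ==> tau r < n" for r using i by (simp add: tau_def)
  define E where "E = mat n n (%(r,c). if c = d then u $ r else if c = tau r then 1 else 0)"
  have E: "E : carrier_mat n n" by (simp add: E_def)
  have dn': "d < n" using i by simp
  have "det E ~= 0"
  proof
   assume "det E = 0"
   then obtain v where v: "v : carrier_vec n" "v ~= 0\<^sub>v n" "E *\<^sub>v v = 0\<^sub>v n"
    using det_0_iff_vec_prod_zero_field[OF E] by auto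
   have row: "u $ r * v $ d + (if tau r ~= d then v $ (tau r) else 0) = 0" if r: "r < n" for r
   proof -
    have "0 = (\<Sum>k<n. E $$ (r,k) * v $ k)"
     using mult_vec_entry[OF E v(1) r] v(3) r by simp
    also have "... = (\<Sum>k<n. (if k = d then u $ r * v $ d else 0) + (if k = tau r then (if tau r ~= d then v $ (tau r) else 0) else 0))"
     using r by (intro sum.cong) (auto simp: E_def)
    also have "... = u $ r * v $ d + (if tau r ~= d then v $ (tau r) else 0)"
     using dn' tn[OF r] by (simp add: sum.distrib)
    finally show ?thesis by simp
   qed
   have vd: "v $ d = 0" using row[OF i(2)] ui by (simp add: tau_def split: if_splits)
   have "v $ k = 0" if "k < n" for k
    using row[OF tn[OF that]] vd by (cases "k = d") (auto simp: tt)
   hence "v = 0\<^sub>v n" using v(1) by (intro eq_vecI) auto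
   thus False using v(2) by simp
  qed
  hence EG: "E : carrier (GL n)" using E by (simp add: carrier_GL)
  have PE: "P * E : carrier (GL n)"
   using monoid.m_closed[OF group.is_monoid[OF group_GL] P(1) EG] by simp
  have "col (P * E) j : W" if "j < Suc d" for j
  proof (cases "j = d")
   case True
   have "col E d = u" using u(1) dn' by (intro eq_vecI) (auto simp: E_def)
   thus ?thesis using True u(2) col_mult2[OF Pc E dn'] by simp
  next
   case False
   hence j: "j < d" "j < n" using that dn by auto
   have "col E j = unit_vec n j" using j i
    by (intro eq_vecI) (auto simp: E_def tau_def unit_vec_def)
   thus ?thesis using P(2)[OF j(1)] col_mult2[OF Pc E j(2)] mult_unit_vec[OF Pc j(2)] by simp
  qed
  hence "good (Suc d)" unfolding good_def using dn' PE by (intro conjI bexI[of _ "P * E"]) auto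
  thus False using mx[of "Suc d"] by (simp add: d_def)
 qed
 thus thesis using that[of P d] P dn by blast
qed

lemma subspace_of_columns:
 fixes W::"'k::field vec set"
 assumes W: "VectorSpace.subspace class_ring W (module_vec TYPE('k) n)"
  and P: "P : carrier (GL n)" and cols: "!!j. j < n ==> col P j : W"
 shows "W = carrier_vec n"
proof
 note Wd = subspaceD[OF W]
 show "W <= carrier_vec n" by (rule Wd(1))
 show "carrier_vec n <= W"
 proof
  fix v::"'k vec" assume v: "v : carrier_vec n"
  obtain Q where Q: "Q : carrier (GL n)" "P * Q = 1\<^sub>m n" using GL_inverse[OF P] by blast
  note c = GL_carrier_mat[OF P] GL_carrier_mat[OF Q(1)]
  define u where "u = Q *\<^sub>v v"
  have u: "u : carrier_vec n" using c v by (simp add: u_def)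
  have "P *\<^sub>v vec n (%i. if i < k then u $ i else 0) : W" if "k <= n" for k
   using that
  proof (induction k)
   case 0
   have "vec n (%i. if i < 0 then u $ i else 0) = 0\<^sub>v n" by (rule eq_vecI) auto
   thus ?case using mult_zero_vec[OF c(1)] Wd(2) by simp
  next
   case (Suc k)
   have s: "vec n (%i. if i < Suc k then u $ i else 0)
     = vec n (%i. if i < k then u $ i else 0) + u $ k \<cdot>\<^sub>v unit_vec n k"
    using Suc.prems by (intro eq_vecI) (auto simp: unit_vec_def less_Suc_eq)
   have "P *\<^sub>v (u $ k \<cdot>\<^sub>v unit_vec n k) = u $ k \<cdot>\<^sub>v col P k"
    using c Suc.prems mult_unit_vec[OF c(1),of k] by (simp add: mult_mat_vec[OF c(1)])
   thus ?case unfolding s using Suc cols[of k] Wd(3,4) c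
    by (subst mult_add_distrib_mat_vec[of _ n n]) auto
  qed
  from this[of n] have "P *\<^sub>v vec n (%i. if i < n then u $ i else 0) : W" by simp
  also have "vec n (%i. if i < n then u $ i else 0) = u" using u by (intro eq_vecI) auto
  finally show "v : W" using c v Q by (simp add: u_def assoc_mult_mat_vec[of _ n n _ n,symmetric])
 qed
qed

section \<open>Representations\<close>

lemma repsI:
 assumes "group F" "!!g. g : carrier F ==> si g : carrier_mat n n"
  "!!g h. g : carrier F ==> h : carrier F ==> si (g \<otimes>\<^bsub>F\<^esub> h) = si g * si h" "si \<one>\<^bsub>F\<^esub> = 1\<^sub>m n"
 shows "(n,si::'g => 'k::field mat) : reps F"
proof -
 interpret F: group F by fact
 have "si g : carrier (GL n)" if g: "g : carrier F" for g
  using assms(2)[OF g] assms(2)[OF F.inv_closed[OF g]] assms(3)[OF g F.inv_closed[OF g]] g assms(4)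
  by (intro GL_I[of _ n "si (inv\<^bsub>F\<^esub> g)"]) auto
 thus ?thesis unfolding reps_def using assms(3) by (auto intro!: homI)
qed

lemma repsD:
 assumes "(n,si::'g => 'k::field mat) : reps F" "group F"
 shows "g : carrier F ==> si g : carrier (GL n)"
  "g : carrier F ==> si g : carrier_mat n n"
  "g : carrier F ==> h : carrier F ==> si (g \<otimes>\<^bsub>F\<^esub> h) = si g * si h"
  "si \<one>\<^bsub>F\<^esub> = 1\<^sub>m n"
  "g : carrier F ==> si g * si (inv\<^bsub>F\<^esub> g) = 1\<^sub>m n"
  "g : carrier F ==> si (inv\<^bsub>F\<^esub> g) * si g = 1\<^sub>m n"
proof -
 interpret F: group F by fact
 have h: "si : hom F (GL n)" using assms(1) by (simp add: reps_def)
 interpret group_hom F "GL n" si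
  using h by (simp add: group_hom_def group_hom_axioms_def assms(2) group_GL)
 show 1: "g : carrier F ==> si g : carrier (GL n)" for g by (rule hom_closed)
 thus "g : carrier F ==> si g : carrier_mat n n" by (rule GL_carrier_mat)
 show 2: "g : carrier F ==> h : carrier F ==> si (g \<otimes>\<^bsub>F\<^esub> h) = si g * si h" for g h by simp
 show 3: "si \<one>\<^bsub>F\<^esub> = 1\<^sub>m n" using hom_one by simp
 show "g : carrier F ==> si g * si (inv\<^bsub>F\<^esub> g) = 1\<^sub>m n"
  "g : carrier F ==> si (inv\<^bsub>F\<^esub> g) * si g = 1\<^sub>m n"
  using 2[of g "inv\<^bsub>F\<^esub> g"] 2[of "inv\<^bsub>F\<^esub> g" g] 3 by auto
qed

lemma rep_isoI:
 assumes "P : carrier (GL n)" "!!g. g : carrier F ==> P * si g = tau g * P"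
 shows "rep_iso F (n,si) (n,tau)"
 using assms by (auto simp: rep_iso_def)

lemma rep_isoI':
 fixes si tau::"'g => 'k::field mat"
 assumes P: "P : carrier (GL n)" "!!g. g : carrier F ==> si g * P = P * tau g"
  and c: "!!g. g : carrier F ==> si g : carrier_mat n n" "!!g. g : carrier F ==> tau g : carrier_mat n n"
 shows "rep_iso F (n,si) (n,tau)"
proof -
 obtain Q where Q: "Q : carrier (GL n)" "P * Q = 1\<^sub>m n" "Q * P = 1\<^sub>m n" using GL_inverse[OF P(1)] .
 note Pc = GL_carrier_mat[OF P(1)] and Qc = GL_carrier_mat[OF Q(1)]
 show ?thesis
 proof (rule rep_isoI[OF Q(1)])
  fix g assume g: "g : carrier F"
  note cg = c[OF g]
  have "Q * si g = Q * (si g * (P * Q))" using Q cg by simp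
  also have "... = Q * ((si g * P) * Q)" using Pc Qc cg by (simp add: assoc_mult_mat[of _ n n _ n _ n])
  also have "... = (Q * P) * (tau g * Q)" using Pc Qc cg
   by (simp add: P(2)[OF g] assoc_mult_mat[of _ n n _ n _ n])
  finally show "Q * si g = tau g * Q" using Q cg Qc by simp
 qed
qed

lemma rep_iso_sym:
 fixes L M::"('g,'k::field) rep"
 assumes "group F" "L : reps F" "M : reps F" "rep_iso F L M"
 shows "rep_iso F M L"
proof -
 obtain n si where L: "L = (n,si)" by (cases L)
 from assms(4) obtain tau P where M: "M = (n,tau)" and P: "P : carrier (GL n)"
  "!!g. g : carrier F ==> P * si g = tau g * P"
  by (auto simp: rep_iso_def L)
 show ?thesis unfolding L M
  using assms(1-3) P repsD(2)[of n _ F] by (intro rep_isoI'[of P]) (auto simp: L M)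
qed

lemma rep_iso_refl: "L : reps F ==> group F ==> rep_iso F L (L::('g,'k::field) rep)"
proof (cases L)
 case (Pair n si)
 assume "L : reps F" "group F"
 thus ?thesis unfolding Pair
  using repsD(2)[of n si F,THEN left_mult_one_mat] repsD(2)[of n si F,THEN right_mult_one_mat]
  by (intro rep_isoI[of "1\<^sub>m n"]) (auto simp: carrier_GL)
qed

lemma rep_iso_trans:
 fixes L M N::"('g,'k::field) rep"
 assumes "group F" "L : reps F" "M : reps F" "N : reps F" "rep_iso F L M" "rep_iso F M N"
 shows "rep_iso F L N"
proof -
 obtain n si where L: "L = (n,si)" by (cases L)
 from assms(5) obtain tau P where M: "M = (n,tau)" and P: "P : carrier (GL n)"
  "!!g. g : carrier F ==> P * si g = tau g * P"
  by (auto simp: rep_iso_def L)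
 from assms(6) obtain rh R where N: "N = (n,rh)" and R: "R : carrier (GL n)"
  "!!g. g : carrier F ==> R * tau g = rh g * R"
  by (auto simp: rep_iso_def M)
 note c = GL_carrier_mat[OF P(1)] GL_carrier_mat[OF R(1)]
 show ?thesis unfolding L N
 proof (rule rep_isoI)
  show "R * P : carrier (GL n)"
   using monoid.m_closed[OF group.is_monoid[OF group_GL] R(1) P(1)] by simp
  fix g assume g: "g : carrier F"
  have s: "si g : carrier_mat n n" "tau g : carrier_mat n n" "rh g : carrier_mat n n"
   using assms(1-4) g by (auto simp: L M N dest: repsD(2))
  have "R * P * si g = R * (tau g * P)" using c s P(2)[OF g] by (simp add: assoc_mult_mat[of _ n n _ n _ n])
  also have "... = (R * tau g) * P" using c s by (simp add: assoc_mult_mat[of _ n n _ n _ n])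
  finally show "R * P * si g = rh g * (R * P)" using c s R(2)[OF g] by (simp add: assoc_mult_mat[of _ n n _ n _ n])
 qed
qed

lemma rep_iso_trace:
 assumes "group F" "L : reps F" "M : reps F" "rep_iso F L M" "g : carrier F"
 shows "trace (snd L g) = trace (snd M g::'k::field mat)"
 using assms by (cases L; cases M) (auto simp: rep_iso_def dest: repsD(2) intro: trace_conj)

lemma iso_class_eq_iff:
 fixes L M::"('g,'k::field) rep"
 assumes "group F" "L : reps F" "M : reps F"
 shows "iso_class F L = iso_class F M \<longleftrightarrow> rep_iso F L M"
 unfolding iso_class_def
 using rep_iso_sym[OF assms] rep_iso_trans[OF assms(1)] rep_iso_refl[of M F] rep_iso_sym[OF assms(1)] assms
 by (smt (verit,best) Collect_cong mem_Collect_eq)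

lemma invariant_block_form:
 fixes si::"'g => 'k::field mat"
 assumes F: "group F" and r: "(n,si) : reps F"
  and W: "VectorSpace.subspace class_ring W (module_vec TYPE('k) n)"
  and inv: "!!g w. g : carrier F ==> w : W ==> si g *\<^sub>v w : W"
  and ne: "W ~= {0\<^sub>v n}" "W ~= carrier_vec n"
 obtains P d A B D where "P : carrier (GL n)" "0 < d" "d < n"
  "!!g. A g : carrier_mat d d" "!!g. B g : carrier_mat d (n - d)" "!!g. D g : carrier_mat (n - d) (n - d)"
  "!!g. g : carrier F ==> si g * P = P * four_block_mat (A g) (B g) (0\<^sub>m (n - d) d) (D g)"
proof -
 obtain P d where P: "P : carrier (GL n)" and d: "d <= n" and cols: "!!j. j < d ==> col P j : W"
  and z: "!!u i. u : carrier_vec n ==> P *\<^sub>v u : W ==> d <= i ==> i < n ==> u $ i = 0"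
  using subspace_adapted_basis[OF W] by metis
 obtain Q where Q: "Q : carrier (GL n)" "P * Q = 1\<^sub>m n" "Q * P = 1\<^sub>m n" using GL_inverse[OF P] .
 note Pc = GL_carrier_mat[OF P] and Qc = GL_carrier_mat[OF Q(1)]
 note Wd = subspaceD[OF W]
 have "d ~= n" using subspace_of_columns[OF W P] cols ne(2) by blast
 moreover have "d ~= 0"
 proof
  assume d0: "d = 0"
  have "w = 0\<^sub>v n" if w: "w : W" for w
  proof -
   have wc: "w : carrier_vec n" using Wd(1) w by blast
   have PQ: "P *\<^sub>v (Q *\<^sub>v w) = w"
    using wc Pc Qc Q by (simp add: assoc_mult_mat_vec[of _ n n _ n,symmetric])
   have "(Q *\<^sub>v w) $ i = 0" if "i < n" for i using z[of "Q *\<^sub>v w" i] that PQ w d0 wc Qc by auto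
   hence "Q *\<^sub>v w = 0\<^sub>v n" using Qc by (intro eq_vecI) auto
   thus ?thesis using PQ mult_zero_vec[OF Pc] by simp
  qed
  thus False using ne(1) Wd(2) by blast
 qed
 ultimately have dd: "0 < d" "d < n" using d by auto
 define T where "T g = Q * (si g * P)" for g
 define A where "A g = mat d d (%(i,j). T g $$ (i,j))" for g
 define B where "B g = mat d (n - d) (%(i,j). T g $$ (i,j + d))" for g
 define D where "D g = mat (n - d) (n - d) (%(i,j). T g $$ (i + d,j + d))" for g
 have "si g * P = P * four_block_mat (A g) (B g) (0\<^sub>m (n - d) d) (D g)" if g: "g : carrier F" for g
 proof -
  have s: "si g : carrier_mat n n" using repsD(2)[OF r F g] .
  have Tc: "T g : carrier_mat n n" using s Pc Qc by (simp add: T_def)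
  have zz: "T g $$ (i,j) = 0" if ij: "j < d" "d <= i" "i < n" for i j
  proof -
   have jn: "j < n" using ij d by simp
   define w where "w = si g *\<^sub>v col P j"
   have w: "w : W" unfolding w_def using inv[OF g] cols ij by blast
   have wc: "w : carrier_vec n" using Wd(1) w by blast
   have "col (T g) j = Q *\<^sub>v w" unfolding T_def w_def
    using s Pc Qc jn col_mult2[of Q n n "si g * P" n j] col_mult2[of "si g" n n P n j] by auto
   moreover have "P *\<^sub>v (Q *\<^sub>v w) = w"
    using wc Pc Qc Q by (simp add: assoc_mult_mat_vec[of _ n n _ n,symmetric])
   ultimately have "col (T g) j $ i = 0" using z[of "Q *\<^sub>v w" i] w wc Qc ij by auto
   thus ?thesis using Tc ij jn by simp
  qed
  have "T g = four_block_mat (A g) (B g) (0\<^sub>m (n - d) d) (D g)"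
   using dd Tc zz by (intro eq_matI) (auto simp: A_def B_def D_def)
  moreover have "P * T g = (P * Q) * (si g * P)"
   using s Pc Qc by (simp add: T_def assoc_mult_mat[of _ n n _ n _ n])
  ultimately show ?thesis using Q s Pc by simp
 qed
 thus thesis using that[of P d A B D] P dd by (simp add: A_def B_def D_def)
qed

lemma block_diag_mult:
 fixes A B C D::"'k::field mat"
 assumes "A : carrier_mat a a" "C : carrier_mat a a" "B : carrier_mat d d" "D : carrier_mat d d"
 shows "four_block_mat A (0\<^sub>m a d) (0\<^sub>m d a) B * four_block_mat C (0\<^sub>m a d) (0\<^sub>m d a) D
  = four_block_mat (A * C) (0\<^sub>m a d) (0\<^sub>m d a) (B * D)"
 using assms by (subst mult_four_block_mat[of _ a a _ d _ d _ _ a _ d]) auto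

lemma direct_sum_carrier:
 assumes "!!L. L : set Ls ==> L : reps F" "group F" "g : carrier F"
 shows "snd (direct_sum_rep Ls) g : carrier_mat (fst (direct_sum_rep Ls)) (fst (direct_sum_rep Ls)::nat)"
  and "!!A. A : set (map (%L. snd L g) Ls) ==> square_mat (A::'k::field mat)"
proof -
 have 1: "snd L g : carrier_mat (fst L) (fst L)" if "L : set Ls" for L
  using repsD(2)[of "fst L" "snd L" F g] assms that by simp
 have "map dim_row (map (%L. snd L g) Ls) = map fst Ls" "map dim_col (map (%L. snd L g) Ls) = map fst Ls"
  using 1 by auto
 hence "dim_row (diag_block_mat (map (%L. snd L g) Ls)) = sum_list (map fst Ls)"
  "dim_col (diag_block_mat (map (%L. snd L g) Ls)) = sum_list (map fst Ls)"
  unfolding dim_diag_block_mat by metis+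
 thus "snd (direct_sum_rep Ls) g : carrier_mat (fst (direct_sum_rep Ls)) (fst (direct_sum_rep Ls))"
  unfolding direct_sum_rep_def fst_conv snd_conv by (intro carrier_matI)
 fix A assume "A : set (map (%L. snd L g) Ls)"
 then obtain L where "L : set Ls" "A = snd L g" by auto
 thus "square_mat A" using carrier_matD[OF 1,of L] by simp
qed

lemma direct_sum_in_reps:
 fixes Ls::"('g,'k::field) rep list"
 assumes "!!L. L : set Ls ==> L : reps F" "group F"
 shows "direct_sum_rep Ls : reps F"
 using assms(1)
proof (induction Ls)
 case Nil
 have "(0,%g::'g. 0\<^sub>m 0 0::'k mat) : reps F" by (rule repsI[OF assms(2)]) auto
 thus ?case by (simp add: direct_sum_rep_def)
next
 case (Cons L Ls)
 obtain n si where L: "L = (n,si)" by (cases L)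
 obtain m tau where D: "direct_sum_rep Ls = (m,tau)" by (cases "direct_sum_rep Ls")
 have rL: "(n,si) : reps F" using Cons.prems[of L] L by simp
 have rD: "(m,tau) : reps F"
  unfolding D[symmetric] by (rule Cons.IH,rule Cons.prems,rule list.set_intros(2))
 note l = repsD[OF rL assms(2)] and r = repsD[OF rD assms(2)]
 have m: "m = sum_list (map fst Ls)" and t: "tau = (%g. diag_block_mat (map (%L. snd L g) Ls))"
  using D by (auto simp: direct_sum_rep_def)
 interpret F: group F by fact
 have e: "snd (direct_sum_rep (L # Ls)) g = four_block_mat (si g) (0\<^sub>m n m) (0\<^sub>m m n) (tau g)"
  if "g : carrier F" for g
  using carrier_matD[OF l(2)[OF that]] carrier_matD[OF r(2)[OF that]]
  by (simp add: direct_sum_rep_def L Let_def t)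
 have "(n + m,snd (direct_sum_rep (L # Ls))) : reps F"
 proof (rule repsI[OF assms(2)])
  show "snd (direct_sum_rep (L # Ls)) g : carrier_mat (n + m) (n + m)" if "g : carrier F" for g
   using e[OF that] l(2)[OF that] r(2)[OF that] by auto
  show "snd (direct_sum_rep (L # Ls)) (g \<otimes>\<^bsub>F\<^esub> h) = snd (direct_sum_rep (L # Ls)) g * snd (direct_sum_rep (L # Ls)) h"
   if "g : carrier F" "h : carrier F" for g h
   unfolding e[OF that(1)] e[OF that(2)] e[OF F.m_closed[OF that]] l(3)[OF that] r(3)[OF that]
   by (rule block_diag_mult[symmetric]) (intro l(2) r(2) that)+
  show "snd (direct_sum_rep (L # Ls)) \<one>\<^bsub>F\<^esub> = 1\<^sub>m (n + m)"
   using e[of "\<one>\<^bsub>F\<^esub>"] l(4) r(4) by (simp add: four_block_one_mat)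
 qed
 moreover have "direct_sum_rep (L # Ls) = (n + m,snd (direct_sum_rep (L # Ls)))"
  by (simp add: direct_sum_rep_def L m)
 ultimately show ?case by simp
qed

lemma direct_sum_trace:
 assumes "!!L. L : set Ls ==> L : reps F" "group F" "g : carrier F"
 shows "trace (snd (direct_sum_rep Ls) g) = (\<Sum>L\<leftarrow>Ls. trace (snd L g::'k::field mat))"
proof -
 have "trace (diag_block_mat (map (%L. snd L g) Ls)) = (\<Sum>A\<leftarrow>map (%L. snd L g) Ls. trace A)"
  by (rule trace_diag_block,rule direct_sum_carrier(2)[where F = F]) (use assms in blast)+
 thus ?thesis by (simp only: direct_sum_rep_def snd_conv map_map comp_def)
qed

lemma rep_iso_direct_sum_append:
 fixes A D::"'g => 'k::field mat"
 assumes F: "group F" and A: "(a,A) : reps F" and D: "(d,D) : reps F"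
  and Ls: "!!L. L : set Ls1 \<union> set Ls2 ==> L : reps F"
  and i1: "rep_iso F (a,A) (direct_sum_rep Ls1)" and i2: "rep_iso F (d,D) (direct_sum_rep Ls2)"
 shows "rep_iso F (a + d,%g. four_block_mat (A g) (0\<^sub>m a d) (0\<^sub>m d a) (D g)) (direct_sum_rep (Ls1 @ Ls2))"
proof -
 obtain tau1 where d1: "direct_sum_rep Ls1 = (a,tau1)"
 proof (cases "direct_sum_rep Ls1")
  case (Pair n t)
  have "n = a" using i1 unfolding Pair rep_iso_def by simp
  thus thesis using that Pair by blast
 qed
 obtain tau2 where d2: "direct_sum_rep Ls2 = (d,tau2)"
 proof (cases "direct_sum_rep Ls2")
  case (Pair n t)
  have "n = d" using i2 unfolding Pair rep_iso_def by simp
  thus thesis using that Pair by blast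
 qed
 obtain P1 where 1: "P1 : carrier (GL a)" "!!g. g : carrier F ==> P1 * A g = tau1 g * P1"
  using i1 unfolding rep_iso_def d1 by blast
 obtain P2 where 2: "P2 : carrier (GL d)" "!!g. g : carrier F ==> P2 * D g = tau2 g * P2"
  using i2 unfolding rep_iso_def d2 by blast
 have r1: "(a,tau1) : reps F" and r2: "(d,tau2) : reps F"
  unfolding d1[symmetric] d2[symmetric] by (rule direct_sum_in_reps[OF _ F],rule Ls,blast)+
 have ds: "direct_sum_rep (Ls1 @ Ls2) = (a + d,snd (direct_sum_rep (Ls1 @ Ls2)))"
  using d1 d2 by (simp add: direct_sum_rep_def)
 have t: "tau1 = (%g. diag_block_mat (map (%L. snd L g) Ls1))"
  "tau2 = (%g. diag_block_mat (map (%L. snd L g) Ls2))"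
  using d1 d2 by (simp_all add: direct_sum_rep_def)
 have e: "snd (direct_sum_rep (Ls1 @ Ls2)) g = four_block_mat (tau1 g) (0\<^sub>m a d) (0\<^sub>m d a) (tau2 g)"
  if "g : carrier F" for g
 proof -
  have "snd (direct_sum_rep (Ls1 @ Ls2)) g
    = diag_block_mat (map (%L. snd L g) Ls1 @ map (%L. snd L g) Ls2)"
   by (simp add: direct_sum_rep_def)
  also have "... = four_block_mat (tau1 g) (0\<^sub>m (dim_row (tau1 g)) (dim_col (tau2 g)))
    (0\<^sub>m (dim_row (tau2 g)) (dim_col (tau1 g))) (tau2 g)"
   unfolding diag_block_mat_append Let_def t ..
  finally show ?thesis
   using carrier_matD[OF repsD(2)[OF r1 F that]] carrier_matD[OF repsD(2)[OF r2 F that]] by simp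
 qed
 let ?P = "four_block_mat P1 (0\<^sub>m a d) (0\<^sub>m d a) P2"
 note Pc = GL_carrier_mat[OF 1(1)] GL_carrier_mat[OF 2(1)]
 have "?P : carrier (GL (a + d))"
  using 1(1) 2(1) Pc by (auto simp: carrier_GL det_four_block_mat_lower_left_zero[OF Pc(1) _ refl Pc(2)])
 hence "rep_iso F (a + d,%g. four_block_mat (A g) (0\<^sub>m a d) (0\<^sub>m d a) (D g))
   (a + d,snd (direct_sum_rep (Ls1 @ Ls2)))"
 proof (rule rep_isoI)
  fix g assume g: "g : carrier F"
  note c = repsD(2)[OF r1 F g] repsD(2)[OF r2 F g] repsD(2)[OF A F g] repsD(2)[OF D F g] Pc
  show "?P * four_block_mat (A g) (0\<^sub>m a d) (0\<^sub>m d a) (D g) = snd (direct_sum_rep (Ls1 @ Ls2)) g * ?P"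
   unfolding e[OF g] block_diag_mult[OF c(5,3,6,4)] block_diag_mult[OF c(1,5,2,6)] 1(2)[OF g] 2(2)[OF g] ..
 qed
 thus ?thesis using ds by metis
qed

section \<open>Schur's lemma and orthogonality of characters\<close>

lemma irreducible_repD:
 assumes "irreducible_rep F (n,si)"
 shows "(n,si) : reps F" "n > 0"
  "VectorSpace.subspace class_ring W (module_vec TYPE('k::field) n) ==>
   (!!g w. g : carrier F ==> w : W ==> (si g::'k mat) *\<^sub>v w : W) ==> W = {0\<^sub>v n} \<or> W = carrier_vec n"
 using assms by (auto simp: irreducible_rep_def)

lemma wide_mat_kernel:
 assumes M: "M : carrier_mat a n" and "a < n"
 obtains v where "v : carrier_vec n" "v ~= 0\<^sub>v n" "M *\<^sub>v v = (0\<^sub>v a::'k::field vec)"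
proof -
 define E where "E = mat n n (%(i,j). if i < a then M $$ (i,j) else 0)"
 have E: "E : carrier_mat n n" by (simp add: E_def)
 have "det E = 0"
 proof (rule ccontr)
  assume "det E ~= 0"
  hence "E : carrier (GL n)" using E by (simp add: carrier_GL)
  then obtain Q where Q: "Q : carrier (GL n)" "E * Q = 1\<^sub>m n" using GL_inverse by blast
  have "(E * Q) $$ (a,a) = (\<Sum>k<n. E $$ (a,k) * Q $$ (k,a))"
   by (rule mult_mat_entry[OF E GL_carrier_mat[OF Q(1)]]) (use assms in auto)
  also have "... = 0" using assms by (intro sum.neutral) (auto simp: E_def)
  finally show False using Q(2) assms by simp
 qed
 then obtain v where v: "v : carrier_vec n" "v ~= 0\<^sub>v n" "E *\<^sub>v v = 0\<^sub>v n"
  using det_0_iff_vec_prod_zero_field[OF E] by auto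
 have "M *\<^sub>v v = 0\<^sub>v a"
 proof (rule eq_vecI)
  fix i assume "i < dim_vec (0\<^sub>v a::'k vec)"
  hence i: "i < a" "i < n" using assms by auto
  have "(M *\<^sub>v v) $ i = (\<Sum>k<n. E $$ (i,k) * v $ k)"
   unfolding mult_vec_entry[OF M v(1) i(1)] using i by (intro sum.cong) (auto simp: E_def)
  also have "... = (E *\<^sub>v v) $ i" by (rule mult_vec_entry[OF E v(1) i(2),symmetric])
  finally show "(M *\<^sub>v v) $ i = 0\<^sub>v a $ i" using v(3) i by simp
 qed (use M in auto)
 thus thesis using that v by blast
qed

lemma mat_eq_zeroI:
 assumes "M : carrier_mat a n" "!!v. v : carrier_vec n ==> M *\<^sub>v v = (0\<^sub>v a::'k::field vec)"
 shows "M = 0\<^sub>m a n"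
proof (rule eq_matI)
 fix i j assume "i < dim_row (0\<^sub>m a n::'k mat)" "j < dim_col (0\<^sub>m a n::'k mat)"
 hence ij: "i < a" "j < n" by auto
 have "M $$ (i,j) = col M j $ i" using ij assms(1) by simp
 also have "... = 0" using assms(2)[of "unit_vec n j"] mult_unit_vec[OF assms(1) ij(2)] ij by simp
 finally show "M $$ (i,j) = 0\<^sub>m a n $$ (i,j)" using ij by simp
qed (use assms in auto)

text \<open>Kernel and image of an intertwiner are invariant subspaces.\<close>

lemma schur:
 fixes M::"'k::field mat"
 assumes F: "group F" and s: "irreducible_rep F (n,si)" and t: "irreducible_rep F (n',tau)"
  and M: "M : carrier_mat n' n" and int: "!!g. g : carrier F ==> tau g * M = M * si g"
 shows "M = 0\<^sub>m n' n \<or> (n = n' & M : carrier (GL n))"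
proof -
 note S = irreducible_repD[OF s] and T = irreducible_repD[OF t]
 note rs = repsD(2)[OF S(1) F] and rt = repsD(2)[OF T(1) F]
 have comm: "tau g *\<^sub>v (M *\<^sub>v v) = M *\<^sub>v (si g *\<^sub>v v)" if "g : carrier F" "v : carrier_vec n" for g v
  using assoc_mult_mat_vec[OF rt[OF that(1)] M that(2)] assoc_mult_mat_vec[OF M rs[OF that(1)] that(2)]
   int[OF that(1)] by simp
 define W where "W = {v : carrier_vec n. M *\<^sub>v v = 0\<^sub>v n'}"
 define I where "I = (%v. M *\<^sub>v v) ` carrier_vec n"
 have "VectorSpace.subspace class_ring W (module_vec TYPE('k) n)"
  by (rule subspaceI) (auto simp: W_def mult_zero_vec[OF M] mult_add_distrib_mat_vec[OF M] mult_mat_vec[OF M])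
 hence WW: "W = {0\<^sub>v n} \<or> W = carrier_vec n"
 proof (rule S(3))
  fix g v assume g: "g : carrier F" and "v : W"
  hence v: "v : carrier_vec n" "M *\<^sub>v v = 0\<^sub>v n'" by (auto simp: W_def)
  show "si g *\<^sub>v v : W" unfolding W_def
   using comm[OF g v(1)] mult_zero_vec[OF rt[OF g]] rs[OF g] v by auto
 qed
 have "VectorSpace.subspace class_ring I (module_vec TYPE('k) n')"
 proof (rule subspaceI)
  show "I <= carrier_vec n'" using M by (auto simp: I_def)
  show "0\<^sub>v n' : I" unfolding I_def by (rule image_eqI[of _ _ "0\<^sub>v n"]) (auto simp: mult_zero_vec[OF M])
  show "v + w : I" if vw: "v : I" "w : I" for v w
  proof -
   obtain a b where "a : carrier_vec n" "b : carrier_vec n" "v = M *\<^sub>v a" "w = M *\<^sub>v b"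
    using vw unfolding I_def by blast
   thus ?thesis unfolding I_def
    by (intro image_eqI[of _ _ "a + b"]) (auto simp: mult_add_distrib_mat_vec[OF M])
  qed
  show "c \<cdot>\<^sub>v v : I" if vI: "v : I" for c v
  proof -
   obtain a where "a : carrier_vec n" "v = M *\<^sub>v a" using vI unfolding I_def by blast
   thus ?thesis unfolding I_def
    by (intro image_eqI[of _ _ "c \<cdot>\<^sub>v a"]) (auto simp: mult_mat_vec[OF M])
  qed
 qed
 hence II: "I = {0\<^sub>v n'} \<or> I = carrier_vec n'"
 proof (rule T(3))
  fix g w assume g: "g : carrier F" and "w : I"
  then obtain a where a: "a : carrier_vec n" "w = M *\<^sub>v a" by (auto simp: I_def)
  thus "tau g *\<^sub>v w : I" using comm[OF g a(1)] rs[OF g] by (auto simp: I_def)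
 qed
 show ?thesis
 proof (cases "M = 0\<^sub>m n' n")
  case False
  have "W ~= carrier_vec n" using mat_eq_zeroI[OF M] False by (auto simp: W_def)
  hence W0: "W = {0\<^sub>v n}" using WW by blast
  have "I ~= {0\<^sub>v n'}" using mat_eq_zeroI[OF M] False by (auto simp: I_def)
  hence I1: "I = carrier_vec n'" using II by blast
  have "~n' < n" using wide_mat_kernel[OF M] W0 by (auto simp: W_def)
  moreover have "~n < n'"
  proof
   assume "n < n'"
   have "ALL j<n'. EX v:carrier_vec n. M *\<^sub>v v = unit_vec n' j" using I1 by (auto simp: I_def image_iff set_eq_iff)
     (metis unit_vec_carrier)
   then obtain f where f: "!!j. j < n' ==> f j : carrier_vec n" "!!j. j < n' ==> M *\<^sub>v f j = unit_vec n' j"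
    by metis
   define N where "N = mat n n' (%(i,j). f j $ i)"
   have N: "N : carrier_mat n n'" by (simp add: N_def)
   have "col (M * N) j = unit_vec n' j" if "j < n'" for j
   proof -
    have "col N j = f j" using f(1)[OF that] that by (intro eq_vecI) (auto simp: N_def)
    thus ?thesis using col_mult2[OF M N that] f(2)[OF that] by simp
   qed
   hence MN: "M * N = 1\<^sub>m n'" using M N by (intro mat_col_eqI) auto
   obtain u where u: "u : carrier_vec n'" "u ~= 0\<^sub>v n'" "N *\<^sub>v u = 0\<^sub>v n"
    using wide_mat_kernel[OF N \<open>n < n'\<close>] .
   have "u = M *\<^sub>v (N *\<^sub>v u)" using MN assoc_mult_mat_vec[OF M N u(1)] u(1) by simp
   thus False using u mult_zero_vec[OF M] by simp
  qed
  ultimately have n: "n = n'" by simp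
  have "det M ~= 0"
   using det_0_iff_vec_prod_zero_field[of M n] M W0 unfolding n W_def by blast
  thus ?thesis using M n by (simp add: carrier_GL)
 qed simp
qed

text \<open>If \<open>c\<close> is an eigenvalue of \<open>M\<close>, the intertwiner \<open>M - c\<close> is singular, hence zero.\<close>

lemma schur_scalar:
 fixes M::"'k::alg_closed_field mat"
 assumes F: "group F" and s: "irreducible_rep F (n,si)"
  and M: "M : carrier_mat n n" and int: "!!g. g : carrier F ==> si g * M = M * si g"
 obtains c where "M = c \<cdot>\<^sub>m 1\<^sub>m n"
proof -
 note S = irreducible_repD[OF s]
 note rs = repsD(2)[OF S(1) F]
 have "degree (char_poly M) > 0" using degree_monic_char_poly[OF M] S(2) by simp
 then obtain c where "poly (char_poly M) c = 0" using alg_closed_imp_poly_has_root by blast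
 then obtain v where v: "v : carrier_vec n" "v ~= 0\<^sub>v n" "M *\<^sub>v v = c \<cdot>\<^sub>v v"
  using eigenvalue_root_char_poly[OF M] M by (auto simp: eigenvalue_def eigenvector_def)
 define N where "N = M + (- c) \<cdot>\<^sub>m 1\<^sub>m n"
 have N: "N : carrier_mat n n" using M by (simp add: N_def)
 have "N = 0\<^sub>m n n \<or> (n = n & N : carrier (GL n))"
 proof (rule schur[OF F s s N])
  fix g assume g: "g : carrier F"
  have "si g * ((- c) \<cdot>\<^sub>m 1\<^sub>m n) = ((- c) \<cdot>\<^sub>m 1\<^sub>m n) * si g"
   using rs[OF g] by (simp add: mult_smult_distrib[of _ n n _ n] mult_smult_assoc_mat[of _ n n _ n])
  thus "si g * N = N * si g" unfolding N_def
   using rs[OF g] M int[OF g] mult_add_distrib_mat[of "si g" n n M n "(- c) \<cdot>\<^sub>m 1\<^sub>m n"]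
    add_mult_distrib_mat[of M n n "(- c) \<cdot>\<^sub>m 1\<^sub>m n" "si g" n] by simp
 qed
 moreover have "N \<notin> carrier (GL n)"
 proof
  assume "N : carrier (GL n)"
  hence "det N ~= 0" by (simp add: carrier_GL)
  moreover have "N *\<^sub>v v = 0\<^sub>v n"
  proof (rule eq_vecI)
   fix i assume "i < dim_vec (0\<^sub>v n::'k vec)"
   hence i: "i < n" by simp
   have "((- c) \<cdot>\<^sub>m 1\<^sub>m n) *\<^sub>v v = (- c) \<cdot>\<^sub>v v" using v(1)
    by (intro eq_vecI) (auto simp: scalar_prod_def smult_mat_def row_def if_distrib[of "%x. x * _"] if_distrib[of "%x. _ * x"] sum_negf cong: if_cong)
   hence "N *\<^sub>v v = c \<cdot>\<^sub>v v + (- c) \<cdot>\<^sub>v v"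
    unfolding N_def using add_mult_distrib_mat_vec[OF M _ v(1),of "(- c) \<cdot>\<^sub>m 1\<^sub>m n"] v(3) by simp
   thus "(N *\<^sub>v v) $ i = 0\<^sub>v n $ i" using v(1) i by simp
  qed (use N in auto)
  ultimately show False using det_0_iff_vec_prod_zero_field[OF N] v by blast
 qed
 ultimately have z: "N = 0\<^sub>m n n" by blast
 have "M = c \<cdot>\<^sub>m 1\<^sub>m n"
 proof (rule eq_matI)
  fix i j assume "i < dim_row (c \<cdot>\<^sub>m 1\<^sub>m n)" "j < dim_col (c \<cdot>\<^sub>m 1\<^sub>m n)"
  hence ij: "i < n" "j < n" by auto
  have "M $$ (i,j) - (c \<cdot>\<^sub>m 1\<^sub>m n) $$ (i,j) = N $$ (i,j)" using ij M by (auto simp: N_def)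
  thus "M $$ (i,j) = (c \<cdot>\<^sub>m 1\<^sub>m n) $$ (i,j)" using z ij by simp
 qed (use M in auto)
 thus thesis by (rule that)
qed

lemma smult_smult_mat: "a \<cdot>\<^sub>m (b \<cdot>\<^sub>m A) = (a * b) \<cdot>\<^sub>m (A::'k::semigroup_mult mat)"
 by (rule eq_matI) (auto simp: mult.assoc)

lemma one_smult_mat: "1 \<cdot>\<^sub>m A = (A::'k::monoid_mult mat)"
 by (rule eq_matI) auto

definition msum::"nat => nat => ('g => 'k::comm_ring_1 mat) => 'g set => 'k mat" where
 "msum a b f X = mat a b (%ij. \<Sum>x\<in>X. f x $$ ij)"

lemma msum_carrier [simp]: "msum a b f X : carrier_mat a b"
 by (simp add: msum_def)

lemma mult_msum:
 assumes "A : carrier_mat c a" "!!x. x : X ==> f x : carrier_mat a b"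
 shows "A * msum a b f X = msum c b (%x. A * f x) X"
proof (rule eq_matI)
 fix i j assume "i < dim_row (msum c b (%x. A * f x) X)" "j < dim_col (msum c b (%x. A * f x) X)"
 hence ij: "i < c" "j < b" by (auto simp: msum_def)
 have "(A * msum a b f X) $$ (i,j) = (\<Sum>k<a. \<Sum>x\<in>X. A $$ (i,k) * f x $$ (k,j))"
  unfolding mult_mat_entry[OF assms(1) msum_carrier ij]
  using ij by (auto simp: msum_def sum_distrib_left intro!: sum.cong)
 also have "... = (\<Sum>x\<in>X. (A * f x) $$ (i,j))"
  by (subst sum.swap) (intro sum.cong refl mult_mat_entry[OF assms(1) assms(2) ij,symmetric])
 finally show "(A * msum a b f X) $$ (i,j) = msum c b (%x. A * f x) X $$ (i,j)"
  using ij by (simp add: msum_def)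
qed (use assms in "auto simp: msum_def")

lemma msum_mult:
 assumes "A : carrier_mat b c" "!!x. x : X ==> f x : carrier_mat a b"
 shows "msum a b f X * A = msum a c (%x. f x * A) X"
proof (rule eq_matI)
 fix i j assume "i < dim_row (msum a c (%x. f x * A) X)" "j < dim_col (msum a c (%x. f x * A) X)"
 hence ij: "i < a" "j < c" by (auto simp: msum_def)
 have "(msum a b f X * A) $$ (i,j) = (\<Sum>k<b. \<Sum>x\<in>X. f x $$ (i,k) * A $$ (k,j))"
  unfolding mult_mat_entry[OF msum_carrier assms(1) ij]
  using ij by (auto simp: msum_def sum_distrib_right intro!: sum.cong)
 also have "... = (\<Sum>x\<in>X. (f x * A) $$ (i,j))"
  by (subst sum.swap) (intro sum.cong refl mult_mat_entry[OF assms(2) assms(1) ij,symmetric])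
 finally show "(msum a b f X * A) $$ (i,j) = msum a c (%x. f x * A) X $$ (i,j)"
  using ij by (simp add: msum_def)
qed (use assms in "auto simp: msum_def")

lemma msum_cong: "(!!x. x : X ==> f x = g x) ==> msum a b f X = msum a b g X"
 by (auto simp: msum_def intro!: eq_matI sum.cong)

text \<open>Representations of \<open>F\<close> on which \<open>K\<close> acts by the scalars \<open>w\<close>. The finite set \<open>S\<close> represents \<open>F\<close> modulo \<open>K\<close>, so
that a sum over \<open>S\<close> of a \<open>K\<close>-invariant function is unchanged by translation. This covers a finite group
(\<open>K\<close> trivial, \<open>S\<close> everything) and an extension of a finite group by \<open>k\<^sup>*\<close> alike.\<close>

locale central_char = group F for F::"('g,'x) monoid_scheme" (structure) +
 fixes K::"'g set" and w::"'g => 'k::{alg_closed_field,field_char_0}" and S::"'g set"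
 assumes K_carrier: "a : K ==> a : carrier F" and w_nonzero: "a : K ==> w a ~= 0"
  and S_finite: "finite S" and S_carrier: "x : S ==> x : carrier F" and S_nonempty: "S ~= {}"
  and translate: "y : carrier F ==> EX p. bij_betw p S S & (ALL x:S. EX a:K. y \<otimes> x = a \<otimes> p x)"
begin

definition weighted::"('g,'k) rep => bool" where
 "weighted L \<longleftrightarrow> L : reps F & (ALL a:K. snd L a = w a \<cdot>\<^sub>m 1\<^sub>m (fst L))"

text \<open>The inner product of characters, multiplied by the number of elements of \<open>S\<close>.\<close>

definition ip::"('g,'k) rep => ('g,'k) rep => 'k" where
 "ip L M = (\<Sum>x\<in>S. trace (snd L (inv x)) * trace (snd M x))"

lemma card_S: "of_nat (card S) ~= (0::'k)"
 using S_finite S_nonempty by simp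

lemma sum_translate:
 fixes h::"'g => 'a::comm_monoid_add"
 assumes "y : carrier F" "!!a x. a : K ==> x : S ==> h (a \<otimes> x) = h x"
 shows "(\<Sum>x\<in>S. h (y \<otimes> x)) = (\<Sum>x\<in>S. h x)"
proof -
 obtain p where p: "bij_betw p S S" "!!x. x : S ==> EX a:K. y \<otimes> x = a \<otimes> p x"
  using translate[OF assms(1)] by blast
 have "h (y \<otimes> x) = h (p x)" if x: "x : S" for x
 proof -
  obtain a where "a : K" "y \<otimes> x = a \<otimes> p x" using p(2)[OF x] by blast
  thus ?thesis using assms(2)[of a "p x"] bij_betwE[OF p(1)] x by auto
 qed
 hence "(\<Sum>x\<in>S. h (y \<otimes> x)) = (\<Sum>x\<in>S. h (p x))" by simp
 also have "... = (\<Sum>x\<in>S. h x)" by (rule sum.reindex_bij_betw[OF p(1)])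
 finally show ?thesis .
qed

lemma weightedD:
 assumes "weighted (n,si)"
 shows "(n,si) : reps F" "a : K ==> x : carrier F ==> si (a \<otimes> x) = w a \<cdot>\<^sub>m si x"
  "a : K ==> x : carrier F ==> si (inv (a \<otimes> x)) = inverse (w a) \<cdot>\<^sub>m si (inv x)"
  "a : K ==> si a = w a \<cdot>\<^sub>m 1\<^sub>m n"
proof -
 show r: "(n,si) : reps F" and a: "a : K ==> si a = w a \<cdot>\<^sub>m 1\<^sub>m n" for a
  using assms by (auto simp: weighted_def)
 note R = repsD[OF r is_group]
 show "si (a \<otimes> x) = w a \<cdot>\<^sub>m si x" if "a : K" "x : carrier F"
  using R(3)[OF K_carrier[OF that(1)] that(2)] a[OF that(1)] R(2)[OF that(2)]
  by (simp add: mult_smult_assoc_mat[of _ n n _ n])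
 show "si (inv (a \<otimes> x)) = inverse (w a) \<cdot>\<^sub>m si (inv x)" if "a : K" "x : carrier F"
 proof -
  note ac = K_carrier[OF that(1)]
  have c: "si (inv a) : carrier_mat n n" "si (inv x) : carrier_mat n n" using R(2) ac that by auto
  have "1\<^sub>m n = w a \<cdot>\<^sub>m si (inv a)"
   using R(5)[OF ac] a[OF that(1)] c by (simp add: mult_smult_assoc_mat[of _ n n _ n])
  hence "inverse (w a) \<cdot>\<^sub>m 1\<^sub>m n = si (inv a)"
   using w_nonzero[OF that(1)] c by (intro eq_matI) (auto simp: field_simps)
  moreover have "si (inv (a \<otimes> x)) = si (inv x) * si (inv a)"
   using ac that by (simp add: inv_mult_group R(3))
  ultimately show ?thesis using c by (metis mult_smult_distrib one_carrier_mat right_mult_one_mat)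
 qed
qed

text \<open>Averaging over \<open>S\<close> makes an arbitrary matrix an intertwiner.\<close>

lemma average_intertwines:
 assumes s: "weighted (n,si)" and t: "weighted (n',tau)" and X: "X : carrier_mat n' n"
  and y: "y : carrier F"
 shows "tau y * msum n' n (%x. tau x * X * si (inv x)) S = msum n' n (%x. tau x * X * si (inv x)) S * si y"
  (is "_ * ?A = _")
proof -
 note Rs = repsD[OF weightedD(1)[OF s] is_group] and Rt = repsD[OF weightedD(1)[OF t] is_group]
 let ?h = "%x. tau x * X * si (inv x)"
 have hc: "?h x : carrier_mat n' n" if "x : carrier F" for x
  using Rs(2)[of "inv x"] Rt(2)[of x] that X by auto
 have hK: "?h (a \<otimes> x) = ?h x" if "a : K" "x : S" for a x
 proof -
  have x: "x : carrier F" using S_carrier that by blast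
  have c: "tau x * X : carrier_mat n' n" "si (inv x) : carrier_mat n n" "tau x : carrier_mat n' n'"
   using x X Rs(2)[of "inv x"] Rt(2)[OF x] by auto
  show ?thesis unfolding weightedD(2)[OF t that(1) x] weightedD(3)[OF s that(1) x]
   using c X w_nonzero[OF that(1)]
   by (simp add: mult_smult_assoc_mat[of _ n' n' _ n] mult_smult_assoc_mat[of _ n' n _ n]
     mult_smult_distrib[of _ n' n _ n] smult_smult_mat one_smult_mat)
 qed
 have "tau y * ?A * si (inv y) = msum n' n (%x. tau y * ?h x * si (inv y)) S"
 proof -
  have "tau y * ?A = msum n' n (%x. tau y * ?h x) S"
   by (rule mult_msum) (use Rt(2)[OF y] hc S_carrier in auto)
  thus ?thesis
   using msum_mult[of "si (inv y)" n n S "%x. tau y * ?h x" n'] Rs(2)[of "inv y"] y hc S_carrier Rt(2)[OF y]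
   by (metis inv_closed mult_carrier_mat)
 qed
 also have "... = msum n' n (%x. ?h (y \<otimes> x)) S"
 proof (rule msum_cong)
  fix x assume "x : S"
  hence x: "x : carrier F" by (rule S_carrier)
  have c: "tau x : carrier_mat n' n'" "tau y : carrier_mat n' n'" "si (inv x) : carrier_mat n n" "si (inv y) : carrier_mat n n"
   using x y Rs(2)[of "inv x"] Rs(2)[of "inv y"] Rt(2)[OF x] Rt(2)[OF y] by auto
  have "?h (y \<otimes> x) = tau y * tau x * X * (si (inv x) * si (inv y))"
   using x y by (simp add: Rt(3) Rs(3) inv_mult_group)
  also have "... = tau y * ?h x * si (inv y)"
   using c X by (simp add: assoc_mult_mat[of _ n' n' _ n' _ n] assoc_mult_mat[of _ n' n' _ n _ n] assoc_mult_mat[of _ n' n _ n _ n])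
  finally show "tau y * ?h x * si (inv y) = ?h (y \<otimes> x)" by simp
 qed
 also have "... = ?A"
  unfolding msum_def
  by (intro eq_matI) (auto intro!: sum_translate[OF y,where h = "%x. ?h x $$ _"] arg_cong[of _ _ "%M. M $$ _"] hK)
 finally have e: "tau y * ?A * si (inv y) = ?A" .
 have c: "tau y : carrier_mat n' n'" "si y : carrier_mat n n" "si (inv y) : carrier_mat n n" "?A : carrier_mat n' n"
  using y Rs(2)[of "inv y"] Rs(2)[OF y] Rt(2)[OF y] by auto
 have "?A * si y = tau y * ?A * si (inv y) * si y" unfolding e ..
 also have "... = tau y * ?A * (si (inv y) * si y)" by (rule assoc_mult_mat[of _ n' n _ n _ n]) (use c in auto)
 also have "... = tau y * ?A" unfolding Rs(6)[OF y] by (rule right_mult_one_mat[of _ n' n]) (use c in auto)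
 finally show ?thesis ..
qed

lemma average_entry:
 assumes s: "(n,si::'g => 'k mat) : reps F" and t: "(n',tau::'g => 'k mat) : reps F" and ij: "i < n'" "j < n'" "k < n" "l < n"
 shows "msum n' n (%x. tau x * mat n' n (%(a,b). if a = j & b = k then 1 else 0) * si (inv x)) S $$ (i,l)
  = (\<Sum>x\<in>S. tau x $$ (i,j) * si (inv x) $$ (k,l))"
proof -
 note Rs = repsD[OF s is_group] and Rt = repsD[OF t is_group]
 let ?X = "mat n' n (%(a,b). if a = j & b = k then 1 else 0)::'k mat"
 have "(tau x * ?X * si (inv x)) $$ (i,l) = tau x $$ (i,j) * si (inv x) $$ (k,l)" if x: "x : S" for x
 proof -
  have c: "tau x : carrier_mat n' n'" "si (inv x) : carrier_mat n n" using S_carrier[OF x] Rs(2)[of "inv x"] Rt(2)[of x] by auto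
  have X: "?X : carrier_mat n' n" by simp
  have 1: "(tau x * ?X) $$ (i,b) = (if b = k then tau x $$ (i,j) else 0)" if "b < n" for b
   unfolding mult_mat_entry[OF c(1) X ij(1) that] using that ij
   by (auto simp: if_distrib[of "%x. _ * x"] cong: if_cong)
  have "(tau x * ?X * si (inv x)) $$ (i,l) = (\<Sum>b<n. (tau x * ?X) $$ (i,b) * si (inv x) $$ (b,l))"
   by (rule mult_mat_entry[of _ n' n _ n]) (use c X ij in auto)
  also have "... = (\<Sum>b<n. if b = k then tau x $$ (i,j) * si (inv x) $$ (k,l) else 0)"
   by (intro sum.cong) (auto simp: 1 simp del: index_mult_mat(1))
  finally show ?thesis using ij by simp
 qed
 thus ?thesis using ij by (simp add: msum_def)
qed

lemma ip_entries:
 assumes s: "(n,si::'g => 'k mat) : reps F" and t: "(n',tau::'g => 'k mat) : reps F"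
 shows "ip (n,si) (n',tau) = (\<Sum>i<n'. \<Sum>k<n. \<Sum>x\<in>S. tau x $$ (i,i) * si (inv x) $$ (k,k))"
proof -
 note Rs = repsD[OF s is_group] and Rt = repsD[OF t is_group]
 have "ip (n,si) (n',tau) = (\<Sum>x\<in>S. \<Sum>i<n'. \<Sum>k<n. tau x $$ (i,i) * si (inv x) $$ (k,k))"
  unfolding ip_def
 proof (rule sum.cong[OF refl])
  fix x assume x: "x : S"
  have c: "tau x : carrier_mat n' n'" "si (inv x) : carrier_mat n n" using S_carrier[OF x] Rs(2)[of "inv x"] Rt(2)[of x] by auto
  show "trace (snd (n,si) (inv x)) * trace (snd (n',tau) x) = (\<Sum>i<n'. \<Sum>k<n. tau x $$ (i,i) * si (inv x) $$ (k,k))"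
   using c by (simp add: trace_def sum_product mult.commute)
 qed
 also have "... = (\<Sum>i<n'. \<Sum>k<n. \<Sum>x\<in>S. tau x $$ (i,i) * si (inv x) $$ (k,k))"
  by (subst sum.swap) (intro sum.cong refl sum.swap)
 finally show ?thesis .
qed

lemma ip_cong_trace:
 assumes "!!g. g : carrier F ==> trace (snd L g) = trace (snd L' g)"
  "!!g. g : carrier F ==> trace (snd M g) = trace (snd M' g)"
 shows "ip L M = ip L' M'"
 unfolding ip_def using assms S_carrier by (intro sum.cong) auto

text \<open>The average of a matrix unit is an intertwiner, which Schur's lemma evaluates; its entries are the diagonal terms
\<open>\<Sum> M(x)\<^sub>i\<^sub>i L(x\<^sup>-\<^sup>1)\<^sub>k\<^sub>k\<close> of the inner product.\<close>

theorem orthogonality: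
 assumes s: "irreducible_rep F L" "weighted L" and t: "irreducible_rep F M" "weighted M"
 shows "ip L M = (if rep_iso F L M then of_nat (card S) else 0)"
proof -
 obtain n si where L: "L = (n,si)" by (cases L)
 obtain n' tau where M: "M = (n',tau)" by (cases M)
 note rL = irreducible_repD(1)[OF s(1)[unfolded L]] and rM = irreducible_repD(1)[OF t(1)[unfolded M]]
 show ?thesis
 proof (cases "rep_iso F L M")
  case False
  have z: "(\<Sum>x\<in>S. tau x $$ (i,i) * si (inv x) $$ (k,k)) = 0" if ik: "i < n'" "k < n" for i k
  proof -
   define A where "A = msum n' n (%x. tau x * mat n' n (%(a,b). if a = i & b = k then 1 else 0) * si (inv x)) S"
   have int: "tau g * A = A * si g" if "g : carrier F" for g unfolding A_def
    by (rule average_intertwines) (use s t that in "auto simp: L M")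
   have "A = 0\<^sub>m n' n \<or> (n = n' & A : carrier (GL n))"
    by (rule schur[OF is_group s(1)[unfolded L] t(1)[unfolded M] _ int]) (simp_all add: A_def)
   moreover have "~(n = n' & A : carrier (GL n))"
    using rep_isoI[of A n F si tau] int False by (auto simp: L M)
   ultimately have "A $$ (i,k) = 0" using ik by simp
   thus ?thesis unfolding A_def average_entry[OF rL rM ik(1) ik(1) ik(2) ik(2)] .
  qed
  show ?thesis unfolding L M ip_entries[OF rL rM] using z False by (simp add: L M)
 next
  case True
  have "ip L M = ip L L"
   using rep_iso_trace[OF is_group rL rM] True by (intro ip_cong_trace) (auto simp: L M)
  also have "ip L L = of_nat (card S)"
  proof -
   define q where "q = (of_nat (card S) / of_nat n::'k)"
   have z: "(\<Sum>x\<in>S. si x $$ (i,i) * si (inv x) $$ (k,k)) = (if i = k then q else 0)"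
    if ik: "i < n" "k < n" for i k
   proof -
    let ?X = "mat n n (%(a,b). if a = i & b = k then 1 else 0)::'k mat"
    define A where "A = msum n n (%x. si x * ?X * si (inv x)) S"
    have int: "si g * A = A * si g" if "g : carrier F" for g unfolding A_def
     by (rule average_intertwines) (use s that in "auto simp: L M")
    obtain c where c: "A = c \<cdot>\<^sub>m 1\<^sub>m n"
     by (rule schur_scalar[OF is_group s(1)[unfolded L] _ int]) (simp_all add: A_def)
    have "c * of_nat n = trace A" unfolding c by (simp add: trace_smult[of _ n])
    also have "... = (\<Sum>x\<in>S. trace (si x * ?X * si (inv x)))"
    proof -
     have "dim_row (si x * ?X * si (inv x)) = n" if "x : S" for x
      using repsD(2)[OF rL is_group S_carrier[OF that]] by simp
     hence "(\<Sum>x\<in>S. trace (si x * ?X * si (inv x))) = (\<Sum>x\<in>S. \<Sum>j<n. (si x * ?X * si (inv x)) $$ (j,j))"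
      unfolding trace_def by (intro sum.cong) auto
     also have "... = trace A" unfolding A_def trace_def msum_def by (subst sum.swap) simp
     finally show ?thesis by simp
    qed
    also have "... = (\<Sum>x\<in>S. trace ?X)"
    proof (rule sum.cong[OF refl])
     fix x assume "x : S"
     hence x: "x : carrier F" by (rule S_carrier)
     note R = repsD[OF rL is_group]
     have cc: "si x : carrier_mat n n" "si (inv x) : carrier_mat n n" "?X : carrier_mat n n" using R(2)[OF x] R(2)[of "inv x"] x by auto
     have "trace (si x * ?X * si (inv x)) = trace (si (inv x) * (si x * ?X))"
      by (rule trace_mult_comm[of _ n n]) (use cc in auto)
     also have "si (inv x) * (si x * ?X) = (si (inv x) * si x) * ?X"
      by (rule assoc_mult_mat[symmetric,of _ n n _ n _ n]) (use cc in auto)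
     also have "... = ?X" using R(6)[OF x] cc by simp
     finally show "trace (si x * ?X * si (inv x)) = trace ?X" .
    qed
    also have "trace ?X = (if i = k then 1 else 0)"
    proof -
     have "trace ?X = (\<Sum>j<n. if j = i then (if i = k then 1 else 0) else 0)"
      unfolding trace_def by (intro sum.cong) auto
     thus ?thesis using ik by simp
    qed
    finally have "c * of_nat n = (if i = k then of_nat (card S) else 0)" by simp
    moreover have "(of_nat n::'k) ~= 0" using irreducible_repD(2)[OF s(1)[unfolded L]] by simp
    ultimately have cq: "c = (if i = k then q else 0)" by (auto simp: q_def field_simps split: if_splits)
    have "A $$ (i,k) = (if i = k then q else 0)" unfolding c cq using ik by auto
    thus ?thesis unfolding A_def average_entry[OF rL rL ik(1) ik(1) ik(2) ik(2)] .
   qed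
   have "ip L L = (\<Sum>i<n. \<Sum>k<n. if i = k then q else 0)"
    unfolding L ip_entries[OF rL rL] by (intro sum.cong refl z) auto
   also have "... = of_nat n * q" by simp
   also have "... = of_nat (card S)" using irreducible_repD(2)[OF s(1)[unfolded L]] by (simp add: q_def)
   finally show ?thesis .
  qed
  finally show ?thesis using True by simp
 qed
qed

end

section \<open>Complete reducibility and multiplicities\<close>

context central_char
begin

lemma direct_sum_rep_iso_one:
 assumes "L : reps F"
 shows "rep_iso F L (direct_sum_rep [L])"
proof (cases L)
 case (Pair n si)
 have "direct_sum_rep [L] = L" by (simp add: direct_sum_rep_def Pair del: diag_block_mat.simps)
 thus ?thesis using rep_iso_refl[OF assms is_group] by simp
qed

text \<open>In block triangular form the corner \<open>B\<close> is a cocycle; averaging \<open>B(x) D(x\<^sup>-\<^sup>1)\<close> over \<open>S\<close> gives a matrix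
\<open>X\<close> with \<open>X D = A X + B\<close>, and conjugating with the unipotent matrix of \<open>X\<close> clears the corner.\<close>

lemma maschke_step:
 assumes s: "weighted (n,si)" and nz: "n > 0" and red: "~irreducible_rep F (n,si)"
 obtains d A D where "0 < d" "d < n" "weighted (d,A)" "weighted (n - d,D)"
  "rep_iso F (n,si) (d + (n - d),%g. four_block_mat (A g) (0\<^sub>m d (n - d)) (0\<^sub>m (n - d) d) (D g))"
proof -
 note r = weightedD(1)[OF s] note R = repsD[OF r is_group]
 obtain W where W: "VectorSpace.subspace class_ring W (module_vec TYPE('k) n)"
  "!!g w. g : carrier F ==> w : W ==> si g *\<^sub>v w : W" "W ~= {0\<^sub>v n}" "W ~= carrier_vec n"
  using red r nz by (auto simp: irreducible_rep_def)
 obtain P d A B D where P: "P : carrier (GL n)" and d: "0 < d" "d < n"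
  and A: "!!g. A g : carrier_mat d d" and B: "!!g. B g : carrier_mat d (n - d)"
  and D: "!!g. D g : carrier_mat (n - d) (n - d)"
  and bl: "!!g. g : carrier F ==> si g * P = P * four_block_mat (A g) (B g) (0\<^sub>m (n - d) d) (D g)"
  using invariant_block_form[OF is_group r W(1,2) W(3,4)] by metis
 define e where "e = n - d"
 have n: "n = d + e" using d by (simp add: e_def)
 note A = A and B = B[folded e_def] and D = D[folded e_def] and bl = bl[folded e_def]
 define T where "T g = four_block_mat (A g) (B g) (0\<^sub>m e d) (D g)" for g
 have T: "T g : carrier_mat n n" for g unfolding T_def n using A B D by auto
 obtain Q where Q: "Q : carrier (GL n)" "P * Q = 1\<^sub>m n" "Q * P = 1\<^sub>m n" using GL_inverse[OF P] .
 note Pc = GL_carrier_mat[OF P] and Qc = GL_carrier_mat[OF Q(1)]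
 have TQ: "T g = Q * (si g * P)" if "g : carrier F" for g
 proof -
  have "Q * (si g * P) = Q * (P * T g)" using bl[OF that] by (simp add: T_def)
  also have "... = (Q * P) * T g" by (rule assoc_mult_mat[OF Qc Pc T,symmetric])
  finally show ?thesis using Q(3) T left_mult_one_mat[OF T] by simp
 qed
 have Tm: "T (g \<otimes> h) = T g * T h" if g: "g : carrier F" and h: "h : carrier F" for g h
 proof -
  have "P * T (g \<otimes> h) = si g * si h * P" using bl[of "g \<otimes> h"] g h R(3)[OF g h] by (simp add: T_def)
  also have "... = si g * (si h * P)" by (rule assoc_mult_mat[OF R(2)[OF g] R(2)[OF h] Pc])
  also have "... = si g * (P * T h)" using bl[OF h] by (simp add: T_def)
  also have "... = (si g * P) * T h" by (rule assoc_mult_mat[OF R(2)[OF g] Pc T,symmetric])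
  also have "... = (P * T g) * T h" using bl[OF g] by (simp add: T_def)
  also have "... = P * (T g * T h)" by (rule assoc_mult_mat[OF Pc T T])
  finally have "Q * (P * T (g \<otimes> h)) = Q * (P * (T g * T h))" by simp
  hence "(Q * P) * T (g \<otimes> h) = (Q * P) * (T g * T h)"
   using assoc_mult_mat[OF Qc Pc T[of "g \<otimes> h"]] assoc_mult_mat[OF Qc Pc mult_carrier_mat[OF T[of g] T[of h]]] by simp
  thus ?thesis unfolding Q(3) using left_mult_one_mat[OF T] left_mult_one_mat[OF mult_carrier_mat[OF T[of g] T[of h]]] by simp
 qed
 have hom: "A (g \<otimes> h) = A g * A h" "B (g \<otimes> h) = A g * B h + B g * D h" "D (g \<otimes> h) = D g * D h"
  if g: "g : carrier F" and h: "h : carrier F" for g h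
 proof -
  have "four_block_mat (A (g \<otimes> h)) (B (g \<otimes> h)) (0\<^sub>m e d) (D (g \<otimes> h))
   = four_block_mat (A g * A h + B g * 0\<^sub>m e d) (A g * B h + B g * D h)
     (0\<^sub>m e d * A h + D g * 0\<^sub>m e d) (0\<^sub>m e d * B h + D g * D h)"
   using Tm[OF g h] mult_four_block_mat[OF A[of g] B[of g] zero_carrier_mat D[of g] A[of h] B[of h] zero_carrier_mat D[of h]]
   unfolding T_def by simp
  also have "B g * 0\<^sub>m e d = 0\<^sub>m d d" by (rule right_mult_zero_mat[OF B])
  also have "A g * A h + 0\<^sub>m d d = A g * A h" by (rule right_add_zero_mat[OF mult_carrier_mat[OF A A]])
  also have "0\<^sub>m e d * A h + D g * 0\<^sub>m e d = 0\<^sub>m e d" using A[of h] D[of g] by simp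
  also have "0\<^sub>m e d * B h + D g * D h = D g * D h"
   using left_mult_zero_mat[OF B] left_add_zero_mat[OF mult_carrier_mat[OF D[of g] D[of h]]] by simp
  finally have eq: "four_block_mat (A (g \<otimes> h)) (B (g \<otimes> h)) (0\<^sub>m e d) (D (g \<otimes> h))
   = four_block_mat (A g * A h) (A g * B h + B g * D h) (0\<^sub>m e d) (D g * D h)" .
  have c1: "A g * B h + B g * D h : carrier_mat d e"
   by (rule add_carrier_mat) (rule mult_carrier_mat[OF B D])
  note q = four_block_mat_eqD[OF eq A mult_carrier_mat[OF A A] D mult_carrier_mat[OF D D] B c1 zero_carrier_mat zero_carrier_mat]
  show "A (g \<otimes> h) = A g * A h" "B (g \<otimes> h) = A g * B h + B g * D h" "D (g \<otimes> h) = D g * D h"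
   by (rule q)+
 qed
 have scal: "A g = c \<cdot>\<^sub>m 1\<^sub>m d & B g = 0\<^sub>m d e & D g = c \<cdot>\<^sub>m 1\<^sub>m e"
  if g: "g : carrier F" and c: "si g = c \<cdot>\<^sub>m 1\<^sub>m n" for g c
 proof -
  have "T g = c \<cdot>\<^sub>m 1\<^sub>m n"
   unfolding TQ[OF g] c using Pc Qc Q(3)
   by (simp add: mult_smult_assoc_mat[of _ n n _ n] mult_smult_distrib[OF Qc Pc])
  hence eq: "four_block_mat (A g) (B g) (0\<^sub>m e d) (D g)
    = four_block_mat (c \<cdot>\<^sub>m 1\<^sub>m d) (0\<^sub>m d e) (0\<^sub>m e d) (c \<cdot>\<^sub>m 1\<^sub>m e)"
   unfolding T_def n smult_one_four_block .
  have c1: "c \<cdot>\<^sub>m 1\<^sub>m x : carrier_mat x x" for x by simp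
  note q = four_block_mat_eqD[OF eq A c1 D c1 B zero_carrier_mat zero_carrier_mat zero_carrier_mat]
  show ?thesis using q by blast
 qed
 have one: "A \<one> = 1\<^sub>m d" "D \<one> = 1\<^sub>m e" using scal[of \<one> 1] R(4) by (auto simp: one_smult_mat)
 have rA: "(d,A) : reps F" by (rule repsI[OF is_group A hom(1) one(1)])
 have rD: "(e,D) : reps F" by (rule repsI[OF is_group D hom(3) one(2)])
 have wA: "weighted (d,A)" and wD: "weighted (e,D)"
  unfolding weighted_def using rA rD scal[OF K_carrier weightedD(4)[OF s]] by auto
 note RD = repsD[OF rD is_group]
 define h where "h x = B x * D (inv x)" for x
 have h: "h x : carrier_mat d e" for x unfolding h_def by (rule mult_carrier_mat[OF B D])
 have hK: "h (a \<otimes> x) = h x" if a: "a : K" and x: "x : S" for a x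
 proof -
  have xc: "x : carrier F" using S_carrier[OF x] .
  have "B (a \<otimes> x) = w a \<cdot>\<^sub>m B x"
   unfolding hom(2)[OF K_carrier[OF a] xc] using scal[OF K_carrier[OF a] weightedD(4)[OF s a]] B[of x]
    left_mult_zero_mat[OF D[of x],of d] by (simp add: mult_smult_assoc_mat[of _ d d _ e])
  thus ?thesis unfolding h_def weightedD(3)[OF wD a xc] using B[of x] D[of "inv x"] w_nonzero[OF a]
   by (simp add: mult_smult_assoc_mat[of _ d e _ e] mult_smult_distrib[of _ d e _ e] smult_smult_mat one_smult_mat)
 qed
 define M where "M = msum d e h S"
 have M: "M : carrier_mat d e" by (simp add: M_def)
 define c where "c = (of_nat (card S)::'k)"
 have key: "M * D g = A g * M + c \<cdot>\<^sub>m B g" if g: "g : carrier F" for g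
 proof -
  have h2: "h (g \<otimes> x) * D g = A g * h x + B g" if x: "x : S" for x
  proof -
   have xc: "x : carrier F" and ix: "inv x : carrier F" and ig: "inv g : carrier F" using S_carrier[OF x] g by auto
   have "D (inv (g \<otimes> x)) * D g = D (inv (g \<otimes> x) \<otimes> g)" using hom(3)[of "inv (g \<otimes> x)" g] g xc by simp
   also have "inv (g \<otimes> x) \<otimes> g = inv x" using g xc by (simp add: inv_mult_group m_assoc)
   finally have 1: "D (inv (g \<otimes> x)) * D g = D (inv x)" .
   have "h (g \<otimes> x) * D g = B (g \<otimes> x) * (D (inv (g \<otimes> x)) * D g)"
    unfolding h_def by (rule assoc_mult_mat[OF B D D])
   also have "... = (A g * B x + B g * D x) * D (inv x)" unfolding 1 hom(2)[OF g xc] ..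
   also have "... = A g * B x * D (inv x) + B g * D x * D (inv x)"
    by (rule add_mult_distrib_mat[OF mult_carrier_mat[OF A B] mult_carrier_mat[OF B D] D])
   also have "A g * B x * D (inv x) = A g * h x" unfolding h_def by (rule assoc_mult_mat[OF A B D])
   also have "B g * D x * D (inv x) = B g * (D x * D (inv x))" by (rule assoc_mult_mat[OF B D D])
   also have "... = B g" unfolding RD(5)[OF xc] by (rule right_mult_one_mat[OF B])
   finally show ?thesis .
  qed
  have "M = msum d e (%x. h (g \<otimes> x)) S"
   unfolding M_def msum_def
   by (intro eq_matI) (auto intro!: sum_translate[OF g,where h = "%x. h x $$ _",symmetric] arg_cong[of _ _ "%M. M $$ _"] hK)
  hence "M * D g = msum d e (%x. h (g \<otimes> x) * D g) S"
   using msum_mult[of "D g" e e S "%x. h (g \<otimes> x)" d] D h by simp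
  also have "... = msum d e (%x. A g * h x + B g) S" by (rule msum_cong[OF h2])
  also have "... = msum d e (%x. A g * h x) S + c \<cdot>\<^sub>m B g"
   using B[of g] A[of g] h
   by (intro eq_matI) (auto simp: msum_def sum.distrib c_def carrier_matD[OF A] carrier_matD[OF h] simp del: index_mult_mat(1))
  also have "msum d e (%x. A g * h x) S = A g * M"
   unfolding M_def by (rule mult_msum[symmetric,OF A h])
  finally show ?thesis .
 qed
 have cn: "c ~= 0" using card_S by (simp add: c_def)
 define X where "X = inverse c \<cdot>\<^sub>m M"
 have X: "X : carrier_mat d e" using M by (simp add: X_def)
 have XD: "X * D g = A g * X + B g" if g: "g : carrier F" for g
 proof -
  have "X * D g = inverse c \<cdot>\<^sub>m (M * D g)" unfolding X_def by (rule mult_smult_assoc_mat[OF M D])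
  also have "... = inverse c \<cdot>\<^sub>m (A g * M) + inverse c \<cdot>\<^sub>m (c \<cdot>\<^sub>m B g)"
   unfolding key[OF g] using A[of g] B[of g] M
   by (intro eq_matI) (auto simp: distrib_left simp del: index_mult_mat(1))
  also have "inverse c \<cdot>\<^sub>m (A g * M) = A g * X" unfolding X_def by (rule mult_smult_distrib[OF A M,symmetric])
  also have "inverse c \<cdot>\<^sub>m (c \<cdot>\<^sub>m B g) = B g" using cn by (simp add: smult_smult_mat one_smult_mat)
  finally show ?thesis .
 qed
 define U where "U = four_block_mat (1\<^sub>m d) X (0\<^sub>m e d) (1\<^sub>m e)"
 have Uc: "U : carrier_mat n n" unfolding U_def n by (rule four_block_carrier_mat) auto
 have "det U = 1"
  unfolding U_def using det_four_block_mat_lower_left_zero[OF one_carrier_mat X refl one_carrier_mat] by simp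
 hence U: "U : carrier (GL n)" using Uc by (simp add: carrier_GL)
 define tau where "tau g = four_block_mat (A g) (0\<^sub>m d e) (0\<^sub>m e d) (D g)" for g
 have tc: "tau g : carrier_mat n n" for g unfolding tau_def n by (rule four_block_carrier_mat[OF A D])
 have TU: "T g * U = U * tau g" if g: "g : carrier F" for g
 proof -
  have "T g * U = four_block_mat (A g * 1\<^sub>m d + B g * 0\<^sub>m e d) (A g * X + B g * 1\<^sub>m e)
    (0\<^sub>m e d * 1\<^sub>m d + D g * 0\<^sub>m e d) (0\<^sub>m e d * X + D g * 1\<^sub>m e)"
   unfolding T_def U_def by (rule mult_four_block_mat[OF A B zero_carrier_mat D one_carrier_mat X zero_carrier_mat one_carrier_mat])
  also have "... = four_block_mat (A g) (X * D g) (0\<^sub>m e d) (D g)"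
   unfolding XD[OF g] using A[of g] B[of g] D[of g] X
    right_add_zero_mat[OF A[of g]] left_add_zero_mat[OF D[of g]] by simp
  also have "... = four_block_mat (1\<^sub>m d * A g + X * 0\<^sub>m e d) (1\<^sub>m d * 0\<^sub>m d e + X * D g)
    (0\<^sub>m e d * A g + 1\<^sub>m e * 0\<^sub>m e d) (0\<^sub>m e d * 0\<^sub>m d e + 1\<^sub>m e * D g)"
   using A[of g] B[of g] D[of g] X right_add_zero_mat[OF A[of g]] left_add_zero_mat[OF D[of g]]
    left_add_zero_mat[OF mult_carrier_mat[OF X D[of g]]] by simp
  also have "... = U * tau g"
   unfolding tau_def U_def by (rule mult_four_block_mat[OF one_carrier_mat X zero_carrier_mat one_carrier_mat A zero_carrier_mat zero_carrier_mat D,symmetric])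
  finally show ?thesis .
 qed
 have "rep_iso F (n,si) (n,tau)"
 proof (rule rep_isoI'[of "P * U"])
  show "P * U : carrier (GL n)"
   using monoid.m_closed[OF group.is_monoid[OF group_GL] P U] by simp
  fix g assume g: "g : carrier F"
  show "si g : carrier_mat n n" by (rule R(2)[OF g])
  show "tau g : carrier_mat n n" by (rule tc)
  have "si g * (P * U) = (si g * P) * U" by (rule assoc_mult_mat[OF R(2)[OF g] Pc Uc,symmetric])
  also have "... = (P * T g) * U" unfolding bl[OF g] T_def ..
  also have "... = P * (T g * U)" by (rule assoc_mult_mat[OF Pc T Uc])
  also have "... = (P * U) * tau g" unfolding TU[OF g] by (rule assoc_mult_mat[OF Pc Uc tc,symmetric])
  finally show "si g * (P * U) = P * U * tau g" .
 qed
 hence "rep_iso F (n,si) (d + (n - d),%g. four_block_mat (A g) (0\<^sub>m d (n - d)) (0\<^sub>m (n - d) d) (D g))"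
  using d by (simp add: tau_def[abs_def] e_def)
 thus thesis using that[OF d wA _ ] wD by (simp add: e_def)
qed

theorem maschke:
 assumes "weighted W"
 obtains Ls where "!!L. L : set Ls ==> irreducible_rep F L" "rep_iso F W (direct_sum_rep Ls)"
proof -
 have "EX Ls. (ALL L:set Ls. irreducible_rep F L) & rep_iso F (n,si) (direct_sum_rep Ls)"
  if "weighted (n,si)" for n si
  using that
 proof (induction n arbitrary: si rule: less_induct)
  case (less n)
  note r = weightedD(1)[OF less.prems]
  consider "n = 0" | "irreducible_rep F (n,si)" | "n > 0" "~irreducible_rep F (n,si)" by blast
  thus ?case
  proof cases
   case 1
   have "rep_iso F (n,si) (direct_sum_rep [])"
    unfolding direct_sum_rep_def 1 list.map sum_list.Nil diag_block_mat.simps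
   proof (rule rep_isoI)
    show "1\<^sub>m 0 : carrier (GL 0)" by (simp add: carrier_GL)
    fix g assume "g : carrier F"
    hence "si g : carrier_mat 0 0" using repsD(2)[OF r is_group] unfolding 1 by blast
    thus "1\<^sub>m 0 * si g = 0\<^sub>m 0 0 * 1\<^sub>m 0" by (intro eq_matI) auto
   qed
   thus ?thesis by (intro exI[of _ "[]"]) simp
  next
   case 2
   thus ?thesis using direct_sum_rep_iso_one[OF r] by (intro exI[of _ "[(n,si)]"]) simp
  next
   case 3
   obtain d A D where d: "0 < d" "d < n" and w: "weighted (d,A)" "weighted (n - d,D)"
    and i: "rep_iso F (n,si) (d + (n - d),%g. four_block_mat (A g) (0\<^sub>m d (n - d)) (0\<^sub>m (n - d) d) (D g))"
    by (rule maschke_step[OF less.prems 3])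
   obtain Ls1 where 1: "ALL L:set Ls1. irreducible_rep F L" "rep_iso F (d,A) (direct_sum_rep Ls1)"
    using less.IH[OF d(2) w(1)] by blast
   obtain Ls2 where 2: "ALL L:set Ls2. irreducible_rep F L" "rep_iso F (n - d,D) (direct_sum_rep Ls2)"
    using less.IH[of "n - d" D] d w(2) by auto
   have Ls: "L : reps F" if "L : set Ls1 \<union> set Ls2" for L
    using that 1 2 irreducible_repD(1)[of F "fst L" "snd L"] by auto
   have j: "rep_iso F (d + (n - d),%g. four_block_mat (A g) (0\<^sub>m d (n - d)) (0\<^sub>m (n - d) d) (D g)) (direct_sum_rep (Ls1 @ Ls2))"
    by (rule rep_iso_direct_sum_append[OF is_group weightedD(1)[OF w(1)] weightedD(1)[OF w(2)] Ls 1(2) 2(2)])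
   note wA = repsD[OF weightedD(1)[OF w(1)] is_group] and wD = repsD[OF weightedD(1)[OF w(2)] is_group]
   have m: "(d + (n - d),%g. four_block_mat (A g) (0\<^sub>m d (n - d)) (0\<^sub>m (n - d) d) (D g)) : reps F"
   proof (rule repsI[OF is_group])
    fix g h assume g: "g : carrier F" and h: "h : carrier F"
    show "four_block_mat (A (g \<otimes> h)) (0\<^sub>m d (n - d)) (0\<^sub>m (n - d) d) (D (g \<otimes> h))
     = four_block_mat (A g) (0\<^sub>m d (n - d)) (0\<^sub>m (n - d) d) (D g) * four_block_mat (A h) (0\<^sub>m d (n - d)) (0\<^sub>m (n - d) d) (D h)"
     unfolding wA(3)[OF g h] wD(3)[OF g h]
     by (rule block_diag_mult[symmetric]) (rule wA(2)[OF g] wA(2)[OF h] wD(2)[OF g] wD(2)[OF h])+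
   next
    fix g assume g: "g : carrier F"
    show "four_block_mat (A g) (0\<^sub>m d (n - d)) (0\<^sub>m (n - d) d) (D g) : carrier_mat (d + (n - d)) (d + (n - d))"
     by (rule four_block_carrier_mat[OF wA(2)[OF g] wD(2)[OF g]])
   qed (simp add: wA(4) wD(4) four_block_one_mat)
   have "direct_sum_rep (Ls1 @ Ls2) : reps F" by (rule direct_sum_in_reps[OF _ is_group]) (use Ls in auto)
   hence "rep_iso F (n,si) (direct_sum_rep (Ls1 @ Ls2))"
    by (rule rep_iso_trans[OF is_group r m _ i j])
   thus ?thesis using 1 2 by (intro exI[of _ "Ls1 @ Ls2"]) auto
  qed
 qed
 from this[of "fst W" "snd W"] show thesis using assms that by auto
qed

lemma weighted_iso:
 assumes W: "weighted W" and M: "M : reps F" and i: "rep_iso F W M"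
 shows "weighted M"
proof -
 obtain n si where Wn: "W = (n,si)" by (cases W)
 from i obtain tau P where Mn: "M = (n,tau)" and P: "P : carrier (GL n)"
  "!!g. g : carrier F ==> P * si g = tau g * P"
  by (auto simp: rep_iso_def Wn)
 obtain Q where Q: "Q : carrier (GL n)" "P * Q = 1\<^sub>m n" "Q * P = 1\<^sub>m n" using GL_inverse[OF P(1)] .
 note Pc = GL_carrier_mat[OF P(1)] and Qc = GL_carrier_mat[OF Q(1)]
 have "tau a = w a \<cdot>\<^sub>m 1\<^sub>m n" if a: "a : K" for a
 proof -
  note ac = K_carrier[OF a]
  have t: "tau a : carrier_mat n n" using repsD(2)[OF M[unfolded Mn] is_group ac] .
  have "tau a = tau a * (P * Q)" using right_mult_one_mat[OF t] by (simp add: Q)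
  also have "... = (P * si a) * Q" unfolding P(2)[OF ac] by (rule assoc_mult_mat[OF t Pc Qc,symmetric])
  also have "P * si a = w a \<cdot>\<^sub>m P" unfolding weightedD(4)[OF W[unfolded Wn] a]
   using mult_smult_distrib[OF Pc one_carrier_mat] right_mult_one_mat[OF Pc] by simp
  also have "(w a \<cdot>\<^sub>m P) * Q = w a \<cdot>\<^sub>m (P * Q)" by (rule mult_smult_assoc_mat[OF Pc Qc])
  finally show ?thesis by (simp add: Q)
 qed
 thus ?thesis using M by (simp add: weighted_def Mn)
qed

lemma weighted_summands:
 assumes W: "weighted (direct_sum_rep Ls)" and Ls: "!!L. L : set Ls ==> L : reps F" and L: "L : set Ls"
 shows "weighted L"
proof -
 have "snd L a = w a \<cdot>\<^sub>m 1\<^sub>m (fst L)" if a: "a : K" for a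
 proof -
  note ac = K_carrier[OF a]
  have d: "dim_row (snd M a) = fst M" if "M : set Ls" for M
   using repsD(2)[of "fst M" "snd M" F a] Ls[OF that] is_group ac by simp
  have e: "map dim_row (map (%L. snd L a) Ls) = map fst Ls" using d by simp
  have "diag_block_mat (map (%L. snd L a) Ls) = w a \<cdot>\<^sub>m 1\<^sub>m (sum_list (map fst Ls))"
   using W a by (simp add: weighted_def direct_sum_rep_def)
  hence "snd L a = w a \<cdot>\<^sub>m 1\<^sub>m (dim_row (snd L a))"
   using L by (intro diag_block_mat_eq_smult_one[of "map (%L. snd L a) Ls" "w a"])
    (use e direct_sum_carrier(2)[OF Ls is_group ac] in "auto simp only: set_map imageI")
  thus ?thesis using d[OF L] by simp
 qed
 thus ?thesis using Ls[OF L] by (simp add: weighted_def)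
qed

lemma ip_direct_sum:
 assumes W: "weighted W" and Ls: "!!L. L : set Ls ==> irreducible_rep F L" and i: "rep_iso F W (direct_sum_rep Ls)"
 shows "ip M W = (\<Sum>L\<leftarrow>Ls. ip M L)" "ip W M = (\<Sum>L\<leftarrow>Ls. ip L M)"
  "!!L. L : set Ls ==> weighted L"
proof -
 have r: "L : reps F" if "L : set Ls" for L
  using irreducible_repD(1)[of F "fst L" "snd L"] Ls[OF that] by simp
 have D: "direct_sum_rep Ls : reps F" by (rule direct_sum_in_reps[OF r is_group])
 have W': "W : reps F" using W by (simp add: weighted_def)
 have t: "trace (snd W g) = (\<Sum>L\<leftarrow>Ls. trace (snd L g))" if "g : carrier F" for g
  using rep_iso_trace[OF is_group W' D i that] direct_sum_trace[OF r is_group that] by simp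
 have sl: "(\<Sum>x\<in>S. \<Sum>L\<leftarrow>Ls. f x L) = (\<Sum>L\<leftarrow>Ls. \<Sum>x\<in>S. f x L)" for f::"'g => ('g,'k) rep => 'k"
  by (induction Ls) (auto simp: sum.distrib)
 show "ip M W = (\<Sum>L\<leftarrow>Ls. ip M L)"
 proof -
  have "ip M W = (\<Sum>x\<in>S. \<Sum>L\<leftarrow>Ls. trace (snd M (inv x)) * trace (snd L x))"
   unfolding ip_def by (intro sum.cong refl) (simp add: t S_carrier sum_list_const_mult)
  thus ?thesis unfolding sl ip_def .
 qed
 show "ip W M = (\<Sum>L\<leftarrow>Ls. ip L M)"
 proof -
  have "ip W M = (\<Sum>x\<in>S. \<Sum>L\<leftarrow>Ls. trace (snd L (inv x)) * trace (snd M x))"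
   unfolding ip_def by (intro sum.cong refl) (simp add: t S_carrier sum_list_mult_const)
  thus ?thesis unfolding sl ip_def .
 qed
 show "!!L. L : set Ls ==> weighted L"
  by (rule weighted_summands[OF weighted_iso[OF W D i] r])
qed

lemma ip_count:
 assumes L: "irreducible_rep F L" "weighted L" and W: "weighted W"
  and Ls: "!!L. L : set Ls ==> irreducible_rep F L" and i: "rep_iso F W (direct_sum_rep Ls)"
 shows "ip L W = of_nat (card S) * of_nat (length (filter (%M. M : iso_class F L) Ls))"
proof -
 have d3: "weighted M" if "M : set Ls" for M by (rule ip_direct_sum(3)[OF W Ls i that])
 have d1: "ip L W = (\<Sum>M\<leftarrow>Ls. ip L M)" by (rule ip_direct_sum(1)[OF W Ls i])
 have "(\<Sum>M\<leftarrow>Ms. ip L M) = of_nat (card S) * of_nat (length (filter (%M. M : iso_class F L) Ms))"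
  if "!!M. M : set Ms ==> irreducible_rep F M & weighted M" for Ms
  using that
 proof (induction Ms)
  case (Cons M Ms)
  have M: "irreducible_rep F M" "weighted M" using Cons.prems[of M] by auto
  have "ip L M = (if M : iso_class F L then of_nat (card S) else 0)"
   unfolding orthogonality[OF L M] using M(2) by (simp add: iso_class_def weighted_def)
  moreover have "(\<Sum>M\<leftarrow>Ms. ip L M) = of_nat (card S) * of_nat (length (filter (%M. M : iso_class F L) Ms))"
   by (rule Cons.IH,rule Cons.prems,rule list.set_intros(2))
  ultimately show ?case by (simp add: algebra_simps)
 qed simp
 thus ?thesis unfolding d1 using Ls d3 by blast
qed

theorem multiplicity_ip:
 assumes L: "irreducible_rep F L" "weighted L" and W: "weighted W"
 shows "of_nat (multiplicity_in F (iso_class F L) W) * of_nat (card S) = ip L W"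
proof -
 obtain Ls where Ls: "!!L. L : set Ls ==> irreducible_rep F L" "rep_iso F W (direct_sum_rep Ls)"
  using maschke[OF W] by metis
 let ?r = "length (filter (%M. M : iso_class F L) Ls)"
 have "multiplicity_in F (iso_class F L) W = ?r"
  unfolding multiplicity_in_def
 proof (rule the_equality)
  show "EX Ls. (ALL L:set Ls. irreducible_rep F L) & rep_iso F W (direct_sum_rep Ls) &
     ?r = length (filter (%M. M : iso_class F L) Ls)" using Ls by blast
  fix r assume "EX Ms. (ALL L:set Ms. irreducible_rep F L) & rep_iso F W (direct_sum_rep Ms) &
     r = length (filter (%M. M : iso_class F L) Ms)"
  then obtain Ms where Ms: "!!L. L : set Ms ==> irreducible_rep F L" "rep_iso F W (direct_sum_rep Ms)"
   and r: "r = length (filter (%M. M : iso_class F L) Ms)" by blast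
  have "of_nat (card S) * of_nat r = (of_nat (card S) * of_nat ?r::'k)"
  proof -
   have "ip L W = of_nat (card S) * of_nat r" unfolding r by (rule ip_count[OF L W Ms])
   moreover have "ip L W = of_nat (card S) * of_nat ?r" by (rule ip_count[OF L W Ls])
   ultimately show ?thesis by metis
  qed
  thus "r = ?r" using card_S by (metis mult_cancel_left of_nat_eq_iff)
 qed
 moreover have "ip L W = of_nat (card S) * of_nat ?r" by (rule ip_count[OF L W Ls])
 ultimately show ?thesis by (simp add: mult.commute)
qed

lemma irreducible_iso:
 assumes L: "irreducible_rep F L" and M: "M : reps F" and i: "rep_iso F L (M::('g,'k) rep)"
 shows "irreducible_rep F M"
proof -
 obtain n si where Ln: "L = (n,si)" by (cases L)
 from i obtain tau P where Mn: "M = (n,tau)" and P: "P : carrier (GL n)"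
  "!!g. g : carrier F ==> P * si g = tau g * P"
  by (auto simp: rep_iso_def Ln)
 note S = irreducible_repD[OF L[unfolded Ln]]
 obtain Q where Q: "Q : carrier (GL n)" "P * Q = 1\<^sub>m n" "Q * P = 1\<^sub>m n" using GL_inverse[OF P(1)] .
 note Pc = GL_carrier_mat[OF P(1)] and Qc = GL_carrier_mat[OF Q(1)]
 have "W = {0\<^sub>v n} \<or> W = carrier_vec n"
  if W: "VectorSpace.subspace class_ring W (module_vec TYPE('k) n)"
   and inv: "!!g w. g : carrier F ==> w : W ==> tau g *\<^sub>v w : W" for W
 proof -
  note Wd = subspaceD[OF W]
  define V where "V = {v : carrier_vec n. P *\<^sub>v v : W}"
  have "VectorSpace.subspace class_ring V (module_vec TYPE('k) n)"
   by (rule subspaceI) (auto simp: V_def mult_zero_vec[OF Pc] mult_add_distrib_mat_vec[OF Pc] mult_mat_vec[OF Pc] Wd)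
  moreover have "si g *\<^sub>v v : V" if g: "g : carrier F" and v: "v : V" for g v
  proof -
   have vc: "v : carrier_vec n" "P *\<^sub>v v : W" using v by (auto simp: V_def)
   have c: "si g : carrier_mat n n" "tau g : carrier_mat n n"
    using repsD(2)[OF S(1) is_group g] repsD(2)[OF M[unfolded Mn] is_group g] by auto
   have "P *\<^sub>v (si g *\<^sub>v v) = tau g *\<^sub>v (P *\<^sub>v v)"
    using assoc_mult_mat_vec[OF Pc c(1) vc(1)] assoc_mult_mat_vec[OF c(2) Pc vc(1)] P(2)[OF g] by simp
   thus ?thesis using inv[OF g vc(2)] vc c by (auto simp: V_def)
  qed
  ultimately have V: "V = {0\<^sub>v n} \<or> V = carrier_vec n" by (rule S(3))
  have wP: "w = P *\<^sub>v (Q *\<^sub>v w)" if "w : carrier_vec n" for w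
   using assoc_mult_mat_vec[OF Pc Qc that] Q(2) that by simp
  from V show ?thesis
  proof
   assume V0: "V = {0\<^sub>v n}"
   have "w = 0\<^sub>v n" if w: "w : W" for w
   proof -
    have wc: "w : carrier_vec n" using Wd(1) w by blast
    have "Q *\<^sub>v w : V" unfolding V_def using wP[OF wc] w Qc wc by auto
    thus ?thesis using V0 wP[OF wc] mult_zero_vec[OF Pc] by simp
   qed
   thus ?thesis using Wd(2) by blast
  next
   assume V1: "V = carrier_vec n"
   have "w : W" if wc: "w : carrier_vec n" for w
   proof -
    have "Q *\<^sub>v w : V" unfolding V1 using Qc wc by auto
    hence "P *\<^sub>v (Q *\<^sub>v w) : W" by (simp add: V_def)
    thus ?thesis using wP[OF wc] by simp
   qed
   thus ?thesis using Wd(1) by blast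
  qed
 qed
 thus ?thesis using M S(2) by (auto simp: irreducible_rep_def Mn)
qed

text \<open>The inner product of \<open>W\<close> with itself is the sum of the squares of its multiplicities, times the number of elements
of \<open>S\<close>.\<close>

lemma irreducible_criterion:
 assumes W: "weighted W" and n: "ip W W = of_nat (card S)"
 shows "irreducible_rep F W"
proof -
 obtain Ls where Ls: "!!L. L : set Ls ==> irreducible_rep F L" "rep_iso F W (direct_sum_rep Ls)"
  using maschke[OF W] by metis
 have d3: "weighted L" if "L : set Ls" for L by (rule ip_direct_sum(3)[OF W Ls that])
 have d2: "ip W W = (\<Sum>L\<leftarrow>Ls. ip L W)" by (rule ip_direct_sum(2)[OF W Ls])
 have r: "L : reps F" if "L : set Ls" for L using d3[OF that] by (simp add: weighted_def)
 define c where "c L = length (filter (%M. M : iso_class F L) Ls)" for L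
 have c1: "c L >= 1" if "L : set Ls" for L
 proof -
  have "L : set (filter (%M. M : iso_class F L) Ls)"
   using that r[OF that] rep_iso_refl[OF r[OF that] is_group] by (simp add: iso_class_def)
  thus ?thesis unfolding c_def by (metis One_nat_def Suc_leI length_pos_if_in_set)
 qed
 have "ip W W = (\<Sum>L\<leftarrow>Ls. of_nat (card S) * of_nat (c L))"
  unfolding d2 c_def
 proof (intro arg_cong[of _ _ sum_list] map_cong refl)
  fix L assume "L : set Ls"
  thus "ip L W = of_nat (card S) * of_nat (length (filter (%M. M : iso_class F L) Ls))"
   by (intro ip_count[OF Ls(1) d3 W Ls])
 qed
 also have "... = of_nat (card S) * of_nat (\<Sum>L\<leftarrow>Ls. c L)"
 proof -
  have "(\<Sum>L\<leftarrow>Ms. of_nat (card S) * of_nat (c L)) = (of_nat (card S) * of_nat (\<Sum>L\<leftarrow>Ms. c L)::'k)" for Ms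
   by (induction Ms) (simp_all add: algebra_simps)
  thus ?thesis .
 qed
 finally have s1: "(\<Sum>L\<leftarrow>Ls. c L) = 1"
  using n card_S by (simp flip: of_nat_mult of_nat_1)
 have "length Ls = (\<Sum>L\<leftarrow>Ls. 1)" by (simp add: sum_list_triv)
 also have "... <= (\<Sum>L\<leftarrow>Ls. c L)" using c1 by (intro sum_list_mono) auto
 finally have "length Ls <= 1" using s1 by simp
 moreover have "Ls ~= []" using s1 by auto
 ultimately obtain L where L: "Ls = [L]" by (cases Ls; cases "tl Ls") auto
 have dl: "direct_sum_rep [L] = L" by (cases L) (simp add: direct_sum_rep_def del: diag_block_mat.simps)
 have "rep_iso F W L" using Ls(2) unfolding L dl .
 moreover have W': "W : reps F" using W by (simp add: weighted_def)
 moreover have rL: "L : reps F" using r L by simp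
 ultimately have "rep_iso F L W" using rep_iso_sym[OF is_group] by blast
 thus ?thesis using irreducible_iso[OF _ W'] Ls(1) L by simp
qed

end

section \<open>Roots of unity\<close>

lemma carrier_kstar: "carrier (kstar::'k::field monoid) = UNIV - {0}"
proof -
 have "x : Units class_ring \<longleftrightarrow> x ~= 0" for x::'k
  unfolding Units_def by (auto intro!: exI[of _ "inverse x"])
 thus ?thesis by (auto simp: units_of_def)
qed

lemma mult_kstar [simp]: "x \<otimes>\<^bsub>kstar\<^esub> y = x * y"
 by (simp add: units_of_def)

lemma one_kstar [simp]: "\<one>\<^bsub>kstar\<^esub> = 1"
 by (simp add: units_of_def)

lemma group_kstar: "comm_group (kstar::'k::field monoid)"
 by (rule comm_groupI) (auto simp: carrier_kstar intro!: exI[of _ "inverse _"] bexI[of _ "inverse _"])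

lemma finite_roots_unity: "n > 0 ==> finite {x::'k::field. x ^ n = 1}"
 and card_roots_unity_le: "n > 0 ==> card {x::'k::field. x ^ n = 1} <= n"
proof -
 assume n: "n > 0"
 let ?p = "monom 1 n - 1::'k poly"
 have d: "degree ?p = n" using n by (subst diff_conv_add_uminus,subst degree_add_eq_left) (auto simp: degree_monom_eq)
 hence p: "?p ~= 0" using n by auto
 have e: "{x. poly ?p x = 0} = {x. x ^ n = 1}" by (auto simp: poly_monom)
 show "finite {x::'k. x ^ n = 1}" using poly_roots_finite[OF p] unfolding e .
 show "card {x::'k. x ^ n = 1} <= n" using card_poly_roots_bound[OF p] unfolding e d .
qed

lemma card_roots_unity:
 assumes n: "n > 0"
 shows "card {x::'k::{alg_closed_field,field_char_0}. x ^ n = 1} = n"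
proof -
 let ?p = "monom 1 n - 1::'k poly"
 have d: "degree ?p = n" using n by (subst diff_conv_add_uminus,subst degree_add_eq_left) (auto simp: degree_monom_eq)
 hence p: "?p ~= 0" using n by auto
 obtain A where A: "size A = degree ?p" "?p = smult (lead_coeff ?p) (\<Prod>x\<in>#A. [:- x,1:])"
  using alg_closed_imp_factorization[OF p] by blast
 have root: "x ^ n = 1" if "x \<in># A" for x
 proof -
  obtain B where "A = add_mset x B" using multi_member_split[OF \<open>x \<in># A\<close>] by blast
  hence "poly ?p x = 0" by (subst A(2)) simp
  thus ?thesis by (simp add: poly_monom)
 qed
 have c: "count A x <= 1" for x
 proof (rule ccontr)
  assume "~count A x <= 1"
  hence "x \<in># A" by (metis count_inI le0)
  then obtain B where B: "A = add_mset x B" using multi_member_split by metis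
  hence "x \<in># B" using \<open>~count A x <= 1\<close> by (metis One_nat_def count_add_mset count_inI le_refl)
  then obtain C where C: "A = add_mset x (add_mset x C)" using B multi_member_split by metis
  define q where "q = smult (lead_coeff ?p) (\<Prod>x\<in>#C. [:- x,1:])"
  have "?p = [:- x,1:] * ([:- x,1:] * q)" by (subst A(2)) (simp add: C q_def)
  hence "poly (pderiv ?p) x = poly (pderiv ([:- x,1:] * ([:- x,1:] * q))) x" by simp
  also have "... = 0" unfolding pderiv_mult poly_add poly_mult by simp
  finally have "of_nat n * x ^ (n - 1) = 0" by (simp add: pderiv_diff pderiv_monom poly_monom)
  hence "x = 0" using n by simp
  thus False using root[OF \<open>x \<in># A\<close>] n by (simp add: power_0_left)
 qed
 have "n = size A" using A d by simp
 also have "... = card (set_mset A)"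
 proof -
  have "size A = (\<Sum>x\<in>set_mset A. count A x)" by (rule size_multiset_overloaded_eq)
  also have "... = (\<Sum>x\<in>set_mset A. 1)" using c by (intro sum.cong refl) (metis One_nat_def Suc_leI antisym count_greater_zero_iff)
  finally show ?thesis by simp
 qed
 also have "... <= card {x::'k. x ^ n = 1}"
  by (rule card_mono[OF finite_roots_unity[OF n]]) (use root in auto)
 finally show ?thesis using card_roots_unity_le[OF n,where 'k = 'k] by simp
qed

lemma compatible_generatorsD:
 assumes z: "compatible_generators (ze::nat => 'k::{alg_closed_field,field_char_0})" and n: "n > 0"
 shows "ze n ^ n = 1" "!!x. x ^ n = 1 ==> EX k<n. x = ze n ^ k"
  "ze n ^ i = 1 \<longleftrightarrow> n dvd i" "ze n ~= 0" "k > 0 ==> ze (n * k) ^ k = ze n"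
proof -
 have g: "generate kstar {ze n} = {x. x ^ n = 1}"
  using z n by (simp add: compatible_generators_def roots_group_def)
 have "ze n : generate kstar {ze n}" by (rule generate.incl) simp
 thus 1: "ze n ^ n = 1" unfolding g by simp
 thus nz: "ze n ~= 0" using n by (metis power_0_left zero_neq_one less_irrefl)
 show "k > 0 ==> ze (n * k) ^ k = ze n" using z n by (simp add: compatible_generators_def)
 have pw: "EX k. x = ze n ^ k" if "x ^ n = 1" for x
 proof -
  interpret comm_group "kstar::'k monoid" by (rule group_kstar)
  have "x : generate kstar {ze n}" using that g by blast
  thus ?thesis
  proof (induction rule: generate.induct)
   case one
   show ?case by (rule exI[of _ 0]) simp
  next
   case (incl h)
   show ?case using incl by (intro exI[of _ 1]) simp
  next
   case (inv h)
   have "ze n ^ (n - 1) * ze n = 1" using 1 n by (metis Suc_pred' power_Suc2)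
   hence "inv\<^bsub>kstar\<^esub> ze n = ze n ^ (n - 1)" using nz by (intro inv_equality) (auto simp: carrier_kstar)
   thus ?case using inv by blast
  next
   case (eng a b)
   thus ?case by (metis mult_kstar power_add)
  qed
 qed
 have md: "ze n ^ k = ze n ^ (k mod n)" for k
 proof -
  have "ze n ^ k = ze n ^ (n * (k div n) + k mod n)" by simp
  also have "... = ze n ^ (k mod n)" unfolding power_add power_mult 1 by simp
  finally show ?thesis .
 qed
 show "EX k<n. x = ze n ^ k" if "x ^ n = 1" for x
  using pw[OF that] md n by (metis mod_less_divisor)
 show "ze n ^ i = 1 \<longleftrightarrow> n dvd i"
 proof
  assume "n dvd i"
  thus "ze n ^ i = 1" using 1 by (auto simp: power_mult)
 next
  assume i: "ze n ^ i = 1"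
  define r where "r = i mod n"
  have r: "ze n ^ r = 1" using md[of i] i by (simp add: r_def)
  have "r = 0"
  proof (rule ccontr)
   assume "r ~= 0"
   hence r0: "r > 0" by simp
   have "{x::'k. x ^ n = 1} <= {x. x ^ r = 1}"
    using pw r by (auto simp flip: power_mult) (metis mult.commute power_mult power_one)
   hence "n <= r"
    using card_mono[OF finite_roots_unity[OF r0]] card_roots_unity[OF n,where 'k = 'k] card_roots_unity_le[OF r0,where 'k = 'k]
    by (metis order_trans)
   thus False using n mod_less_divisor[of n i] unfolding r_def by linarith
  qed
  thus "n dvd i" by (simp add: r_def dvd_eq_mod_eq_0)
 qed
qed

lemma root_power_eq_iff:
 assumes z: "compatible_generators (ze::nat => 'k::{alg_closed_field,field_char_0})" and n: "n > 0"
 shows "ze n ^ i = ze n ^ j \<longleftrightarrow> i mod n = j mod n"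
proof -
 have *: "ze n ^ i = ze n ^ j \<longleftrightarrow> i mod n = j mod n" if "i <= j" for i j
 proof -
  have "ze n ^ j = ze n ^ i * ze n ^ (j - i)" using that by (simp flip: power_add)
  hence "ze n ^ i = ze n ^ j \<longleftrightarrow> ze n ^ (j - i) = 1"
   using compatible_generatorsD(4)[OF z n] by simp
  also have "... \<longleftrightarrow> i mod n = j mod n"
   unfolding compatible_generatorsD(3)[OF z n] using that by (metis mod_eq_dvd_iff_nat)
  finally show ?thesis .
 qed
 thus ?thesis by (metis nle_le)
qed

section \<open>Induced representations\<close>

text \<open>The block at \<open>(a,b)\<close> is \<open>\<mu>(t\<^sub>a\<^sup>-\<^sup>1 x t\<^sub>b)\<close> if this element lies in \<open>B\<close> and zero otherwise.\<close>

definition induced ::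
  "('g,'x) monoid_scheme => 'g set => (nat => 'g) => nat => ('g,'k::field) rep => ('g,'k) rep" where
 "induced F B t e = (%(d,mm). (e * d,%x. mat (e * d) (e * d) (%(i,j).
   let y = inv\<^bsub>F\<^esub> t (i div d) \<otimes>\<^bsub>F\<^esub> x \<otimes>\<^bsub>F\<^esub> t (j div d) in
   if y : B then mm y $$ (i mod d,j mod d) else 0)))"

locale transversal = group F for F::"('g,'x) monoid_scheme" (structure) +
 fixes B::"'g set" and t::"nat => 'g" and e::nat
 assumes B: "subgroup B F" and t: "a < e ==> t a : carrier F"
  and cosets: "x : carrier F ==> EX! a. a < e & inv (t a) \<otimes> x : B"
begin

lemma group_B: "group (F\<lparr>carrier := B\<rparr>)"
 using B by (rule subgroup_imp_group)

lemma inv_t_t: "a < e ==> b < e ==> inv (t a) \<otimes> t b : B \<longleftrightarrow> a = b"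
 using cosets[OF t] t subgroup.one_closed[OF B] by (metis l_inv)

context
 fixes d::nat and mm::"'g => 'k::field mat"
 assumes mm: "(d,mm) : reps (F\<lparr>carrier := B\<rparr>)"
begin

lemma reps_B:
 "y : B ==> mm y : carrier_mat d d" "y : B ==> y' : B ==> mm (y \<otimes> y') = mm y * mm y'" "mm \<one> = 1\<^sub>m d"
 using repsD[OF mm group_B] by auto

lemma induced_in_reps: "induced F B t e (d,mm) : reps F"
proof -
 define I where "I = snd (induced F B t e (d,mm))"
 have ent: "I x $$ (i,j) = (if inv t (i div d) \<otimes> x \<otimes> t (j div d) : B
   then mm (inv t (i div d) \<otimes> x \<otimes> t (j div d)) $$ (i mod d,j mod d) else 0)"
  if "i < e * d" "j < e * d" for x i j
  using that by (simp add: I_def induced_def Let_def)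
 have c: "I x : carrier_mat (e * d) (e * d)" for x by (simp add: I_def induced_def)
 have "(e * d,I) : reps F"
 proof (rule repsI[OF is_group c])
  show "I \<one> = 1\<^sub>m (e * d)"
  proof (rule eq_matI)
   fix i j assume "i < dim_row (1\<^sub>m (e * d)::'k mat)" "j < dim_col (1\<^sub>m (e * d)::'k mat)"
   hence ij: "i < e * d" "j < e * d" by auto
   note ab = div_lt[OF ij(1)] div_lt[OF ij(2)] mod_lt[OF ij(1)] mod_lt[OF ij(2)]
   have ij_eq: "i = j \<longleftrightarrow> i div d = j div d & i mod d = j mod d" by (metis div_mult_mod_eq)
   show "I \<one> $$ (i,j) = 1\<^sub>m (e * d) $$ (i,j)"
    unfolding ent[OF ij] using ij ab t[OF ab(1)] t[OF ab(2)] inv_t_t[OF ab(1,2)] reps_B(3) ij_eq by auto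
  qed (use c in auto)
 next
  fix x y assume x: "x : carrier F" and y: "y : carrier F"
  show "I (x \<otimes> y) = I x * I y"
  proof (rule eq_matI)
   fix i j assume "i < dim_row (I x * I y)" "j < dim_col (I x * I y)"
   hence ij: "i < e * d" "j < e * d" using c[of x] c[of y] by auto
   note ab = div_lt[OF ij(1)] div_lt[OF ij(2)] mod_lt[OF ij(1)] mod_lt[OF ij(2)]
   define a where "a = i div d" define b where "b = j div d"
   note ta = t[OF ab(1)] note tb = t[OF ab(2)]
   have yb: "y \<otimes> t b : carrier F" using y tb by (simp add: b_def)
   obtain c0 where c0: "c0 < e" "inv (t c0) \<otimes> (y \<otimes> t b) : B" and un: "!!c. c < e ==> inv (t c) \<otimes> (y \<otimes> t b) : B ==> c = c0"
    using cosets[OF yb] by blast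
   note tc = t[OF c0(1)]
   define u where "u = inv (t c0) \<otimes> (y \<otimes> t b)"
   define v where "v = inv (t a) \<otimes> x \<otimes> t c0"
   have uB: "u : B" using c0 by (simp add: u_def)
   have uc: "u : carrier F" and vc: "v : carrier F" using tc yb ta x by (auto simp: u_def v_def a_def)
   have vu: "v \<otimes> u = inv (t a) \<otimes> (x \<otimes> y) \<otimes> t b"
   proof -
    have "v \<otimes> u = inv (t a) \<otimes> x \<otimes> (t c0 \<otimes> (inv (t c0) \<otimes> (y \<otimes> t b)))"
     unfolding u_def v_def using ta x tc yb by (simp add: m_assoc a_def)
    also have "t c0 \<otimes> (inv (t c0) \<otimes> (y \<otimes> t b)) = y \<otimes> t b" using tc yb by (simp add: m_assoc[symmetric])
    finally show ?thesis using ta x y tb by (simp add: m_assoc a_def b_def)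
   qed
   have vB: "v \<otimes> u : B \<longleftrightarrow> v : B"
   proof
    assume "v \<otimes> u : B"
    hence "(v \<otimes> u) \<otimes> inv u : B" using subgroup.m_closed[OF B] subgroup.m_inv_closed[OF B uB] by blast
    thus "v : B" using uc vc by (simp add: m_assoc)
   qed (use uB subgroup.m_closed[OF B] in blast)
   have "(I x * I y) $$ (i,j) = (\<Sum>k<e*d. I x $$ (i,k) * I y $$ (k,j))"
    by (rule mult_mat_entry[OF c c ij])
   also have "... = (\<Sum>k<e*d.
     (if inv (t a) \<otimes> x \<otimes> t (k div d) : B then mm (inv (t a) \<otimes> x \<otimes> t (k div d)) $$ (i mod d,k mod d) else 0) *
     (if inv (t (k div d)) \<otimes> y \<otimes> t b : B then mm (inv (t (k div d)) \<otimes> y \<otimes> t b) $$ (k mod d,j mod d) else 0))"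
    by (intro sum.cong refl) (simp only: ent ij lessThan_iff a_def b_def)
   also have "... = (\<Sum>c<e. \<Sum>l<d.
     (if inv (t a) \<otimes> x \<otimes> t c : B then mm (inv (t a) \<otimes> x \<otimes> t c) $$ (i mod d,l) else 0) *
     (if inv (t c) \<otimes> y \<otimes> t b : B then mm (inv (t c) \<otimes> y \<otimes> t b) $$ (l,j mod d) else 0))"
    by (rule sum_div_mod)
   also have "... = (\<Sum>c<e. if c = c0 then (\<Sum>l<d. (if v : B then mm v $$ (i mod d,l) else 0) * mm u $$ (l,j mod d)) else 0)"
   proof (rule sum.cong[OF refl])
    fix c assume "c : {..<e}"
    hence ce: "c < e" by simp
    have as: "inv (t c) \<otimes> y \<otimes> t b = inv (t c) \<otimes> (y \<otimes> t b)" using t[OF ce] y tb by (simp add: m_assoc b_def)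
    show "(\<Sum>l<d. (if inv (t a) \<otimes> x \<otimes> t c : B then mm (inv (t a) \<otimes> x \<otimes> t c) $$ (i mod d,l) else 0) *
     (if inv (t c) \<otimes> y \<otimes> t b : B then mm (inv (t c) \<otimes> y \<otimes> t b) $$ (l,j mod d) else 0))
     = (if c = c0 then (\<Sum>l<d. (if v : B then mm v $$ (i mod d,l) else 0) * mm u $$ (l,j mod d)) else 0)"
    proof (cases "c = c0")
     case True
     have "inv (t c) \<otimes> (y \<otimes> t b) = u" "inv (t a) \<otimes> x \<otimes> t c = v" unfolding u_def v_def True by simp_all
     thus ?thesis unfolding as using uB True by (simp only: if_True refl)
    next
     case False
     hence "inv (t c) \<otimes> (y \<otimes> t b) \<notin> B" using un[OF ce] by blast
     thus ?thesis unfolding as using False by simp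
    qed
   qed
   also have "... = (\<Sum>l<d. (if v : B then mm v $$ (i mod d,l) else 0) * mm u $$ (l,j mod d))"
    using c0(1) by simp
   also have "... = (if v \<otimes> u : B then mm (v \<otimes> u) $$ (i mod d,j mod d) else 0)"
   proof (cases "v : B")
    case True
    thus ?thesis
     unfolding vB using True reps_B(2)[OF True uB] mult_mat_entry[OF reps_B(1)[OF True] reps_B(1)[OF uB] ab(3,4)] by simp
   next
    case False
    thus ?thesis unfolding vB by simp
   qed
   also have "... = I (x \<otimes> y) $$ (i,j)" unfolding ent[OF ij] vu a_def b_def ..
   finally show "I (x \<otimes> y) $$ (i,j) = (I x * I y) $$ (i,j)" by simp
  qed (use c[of x] c[of y] c[of "x \<otimes> y"] in auto)
 qed
 thus ?thesis by (simp add: I_def induced_def)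
qed

lemma trace_induced:
 assumes "x : carrier F"
 shows "trace (snd (induced F B t e (d,mm)) x)
  = (\<Sum>a<e. if inv (t a) \<otimes> x \<otimes> t a : B then trace (mm (inv (t a) \<otimes> x \<otimes> t a)) else 0)"
proof -
 have "trace (snd (induced F B t e (d,mm)) x) = (\<Sum>k<e*d. if inv (t (k div d)) \<otimes> x \<otimes> t (k div d) : B
   then mm (inv (t (k div d)) \<otimes> x \<otimes> t (k div d)) $$ (k mod d,k mod d) else 0)"
  by (simp add: trace_def induced_def Let_def)
 also have "... = (\<Sum>a<e. \<Sum>l<d. if inv (t a) \<otimes> x \<otimes> t a : B then mm (inv (t a) \<otimes> x \<otimes> t a) $$ (l,l) else 0)"
  by (rule sum_div_mod)
 also have "... = (\<Sum>a<e. if inv (t a) \<otimes> x \<otimes> t a : B then trace (mm (inv (t a) \<otimes> x \<otimes> t a)) else 0)"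
  using reps_B(1) by (intro sum.cong refl) (auto simp: trace_def)
 finally show ?thesis .
qed

lemma induced_central:
 assumes "x : B" "!!y. y : carrier F ==> x \<otimes> y = y \<otimes> x" "mm x = c \<cdot>\<^sub>m 1\<^sub>m d"
 shows "snd (induced F B t e (d,mm)) x = c \<cdot>\<^sub>m 1\<^sub>m (e * d)"
proof (rule eq_matI)
 fix i j assume "i < dim_row (c \<cdot>\<^sub>m 1\<^sub>m (e * d))" "j < dim_col (c \<cdot>\<^sub>m 1\<^sub>m (e * d))"
 hence ij: "i < e * d" "j < e * d" by auto
 note ab = div_lt[OF ij(1)] div_lt[OF ij(2)] mod_lt[OF ij(1)] mod_lt[OF ij(2)]
 define a where "a = i div d" define b where "b = j div d"
 have ta: "t a : carrier F" "t b : carrier F" using t ab by (auto simp: a_def b_def)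
 have xc: "x : carrier F" using subgroup.mem_carrier[OF B] assms(1) .
 have ij_eq: "i = j \<longleftrightarrow> a = b & i mod d = j mod d" unfolding a_def b_def by (metis div_mult_mod_eq)
 have e: "inv (t a) \<otimes> x \<otimes> t b = x \<otimes> (inv (t a) \<otimes> t b)"
  using assms(2)[of "inv (t a)",symmetric] ta xc by (simp add: m_assoc[symmetric])
 have "x \<otimes> (inv (t a) \<otimes> t b) : B \<longleftrightarrow> a = b"
 proof
  assume "x \<otimes> (inv (t a) \<otimes> t b) : B"
  hence "inv x \<otimes> (x \<otimes> (inv (t a) \<otimes> t b)) : B"
   using subgroup.m_closed[OF B] subgroup.m_inv_closed[OF B assms(1)] by blast
  hence "inv (t a) \<otimes> t b : B" using xc ta by (simp add: m_assoc[symmetric])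
  thus "a = b" using inv_t_t[OF ab(1,2)] by (simp add: a_def b_def)
 next
  assume "a = b"
  thus "x \<otimes> (inv (t a) \<otimes> t b) : B" using ta xc assms(1) by simp
 qed
 moreover define y where "y = inv (t a) \<otimes> x \<otimes> t b"
 ultimately have yB: "y : B \<longleftrightarrow> a = b" using e by simp
 have "snd (induced F B t e (d,mm)) x $$ (i,j) = (if y : B then mm y $$ (i mod d,j mod d) else 0)"
  using ij by (simp add: induced_def Let_def y_def a_def b_def)
 also have "... = (if a = b then mm x $$ (i mod d,j mod d) else 0)"
 proof (cases "a = b")
  case True
  have "y = x" unfolding y_def e unfolding True using ta xc by simp
  thus ?thesis using True yB by simp
 next
  case False
  thus ?thesis using yB by simp
 qed
 also have "... = (c \<cdot>\<^sub>m 1\<^sub>m (e * d)) $$ (i,j)" using ij ij_eq ab assms(3) by auto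
 finally show "snd (induced F B t e (d,mm)) x $$ (i,j) = (c \<cdot>\<^sub>m 1\<^sub>m (e * d)) $$ (i,j)" .
qed (auto simp: induced_def)

end

end

section \<open>Finite subgroups of \<open>SL\<^sub>2\<close>\<close>

lemma carrier_lin_group [simp]: "carrier (lin_group H) = H"
 and mult_lin_group [simp]: "x \<otimes>\<^bsub>lin_group H\<^esub> y = x * y"
 and one_lin_group [simp]: "\<one>\<^bsub>lin_group H\<^esub> = I2"
 by (simp_all add: lin_group_def)

lemma group_lin_group: "subgroup H (GL 2) ==> group (lin_group H)"
 unfolding lin_group_def by (rule subgroup.subgroup_is_group[OF _ group_GL])

lemma pow_lin_group: "x [^]\<^bsub>lin_group H\<^esub> (k::nat) = x [^]\<^bsub>GL 2\<^esub> k"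
 by (simp add: nat_pow_def lin_group_def)

lemma mat2_eqI:
 assumes "A : carrier_mat 2 2" "B : carrier_mat 2 2"
  "A $$ (0,0) = B $$ (0,0)" "A $$ (0,1) = B $$ (0,1)" "A $$ (1,0) = B $$ (1,0)" "A $$ (1,1) = B $$ (1,1)"
 shows "A = B"
 using assms by (intro eq_matI) (auto simp: less_2_cases_iff)

lemma mult_mat2:
 assumes "A : carrier_mat 2 2" "B : carrier_mat 2 2" "i < 2" "j < 2"
 shows "(A * B) $$ (i,j) = A $$ (i,0) * B $$ (0,j) + A $$ (i,1) * (B::'k::field mat) $$ (1,j)"
 unfolding mult_mat_entry[OF assms] by (simp add: numeral_2_eq_2)

lemma det_mat2:
 assumes "A : carrier_mat 2 2"
 shows "det A = A $$ (0,0) * A $$ (1,1) - A $$ (0,1) * (A::'k::field mat) $$ (1,0)"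
proof -
 have m: "mat_delete A 0 j : carrier_mat 1 1" for j using assms by (simp add: mat_delete_def)
 have "det A = (\<Sum>j<2. A $$ (0,j) * cofactor A 0 j)" by (rule laplace_expansion_row[OF assms]) simp
 also have "... = A $$ (0,0) * A $$ (1,1) - A $$ (0,1) * A $$ (1,0)"
  using assms by (simp add: numeral_2_eq_2 cofactor_def det_single[OF m]) (simp add: mat_delete_def)
 finally show ?thesis .
qed

lemma trace_mat2: "A : carrier_mat 2 2 ==> trace A = A $$ (0,0) + A $$ (1,1)"
 by (simp add: trace_def numeral_2_eq_2)

lemma SL2_D: "g : SL 2 ==> g : carrier_mat 2 2 & det g = 1 & g : carrier (GL 2)"
 by (auto simp: SL_def dest: GL_carrier_mat)

lemma cayley_hamilton_SL2:
 assumes "g : SL 2"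
 shows "g * g = trace g \<cdot>\<^sub>m g + (-1) \<cdot>\<^sub>m (I2::'k::field mat)"
proof -
 have g: "g : carrier_mat 2 2" and d: "g $$ (0,0) * g $$ (1,1) - g $$ (0,1) * g $$ (1,0) = 1"
  using SL2_D[OF assms] det_mat2[of g] by auto
 show ?thesis
  by (rule mat2_eqI) (use g d in "auto simp: mult_mat2[OF g g] trace_mat2[OF g] algebra_simps simp del: index_mult_mat(1)")
qed

lemma scalar_carrier [simp]: "scalar a : carrier_mat 2 2"
 by (simp add: scalar_def)

lemma scalar_mult: "A : carrier_mat 2 2 ==> scalar a * A = a \<cdot>\<^sub>m (A::'k::field mat)"
 "A : carrier_mat 2 2 ==> A * scalar a = a \<cdot>\<^sub>m (A::'k::field mat)"
 by (simp_all add: scalar_def mult_smult_assoc_mat[of _ 2 2 _ 2] mult_smult_distrib[of _ 2 2 _ 2])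

lemma det_scalar: "det (scalar a) = (a::'k::field)\<^sup>2"
 by (simp add: scalar_def)

lemma scalar_in_GL: "a ~= 0 ==> scalar a : carrier (GL 2)"
 by (simp add: carrier_GL det_scalar)

lemma scalar_eq_iff [simp]: "scalar a = scalar b \<longleftrightarrow> a = (b::'k::field)"
proof
 assume "scalar a = scalar b"
 hence "scalar a $$ (0,0) = scalar b $$ (0,0)" by simp
 thus "a = b" by (simp add: scalar_def)
qed simp

lemma scalar_one [simp]: "scalar 1 = I2"
 by (simp add: scalar_def one_smult_mat)

lemma SL2_scalar: "c \<cdot>\<^sub>m I2 : SL 2 ==> c = 1 \<or> c = (-1::'k::field)"
 by (auto simp: SL_def power2_eq_1_iff)

lemma SL2_involution:
 assumes g: "g : SL 2" and i: "g * g = I2" and n: "g ~= I2"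
 shows "g = scalar (-1::'k::field_char_0)"
proof -
 note gc = conjunct1[OF SL2_D[OF g]]
 have "I2 = trace g \<cdot>\<^sub>m g + (-1) \<cdot>\<^sub>m (I2::'k mat)" using cayley_hamilton_SL2[OF g] i by simp
 hence e: "(I2::'k mat) $$ (a,b) = (trace g \<cdot>\<^sub>m g + (-1) \<cdot>\<^sub>m (I2::'k mat)) $$ (a,b)" for a b by simp
 have e2: "trace g * g $$ (a,b) = (if a = b then 2 else 0)" if "a < 2" "b < 2" for a b
  using e[of a b] that gc by (auto split: if_splits)
 have t: "trace g ~= 0" using e2[of 0 0] by auto
 have "g = (2 / trace g) \<cdot>\<^sub>m I2"
  by (rule mat2_eqI) (use gc t e2[of 0 0] e2[of 0 1] e2[of 1 0] e2[of 1 1] in "auto simp: field_simps")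
 hence "g = 1 \<cdot>\<^sub>m I2 \<or> g = (-1) \<cdot>\<^sub>m I2" using SL2_scalar g by metis
 thus ?thesis using n by (auto simp: scalar_def one_smult_mat)
qed

lemma trace_inverse_SL2:
 assumes g: "g : SL 2" and h: "h : carrier_mat 2 2" "g * h = I2"
 shows "trace h = trace (g::'k::field mat)"
proof -
 note gc = conjunct1[OF SL2_D[OF g]]
 have "g = g * (g * h)" using gc h by simp
 also have "... = (g * g) * h" by (rule assoc_mult_mat[OF gc gc h(1),symmetric])
 also have "... = (trace g \<cdot>\<^sub>m g) * h + ((-1) \<cdot>\<^sub>m I2) * h"
  unfolding cayley_hamilton_SL2[OF g] by (rule add_mult_distrib_mat[of _ 2 2]) (use gc h in auto)
 also have "... = trace g \<cdot>\<^sub>m I2 + (-1) \<cdot>\<^sub>m h"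
  using gc h by (simp add: mult_smult_assoc_mat[of _ 2 2 _ 2])
 finally have "trace g = trace (trace g \<cdot>\<^sub>m I2 + (-1) \<cdot>\<^sub>m h)" by simp
 also have "... = trace g * 2 - trace h" using h(1) by (simp add: trace_mat2)
 finally show ?thesis by (simp add: algebra_simps)
qed

lemma mult_vec2:
 assumes "A : carrier_mat 2 2" "v : carrier_vec 2" "i < 2"
 shows "(A *\<^sub>v v) $ i = A $$ (i,0) * v $ 0 + (A::'k::field mat) $$ (i,1) * v $ 1"
 unfolding mult_vec_entry[OF assms] by (simp add: numeral_2_eq_2)

lemma vec2_eqI:
 assumes "u : carrier_vec 2" "v : carrier_vec 2" "u $ 0 = v $ 0" "u $ 1 = v $ 1"
 shows "u = v"
 using assms by (intro eq_vecI) (auto simp: less_2_cases_iff)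

text \<open>An element with eigenvalue \<open>1\<close> is unipotent, so \<open>g\<^sup>k = k g - (k - 1)\<close>, which is \<open>1\<close> only for \<open>g = 1\<close>.\<close>

lemma SL2_fixes_vector_finite_order:
 assumes g: "g : SL 2" and v: "v : carrier_vec 2" "v ~= 0\<^sub>v 2" "g *\<^sub>v v = v"
  and n: "(n::nat) > 0" "g [^]\<^bsub>GL 2\<^esub> n = I2"
 shows "g = (I2::'k::field_char_0 mat)"
proof -
 note gc = conjunct1[OF SL2_D[OF g]]
 have "trace g = 2"
 proof -
  have d: "g $$ (0,0) * g $$ (1,1) - g $$ (0,1) * g $$ (1,0) = 1" using SL2_D[OF g] det_mat2[OF gc] by simp
  have e: "g $$ (0,0) * v $ 0 + g $$ (0,1) * v $ 1 = v $ 0" "g $$ (1,0) * v $ 0 + g $$ (1,1) * v $ 1 = v $ 1"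
   using mult_vec2[OF gc v(1),of 0] mult_vec2[OF gc v(1),of 1] v(3) by auto
  have "(2 - (g $$ (0,0) + g $$ (1,1))) * v $ 0 = 0" "(2 - (g $$ (0,0) + g $$ (1,1))) * v $ 1 = 0"
  proof -
   let ?a = "g $$ (0,0)" and ?b = "g $$ (0,1)" and ?c = "g $$ (1,0)" and ?d = "g $$ (1,1)"
    and ?x = "v $ 0" and ?y = "v $ 1"
   have "(2 - (?a + ?d)) * ?x = (1 - ?d) * (?x - (?a * ?x + ?b * ?y)) + ?b * (?y - (?c * ?x + ?d * ?y))
     + (1 - (?a * ?d - ?b * ?c)) * ?x"
    by (simp add: algebra_simps)
   thus "(2 - (?a + ?d)) * ?x = 0" unfolding e d by simp
   have "(2 - (?a + ?d)) * ?y = (1 - ?a) * (?y - (?c * ?x + ?d * ?y)) + ?c * (?x - (?a * ?x + ?b * ?y))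
     + (1 - (?a * ?d - ?b * ?c)) * ?y"
    by (simp add: algebra_simps)
   thus "(2 - (?a + ?d)) * ?y = 0" unfolding e d by simp
  qed
  moreover have "v $ 0 ~= 0 \<or> v $ 1 ~= 0" using v vec2_eqI[of v "0\<^sub>v 2"] by auto
  ultimately show ?thesis by (auto simp: trace_mat2[OF gc])
 qed
 hence gg: "g * g = 2 \<cdot>\<^sub>m g + (-1) \<cdot>\<^sub>m I2" using cayley_hamilton_SL2[OF g] by simp
 have "g [^]\<^bsub>GL 2\<^esub> k = of_nat k \<cdot>\<^sub>m g + (1 - of_nat k) \<cdot>\<^sub>m I2" for k
 proof (induction k)
  case 0
  show ?case by (rule mat2_eqI) (use gc in "auto simp: nat_pow_def")
 next
  case (Suc k)
  have "g [^]\<^bsub>GL 2\<^esub> Suc k = g [^]\<^bsub>GL 2\<^esub> k * g" by (simp add: nat_pow_def)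
  also have "... = (of_nat k \<cdot>\<^sub>m g) * g + ((1 - of_nat k) \<cdot>\<^sub>m I2) * g"
   unfolding Suc by (rule add_mult_distrib_mat[of _ 2 2]) (use gc in auto)
  also have "... = of_nat k \<cdot>\<^sub>m (2 \<cdot>\<^sub>m g + (-1) \<cdot>\<^sub>m I2) + (1 - of_nat k) \<cdot>\<^sub>m g"
   using gc by (simp add: mult_smult_assoc_mat[of _ 2 2 _ 2] gg)
  also have "... = of_nat (Suc k) \<cdot>\<^sub>m g + (1 - of_nat (Suc k)) \<cdot>\<^sub>m I2"
   by (rule mat2_eqI) (use gc in "auto simp: algebra_simps")
  finally show ?case .
 qed
 from this[of n] n have "I2 = of_nat n \<cdot>\<^sub>m g + (1 - of_nat n) \<cdot>\<^sub>m (I2::'k mat)" by simp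
 hence e: "(I2::'k mat) $$ (a,b) = (of_nat n \<cdot>\<^sub>m g + (1 - of_nat n) \<cdot>\<^sub>m (I2::'k mat)) $$ (a,b)" for a b by simp
 show ?thesis
  by (rule mat2_eqI) (use gc n(1) e[of 0 0] e[of 0 1] e[of 1 0] e[of 1 1] in "auto simp: algebra_simps")
qed

text \<open>A finite subgroup of \<open>SL\<^sub>2\<close> with a common eigenvector embeds into \<open>k\<^sup>*\<close> by its eigenvalues there.\<close>

lemma SL2_common_eigenvector_cyclic:
 fixes C::"'k::{alg_closed_field,field_char_0} mat set"
 assumes z: "compatible_generators (ze::nat => 'k)"
  and C: "subgroup C (GL 2)" "C <= SL 2" "finite C"
  and v: "v : carrier_vec 2" "v ~= 0\<^sub>v 2" and ev: "!!g. g : C ==> EX a. g *\<^sub>v v = a \<cdot>\<^sub>v v"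
 obtains c where "c : C" "!!g. g : C ==> EX i::nat. g = c [^]\<^bsub>GL 2\<^esub> i"
  "!!i::nat. c [^]\<^bsub>GL 2\<^esub> i = I2 \<longleftrightarrow> card C dvd i"
proof -
 interpret GL: group "GL 2::'k mat monoid" by (rule group_GL)
 interpret L: group "lin_group C" by (rule group_lin_group[OF C(1)])
 define N where "N = card C"
 have N: "N > 0" using C(3) subgroup.one_closed[OF C(1)] by (auto simp: N_def card_gt_0_iff)
 obtain al where al: "!!g. g : C ==> g *\<^sub>v v = al g \<cdot>\<^sub>v v" using ev by metis
 have Cc: "g : carrier_mat 2 2" if "g : C" for g using C(2) that SL2_D by blast
 have un: "a = b" if "a \<cdot>\<^sub>v v = b \<cdot>\<^sub>v v" for a b
 proof -
  have "v $ 0 ~= 0 \<or> v $ 1 ~= 0" using v vec2_eqI[of v "0\<^sub>v 2"] by auto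
  moreover have "(a \<cdot>\<^sub>v v) $ i = (b \<cdot>\<^sub>v v) $ i" for i using that by simp
  from this[of 0] this[of 1] have "a * v $ 0 = b * v $ 0" "a * v $ 1 = b * v $ 1" using v by auto
  ultimately show ?thesis by auto
 qed
 have hom: "al (g * h) = al g * al h" if "g : C" "h : C" for g h
 proof (rule un)
  have "g * h : C" using subgroup.m_closed[OF C(1) that] by simp
  hence "al (g * h) \<cdot>\<^sub>v v = (g * h) *\<^sub>v v" using al by simp
  also have "... = g *\<^sub>v (h *\<^sub>v v)" by (rule assoc_mult_mat_vec[OF Cc[OF that(1)] Cc[OF that(2)] v(1)])
  also have "... = al h \<cdot>\<^sub>v (al g \<cdot>\<^sub>v v)" using al that mult_mat_vec[OF Cc[OF that(1)] v(1)] by simp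
  finally show "al (g * h) \<cdot>\<^sub>v v = (al g * al h) \<cdot>\<^sub>v v" by (simp add: smult_smult_assoc mult.commute)
 qed
 have one: "al (I2) = 1"
  by (rule un) (use al[of "I2"] subgroup.one_closed[OF C(1)] v in simp)
 have powC: "g [^]\<^bsub>GL 2\<^esub> i : C & al (g [^]\<^bsub>GL 2\<^esub> i) = al g ^ i" if "g : C" for g and i::nat
 proof (induction i)
  case 0
  thus ?case using subgroup.one_closed[OF C(1)] one by simp
 next
  case (Suc i)
  thus ?case using hom[of "g [^]\<^bsub>GL 2\<^esub> i" g] that subgroup.m_closed[OF C(1)] by (simp add: nat_pow_def mult.commute)
 qed
 have powN: "g [^]\<^bsub>GL 2\<^esub> N = I2" if "g : C" for g
  using L.pow_order_eq_1[of g] that by (simp add: pow_lin_group Coset.order_def N_def)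
 have inj1: "g = I2" if "g : C" "al g = 1" for g
  by (rule SL2_fixes_vector_finite_order[OF _ v _ N powN[OF that(1)]]) (use that C(2) al[OF that(1)] v in auto)
 have inj: "g = h" if "g : C" "h : C" "al g = al h" for g h
 proof -
  have ih: "inv\<^bsub>GL 2\<^esub> h : C" using subgroup.m_inv_closed[OF C(1) that(2)] .
  have hG: "g : carrier (GL 2)" "h : carrier (GL 2)" using subgroup.mem_carrier[OF C(1)] that by auto
  have hh: "h * inv\<^bsub>GL 2\<^esub> h = I2" using GL.r_inv[OF hG(2)] by simp
  have "al (g * inv\<^bsub>GL 2\<^esub> h) = al (h * inv\<^bsub>GL 2\<^esub> h)" using hom that ih by simp
  hence "g * inv\<^bsub>GL 2\<^esub> h = I2"
   using inj1[of "g * inv\<^bsub>GL 2\<^esub> h"] hh one subgroup.m_closed[OF C(1) that(1) ih] by simp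
  thus ?thesis using GL.inv_equality[of g "inv\<^bsub>GL 2\<^esub> h"] hG GL.inv_inv by auto
 qed
 have "al ` C = {x. x ^ N = 1}"
 proof (rule card_seteq)
  show "finite {x::'k. x ^ N = 1}" by (rule finite_roots_unity[OF N])
  show "al ` C <= {x. x ^ N = 1}" using powC powN one by (metis (mono_tags,lifting) image_subsetI mem_Collect_eq)
  have "card (al ` C) = N" unfolding N_def using inj by (intro card_image inj_onI) auto
  thus "card {x::'k. x ^ N = 1} <= card (al ` C)" using card_roots_unity_le[OF N,where 'k = 'k] by simp
 qed
 moreover have "ze N ^ N = 1" by (rule compatible_generatorsD(1)[OF z N])
 ultimately obtain c where c: "c : C" "al c = ze N" by (metis (mono_tags,lifting) imageE mem_Collect_eq)
 have "EX i::nat. g = c [^]\<^bsub>GL 2\<^esub> i" if g: "g : C" for g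
 proof -
  have "al g ^ N = 1" using powC[OF g,of N] powN[OF g] one by simp
  then obtain i where "al g = ze N ^ i" using compatible_generatorsD(2)[OF z N] by blast
  hence "g = c [^]\<^bsub>GL 2\<^esub> i" using powC[OF c(1),of i] c(2) g by (intro inj) auto
  thus ?thesis by blast
 qed
 moreover have "c [^]\<^bsub>GL 2\<^esub> i = I2 \<longleftrightarrow> N dvd i" for i::nat
  using powC[OF c(1),of i] inj1[of "c [^]\<^bsub>GL 2\<^esub> i"] one compatible_generatorsD(3)[OF z N,of i] c(2) by auto
 ultimately show thesis using that[of c] c(1) by (simp add: N_def)
qed

lemma finite_central_char:
 assumes "group F" "finite (carrier F)"
 shows "central_char F {\<one>\<^bsub>F\<^esub>} (%_. 1::'k::{alg_closed_field,field_char_0}) (carrier F)"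
proof -
 interpret group F by fact
 show ?thesis
 proof
  fix y assume y: "y : carrier F"
  have "bij_betw (%x. y \<otimes>\<^bsub>F\<^esub> x) (carrier F) (carrier F)"
   using y by (intro bij_betw_byWitness[of _ "%x. inv\<^bsub>F\<^esub> y \<otimes>\<^bsub>F\<^esub> x"]) (auto simp: m_assoc[symmetric])
  thus "EX p. bij_betw p (carrier F) (carrier F) & (ALL x:carrier F. EX a:{\<one>\<^bsub>F\<^esub>}. y \<otimes>\<^bsub>F\<^esub> x = a \<otimes>\<^bsub>F\<^esub> p x)"
   using y by (intro exI[of _ "%x. y \<otimes>\<^bsub>F\<^esub> x"]) auto
 qed (use assms in auto)
qed

lemma lin_group_central_char:
 assumes "subgroup H (GL 2)" "finite H"
 shows "central_char (lin_group H) {I2} (%_. 1::'k::{alg_closed_field,field_char_0}) H"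
 using finite_central_char[OF group_lin_group[OF assms(1)]] assms(2) by simp

lemma even_order_involution:
 assumes "group G" "finite (carrier G)" "even (card (carrier G))"
 obtains x where "x : carrier G" "x ~= \<one>\<^bsub>G\<^esub>" "x \<otimes>\<^bsub>G\<^esub> x = \<one>\<^bsub>G\<^esub>"
proof -
 interpret group G by fact
 obtain r where "Coset.order G = 2 ^ 1 * r" using assms(3) by (auto simp: Coset.order_def)
 then obtain H where H: "subgroup H G" "card H = 2 ^ 1" using sylow_thm[of 2 G 1 r] assms by auto
 then obtain x where x: "x : H" "x ~= \<one>\<^bsub>G\<^esub>"
  by (metis card_2_iff' power_one_right subgroup.one_closed)
 interpret H: group "G\<lparr>carrier := H\<rparr>" by (rule subgroup_imp_group[OF H(1)])
 have "x [^]\<^bsub>G\<lparr>carrier := H\<rparr>\<^esub> card H = \<one>\<^bsub>G\<^esub>"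
  using H.pow_order_eq_1[of x] x by (simp add: Coset.order_def)
 hence "x \<otimes>\<^bsub>G\<^esub> x = \<one>\<^bsub>G\<^esub>"
  using x subgroup.mem_carrier[OF H(1) x(1)] by (simp add: H(2) numeral_2_eq_2 nat_pow_def)
 thus thesis using that x subgroup.mem_carrier[OF H(1) x(1)] by blast
qed

text \<open>A reducible two-dimensional representation is a sum of two characters, which makes the group commutative.\<close>

lemma natural_rep_irreducible:
 fixes G1::"'k::{alg_closed_field,field_char_0} mat set"
 assumes G: "subgroup G1 (GL 2)" "finite G1" and nc: "~comm_group (lin_group G1)"
 shows "irreducible_rep (lin_group G1) (2,%g. g)"
proof (rule ccontr)
 assume red: "~irreducible_rep (lin_group G1) (2,%g. g)"
 interpret L: group "lin_group G1" by (rule group_lin_group[OF G(1)])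
 interpret C: central_char "lin_group G1" "{I2}" "%_. 1::'k" G1
  by (rule lin_group_central_char) (rule G)+
 have Gc: "g : carrier_mat 2 2" if "g : G1" for g using subgroup.mem_carrier[OF G(1) that] GL_carrier_mat by blast
 have r: "(2,%g. g) : reps (lin_group G1)" by (rule repsI[OF L.is_group]) (use Gc in auto)
 have w: "C.weighted (2,%g. g)" using r by (simp add: C.weighted_def one_smult_mat)
 obtain d A D where d: "0 < d" "d < 2" and wA: "C.weighted (d,A)" and wD: "C.weighted (2 - d,D)"
  and i: "rep_iso (lin_group G1) (2,%g. g) (d + (2 - d),%g. four_block_mat (A g) (0\<^sub>m d (2 - d)) (0\<^sub>m (2 - d) d) (D g))"
  by (rule C.maschke_step[OF w _ red]) simp
 have d1: "d = 1" using d by simp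
 define T where "T g = four_block_mat (A g) (0\<^sub>m 1 1) (0\<^sub>m 1 1) (D g)" for g
 obtain P where P: "P : carrier (GL 2)" "!!g. g : G1 ==> P * g = T g * P"
  using i by (auto simp: rep_iso_def d1 T_def)
 obtain Q where Q: "Q : carrier (GL 2)" "P * Q = I2" "Q * P = I2" using GL_inverse[OF P(1)] .
 note Pc = GL_carrier_mat[OF P(1)] and Qc = GL_carrier_mat[OF Q(1)]
 have A: "A g : carrier_mat 1 1" and D: "D g : carrier_mat 1 1" if "g : G1" for g
  using repsD(2)[OF C.weightedD(1)[OF wA] L.is_group,of g] repsD(2)[OF C.weightedD(1)[OF wD] L.is_group,of g] that d1 by auto
 have com1: "X * Y = Y * X" if "X : carrier_mat 1 1" "Y : carrier_mat 1 1" for X Y::"'k mat"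
  using that by (intro eq_matI) (auto simp: scalar_prod_def mult.commute)
 have Tc: "T g : carrier_mat 2 2" if "g : G1" for g
  using four_block_carrier_mat[OF A[OF that] D[OF that]] by (simp add: T_def numeral_2_eq_2)
 have TT: "T g * T h = T h * T g" if "g : G1" "h : G1" for g h
  unfolding T_def block_diag_mult[OF A[OF that(1)] A[OF that(2)] D[OF that(1)] D[OF that(2)]]
   block_diag_mult[OF A[OF that(2)] A[OF that(1)] D[OF that(2)] D[OF that(1)]]
  using com1[OF A[OF that(1)] A[OF that(2)]] com1[OF D[OF that(1)] D[OF that(2)]] by simp
 have PT: "P * (g * h) = (T g * T h) * P" if g: "g : G1" and h: "h : G1" for g h
 proof -
  have "P * (g * h) = (P * g) * h" by (rule assoc_mult_mat[OF Pc Gc[OF g] Gc[OF h],symmetric])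
  also have "... = T g * (P * h)" unfolding P(2)[OF g] by (rule assoc_mult_mat[OF Tc[OF g] Pc Gc[OF h]])
  also have "... = (T g * T h) * P" unfolding P(2)[OF h] by (rule assoc_mult_mat[OF Tc[OF g] Tc[OF h] Pc,symmetric])
  finally show ?thesis .
 qed
 have "g * h = h * g" if g: "g : G1" and h: "h : G1" for g h
 proof -
  have "P * (g * h) = P * (h * g)" using PT[OF g h] PT[OF h g] TT[OF g h] by simp
  hence "Q * (P * (g * h)) = Q * (P * (h * g))" by simp
  hence "(Q * P) * (g * h) = (Q * P) * (h * g)"
   using assoc_mult_mat[OF Qc Pc mult_carrier_mat[OF Gc[OF g] Gc[OF h]]]
    assoc_mult_mat[OF Qc Pc mult_carrier_mat[OF Gc[OF h] Gc[OF g]]] by simp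
  thus ?thesis unfolding Q(3)
   using left_mult_one_mat[OF mult_carrier_mat[OF Gc[OF g] Gc[OF h]]] left_mult_one_mat[OF mult_carrier_mat[OF Gc[OF h] Gc[OF g]]] by simp
 qed
 hence "comm_group (lin_group G1)" by (intro L.group_comm_groupI) simp
 thus False using nc by blast
qed

text \<open>If \<open>G\<^sub>1\<close> had no involution its order would be odd and squaring a permutation, whence
  \<open>\<Sum> tr (g\<^sup>2) = \<Sum> tr g = 0\<close>. But \<open>tr (g\<^sup>2) = (tr g)\<^sup>2 - 2\<close> on \<open>SL\<^sub>2\<close>, and the sum of \<open>(tr g)\<^sup>2\<close> is the order of \<open>G\<^sub>1\<close>
 by irreducibility.\<close>

lemma minus_one_in_nonabelian:
 fixes G1::"'k::{alg_closed_field,field_char_0} mat set"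
 assumes G: "subgroup G1 (GL 2)" "G1 <= SL 2" "finite G1" and nc: "~comm_group (lin_group G1)"
 shows "scalar (-1) : G1"
proof (rule ccontr)
 assume no: "scalar (-1) \<notin> G1"
 interpret L: group "lin_group G1" by (rule group_lin_group[OF G(1)])
 interpret C: central_char "lin_group G1" "{I2}" "%_. 1::'k" G1
  by (rule lin_group_central_char) (rule G)+
 have Gc: "g : carrier_mat 2 2" if "g : G1" for g using G(2) that SL2_D by blast
 define N where "N = card G1"
 have "odd N"
 proof
  assume "even N"
  hence ev: "finite (carrier (lin_group G1))" "even (card (carrier (lin_group G1)))"
   using G(3) by (simp_all add: N_def)
  obtain x where "x : G1" "x ~= I2" "x * x = I2"
   by (rule even_order_involution[OF L.is_group ev]) simp
  thus False using SL2_involution[of x] G(2) no by auto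
 qed
 then obtain r where r: "N + 1 = 2 * r" by (metis even_Suc evenE Suc_eq_plus1)
 have inj: "inj_on (%g. g * g) G1"
 proof (rule inj_onI)
  fix g h assume g: "g : G1" and h: "h : G1" and e: "g * g = h * h"
  have sq: "x = (x * x) [^]\<^bsub>lin_group G1\<^esub> r" if "x : G1" for x
  proof -
   have "(x * x) [^]\<^bsub>lin_group G1\<^esub> r = (x [^]\<^bsub>lin_group G1\<^esub> (2::nat)) [^]\<^bsub>lin_group G1\<^esub> r"
    using that L.nat_pow_mult[of x 1 1] left_mult_one_mat[OF Gc[OF that]] by (simp add: numeral_2_eq_2)
   also have "... = x [^]\<^bsub>lin_group G1\<^esub> (N + 1)" unfolding r using that by (simp add: L.nat_pow_pow)
   also have "... = x" using L.pow_order_eq_1[of x] that left_mult_one_mat[OF Gc[OF that]] by (simp add: Coset.order_def N_def)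
   finally show ?thesis by simp
  qed
  show "g = h" using sq[OF g] sq[OF h] e by simp
 qed
 hence img: "(%g. g * g) ` G1 = G1"
  using G(3) L.m_closed by (intro endo_inj_surj) auto
 let ?V = "(2,%g. g)::('k mat,'k) rep" let ?I = "(1,%g. 1\<^sub>m 1)::('k mat,'k) rep"
 have irr: "irreducible_rep (lin_group G1) ?V" by (rule natural_rep_irreducible[OF G(1,3) nc])
 have wV: "C.weighted ?V" using irreducible_repD(1)[OF irr] by (simp add: C.weighted_def one_smult_mat)
 have wI: "C.weighted ?I" unfolding C.weighted_def
  by (auto simp: one_smult_mat intro!: repsI L.is_group)
 have "C.ip ?I ?I = of_nat (card G1)" by (simp add: C.ip_def)
 hence iI: "irreducible_rep (lin_group G1) ?I" by (rule C.irreducible_criterion[OF wI])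
 have "C.ip ?I ?V = 0" using C.orthogonality[OF iI wI irr wV] by (simp add: rep_iso_def)
 hence s0: "(\<Sum>g\<in>G1. trace g) = 0" by (simp add: C.ip_def)
 have "C.ip ?V ?V = of_nat N"
  using C.orthogonality[OF irr wV irr wV] rep_iso_refl[OF irreducible_repD(1)[OF irr] L.is_group] by (simp add: N_def)
 moreover have "C.ip ?V ?V = (\<Sum>g\<in>G1. trace g * trace g)"
  unfolding C.ip_def
 proof (rule sum.cong)
  fix g assume "g : G1"
  hence g: "g : carrier (lin_group G1)" by simp
  have "trace (inv\<^bsub>lin_group G1\<^esub> g) = trace g"
   using L.r_inv[OF g] L.inv_closed[OF g] g G(2) by (intro trace_inverse_SL2) (auto intro: Gc)
  thus "trace (snd ?V (inv\<^bsub>lin_group G1\<^esub> g)) * trace (snd ?V g) = trace g * trace g" by simp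
 qed simp
 moreover have "(\<Sum>g\<in>G1. trace g) = (\<Sum>g\<in>G1. trace (g * g))"
  by (subst (1) img[symmetric]) (simp add: sum.reindex[OF inj])
 moreover have "trace (g * g) = trace g * trace g - 2" if "g : G1" for g
 proof -
  have "g : SL 2" using that G(2) by blast
  thus ?thesis using Gc[OF that] by (simp add: cayley_hamilton_SL2 trace_mat2 algebra_simps)
 qed
 ultimately have "0 = of_nat N - (2::'k) * of_nat N"
  using s0 by (simp add: sum_subtractf N_def)
 hence "of_nat N = (0::'k)" by simp
 thus False using \<open>odd N\<close> by simp
qed

section \<open>Sylow subgroups of finite subgroups of \<open>SL\<^sub>2\<close>\<close>

lemma (in monoid) nat_pow_two: "x : carrier G ==> x [^] (2::nat) = x \<otimes> x"
 by (simp add: numeral_2_eq_2)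

text \<open>Conjugacy classes other than those of central elements have a number of elements divisible by \<open>p\<close>.\<close>

lemma p_group_center:
 assumes G: "group G" and p: "prime p" and ord: "card (carrier G) = p ^ a" and n1: "card (carrier G) > 1"
 obtains z where "z : carrier G" "z ~= \<one>\<^bsub>G\<^esub>" "!!g. g : carrier G ==> g \<otimes>\<^bsub>G\<^esub> z = z \<otimes>\<^bsub>G\<^esub> g"
proof (rule ccontr)
 assume "~thesis"
 hence no: "z = \<one>\<^bsub>G\<^esub>" if "z : carrier G" "!!g. g : carrier G ==> g \<otimes>\<^bsub>G\<^esub> z = z \<otimes>\<^bsub>G\<^esub> g" for z
  using that \<open>!!z. [|z : carrier G; z ~= \<one>\<^bsub>G\<^esub>; !!g. g : carrier G ==> g \<otimes>\<^bsub>G\<^esub> z = z \<otimes>\<^bsub>G\<^esub> g|] ==> thesis\<close> by blast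
 interpret group G by fact
 define ph where "ph = (%g. \<lambda>h \<in> carrier G. g \<otimes>\<^bsub>G\<^esub> h \<otimes>\<^bsub>G\<^esub> (inv\<^bsub>G\<^esub> g))"
 interpret A: group_action G "carrier G" ph unfolding ph_def by (rule action_by_conjugation)
 define Os where "Os = orbits G (carrier G) ph"
 have fin: "finite (carrier G)" using n1 by (metis card.infinite not_less_zero)
 have part: "partition (carrier G) Os" unfolding Os_def by (rule A.orbit_partition)
 have Un: "\<Union>Os = carrier G" using part by (auto simp: partition_def)
 have finO: "finite Os" "!!X. X : Os ==> finite X"
  using fin Un by (auto intro: finite_UnionD finite_subset)
 have disj: "pairwise disjnt Os"
  unfolding pairwise_def disjnt_def
 proof (intro ballI impI)
  fix X Y assume XY: "X : Os" "Y : Os" "X ~= Y"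
  show "X \<inter> Y = {}"
  proof (rule ccontr)
   assume "X \<inter> Y ~= {}"
   then obtain x where x: "x : X" "x : Y" by blast
   hence "x : carrier G" using Un XY by blast
   hence "EX! b:Os. x : b" using part unfolding partition_def by blast
   thus False using x XY by blast
  qed
 qed
 have one: "orbit G ph \<one>\<^bsub>G\<^esub> = {\<one>\<^bsub>G\<^esub>}"
  unfolding orbit_def ph_def by (auto intro!: exI[of _ "\<one>\<^bsub>G\<^esub>"])
 have oneO: "{\<one>\<^bsub>G\<^esub>} : Os" unfolding Os_def orbits_def using one by blast
 have pd: "p dvd card X" if X: "X : Os - {{\<one>\<^bsub>G\<^esub>}}" for X
 proof -
  obtain x where x: "x : carrier G" "X = orbit G ph x" using X by (auto simp: Os_def orbits_def)
  have "card X dvd p ^ a"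
   using A.orbit_stabilizer_theorem[OF x(1)] x(2) ord by (metis Coset.order_def dvd_triv_left)
  then obtain i where i: "card X = p ^ i" using divides_primepow_nat[OF p] by blast
  have "i ~= 0"
  proof
   assume "i = 0"
   hence "card X = 1" using i by simp
   moreover have xX: "x : X" using x A.orbit_refl by simp
   ultimately have X1: "X = {x}" by (metis card_1_singletonE singletonD)
   have "g \<otimes>\<^bsub>G\<^esub> x = x \<otimes>\<^bsub>G\<^esub> g" if g: "g : carrier G" for g
   proof -
    have "g \<otimes>\<^bsub>G\<^esub> x \<otimes>\<^bsub>G\<^esub> inv\<^bsub>G\<^esub> g : X" unfolding x(2) orbit_def ph_def using g x(1) by auto
    hence "g \<otimes>\<^bsub>G\<^esub> x \<otimes>\<^bsub>G\<^esub> inv\<^bsub>G\<^esub> g = x" using X1 by simp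
    thus ?thesis using g x(1) by (metis inv_solve_right m_closed)
   qed
   hence "x = \<one>\<^bsub>G\<^esub>" using no x(1) by blast
   thus False using X x(2) one by simp
  qed
  thus ?thesis using i by (simp add: dvd_power)
 qed
 have "card (carrier G) = (\<Sum>X\<in>Os. card X)"
  unfolding Un[symmetric] by (rule card_Union_disjoint[OF disj finO(2)])
 also have "... = 1 + (\<Sum>X\<in>Os - {{\<one>\<^bsub>G\<^esub>}}. card X)"
  using sum.remove[OF finO(1) oneO,of card] by simp
 finally have "p ^ a = 1 + (\<Sum>X\<in>Os - {{\<one>\<^bsub>G\<^esub>}}. card X)" using ord by simp
 moreover have "p dvd (\<Sum>X\<in>Os - {{\<one>\<^bsub>G\<^esub>}}. card X)" by (rule dvd_sum) (rule pd)
 moreover have "p dvd p ^ a" using n1 ord by (cases a) auto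
 ultimately have "p dvd 1" by (metis dvd_add_left_iff)
 thus False using p by simp
qed

lemma mat2_eigenspace:
 assumes h: "h : carrier_mat 2 2" and v: "v : carrier_vec 2" "v ~= 0\<^sub>v 2" "h *\<^sub>v v = l \<cdot>\<^sub>v v"
  and u: "u : carrier_vec 2" "h *\<^sub>v u = l \<cdot>\<^sub>v (u::'k::field vec)"
 shows "h = l \<cdot>\<^sub>m I2 \<or> (EX a. u = a \<cdot>\<^sub>v v)"
proof -
 let ?a = "h $$ (0,0)" and ?b = "h $$ (0,1)" and ?c = "h $$ (1,0)" and ?d = "h $$ (1,1)"
 define x y x' y' where xy: "x = v $ 0" "y = v $ 1" "x' = u $ 0" "y' = u $ 1"
 have e: "?a * x + ?b * y = l * x" "?c * x + ?d * y = l * y" "?a * x' + ?b * y' = l * x'" "?c * x' + ?d * y' = l * y'"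
  using mult_vec2[OF h v(1),of 0] mult_vec2[OF h v(1),of 1] mult_vec2[OF h u(1),of 0] mult_vec2[OF h u(1),of 1] v u
  by (auto simp: xy)
 have nz: "x ~= 0 \<or> y ~= 0" using v vec2_eqI[of v "0\<^sub>v 2"] by (auto simp: xy)
 define D where "D = x * y' - y * x'"
 show ?thesis
 proof (cases "D = 0")
  case True
  have "EX a. x' = a * x & y' = a * y"
  proof (cases "x = 0")
   case True
   thus ?thesis using nz \<open>D = 0\<close> by (intro exI[of _ "y' / y"]) (auto simp: D_def)
  next
   case False
   thus ?thesis using \<open>D = 0\<close> by (intro exI[of _ "x' / x"]) (auto simp: D_def field_simps)
  qed
  then obtain a where "x' = a * x" "y' = a * y" by blast
  hence "u = a \<cdot>\<^sub>v v" by (intro vec2_eqI) (use u v in "auto simp: xy")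
  thus ?thesis by blast
 next
  case False
  have "(?a - l) * D = y' * (?a * x + ?b * y - l * x) - y * (?a * x' + ?b * y' - l * x')"
   "?b * D = x * (?a * x' + ?b * y' - l * x') - x' * (?a * x + ?b * y - l * x)"
   "?c * D = y' * (?c * x + ?d * y - l * y) - y * (?c * x' + ?d * y' - l * y')"
   "(?d - l) * D = x * (?c * x' + ?d * y' - l * y') - x' * (?c * x + ?d * y - l * y)"
   by (simp_all add: D_def algebra_simps)
  hence "(?a - l) * D = 0" "?b * D = 0" "?c * D = 0" "(?d - l) * D = 0" unfolding e by simp_all
  hence "?a = l" "?b = 0" "?c = 0" "?d = l" using False by auto
  hence "h = l \<cdot>\<^sub>m I2" by (intro mat2_eqI) (use h in auto)
  thus ?thesis by blast
 qed
qed

lemma mat_eigenvector_exists: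
 assumes h: "h : carrier_mat n n" and "n > 0"
 obtains v l where "v : carrier_vec n" "v ~= 0\<^sub>v n" "h *\<^sub>v v = (l::'k::alg_closed_field) \<cdot>\<^sub>v v"
proof -
 have "degree (char_poly h) > 0" using degree_monic_char_poly[OF h] assms(2) by simp
 then obtain c where "poly (char_poly h) c = 0" using alg_closed_imp_poly_has_root by blast
 thus thesis using that eigenvalue_root_char_poly[OF h,of c] h by (auto simp: eigenvalue_def eigenvector_def)
qed

text \<open>Modulo \<open>\<plusminus>1\<close> the \<open>p\<close>-group \<open>P\<close> has a central element \<open>h\<close>, whose centraliser \<open>C\<close> in \<open>P\<close> has a common
  eigenvector and so is cyclic. An element \<open>x\<close> outside \<open>C\<close> satisfies \<open>x h = - h x\<close>, hence is traceless with square
  \<open>-1\<close>; the same holds for all \<open>g x\<close> with \<open>g\<close> in \<open>C\<close>, so \<open>x\<close> inverts \<open>C\<close>.\<close>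

lemma SL2_p_subgroup_structure:
 fixes P::"'k::{alg_closed_field,field_char_0} mat set"
 assumes z: "compatible_generators (ze::nat => 'k)" and p: "prime p"
  and P: "subgroup P (GL 2)" "P <= SL 2" "finite P" "card P = p ^ a"
 shows "(EX c:P. (ALL g:P. EX i::nat. g = c [^]\<^bsub>GL 2\<^esub> i) & (ALL i::nat. c [^]\<^bsub>GL 2\<^esub> i = I2 \<longleftrightarrow> card P dvd i)) \<or>
  (EX c:P. EX x:P. EX k>0. (ALL i::nat. c [^]\<^bsub>GL 2\<^esub> i = I2 \<longleftrightarrow> 2 * k dvd i) & c [^]\<^bsub>GL 2\<^esub> k = x * x &
   c * (x * c) = x & (ALL i::nat. x ~= c [^]\<^bsub>GL 2\<^esub> i) &
   (ALL g:P. EX i::nat. g = c [^]\<^bsub>GL 2\<^esub> i \<or> g = c [^]\<^bsub>GL 2\<^esub> i * x))"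
proof -
 interpret GL: group "GL 2::'k mat monoid" by (rule group_GL)
 interpret L: group "lin_group P" by (rule group_lin_group[OF P(1)])
 note P1 = subgroup.one_closed[OF P(1),simplified] and Pm = subgroup.m_closed[OF P(1),simplified]
  and Pi = subgroup.m_inv_closed[OF P(1)]
 have Pc: "g : carrier_mat 2 2" and PG: "g : carrier (GL 2)" if "g : P" for g
  using P(2) that SL2_D by blast+
 show ?thesis
 proof (cases "EX v:carrier_vec 2. v ~= 0\<^sub>v 2 & (ALL g:P. EX b. g *\<^sub>v v = b \<cdot>\<^sub>v v)")
  case True
  then obtain v where v: "v : carrier_vec 2" "v ~= 0\<^sub>v 2" "!!g. g : P ==> EX b. g *\<^sub>v v = b \<cdot>\<^sub>v v" by blast
  obtain c where "c : P" "!!g. g : P ==> EX i::nat. g = c [^]\<^bsub>GL 2\<^esub> i"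
    "!!i::nat. c [^]\<^bsub>GL 2\<^esub> i = I2 \<longleftrightarrow> card P dvd i"
   using SL2_common_eigenvector_cyclic[OF z P(1-3) v(1,2) v(3)] by blast
  thus ?thesis by blast
 next
  case False
  define N where "N = P \<inter> {I2,scalar (-1)}"
  have m1: "scalar (-1) * A = A * scalar (-1)" if "A : carrier_mat 2 2" for A::"'k mat"
   using that by (simp add: scalar_mult)
  have sq: "scalar (-1) * scalar (-1) = (I2::'k mat)"
   by (simp add: scalar_mult) (simp add: scalar_def smult_smult_mat one_smult_mat)
  have sinv: "inv\<^bsub>GL 2\<^esub> scalar (-1) = (scalar (-1)::'k mat)"
   by (rule GL.inv_equality) (use sq scalar_in_GL[of "-1::'k"] in simp_all)
  have Nsub: "subgroup N (lin_group P)"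
  proof (rule L.subgroupI)
   show "N ~= {}" using P1 by (auto simp: N_def)
   fix x assume x: "x : N"
   have "inv\<^bsub>lin_group P\<^esub> x = x"
    by (rule L.inv_equality) (use x sq in "auto simp: N_def")
   thus "inv\<^bsub>lin_group P\<^esub> x : N" using x by simp
   fix y assume y: "y : N"
   show "x \<otimes>\<^bsub>lin_group P\<^esub> y : N" using x y sq Pm left_mult_one_mat[OF scalar_carrier,of "-1::'k"] right_mult_one_mat[OF scalar_carrier,of "-1::'k"]
    by (auto simp: N_def)
  qed (auto simp: N_def)
  have cen: "x * g = g * x" if "x : N" "g : P" for x g
   using that m1[OF Pc[of g]] left_mult_one_mat[OF Pc[of g]] right_mult_one_mat[OF Pc[of g]] by (auto simp: N_def)
  have N: "N \<lhd> lin_group P"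
  proof (rule L.normalI[OF Nsub],rule ballI)
   fix g assume "g : carrier (lin_group P)"
   hence "x * g = g * x" if "x : N" for x using cen[OF that] by simp
   hence "(\<Union>x\<in>N. {x * g}) = (\<Union>x\<in>N. {g * x})" by (intro SUP_cong) simp_all
   thus "N #>\<^bsub>lin_group P\<^esub> g = g <#\<^bsub>lin_group P\<^esub> N"
    by (simp only: r_coset_def l_coset_def mult_lin_group)
  qed
  interpret Q: group "lin_group P Mod N" by (rule normal.factorgroup_is_group[OF N])
  have cardQ: "card (carrier (lin_group P Mod N)) * card N = p ^ a"
   using L.lagrange[OF Nsub] P(4) by (simp add: FactGroup_def Coset.order_def)
  then obtain b where b: "card (carrier (lin_group P Mod N)) = p ^ b"
   using divides_primepow_nat[OF p] by (metis dvd_triv_left)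
  have "card (carrier (lin_group P Mod N)) > 1"
  proof (rule ccontr)
   assume "~?thesis"
   hence "card (carrier (lin_group P Mod N)) = 1"
    using b prime_gt_0_nat[OF p] by (metis less_one linorder_neqE_nat nat_zero_less_power_iff not_less_zero)
   hence "card N = card P" using cardQ P(4) by simp
   hence "N = P" using P(3) by (intro card_subset_eq) (auto simp: N_def)
   hence "ALL g:P. EX b. g *\<^sub>v unit_vec 2 0 = b \<cdot>\<^sub>v unit_vec 2 0"
   proof (intro ballI)
    fix g assume "g : P"
    hence "g = scalar 1 \<or> g = scalar (-1)" using \<open>N = P\<close> by (auto simp: N_def)
    then obtain s where g: "g = scalar s" by blast
    show "EX b. g *\<^sub>v unit_vec 2 0 = b \<cdot>\<^sub>v unit_vec 2 0"
     unfolding g by (rule exI[of _ s],rule vec2_eqI)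
      (use mult_vec2[OF scalar_carrier unit_vec_carrier,of 0 s 0] mult_vec2[OF scalar_carrier unit_vec_carrier,of 1 s 0]
       mult_mat_vec_carrier[OF scalar_carrier unit_vec_carrier,of s 0] in "simp_all add: scalar_def del: index_mult_mat_vec")
   qed
   moreover have "unit_vec 2 0 ~= (0\<^sub>v 2::'k vec)"
    by (metis index_unit_vec(1) index_zero_vec(1) pos2 zero_neq_one)
   ultimately show False using False unit_vec_carrier by blast
  qed
  then obtain X where X: "X : carrier (lin_group P Mod N)" "X ~= \<one>\<^bsub>lin_group P Mod N\<^esub>"
   "!!Y. Y : carrier (lin_group P Mod N) ==> Y \<otimes>\<^bsub>lin_group P Mod N\<^esub> X = X \<otimes>\<^bsub>lin_group P Mod N\<^esub> Y"
   using p_group_center[OF Q.is_group p b] by metis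
  obtain h where h: "h : P" "X = N #>\<^bsub>lin_group P\<^esub> h" using X(1) by (auto simp: FactGroup_def RCOSETS_def)
  have hN: "h \<notin> N" using X(2) h(2) L.coset_join2[OF _ Nsub,of h] h(1) by (auto simp: FactGroup_def)
  have comm: "g * h = h * g \<or> (g * h = scalar (-1) * (h * g) & scalar (-1) : P)" if g: "g : P" for g
  proof -
   have "(N #>\<^bsub>lin_group P\<^esub> g) \<otimes>\<^bsub>lin_group P Mod N\<^esub> X = X \<otimes>\<^bsub>lin_group P Mod N\<^esub> (N #>\<^bsub>lin_group P\<^esub> g)"
    using X(3) g by (auto simp: FactGroup_def RCOSETS_def)
   hence "N #>\<^bsub>lin_group P\<^esub> (g * h) = N #>\<^bsub>lin_group P\<^esub> (h * g)"
    using normal.rcos_sum[OF N,of g h] normal.rcos_sum[OF N,of h g] g h by (simp add: FactGroup_def)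
   moreover have "g * h : N #>\<^bsub>lin_group P\<^esub> (g * h)"
    using L.rcos_self[OF _ Nsub,of "g * h"] Pm[OF g h(1)] by simp
   ultimately obtain n where "n : N" "g * h = n * (h * g)" by (auto simp: r_coset_def)
   thus ?thesis using left_mult_one_mat[OF Pc[OF Pm[OF h(1) g]]] by (auto simp: N_def)
  qed
  note hc = Pc[OF h(1)]
  obtain v l where v: "v : carrier_vec 2" "v ~= 0\<^sub>v 2" "h *\<^sub>v v = l \<cdot>\<^sub>v v"
   using mat_eigenvector_exists[OF hc] by auto
  have hns: "h ~= l \<cdot>\<^sub>m I2" for l
  proof
   assume e: "h = l \<cdot>\<^sub>m I2"
   hence "l = 1 \<or> l = -1" using SL2_scalar[of l] h(1) P(2) by auto
   hence "h : N" using e h(1) by (auto simp: N_def scalar_def one_smult_mat)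
   thus False using hN by blast
  qed
  define C where "C = {g : P. g * h = h * g}"
  have Csub: "subgroup C (GL 2)"
  proof (rule GL.subgroupI)
   show "C <= carrier (GL 2)" using PG by (auto simp: C_def)
   show "C ~= {}" using P1 hc by (auto simp: C_def)
   fix g assume g: "g : C"
   hence gP: "g : P" and gh: "g * h = h * g" by (auto simp: C_def)
   have "inv\<^bsub>GL 2\<^esub> g \<otimes>\<^bsub>GL 2\<^esub> h = h \<otimes>\<^bsub>GL 2\<^esub> inv\<^bsub>GL 2\<^esub> g"
    using gh PG[OF gP] PG[OF h(1)] by (metis GL.inv_solve_left GL.inv_solve_right GL.m_closed GL.inv_closed GL.m_assoc mult_GL)
   thus "inv\<^bsub>GL 2\<^esub> g : C" using Pi[OF gP] by (simp add: C_def)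
   fix g' assume g': "g' : C"
   hence gP': "g' : P" and gh': "g' * h = h * g'" by (auto simp: C_def)
   have "(g * g') * h = g * (g' * h)" by (rule assoc_mult_mat[OF Pc[OF gP] Pc[OF gP'] hc])
   also have "... = (g * h) * g'" unfolding gh' by (rule assoc_mult_mat[OF Pc[OF gP] hc Pc[OF gP'],symmetric])
   also have "... = h * (g * g')" unfolding gh by (rule assoc_mult_mat[OF hc Pc[OF gP] Pc[OF gP']])
   finally show "g \<otimes>\<^bsub>GL 2\<^esub> g' : C" using Pm[OF gP gP'] by (simp add: C_def)
  qed
  have Cev: "EX b. g *\<^sub>v v = b \<cdot>\<^sub>v v" if "g : C" for g
  proof -
   have gP: "g : P" and gh: "g * h = h * g" using that by (auto simp: C_def)
   have "h *\<^sub>v (g *\<^sub>v v) = g *\<^sub>v (h *\<^sub>v v)"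
    using assoc_mult_mat_vec[OF hc Pc[OF gP] v(1)] assoc_mult_mat_vec[OF Pc[OF gP] hc v(1)] gh by simp
   also have "... = l \<cdot>\<^sub>v (g *\<^sub>v v)" unfolding v(3) by (rule mult_mat_vec[OF Pc[OF gP] v(1)])
   finally have "h = l \<cdot>\<^sub>m I2 \<or> (EX a. g *\<^sub>v v = a \<cdot>\<^sub>v v)"
    using mat2_eigenspace[OF hc v] Pc[OF gP] v(1) by (metis mult_mat_vec_carrier)
   thus ?thesis using hns by blast
  qed
  have CP: "C <= P" by (auto simp: C_def)
  obtain c where c: "c : C" "!!g. g : C ==> EX i::nat. g = c [^]\<^bsub>GL 2\<^esub> i"
    "!!i::nat. c [^]\<^bsub>GL 2\<^esub> i = I2 \<longleftrightarrow> card C dvd i"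
  proof (rule SL2_common_eigenvector_cyclic[OF z Csub _ _ v(1,2) Cev])
   show "C <= SL 2" "finite C" using CP P(2,3) finite_subset by auto
  qed auto
  obtain x where x: "x : P" "x \<notin> C"
  proof -
   have "C ~= P" using Cev v False by blast
   thus thesis using that CP by blast
  qed
  have m1P: "scalar (-1) : P" and anti0: "x * h = scalar (-1) * (h * x)" using comm[OF x(1)] x by (auto simp: C_def)
  have anti: "y * y = scalar (-1)" if y: "y : P" "y * h = scalar (-1) * (h * y)" for y
  proof -
   note yc = Pc[OF y(1)]
   obtain h' where h': "h' : carrier (GL 2)" "h * h' = I2" "h' * h = I2" using GL_inverse[OF PG[OF h(1)]] .
   note hc' = GL_carrier_mat[OF h'(1)]
   have "y = y * (h * h')" using yc h' by simp
   also have "... = (y * h) * h'" by (rule assoc_mult_mat[OF yc hc hc',symmetric])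
   also have "... = (-1) \<cdot>\<^sub>m ((h * y) * h')" unfolding y(2) using hc yc hc'
    by (simp only: scalar_mult[OF mult_carrier_mat[OF hc yc]] mult_smult_assoc_mat[OF mult_carrier_mat[OF hc yc] hc'])
   finally have "trace y = trace ((-1) \<cdot>\<^sub>m ((h * y) * h'))" by simp
   also have "... = - trace ((h * y) * h')" using hc yc hc' by (subst trace_smult[of _ 2]) auto
   also have "trace ((h * y) * h') = trace (h' * (h * y))" by (rule trace_mult_comm[of _ 2 2]) (use hc yc hc' in auto)
   also have "h' * (h * y) = y" using assoc_mult_mat[OF hc' hc yc] h'(3) yc by simp
   finally have "trace y = 0" by simp
   hence "y * y = (0::'k) \<cdot>\<^sub>m y + (-1) \<cdot>\<^sub>m I2" using cayley_hamilton_SL2[of y] y(1) P(2) by auto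
   also have "... = scalar (-1)" by (rule mat2_eqI) (use yc in "auto simp: scalar_def")
   finally show ?thesis .
  qed
  have xx: "x * x = scalar (-1)" by (rule anti[OF x(1) anti0])
  have xcx: "g * (x * g) = x" if g: "g : C" for g
  proof -
   have gP: "g : P" and gh: "g * h = h * g" using g by (auto simp: C_def)
   note cc = Pc[OF gP] Pc[OF x(1)] hc
   have "(g * x) * h = g * (x * h)" by (rule assoc_mult_mat[OF cc])
   also have "... = (-1) \<cdot>\<^sub>m (g * (h * x))" unfolding anti0 using cc by (simp add: scalar_mult mult_smult_distrib[of _ 2 2 _ 2])
   also have "g * (h * x) = (g * h) * x" by (rule assoc_mult_mat[OF cc(1,3,2),symmetric])
   also have "... = h * (g * x)" unfolding gh by (rule assoc_mult_mat[OF cc(3,1,2)])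
   finally have "(g * x) * h = scalar (-1) * (h * (g * x))" using cc by (simp add: scalar_mult)
   hence "(g * x) * (g * x) = x * x" using anti[OF Pm[OF gP x(1)]] xx by simp
   hence "(g * (x * g)) * x = x * x"
    using cc by (simp add: assoc_mult_mat[of _ 2 2 _ 2 _ 2])
   thus ?thesis
    using GL.right_cancel[OF PG[OF x(1)] PG[OF Pm[OF gP Pm[OF x(1) gP]]] PG[OF x(1)]] by simp
  qed
  have m1C: "scalar (-1) : C" using m1P m1[OF hc] by (simp add: C_def)
  have finC: "finite C" using CP P(3) finite_subset by blast
  have "even (card C)"
  proof -
   interpret LC: group "lin_group C" by (rule group_lin_group[OF Csub])
   have "scalar (-1) [^]\<^bsub>lin_group C\<^esub> (2::nat) = \<one>\<^bsub>lin_group C\<^esub>"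
    using LC.nat_pow_two[of "scalar (-1)"] m1C sq by simp
   hence "LC.ord (scalar (-1)) dvd 2" using LC.pow_eq_id m1C by simp
   moreover have "LC.ord (scalar (-1)) ~= 1" using LC.ord_eq_1[of "scalar (-1)"] m1C
    by (metis carrier_lin_group one_lin_group scalar_eq_iff scalar_one neg_one_neq_one)
   ultimately have "LC.ord (scalar (-1)) = 2" using prime_nat_iff two_is_prime_nat by blast
   thus ?thesis using LC.ord_dvd_group_order[of "scalar (-1)"] m1C finC by (simp add: Coset.order_def)
  qed
  then obtain k where k: "card C = 2 * k" by blast
  have k0: "k > 0" using k finC m1C by (metis card_gt_0_iff empty_iff mult_0_right neq0_conv)
  have cG: "c : carrier (GL 2)" using c(1) CP PG by blast
  have cPow: "c [^]\<^bsub>GL 2\<^esub> i : C" for i::nat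
   using c(1) subgroup.m_closed[OF Csub] subgroup.one_closed[OF Csub] by (induction i) (auto simp: nat_pow_def)
  have "c [^]\<^bsub>GL 2\<^esub> k * c [^]\<^bsub>GL 2\<^esub> k = I2"
   using GL.nat_pow_mult[OF cG,of k k] c(3)[of "2 * k"] k by (simp add: mult_2)
  moreover have "c [^]\<^bsub>GL 2\<^esub> k ~= I2" using c(3)[of k] k k0 by (auto dest: dvd_imp_le)
  ultimately have ck: "c [^]\<^bsub>GL 2\<^esub> k = scalar (-1)"
   using SL2_involution[of "c [^]\<^bsub>GL 2\<^esub> k"] cPow CP P(2) by blast
  have cover: "EX i::nat. g = c [^]\<^bsub>GL 2\<^esub> i \<or> g = c [^]\<^bsub>GL 2\<^esub> i * x" if g: "g : P" for g
  proof (cases "g : C")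
   case True
   thus ?thesis using c(2) by blast
  next
   case gC: False
   hence gh: "g * h = scalar (-1) * (h * g)" using comm[OF g] g by (auto simp: C_def)
   note cc = Pc[OF g] Pc[OF x(1)] hc
   have gx: "g * x : C"
   proof -
    have "(g * x) * h = g * (x * h)" by (rule assoc_mult_mat[OF cc])
    also have "... = (-1) \<cdot>\<^sub>m (g * (h * x))" unfolding anti0 using cc by (simp add: scalar_mult mult_smult_distrib[of _ 2 2 _ 2])
    also have "g * (h * x) = (g * h) * x" by (rule assoc_mult_mat[OF cc(1,3,2),symmetric])
    also have "... = (-1) \<cdot>\<^sub>m (h * (g * x))" unfolding gh using cc by (simp add: scalar_mult mult_smult_assoc_mat[of _ 2 2 _ 2])
    finally show ?thesis using Pm[OF g x(1)] by (simp add: C_def smult_smult_mat one_smult_mat)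
   qed
   hence "scalar (-1) * (g * x) : C" using m1C subgroup.m_closed[OF Csub] by simp
   then obtain i where i: "scalar (-1) * (g * x) = c [^]\<^bsub>GL 2\<^esub> (i::nat)" using c(2) by blast
   have "c [^]\<^bsub>GL 2\<^esub> i * x = (-1) \<cdot>\<^sub>m ((g * x) * x)" unfolding i[symmetric] using cc by (simp add: scalar_mult mult_smult_assoc_mat[of _ 2 2 _ 2])
   also have "(g * x) * x = g * (x * x)" by (rule assoc_mult_mat[OF cc(1,2,2)])
   also have "(-1) \<cdot>\<^sub>m (g * (x * x)) = g" unfolding xx using cc by (simp add: scalar_mult smult_smult_mat one_smult_mat)
   finally show ?thesis by metis
  qed
  have "ALL i::nat. x ~= c [^]\<^bsub>GL 2\<^esub> i" using x(2) cPow by blast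
  thus ?thesis
   using c(1,3) CP x(1) k k0 ck xx xcx[OF c(1)] cover by (intro disjI2 bexI[of _ c] bexI[of _ x] exI[of _ k]) auto
 qed
qed

section \<open>Central extensions by \<open>k\<^sup>*\<close> and their retractions\<close>

lemma mult_pred_add: "n > 0 ==> i * (n - 1) + i = n * (i::nat)"
 by (cases n) (simp_all add: algebra_simps)

locale central_ext =
 fixes Q::"('a,'x) monoid_scheme" and E::"('e,'y) monoid_scheme" (structure)
  and io::"'k::{alg_closed_field,field_char_0} => 'e" and pj::"'e => 'a"
 assumes ext: "central_extension Q E io pj" and group_Q: "group Q"
begin

sublocale E: group E
 using ext by (simp add: central_extension_def)

sublocale Q: group Q by (rule group_Q)

lemma iota_closed [simp]: "a ~= 0 ==> io a : carrier E"
 and iota_mult: "a ~= 0 ==> b ~= 0 ==> io (a * b) = io a \<otimes> io b"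
 and iota_inj: "a ~= 0 ==> b ~= 0 ==> io a = io b ==> a = b"
 and iota_central: "a ~= 0 ==> x : carrier E ==> io a \<otimes> x = x \<otimes> io a"
 and pi_closed [simp]: "x : carrier E ==> pj x : carrier Q"
 and pi_mult [simp]: "x : carrier E ==> y : carrier E ==> pj (x \<otimes> y) = pj x \<otimes>\<^bsub>Q\<^esub> pj y"
 and pi_surj: "q : carrier Q ==> EX x:carrier E. pj x = q"
 and pi_kernel: "x : carrier E ==> pj x = \<one>\<^bsub>Q\<^esub> \<longleftrightarrow> (EX a. a ~= 0 & x = io a)"
proof -
 have i: "io : hom kstar E" "inj_on io (UNIV - {0})"
  using ext by (auto simp: central_extension_def mon_def carrier_kstar)
 show "a ~= 0 ==> io a : carrier E" using hom_in_carrier[OF i(1)] by (simp add: carrier_kstar)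
 show "a ~= 0 ==> b ~= 0 ==> io (a * b) = io a \<otimes> io b" using hom_mult[OF i(1),of a b] by (simp add: carrier_kstar)
 show "a ~= 0 ==> b ~= 0 ==> io a = io b ==> a = b" using i(2) by (auto dest: inj_onD)
 show "a ~= 0 ==> x : carrier E ==> io a \<otimes> x = x \<otimes> io a"
  using ext by (auto simp: central_extension_def carrier_kstar)
 have p: "pj : hom E Q" "pj ` carrier E = carrier Q" using ext by (auto simp: central_extension_def epi_def)
 show "x : carrier E ==> pj x : carrier Q" using hom_in_carrier[OF p(1)] .
 show "x : carrier E ==> y : carrier E ==> pj (x \<otimes> y) = pj x \<otimes>\<^bsub>Q\<^esub> pj y" using hom_mult[OF p(1)] .
 show "q : carrier Q ==> EX x:carrier E. pj x = q" using p(2) by (metis imageE)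
 have "io ` (UNIV - {0}) = kernel E Q pj" using ext by (simp add: central_extension_def carrier_kstar)
 thus "x : carrier E ==> pj x = \<one>\<^bsub>Q\<^esub> \<longleftrightarrow> (EX a. a ~= 0 & x = io a)"
  unfolding kernel_def by blast
qed

lemma pi_hom: "group_hom E Q pj"
 by unfold_locales (auto simp: hom_def)

lemma pi_one [simp]: "pj \<one> = \<one>\<^bsub>Q\<^esub>" and pi_inv [simp]: "x : carrier E ==> pj (inv x) = inv\<^bsub>Q\<^esub> pj x"
 and pi_pow: "x : carrier E ==> pj (x [^] (n::nat)) = pj x [^]\<^bsub>Q\<^esub> n"
 using group_hom.hom_one[OF pi_hom] group_hom.hom_inv[OF pi_hom] group_hom.hom_nat_pow[OF pi_hom] by auto

lemma pi_iota [simp]: "a ~= 0 ==> pj (io a) = \<one>\<^bsub>Q\<^esub>"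
 using pi_kernel[of "io a"] by auto

lemma iota_one: "io 1 = \<one>"
proof -
 have "io 1 \<otimes> io 1 = io 1" using iota_mult[of 1 1] by simp
 thus ?thesis using E.l_cancel_one[of "io 1" "io 1"] by simp
qed

lemma iota_power: "a ~= 0 ==> io (a ^ n) = io a [^] (n::nat)"
 by (induction n) (simp_all add: iota_one iota_mult iota_central)

lemma fiber:
 assumes "x : carrier E" "y : carrier E" "pj x = pj y"
 obtains a where "a ~= 0" "x = io a \<otimes> y"
proof -
 have "pj (x \<otimes> inv y) = \<one>\<^bsub>Q\<^esub>" using assms by simp
 then obtain a where "a ~= 0" "x \<otimes> inv y = io a" using pi_kernel[of "x \<otimes> inv y"] assms by auto
 moreover have "x = (x \<otimes> inv y) \<otimes> y" using assms by (simp add: E.m_assoc)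
 ultimately show thesis using that[of a] by simp
qed

lemma iota_mult_left: "a ~= 0 ==> b ~= 0 ==> x : carrier E ==> io a \<otimes> (io b \<otimes> x) = io (a * b) \<otimes> x"
 by (simp add: iota_mult E.m_assoc)

lemma mult_iota_left: "a ~= 0 ==> x : carrier E ==> y : carrier E ==> x \<otimes> (io a \<otimes> y) = io a \<otimes> (x \<otimes> y)"
 using iota_central[of a x] by (simp add: E.m_assoc[symmetric])

lemma iota_mult_mult:
 assumes "a ~= 0" "b ~= 0" "x : carrier E" "y : carrier E"
 shows "(io a \<otimes> x) \<otimes> (io b \<otimes> y) = io (a * b) \<otimes> (x \<otimes> y)"
proof -
 have "(io a \<otimes> x) \<otimes> (io b \<otimes> y) = io a \<otimes> (x \<otimes> (io b \<otimes> y))" using assms by (simp add: E.m_assoc)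
 also have "x \<otimes> (io b \<otimes> y) = io b \<otimes> (x \<otimes> y)" by (rule mult_iota_left[OF assms(2-4)])
 also have "io a \<otimes> (io b \<otimes> (x \<otimes> y)) = io (a * b) \<otimes> (x \<otimes> y)"
  by (rule iota_mult_left) (use assms in auto)
 finally show ?thesis .
qed

text \<open>A retraction of degree \<open>n\<close> is a homomorphism \<open>E \<rightarrow> k\<^sup>*\<close> restricting to the \<open>n\<close>-th power map.\<close>

definition retraction::"nat => ('e => 'k) => bool" where
 "retraction n de \<longleftrightarrow> de : hom E kstar & (ALL a. a ~= 0 \<longrightarrow> de (io a) = a ^ n)"

text \<open>A subgroup meeting \<open>k\<^sup>*\<close> trivially and mapping onto \<open>Q\<close> makes the extension a direct product.\<close>

lemma retraction_complement:
 assumes T: "subgroup T E" and inj: "!!t. t : T ==> pj t = \<one>\<^bsub>Q\<^esub> ==> t = \<one>" and surj: "!!q. q : carrier Q ==> EX t:T. pj t = q"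
 shows "EX de. retraction 1 de"
proof -
 note Tc = subgroup.mem_carrier[OF T] and Tm = subgroup.m_closed[OF T] and Ti = subgroup.m_inv_closed[OF T]
 have un: "a = b & t = u" if "a ~= 0" "b ~= 0" "t : T" "u : T" "io a \<otimes> t = io b \<otimes> u" for a b t u
 proof -
  note tc = Tc[OF that(3)] and uc = Tc[OF that(4)]
  have "pj t = pj u" using arg_cong[OF that(5),of pj] that(1,2) tc uc by simp
  hence "pj (t \<otimes> inv u) = \<one>\<^bsub>Q\<^esub>" using tc uc by simp
  hence "t \<otimes> inv u = \<one>" using inj[OF Tm[OF that(3) Ti[OF that(4)]]] by simp
  hence tu: "t = u" using E.inv_equality[of t "inv u"] tc uc by simp
  hence "io a = io b" using that(1,2,5) tc by simp
  thus ?thesis using iota_inj that tu by blast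
 qed
 define de where "de y = (THE a. a ~= 0 & (EX t:T. y = io a \<otimes> t))" for y
 have d: "de (io a \<otimes> t) = a" if "a ~= 0" "t : T" for a t
  unfolding de_def by (rule the_equality) (use un that in blast)+
 have dec: "EX a t. a ~= 0 & t : T & y = io a \<otimes> t" if y: "y : carrier E" for y
 proof -
  obtain t where t: "t : T" "pj t = pj y" using surj[OF pi_closed[OF y]] by blast
  obtain a where "a ~= 0" "y = io a \<otimes> t" by (rule fiber[OF y Tc[OF t(1)]]) (simp add: t)
  thus ?thesis using t by blast
 qed
 have "de : hom E kstar"
 proof (rule homI)
  fix x assume "x : carrier E"
  then obtain a t where "a ~= 0" "t : T" "x = io a \<otimes> t" using dec by blast
  thus "de x : carrier kstar" using d[of a t] by (simp add: carrier_kstar)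
 next
  fix x y assume x: "x : carrier E" and y: "y : carrier E"
  obtain a t where a: "a ~= 0" "t : T" "x = io a \<otimes> t" using dec[OF x] by blast
  obtain b u where b: "b ~= 0" "u : T" "y = io b \<otimes> u" using dec[OF y] by blast
  have "x \<otimes> y = io (a * b) \<otimes> (t \<otimes> u)"
   unfolding a(3) b(3) by (rule iota_mult_mult[OF a(1) b(1) Tc[OF a(2)] Tc[OF b(2)]])
  thus "de (x \<otimes> y) = de x \<otimes>\<^bsub>kstar\<^esub> de y"
   using d[of "a * b" "t \<otimes> u"] d[of a t] d[of b u] a b Tm[OF a(2) b(2)] by simp
 qed
 moreover have "de (io a) = a" if "a ~= 0" for a
  using d[OF that subgroup.one_closed[OF T]] that by simp
 ultimately show ?thesis by (auto simp: retraction_def)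
qed

text \<open>The lift of a generator can be rescaled so that its \<open>N\<close>-th power is \<open>1\<close>.\<close>

lemma retraction_cyclic:
 assumes c: "c : carrier Q" and gen: "!!q. q : carrier Q ==> EX i::nat. q = c [^]\<^bsub>Q\<^esub> i"
  and ord: "!!i::nat. c [^]\<^bsub>Q\<^esub> i = \<one>\<^bsub>Q\<^esub> \<longleftrightarrow> N dvd i" and N: "N > 0"
 shows "EX de. retraction 1 de"
proof -
 obtain y where y: "y : carrier E" "pj y = c" using pi_surj[OF c] by blast
 have "pj (y [^] N) = \<one>\<^bsub>Q\<^esub>" using y ord[of N] by (simp add: pi_pow)
 then obtain b where b: "b ~= 0" "y [^] N = io b" using pi_kernel[of "y [^] N"] y by auto
 obtain r where r: "r ^ N = inverse b" using nth_root_exists[OF N] by metis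
 hence r0: "r ~= 0" using b N by (auto simp: power_0_left split: if_splits)
 define x where "x = io r \<otimes> y"
 have x: "x : carrier E" "pj x = c" using r0 y c by (auto simp: x_def)
 have xN: "x [^] N = \<one>"
 proof -
  have "x [^] N = io r [^] N \<otimes> y [^] N" unfolding x_def
   by (rule E.pow_mult_distrib) (use iota_central r0 y in auto)
  also have "... = io (r ^ N * b)" using r0 b by (simp add: iota_power iota_mult)
  finally show ?thesis using r b by (simp add: iota_one)
 qed
 have pm: "x [^] (i + N * j) = x [^] i" for i j::nat
  using x xN by (simp add: E.nat_pow_mult[symmetric] E.nat_pow_pow[symmetric])
 show ?thesis
 proof (rule retraction_complement[of "range (%i::nat. x [^] i)"])
  show "subgroup (range (%i::nat. x [^] i)) E"
  proof (rule E.subgroupI)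
   fix a assume "a : range (%i::nat. x [^] i)"
   then obtain i::nat where i: "a = x [^] i" by blast
   have "x [^] (i * (N - 1)) \<otimes> x [^] i = x [^] (0 + N * i)"
    using E.nat_pow_mult[OF x(1),of "i * (N - 1)" i] mult_pred_add[OF N,of i] by simp
   hence "x [^] (i * (N - 1)) \<otimes> a = \<one>" unfolding pm i by simp
   hence "inv a = x [^] (i * (N - 1))" using x i by (intro E.inv_equality) auto
   thus "inv a : range (%i::nat. x [^] i)" by blast
   fix b assume "b : range (%i::nat. x [^] i)"
   thus "a \<otimes> b : range (%i::nat. x [^] i)" using i x by (auto simp: E.nat_pow_mult)
  qed (use x in auto)
  fix t assume "t : range (%i::nat. x [^] i)" "pj t = \<one>\<^bsub>Q\<^esub>"
  then obtain i::nat where i: "t = x [^] i" "N dvd i" using x ord by (auto simp: pi_pow)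
  then obtain j where j: "i = 0 + N * j" by auto
  show "t = \<one>" unfolding i(1) j pm by simp
 next
  fix q assume "q : carrier Q"
  then obtain i::nat where "q = c [^]\<^bsub>Q\<^esub> i" using gen by blast
  thus "EX t:range (%i::nat. x [^] i). pj t = q" using x by (intro bexI[of _ "x [^] i"]) (auto simp: pi_pow)
 qed
qed

text \<open>For a generalised quaternion group, first rescale the lift of \<open>c\<close> so that the lift of \<open>x\<close> inverts it, and
  then the lift of \<open>x\<close> so that its square is the right power; the order of the lift of \<open>c\<close> comes out by itself.\<close>

lemma retraction_dicyclic:
 assumes c: "c : carrier Q" and x: "x : carrier Q" and k: "k > 0"
  and ord: "!!i::nat. c [^]\<^bsub>Q\<^esub> i = \<one>\<^bsub>Q\<^esub> \<longleftrightarrow> 2 * k dvd i" and ck: "c [^]\<^bsub>Q\<^esub> k = x \<otimes>\<^bsub>Q\<^esub> x"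
  and cxc: "c \<otimes>\<^bsub>Q\<^esub> (x \<otimes>\<^bsub>Q\<^esub> c) = x" and xC: "!!i::nat. x ~= c [^]\<^bsub>Q\<^esub> i"
  and cover: "!!q. q : carrier Q ==> EX i::nat. q = c [^]\<^bsub>Q\<^esub> i \<or> q = c [^]\<^bsub>Q\<^esub> i \<otimes>\<^bsub>Q\<^esub> x"
 shows "EX de. retraction 1 de"
proof -
 obtain c0 where c0: "c0 : carrier E" "pj c0 = c" using pi_surj[OF c] by blast
 obtain x0 where x0: "x0 : carrier E" "pj x0 = x" using pi_surj[OF x] by blast
 obtain a where a: "a ~= 0" "c0 \<otimes> (x0 \<otimes> c0) = io a \<otimes> x0"
  by (rule fiber[of "c0 \<otimes> (x0 \<otimes> c0)" x0]) (use c0 x0 cxc in auto)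
 obtain r where r: "r ^ 2 = inverse a" using nth_root_exists[of 2] by (metis pos2)
 hence r0: "r ~= 0" using a by auto
 define d where "d = io r \<otimes> c0"
 have d: "d : carrier E" "pj d = c" using r0 c0 c by (auto simp: d_def)
 have dxd: "d \<otimes> (x0 \<otimes> d) = x0"
 proof -
  have "x0 \<otimes> d = io r \<otimes> (x0 \<otimes> c0)" unfolding d_def by (rule mult_iota_left[OF r0 x0(1) c0(1)])
  hence "d \<otimes> (x0 \<otimes> d) = io (r * r) \<otimes> (c0 \<otimes> (x0 \<otimes> c0))"
   unfolding d_def using iota_mult_mult[OF r0 r0 c0(1),of "x0 \<otimes> c0"] c0 x0 by simp
  also have "... = io (r * r * a) \<otimes> x0" unfolding a(2) using r0 a(1) x0 by (simp add: iota_mult_left)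
  also have "r * r * a = 1" using r a(1) by (simp add: power2_eq_square)
  finally show ?thesis using x0 by (simp add: iota_one)
 qed
 obtain s where s: "s ~= 0" "x0 \<otimes> x0 = io s \<otimes> d [^] k"
  by (rule fiber[of "x0 \<otimes> x0" "d [^] k"]) (use x0 d ck in "auto simp: pi_pow")
 obtain u where u: "u ^ 2 = inverse s" using nth_root_exists[of 2] by (metis pos2)
 hence u0: "u ~= 0" using s by auto
 define y where "y = io u \<otimes> x0"
 have y: "y : carrier E" "pj y = x" using u0 x0 x by (auto simp: y_def)
 have yy: "y \<otimes> y = d [^] k"
 proof -
  have "y \<otimes> y = io (u * u) \<otimes> (x0 \<otimes> x0)" unfolding y_def by (rule iota_mult_mult[OF u0 u0 x0(1) x0(1)])
  also have "... = io (u * u * s) \<otimes> d [^] k" unfolding s(2) using u0 s d by (simp add: iota_mult_left)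
  also have "u * u * s = 1" using u s by (simp add: power2_eq_square)
  finally show ?thesis using d by (simp add: iota_one)
 qed
 have dyd: "d \<otimes> (y \<otimes> d) = y"
 proof -
  have "y \<otimes> d = io u \<otimes> (x0 \<otimes> d)" unfolding y_def using u0 x0 d by (simp add: E.m_assoc)
  hence "d \<otimes> (y \<otimes> d) = io u \<otimes> (d \<otimes> (x0 \<otimes> d))"
   using mult_iota_left[OF u0 d(1),of "x0 \<otimes> d"] x0 d by simp
  thus ?thesis unfolding dxd y_def .
 qed
 have dyd': "d [^] i \<otimes> (y \<otimes> d [^] i) = y" for i::nat
 proof (induction i)
  case (Suc i)
  have e: "d [^] Suc i = d \<otimes> d [^] i" "d [^] Suc i = d [^] i \<otimes> d" by (rule E.nat_pow_Suc2[OF d(1)]) simp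
  have "d [^] Suc i \<otimes> (y \<otimes> d [^] Suc i) = (d [^] i \<otimes> d) \<otimes> (y \<otimes> (d \<otimes> d [^] i))" using e by metis
  also have "... = d [^] i \<otimes> ((d \<otimes> (y \<otimes> d)) \<otimes> d [^] i)" using d(1) y(1) by (simp add: E.m_assoc)
  finally have "d [^] Suc i \<otimes> (y \<otimes> d [^] Suc i) = d [^] i \<otimes> ((d \<otimes> (y \<otimes> d)) \<otimes> d [^] i)" .
  thus ?case using Suc dyd by simp
 qed (use y in simp)
 have d2k: "d [^] (2 * k) = \<one>"
 proof -
  have "d [^] k \<otimes> (y \<otimes> d [^] k) = (d [^] k \<otimes> d [^] k) \<otimes> y"
   unfolding yy[symmetric] using y by (simp add: E.m_assoc)
  hence "(d [^] k \<otimes> d [^] k) \<otimes> y = y" using dyd'[of k] by simp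
  hence "d [^] k \<otimes> d [^] k = \<one>" using d y E.r_cancel_one[of y "d [^] k \<otimes> d [^] k"] by simp
  thus ?thesis using d by (simp add: E.nat_pow_mult mult_2)
 qed
 define n where "n = 2 * k"
 have n: "n > 0" "d [^] n = \<one>" using k d2k by (auto simp: n_def)
 have pm: "d [^] (i + n * j) = d [^] i" for i j::nat
  using d n by (simp add: E.nat_pow_mult[symmetric] E.nat_pow_pow[symmetric])
 have pinv: "d [^] (i * (n - 1)) \<otimes> d [^] i = \<one>" for i::nat
 proof -
  have "d [^] (i * (n - 1)) \<otimes> d [^] i = d [^] (0 + n * i)"
   using E.nat_pow_mult[OF d(1),of "i * (n - 1)" i] mult_pred_add[OF n(1),of i] by simp
  thus ?thesis unfolding pm by simp
 qed
 have yd: "y \<otimes> d [^] i = d [^] (i * (n - 1)) \<otimes> y" for i::nat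
 proof -
  have "d [^] (i * (n - 1)) \<otimes> y = d [^] (i * (n - 1)) \<otimes> (d [^] i \<otimes> (y \<otimes> d [^] i))" using dyd' by simp
  also have "... = (d [^] (i * (n - 1)) \<otimes> d [^] i) \<otimes> (y \<otimes> d [^] i)" using d y by (simp add: E.m_assoc)
  finally show ?thesis unfolding pinv using d y by simp
 qed
 define T where "T = range (%i::nat. d [^] i) \<union> range (%i::nat. d [^] i \<otimes> y)"
 have 1: "d [^] i : T" "d [^] i \<otimes> y : T" for i::nat by (auto simp: T_def)
 have Tcases: "EX i::nat. t = d [^] i \<or> t = d [^] i \<otimes> y" if "t : T" for t using that by (auto simp: T_def)
 have dd: "d [^] i \<otimes> d [^] j = d [^] (i + j)" for i j::nat using d by (simp add: E.nat_pow_mult)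
 have m1: "d [^] i \<otimes> (d [^] j \<otimes> y) = d [^] (i + j) \<otimes> y" for i j::nat
  using d y by (simp add: dd[symmetric] E.m_assoc)
 have m2: "(d [^] i \<otimes> y) \<otimes> d [^] j = d [^] (i + j * (n - 1)) \<otimes> y" for i j::nat
  using d y by (simp add: E.m_assoc yd m1)
 have m3: "(d [^] i \<otimes> y) \<otimes> (d [^] j \<otimes> y) = d [^] (i + j * (n - 1) + k)" for i j::nat
 proof -
  have "(d [^] i \<otimes> y) \<otimes> (d [^] j \<otimes> y) = ((d [^] i \<otimes> y) \<otimes> d [^] j) \<otimes> y" using d y by (simp add: E.m_assoc)
  also have "... = d [^] (i + j * (n - 1)) \<otimes> (y \<otimes> y)" unfolding m2 using d y by (simp add: E.m_assoc)
  finally show ?thesis unfolding yy dd .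
 qed
 have Tm: "t \<otimes> t' : T" if t: "t : T" and t': "t' : T" for t t'
  using Tcases[OF t] Tcases[OF t'] m1 m2 m3 dd 1 by metis
 show ?thesis
 proof (rule retraction_complement[of T])
  show "subgroup T E"
  proof (rule E.subgroupI)
   show "T <= carrier E" using d y by (auto simp: T_def)
   show "T ~= {}" by (auto simp: T_def)
   fix t assume t: "t : T"
   hence tc: "t : carrier E" using d y by (auto simp: T_def)
   from Tcases[OF t] obtain i::nat where i: "t = d [^] i \<or> t = d [^] i \<otimes> y" by blast
   thus "inv t : T"
   proof
    assume "t = d [^] i"
    hence "inv t = d [^] (i * (n - 1))" using pinv d by (intro E.inv_equality) auto
    thus ?thesis using 1 by simp
   next
    assume t': "t = d [^] i \<otimes> y"
    have "i + i * (n - 1) = 0 + n * i" using mult_pred_add[OF n(1),of i] by simp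
    hence "t \<otimes> t = d [^] k" unfolding t' m3 using pm[of k i] by (simp add: add.commute)
    hence "(t \<otimes> t) \<otimes> (t \<otimes> t) = \<one>" using dd[of k k] d2k by (simp add: mult_2)
    hence "(t \<otimes> (t \<otimes> t)) \<otimes> t = \<one>" using tc by (simp add: E.m_assoc)
    hence "inv t = t \<otimes> (t \<otimes> t)" using tc by (intro E.inv_equality) auto
    thus ?thesis using Tm t by simp
   qed
   fix t' assume "t' : T"
   thus "t \<otimes> t' : T" using Tm t by simp
  qed
  fix t assume t: "t : T" "pj t = \<one>\<^bsub>Q\<^esub>"
  from Tcases[OF t(1)] obtain i::nat where "t = d [^] i \<or> t = d [^] i \<otimes> y" by blast
  thus "t = \<one>"
  proof
   assume ti: "t = d [^] i"
   hence "n dvd i" using t(2) d ord[of i] by (simp add: pi_pow n_def)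
   then obtain j where j: "i = 0 + n * j" by auto
   show ?thesis unfolding ti j pm by simp
  next
   assume ti: "t = d [^] i \<otimes> y"
   hence "c [^]\<^bsub>Q\<^esub> i \<otimes>\<^bsub>Q\<^esub> x = \<one>\<^bsub>Q\<^esub>" using t(2) d y by (simp add: pi_pow)
   moreover have "c [^]\<^bsub>Q\<^esub> i \<otimes>\<^bsub>Q\<^esub> c [^]\<^bsub>Q\<^esub> (i * (n - 1)) = \<one>\<^bsub>Q\<^esub>"
   proof -
    have "i + i * (n - 1) = n * i" using mult_pred_add[OF n(1),of i] by simp
    thus ?thesis using c ord[of "n * i"] by (simp add: Q.nat_pow_mult n_def)
   qed
   ultimately have "x \<otimes>\<^bsub>Q\<^esub> c [^]\<^bsub>Q\<^esub> i = \<one>\<^bsub>Q\<^esub>" "c [^]\<^bsub>Q\<^esub> (i * (n - 1)) \<otimes>\<^bsub>Q\<^esub> c [^]\<^bsub>Q\<^esub> i = \<one>\<^bsub>Q\<^esub>"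
    using c x by (auto intro: Q.inv_comm)
   hence "inv\<^bsub>Q\<^esub> (c [^]\<^bsub>Q\<^esub> i) = x" "inv\<^bsub>Q\<^esub> (c [^]\<^bsub>Q\<^esub> i) = c [^]\<^bsub>Q\<^esub> (i * (n - 1))"
    using c x by (auto intro!: Q.inv_equality)
   hence "x = c [^]\<^bsub>Q\<^esub> (i * (n - 1))" by simp
   thus ?thesis using xC by blast
  qed
 next
  fix q assume "q : carrier Q"
  then obtain i::nat where "q = c [^]\<^bsub>Q\<^esub> i \<or> q = c [^]\<^bsub>Q\<^esub> i \<otimes>\<^bsub>Q\<^esub> x" using cover by blast
  thus "EX t:T. pj t = q"
  proof
   assume "q = c [^]\<^bsub>Q\<^esub> i"
   thus ?thesis using d 1(1)[of i] by (intro bexI[of _ "d [^] i"]) (auto simp: pi_pow)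
  next
   assume "q = c [^]\<^bsub>Q\<^esub> i \<otimes>\<^bsub>Q\<^esub> x"
   thus ?thesis using d y 1(2)[of i] by (intro bexI[of _ "d [^] i \<otimes> y"]) (auto simp: pi_pow)
  qed
 qed
qed

definition preimage::"'a set => 'e set" where
 "preimage B = {x : carrier E. pj x : B}"

lemma preimage_subgroup: "subgroup B Q ==> subgroup (preimage B) E"
 by (rule E.subgroupI)
  (auto simp: preimage_def subgroup.m_closed subgroup.m_inv_closed subgroup.one_closed intro!: exI[of _ \<one>])

lemma restrict_central_ext:
 assumes B: "subgroup B Q"
 shows "central_ext (Q\<lparr>carrier := B\<rparr>) (E\<lparr>carrier := preimage B\<rparr>) io pj"
proof (rule central_ext.intro)
 show "group (Q\<lparr>carrier := B\<rparr>)" by (rule Q.subgroup_imp_group[OF B])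
 note B1 = subgroup.one_closed[OF B] and Bc = subgroup.mem_carrier[OF B]
 show "central_extension (Q\<lparr>carrier := B\<rparr>) (E\<lparr>carrier := preimage B\<rparr>) io pj"
  unfolding central_extension_def
 proof (intro conjI)
  show "group (E\<lparr>carrier := preimage B\<rparr>)" by (rule E.subgroup_imp_group[OF preimage_subgroup[OF B]])
  show "io : mon kstar (E\<lparr>carrier := preimage B\<rparr>)"
   unfolding mon_def using B1 by (auto simp: hom_def carrier_kstar preimage_def iota_mult intro!: inj_onI iota_inj)
  have "EX x:preimage B. pj x = q" if "q : B" for q
   using pi_surj[OF Bc[OF that]] that by (auto simp: preimage_def)
  thus "pj : epi (E\<lparr>carrier := preimage B\<rparr>) (Q\<lparr>carrier := B\<rparr>)"
   unfolding epi_def by (auto simp: hom_def preimage_def image_iff)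
  show "io ` carrier kstar = kernel (E\<lparr>carrier := preimage B\<rparr>) (Q\<lparr>carrier := B\<rparr>) pj"
   using pi_kernel B1 by (auto simp: kernel_def carrier_kstar preimage_def)
  show "ALL a:carrier kstar. ALL x:carrier (E\<lparr>carrier := preimage B\<rparr>).
    io a \<otimes>\<^bsub>E\<lparr>carrier := preimage B\<rparr>\<^esub> x = x \<otimes>\<^bsub>E\<lparr>carrier := preimage B\<rparr>\<^esub> io a"
   using iota_central by (auto simp: carrier_kstar preimage_def)
 qed
qed

text \<open>The transfer: the determinant of the representation induced from a retraction on the preimage of \<open>B\<close>.\<close>

lemma retraction_transfer:
 assumes B: "subgroup B Q" and fin: "finite (carrier Q)"
  and d: "central_ext.retraction (E\<lparr>carrier := preimage B\<rparr>) io 1 de"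
 shows "EX de'. retraction (card (rcosets\<^bsub>Q\<^esub> B)) de'"
proof -
 interpret R: central_ext "Q\<lparr>carrier := B\<rparr>" "E\<lparr>carrier := preimage B\<rparr>" io pj
  by (rule restrict_central_ext[OF B])
 define e where "e = card (rcosets\<^bsub>Q\<^esub> B)"
 have "finite (rcosets\<^bsub>Q\<^esub> B)" using fin by (simp add: RCOSETS_def)
 then obtain f where f: "bij_betw f {..<e} (rcosets\<^bsub>Q\<^esub> B)"
  using ex_bij_betw_nat_finite by (metis e_def lessThan_atLeast0)
 have "EX x:carrier E. f a = B #>\<^bsub>Q\<^esub> inv\<^bsub>Q\<^esub> pj x" if a: "a < e" for a
 proof -
  have "f a : rcosets\<^bsub>Q\<^esub> B" using bij_betwE[OF f] a by auto
  then obtain q where q: "q : carrier Q" "f a = B #>\<^bsub>Q\<^esub> q" by (auto simp: RCOSETS_def)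
  obtain x where "x : carrier E" "pj x = inv\<^bsub>Q\<^esub> q" using pi_surj[of "inv\<^bsub>Q\<^esub> q"] q by auto
  thus ?thesis using q by (intro bexI[of _ x]) auto
 qed
 then obtain t where t: "!!a. a < e ==> t a : carrier E" "!!a. a < e ==> f a = B #>\<^bsub>Q\<^esub> inv\<^bsub>Q\<^esub> pj (t a)"
  by metis
 have coset: "inv (t a) \<otimes> x : preimage B \<longleftrightarrow> f a = B #>\<^bsub>Q\<^esub> inv\<^bsub>Q\<^esub> pj x" if "a < e" "x : carrier E" for a x
 proof -
  let ?u = "pj (t a)" and ?v = "pj x"
  have uv: "?u : carrier Q" "?v : carrier Q" using t(1) that by auto
  have "inv (t a) \<otimes> x : preimage B \<longleftrightarrow> inv\<^bsub>Q\<^esub> ?u \<otimes>\<^bsub>Q\<^esub> ?v : B"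
   using t(1) that by (simp add: preimage_def)
  also have "... \<longleftrightarrow> inv\<^bsub>Q\<^esub> ?u : B #>\<^bsub>Q\<^esub> inv\<^bsub>Q\<^esub> ?v"
  proof
   assume *: "inv\<^bsub>Q\<^esub> ?u \<otimes>\<^bsub>Q\<^esub> ?v : B"
   have "inv\<^bsub>Q\<^esub> ?u = (inv\<^bsub>Q\<^esub> ?u \<otimes>\<^bsub>Q\<^esub> ?v) \<otimes>\<^bsub>Q\<^esub> inv\<^bsub>Q\<^esub> ?v" using uv by (simp add: Q.m_assoc)
   thus "inv\<^bsub>Q\<^esub> ?u : B #>\<^bsub>Q\<^esub> inv\<^bsub>Q\<^esub> ?v" using * unfolding r_coset_def by blast
  next
   assume "inv\<^bsub>Q\<^esub> ?u : B #>\<^bsub>Q\<^esub> inv\<^bsub>Q\<^esub> ?v"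
   then obtain b where b: "b : B" "inv\<^bsub>Q\<^esub> ?u = b \<otimes>\<^bsub>Q\<^esub> inv\<^bsub>Q\<^esub> ?v" by (auto simp: r_coset_def)
   thus "inv\<^bsub>Q\<^esub> ?u \<otimes>\<^bsub>Q\<^esub> ?v : B" using uv subgroup.mem_carrier[OF B b(1)] by (simp add: Q.m_assoc)
  qed
  also have "... \<longleftrightarrow> B #>\<^bsub>Q\<^esub> inv\<^bsub>Q\<^esub> ?u = B #>\<^bsub>Q\<^esub> inv\<^bsub>Q\<^esub> ?v"
   using Q.repr_independence[OF _ _ B,of "inv\<^bsub>Q\<^esub> ?u" "inv\<^bsub>Q\<^esub> ?v"] Q.rcos_self[OF _ B,of "inv\<^bsub>Q\<^esub> ?u"] uv by auto
  finally show ?thesis using t(2)[OF that(1)] by simp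
 qed
 interpret T: transversal E "preimage B" t e
 proof (intro transversal.intro transversal_axioms.intro)
  fix x assume x: "x : carrier E"
  have "B #>\<^bsub>Q\<^esub> inv\<^bsub>Q\<^esub> pj x : rcosets\<^bsub>Q\<^esub> B" using x by (auto simp: RCOSETS_def)
  hence "B #>\<^bsub>Q\<^esub> inv\<^bsub>Q\<^esub> pj x : f ` {..<e}" using f by (simp add: bij_betw_def)
  then obtain a where a: "a < e" "f a = B #>\<^bsub>Q\<^esub> inv\<^bsub>Q\<^esub> pj x" by auto
  have "b = a" if "b < e" "f b = B #>\<^bsub>Q\<^esub> inv\<^bsub>Q\<^esub> pj x" for b
   using f that a by (auto simp: bij_betw_def dest!: inj_onD[of f _ b a])
  hence "EX! a. a < e & f a = B #>\<^bsub>Q\<^esub> inv\<^bsub>Q\<^esub> pj x" using a by blast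
  thus "EX! a. a < e & inv (t a) \<otimes> x : preimage B" using coset[OF _ x] by (metis (no_types,lifting))
 qed (rule E.is_group preimage_subgroup[OF B] t(1) | assumption)+
 have de: "de : hom (E\<lparr>carrier := preimage B\<rparr>) kstar" "!!a. a ~= 0 ==> de (io a) = a"
  using d by (auto simp: R.retraction_def)
 define mm where "mm y = de y \<cdot>\<^sub>m (1\<^sub>m 1::'k mat)" for y
 have mm: "(1,mm) : reps (E\<lparr>carrier := preimage B\<rparr>)"
 proof (rule repsI[OF R.E.is_group])
  fix g h assume gh: "g : carrier (E\<lparr>carrier := preimage B\<rparr>)" "h : carrier (E\<lparr>carrier := preimage B\<rparr>)"
  show "mm (g \<otimes>\<^bsub>E\<lparr>carrier := preimage B\<rparr>\<^esub> h) = mm g * mm h"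
   unfolding mm_def hom_mult[OF de(1) gh]
   by (simp add: mult_smult_assoc_mat[of _ 1 1 _ 1] mult_smult_distrib[of _ 1 1 _ 1] smult_smult_mat mult.commute)
 next
  have "de \<one> = 1" using de(2)[of 1] by (simp add: iota_one)
  thus "mm \<one>\<^bsub>E\<lparr>carrier := preimage B\<rparr>\<^esub> = 1\<^sub>m 1" by (simp add: mm_def one_smult_mat)
 qed (simp add: mm_def)
 define I where "I = snd (induced E (preimage B) t e (1,mm))"
 have rI: "(e,I) : reps E" using T.induced_in_reps[OF mm] by (simp add: I_def induced_def)
 have "(%x. det (I x)) : hom E kstar"
 proof (rule homI)
  fix x assume "x : carrier E"
  thus "det (I x) : carrier kstar" using repsD(1)[OF rI E.is_group] by (auto simp: carrier_kstar carrier_GL)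
 next
  fix x y assume xy: "x : carrier E" "y : carrier E"
  show "det (I (x \<otimes> y)) = det (I x) \<otimes>\<^bsub>kstar\<^esub> det (I y)"
   unfolding repsD(3)[OF rI E.is_group xy] mult_kstar
   by (rule det_mult[OF repsD(2)[OF rI E.is_group xy(1)] repsD(2)[OF rI E.is_group xy(2)]])
 qed
 moreover have "det (I (io a)) = a ^ e" if a: "a ~= 0" for a
 proof -
  have "io a : preimage B" using a subgroup.one_closed[OF B] by (simp add: preimage_def)
  moreover have "mm (io a) = a \<cdot>\<^sub>m 1\<^sub>m 1" using de(2)[OF a] by (simp add: mm_def)
  ultimately have "I (io a) = a \<cdot>\<^sub>m 1\<^sub>m (e * 1)"
   unfolding I_def by (intro T.induced_central[OF mm]) (use iota_central a in auto)
  thus ?thesis by simp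
 qed
 ultimately have "retraction e (%x. det (I x))" by (simp add: retraction_def)
 thus ?thesis unfolding e_def by blast
qed

text \<open>Retractions of degrees \<open>n\<close> and \<open>l\<close> have a quotient of degree \<open>n - l\<close>, so all degrees are
multiples of the least positive one, which is therefore \<open>1\<close>.\<close>

lemma retraction_gcd:
 assumes "!!p. prime p ==> EX n de. ~p dvd n & retraction n de"
 shows "EX de. retraction 1 de"
proof -
 define D where "D n \<longleftrightarrow> (EX de. retraction n de)" for n
 have minus: "D (n - l)" if "D n" "D l" "l <= n" for n l
 proof -
  obtain de1 de2 where d: "retraction n de1" "retraction l de2" using \<open>D n\<close> \<open>D l\<close> by (auto simp: D_def)
  have h: "de1 : hom E kstar" "de2 : hom E kstar" using d by (auto simp: retraction_def)
  have nz: "de1 x ~= 0" "de2 x ~= 0" if "x : carrier E" for x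
   using hom_in_carrier[OF h(1) that] hom_in_carrier[OF h(2) that] by (auto simp: carrier_kstar)
  have "(%x. de1 x / de2 x) : hom E kstar"
   using hom_mult[OF h(1)] hom_mult[OF h(2)] nz by (intro homI) (auto simp: carrier_kstar)
  moreover have "de1 (io a) / de2 (io a) = a ^ (n - l)" if "a ~= 0" for a
   using d that \<open>l <= n\<close> by (simp add: retraction_def power_diff)
  ultimately show ?thesis by (auto simp: D_def retraction_def)
 qed
 have ex: "EX n. n > 0 & D n" using assms[OF two_is_prime_nat] unfolding D_def by (metis dvd_0_right neq0_conv)
 define d where "d = (LEAST n. n > 0 & D n)"
 have d: "d > 0" "D d" using LeastI_ex[OF ex] by (auto simp: d_def)
 have least: "d <= n" if "n > 0" "D n" for n unfolding d_def using that by (intro Least_le) simp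
 have dvd: "d dvd n" if "D n" for n
  using that
 proof (induction n rule: less_induct)
  case (less n)
  show ?case
  proof (cases "n = 0")
   case False
   hence "d <= n" using least less.prems by simp
   hence "d dvd n - d" using less.IH[of "n - d"] minus[OF less.prems d(2)] d(1) by simp
   thus ?thesis using \<open>d <= n\<close> by (rule dvd_diffD[OF _ dvd_refl])
  qed simp
 qed
 have "d = 1"
 proof (rule ccontr)
  assume "d ~= 1"
  then obtain p where p: "prime p" "p dvd d" using prime_factor_nat by blast
  thus False using assms[OF p(1)] dvd p(2) unfolding D_def by (meson dvd_trans)
 qed
 thus ?thesis using d(2) by (simp add: D_def)
qed

end

text \<open>In cohomological terms: \<open>H\<^sup>2(G\<^sub>1, k\<^sup>*) = 0\<close>.\<close>

theorem SL2_extension_retraction: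
 fixes G1::"'k::{alg_closed_field,field_char_0} mat set" and E::"('e,'y) monoid_scheme"
 assumes z: "compatible_generators (ze::nat => 'k)"
  and G: "subgroup G1 (GL 2)" "G1 <= SL 2" "finite G1" and E: "central_ext (lin_group G1) E io pj"
 shows "EX de. central_ext.retraction E io 1 de"
proof -
 interpret E: central_ext "lin_group G1" E io pj by fact
 show ?thesis
 proof (rule E.retraction_gcd)
  fix p::nat assume p: "prime p"
  define a where "a = multiplicity p (card G1)"
  define r where "r = card G1 div p ^ a"
  have c0: "card G1 ~= 0" using G(3) subgroup.one_closed[OF G(1)] by auto
  have cr: "card G1 = p ^ a * r" by (simp add: r_def a_def multiplicity_dvd)
  have pr: "~p dvd r" unfolding r_def a_def using c0 p
   by (intro multiplicity_decompose) (auto dest: prime_gt_1_nat)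
  obtain P where P: "subgroup P (lin_group G1)" "card P = p ^ a"
   using sylow_thm[OF p E.group_Q,of a r] cr G(3) by (auto simp: Coset.order_def)
  have PG: "P <= G1" using subgroup.subset[OF P(1)] by simp
  have P': "subgroup P (GL 2)"
   using group.incl_subgroup[OF group_GL G(1),of P] P(1) by (simp add: lin_group_def)
  have finP: "finite P" using PG G(3) finite_subset by blast
  have eqP: "(lin_group G1)\<lparr>carrier := P\<rparr> = lin_group P" by (simp add: lin_group_def)
  interpret R: central_ext "lin_group P" "E\<lparr>carrier := E.preimage P\<rparr>" io pj
   using E.restrict_central_ext[OF P(1)] unfolding eqP .
  have "EX de. R.retraction 1 de"
   using SL2_p_subgroup_structure[OF z p P' subset_trans[OF PG G(2)] finP P(2)]
  proof (elim disjE bexE exE conjE)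
   fix c assume c: "c : P" "ALL g:P. EX i::nat. g = c [^]\<^bsub>GL 2\<^esub> i" "ALL i::nat. c [^]\<^bsub>GL 2\<^esub> i = I2 \<longleftrightarrow> card P dvd i"
   show ?thesis
    by (rule R.retraction_cyclic[of c "card P"])
     (use c P(2) prime_gt_0_nat[OF p] in "auto simp: pow_lin_group")
  next
   fix c x k
   assume "c : P" "x : P" "k > 0" "ALL i::nat. c [^]\<^bsub>GL 2\<^esub> i = I2 \<longleftrightarrow> 2 * k dvd i" "c [^]\<^bsub>GL 2\<^esub> k = x * x"
    "c * (x * c) = x" "ALL i::nat. x ~= c [^]\<^bsub>GL 2\<^esub> i"
    "ALL g:P. EX i::nat. g = c [^]\<^bsub>GL 2\<^esub> i \<or> g = c [^]\<^bsub>GL 2\<^esub> i * x"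
   thus ?thesis
    by (intro R.retraction_dicyclic[of c x k]) (simp_all add: pow_lin_group)
  qed
  then obtain de where "R.retraction 1 de" by blast
  then obtain de' where d: "E.retraction (card (rcosets\<^bsub>lin_group G1\<^esub> P)) de'"
   using E.retraction_transfer[OF P(1)] G(3) by auto
  have "card (rcosets\<^bsub>lin_group G1\<^esub> P) * card P = card G1"
   using E.Q.lagrange[OF P(1)] by (simp add: Coset.order_def)
  hence "card (rcosets\<^bsub>lin_group G1\<^esub> P) = r" unfolding cr P(2) using p by (simp add: mult.commute)
  thus "EX n de. ~p dvd n & E.retraction n de" using d pr by blast
 qed
qed

section \<open>Cocycles and extension classes\<close>

lemma cocycleD:
 assumes "c : carrier (cocycle_group Q)"
 shows "x : carrier Q ==> y : carrier Q ==> c (x,y) ~= (0::'k::field)"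
  "x : carrier Q ==> y : carrier Q ==> z : carrier Q ==>
   c (x,y) * c (x \<otimes>\<^bsub>Q\<^esub> y,z) = c (y,z) * c (x,y \<otimes>\<^bsub>Q\<^esub> z)"
  "c : extensional (carrier Q \<times> carrier Q)"
 using assms by (auto simp: cocycle_group_def carrier_kstar PiE_def Pi_def)

lemma cocycleI:
 assumes "!!x y. x : carrier Q ==> y : carrier Q ==> c (x,y) ~= (0::'k::field)"
  "!!x y z. x : carrier Q ==> y : carrier Q ==> z : carrier Q ==>
   c (x,y) * c (x \<otimes>\<^bsub>Q\<^esub> y,z) = c (y,z) * c (x,y \<otimes>\<^bsub>Q\<^esub> z)"
  "c : extensional (carrier Q \<times> carrier Q)"
 shows "c : carrier (cocycle_group Q)"
 using assms by (auto simp: cocycle_group_def carrier_kstar PiE_def)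

lemma mult_cocycle [simp]: "c \<otimes>\<^bsub>cocycle_group Q\<^esub> d = (\<lambda>p\<in>carrier Q \<times> carrier Q. c p * d p)"
 and one_cocycle [simp]: "\<one>\<^bsub>cocycle_group Q\<^esub> = (\<lambda>p\<in>carrier Q \<times> carrier Q. 1)"
 by (simp_all add: cocycle_group_def)

definition boundary::"('a,'x) monoid_scheme => ('a => 'k::field) => 'a \<times> 'a => 'k" where
 "boundary Q f = (\<lambda>(x,y)\<in>carrier Q \<times> carrier Q. f x * f y / f (x \<otimes>\<^bsub>Q\<^esub> y))"

lemma boundary_apply: "x : carrier Q ==> y : carrier Q ==> boundary Q f (x,y) = f x * f y / f (x \<otimes>\<^bsub>Q\<^esub> y)"
 by (simp add: boundary_def)

lemma coboundaries_eq: "coboundaries Q = {boundary Q f | f. ALL x:carrier Q. f x ~= (0::'k::field)}"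
 unfolding coboundaries_def boundary_def by (auto simp: carrier_kstar Pi_def)

lemma cocycle_comm_group:
 assumes "group Q"
 shows "comm_group (cocycle_group Q::('a \<times> 'a => 'k::field) monoid)"
proof -
 interpret group Q by fact
 show ?thesis
 proof (rule comm_groupI)
  fix c d::"'a \<times> 'a => 'k" assume c: "c : carrier (cocycle_group Q)" and d: "d : carrier (cocycle_group Q)"
  note C = cocycleD[OF c] and D = cocycleD[OF d]
  show "c \<otimes>\<^bsub>cocycle_group Q\<^esub> d : carrier (cocycle_group Q)"
  proof (rule cocycleI)
   fix x y z assume xyz: "x : carrier Q" "y : carrier Q" "z : carrier Q"
   have "(c (x,y) * c (x \<otimes>\<^bsub>Q\<^esub> y,z)) * (d (x,y) * d (x \<otimes>\<^bsub>Q\<^esub> y,z))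
     = (c (y,z) * c (x,y \<otimes>\<^bsub>Q\<^esub> z)) * (d (y,z) * d (x,y \<otimes>\<^bsub>Q\<^esub> z))"
    unfolding C(2)[OF xyz] D(2)[OF xyz] ..
   thus "(c \<otimes>\<^bsub>cocycle_group Q\<^esub> d) (x,y) * (c \<otimes>\<^bsub>cocycle_group Q\<^esub> d) (x \<otimes>\<^bsub>Q\<^esub> y,z)
    = (c \<otimes>\<^bsub>cocycle_group Q\<^esub> d) (y,z) * (c \<otimes>\<^bsub>cocycle_group Q\<^esub> d) (x,y \<otimes>\<^bsub>Q\<^esub> z)"
    using xyz by (simp add: mult_ac)
  qed (use C(1) D(1) in auto)
  show "c \<otimes>\<^bsub>cocycle_group Q\<^esub> d = d \<otimes>\<^bsub>cocycle_group Q\<^esub> c" by (auto simp: mult.commute)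
  show "\<one>\<^bsub>cocycle_group Q\<^esub> \<otimes>\<^bsub>cocycle_group Q\<^esub> c = c"
   using C(3) by (auto simp: extensional_def restrict_def)
  have "(\<lambda>p\<in>carrier Q \<times> carrier Q. inverse (c p)) : carrier (cocycle_group Q)"
  proof (rule cocycleI)
   fix x y z assume xyz: "x : carrier Q" "y : carrier Q" "z : carrier Q"
   thus "(\<lambda>p\<in>carrier Q \<times> carrier Q. inverse (c p)) (x,y) * (\<lambda>p\<in>carrier Q \<times> carrier Q. inverse (c p)) (x \<otimes>\<^bsub>Q\<^esub> y,z)
    = (\<lambda>p\<in>carrier Q \<times> carrier Q. inverse (c p)) (y,z) * (\<lambda>p\<in>carrier Q \<times> carrier Q. inverse (c p)) (x,y \<otimes>\<^bsub>Q\<^esub> z)"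
    using C(2)[OF xyz] by (simp flip: inverse_mult_distrib)
  qed (use C(1) in auto)
  moreover have "(\<lambda>p\<in>carrier Q \<times> carrier Q. inverse (c p)) \<otimes>\<^bsub>cocycle_group Q\<^esub> c = \<one>\<^bsub>cocycle_group Q\<^esub>"
   using C(1) by (auto simp: restrict_def)
  ultimately show "EX y:carrier (cocycle_group Q). y \<otimes>\<^bsub>cocycle_group Q\<^esub> c = \<one>\<^bsub>cocycle_group Q\<^esub>" by blast
  fix b::"'a \<times> 'a => 'k"
  show "c \<otimes>\<^bsub>cocycle_group Q\<^esub> d \<otimes>\<^bsub>cocycle_group Q\<^esub> b = c \<otimes>\<^bsub>cocycle_group Q\<^esub> (d \<otimes>\<^bsub>cocycle_group Q\<^esub> b)"
   by (auto simp: mult.assoc)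
 next
  show "\<one>\<^bsub>cocycle_group Q\<^esub> : carrier (cocycle_group Q)" by (rule cocycleI) auto
 qed
qed

lemma boundary_cocycle:
 assumes "group Q" "!!x. x : carrier Q ==> f x ~= (0::'k::field)"
 shows "boundary Q f : carrier (cocycle_group Q)"
proof -
 interpret group Q by fact
 show ?thesis
 proof (rule cocycleI)
  fix x y z assume xyz: "x : carrier Q" "y : carrier Q" "z : carrier Q"
  thus "boundary Q f (x,y) * boundary Q f (x \<otimes>\<^bsub>Q\<^esub> y,z) = boundary Q f (y,z) * boundary Q f (x,y \<otimes>\<^bsub>Q\<^esub> z)"
   using assms(2)[of "x \<otimes>\<^bsub>Q\<^esub> y"] assms(2)[of "y \<otimes>\<^bsub>Q\<^esub> z"] by (simp add: boundary_apply m_assoc)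
 qed (use assms(2) in \<open>auto simp: boundary_apply\<close>,simp add: boundary_def)
qed

lemma coboundaries_subgroup:
 assumes Q: "group Q"
 shows "subgroup (coboundaries Q) (cocycle_group Q::('a \<times> 'a => 'k::field) monoid)"
proof -
 interpret group Q by fact
 interpret C: comm_group "cocycle_group Q::('a \<times> 'a => 'k) monoid" by (rule cocycle_comm_group[OF Q])
 have mb: "boundary Q f \<otimes>\<^bsub>cocycle_group Q\<^esub> boundary Q g = boundary Q (%x. f x * g x)" for f g::"'a => 'k"
  by (auto simp: boundary_def restrict_def)
 show ?thesis
 proof (rule C.subgroupI)
  show "coboundaries Q <= carrier (cocycle_group Q::('a \<times> 'a => 'k) monoid)"
   unfolding coboundaries_eq using boundary_cocycle[OF Q] by auto
  show "coboundaries Q ~= ({}::('a \<times> 'a => 'k) set)" unfolding coboundaries_eq by (auto intro!: exI[of _ "%_. 1"])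
  fix a::"'a \<times> 'a => 'k" assume "a : coboundaries Q"
  then obtain f where f: "a = boundary Q f" "ALL x:carrier Q. f x ~= 0" by (auto simp: coboundaries_eq)
  have "boundary Q (%x. inverse (f x)) \<otimes>\<^bsub>cocycle_group Q\<^esub> a = \<one>\<^bsub>cocycle_group Q\<^esub>"
   unfolding f(1) mb using f(2) by (auto simp: boundary_def restrict_def)
  moreover have "boundary Q (%x. inverse (f x)) : carrier (cocycle_group Q)" "a : carrier (cocycle_group Q)"
   unfolding f(1) using f(2) by (auto intro!: boundary_cocycle[OF Q])
  ultimately have "inv\<^bsub>cocycle_group Q\<^esub> a = boundary Q (%x. inverse (f x))" by (intro C.inv_equality)
  thus "inv\<^bsub>cocycle_group Q\<^esub> a : coboundaries Q" unfolding coboundaries_eq using f(2) by auto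
  fix b::"'a \<times> 'a => 'k" assume "b : coboundaries Q"
  then obtain g where g: "b = boundary Q g" "ALL x:carrier Q. g x ~= 0" by (auto simp: coboundaries_eq)
  show "a \<otimes>\<^bsub>cocycle_group Q\<^esub> b : coboundaries Q"
   unfolding f(1) g(1) mb coboundaries_eq using f(2) g(2) by auto
 qed
qed

context central_ext
begin

lemma sections_differ:
 assumes "s : carrier Q \<rightarrow> carrier E" "!!x. x : carrier Q ==> pj (s x) = x"
  "s' : carrier Q \<rightarrow> carrier E" "!!x. x : carrier Q ==> pj (s' x) = x"
 obtains f where "!!x. x : carrier Q ==> f x ~= 0 & s' x = io (f x) \<otimes> s x"
proof -
 have "EX a. a ~= 0 & s' x = io a \<otimes> s x" if x: "x : carrier Q" for x
 proof -
  have c: "s' x : carrier E" "s x : carrier E" using assms x by auto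
  obtain a where "a ~= 0" "s' x = io a \<otimes> s x" by (rule fiber[OF c]) (simp add: assms x)
  thus ?thesis by blast
 qed
 thus thesis using that by metis
qed

text \<open>Two sections differ by a function with values in \<open>k\<^sup>*\<close>, and their cocycles by its coboundary.\<close>

lemma extension_class_coset:
 assumes c: "c : extension_class Q E io pj"
 shows "extension_class Q E io pj = coboundaries Q #>\<^bsub>cocycle_group Q\<^esub> c"
proof -
 obtain s where cc: "c : carrier (cocycle_group Q)" and s: "s : carrier Q \<rightarrow> carrier E" "!!x. x : carrier Q ==> pj (s x) = x"
  and sc: "!!x y. x : carrier Q ==> y : carrier Q ==> s x \<otimes> s y = io (c (x,y)) \<otimes> s (x \<otimes>\<^bsub>Q\<^esub> y)"
  using c unfolding extension_class_def by blast
 have sC: "s x : carrier E" if "x : carrier Q" for x using s(1) that by auto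
 note cD = cocycleD[OF cc]
 show ?thesis
 proof (rule Set.set_eqI,rule iffI)
  fix d assume "d : extension_class Q E io pj"
  then obtain s' where dc: "d : carrier (cocycle_group Q)" and s': "s' : carrier Q \<rightarrow> carrier E" "!!x. x : carrier Q ==> pj (s' x) = x"
   and sd: "!!x y. x : carrier Q ==> y : carrier Q ==> s' x \<otimes> s' y = io (d (x,y)) \<otimes> s' (x \<otimes>\<^bsub>Q\<^esub> y)"
   unfolding extension_class_def by blast
  note dD = cocycleD[OF dc]
  obtain f where f: "!!x. x : carrier Q ==> f x ~= 0 & s' x = io (f x) \<otimes> s x"
   using sections_differ[OF s s'] by blast
  have key: "d (x,y) = boundary Q f (x,y) * c (x,y)" if xy: "x : carrier Q" "y : carrier Q" for x y
  proof -
   have xyQ: "x \<otimes>\<^bsub>Q\<^esub> y : carrier Q" using xy by simp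
   note fx = f[OF xy(1)] and fy = f[OF xy(2)] and fxy = f[OF xyQ]
   have c0: "c (x,y) ~= 0" "d (x,y) ~= 0" using cD(1) dD(1) xy by auto
   have "s' x \<otimes> s' y = io (f x * f y) \<otimes> (s x \<otimes> s y)"
    using fx fy iota_mult_mult[of "f x" "f y" "s x" "s y"] sC xy by simp
   also have "... = io (f x * f y * c (x,y)) \<otimes> s (x \<otimes>\<^bsub>Q\<^esub> y)"
    unfolding sc[OF xy] by (rule iota_mult_left) (use fx fy c0 sC[OF xyQ] in auto)
   finally have 1: "s' x \<otimes> s' y = io (f x * f y * c (x,y)) \<otimes> s (x \<otimes>\<^bsub>Q\<^esub> y)" .
   have "s' x \<otimes> s' y = io (d (x,y)) \<otimes> (io (f (x \<otimes>\<^bsub>Q\<^esub> y)) \<otimes> s (x \<otimes>\<^bsub>Q\<^esub> y))" using sd[OF xy] fxy by simp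
   also have "... = io (d (x,y) * f (x \<otimes>\<^bsub>Q\<^esub> y)) \<otimes> s (x \<otimes>\<^bsub>Q\<^esub> y)"
    by (rule iota_mult_left) (use fxy c0 sC[OF xyQ] in auto)
   finally have "io (f x * f y * c (x,y)) = io (d (x,y) * f (x \<otimes>\<^bsub>Q\<^esub> y))"
    using 1 sC[OF xyQ] fx fy fxy c0 by simp
   hence "f x * f y * c (x,y) = d (x,y) * f (x \<otimes>\<^bsub>Q\<^esub> y)"
    by (rule iota_inj[rotated 2]) (use fx fy fxy c0 in auto)
   thus ?thesis using fxy xy by (simp add: boundary_apply field_simps)
  qed
  have "d = boundary Q f \<otimes>\<^bsub>cocycle_group Q\<^esub> c"
  proof (rule extensionalityI[OF dD(3)])
   fix p assume "p : carrier Q \<times> carrier Q"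
   thus "d p = (boundary Q f \<otimes>\<^bsub>cocycle_group Q\<^esub> c) p" using key by auto
  qed simp
  moreover have "boundary Q f : coboundaries Q" unfolding coboundaries_eq using f by auto
  ultimately show "d : coboundaries Q #>\<^bsub>cocycle_group Q\<^esub> c" unfolding r_coset_def by blast
 next
  fix d assume "d : coboundaries Q #>\<^bsub>cocycle_group Q\<^esub> c"
  then obtain f where f: "!!x. x : carrier Q ==> f x ~= 0" and d: "d = boundary Q f \<otimes>\<^bsub>cocycle_group Q\<^esub> c"
   unfolding r_coset_def coboundaries_eq by blast
  interpret C: comm_group "cocycle_group Q::('a \<times> 'a => 'k) monoid" by (rule cocycle_comm_group[OF group_Q])
  have dc: "d : carrier (cocycle_group Q)" unfolding d using boundary_cocycle[OF group_Q f] cc by (rule C.m_closed)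
  define s' where "s' x = io (f x) \<otimes> s x" for x
  have "s' x \<otimes> s' y = io (d (x,y)) \<otimes> s' (x \<otimes>\<^bsub>Q\<^esub> y)" if xy: "x : carrier Q" "y : carrier Q" for x y
  proof -
   have xyQ: "x \<otimes>\<^bsub>Q\<^esub> y : carrier Q" using xy by simp
   note fx = f[OF xy(1)] and fy = f[OF xy(2)] and fxy = f[OF xyQ]
   have c0: "c (x,y) ~= 0" "d (x,y) ~= 0" using cD(1) cocycleD(1)[OF dc] xy by auto
   have "s' x \<otimes> s' y = io (f x * f y) \<otimes> (s x \<otimes> s y)"
    unfolding s'_def by (rule iota_mult_mult[OF fx fy sC[OF xy(1)] sC[OF xy(2)]])
   also have "... = io (f x * f y * c (x,y)) \<otimes> s (x \<otimes>\<^bsub>Q\<^esub> y)"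
    unfolding sc[OF xy] by (rule iota_mult_left) (use fx fy c0 sC[OF xyQ] in auto)
   also have "f x * f y * c (x,y) = d (x,y) * f (x \<otimes>\<^bsub>Q\<^esub> y)"
    unfolding d using xy fxy by (simp add: boundary_apply)
   also have "io (d (x,y) * f (x \<otimes>\<^bsub>Q\<^esub> y)) \<otimes> s (x \<otimes>\<^bsub>Q\<^esub> y) = io (d (x,y)) \<otimes> s' (x \<otimes>\<^bsub>Q\<^esub> y)"
    unfolding s'_def by (rule iota_mult_left[symmetric]) (use fxy c0 sC[OF xyQ] in auto)
   finally show ?thesis .
  qed
  moreover have "s' : carrier Q \<rightarrow> carrier E" using f sC by (auto simp: s'_def)
  moreover have "pj (s' x) = x" if "x : carrier Q" for x
   using f[OF that] sC[OF that] s(2)[OF that] that by (simp add: s'_def)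
  ultimately show "d : extension_class Q E io pj" unfolding extension_class_def using dc by blast
 qed
qed

end

text \<open>Cocycles need not be normalised, whence the first component of the unit.\<close>

definition cocycle_ext::"('a,'x) monoid_scheme => ('a \<times> 'a => 'k::field) => ('k \<times> 'a) monoid" where
 "cocycle_ext Q c = \<lparr>carrier = (UNIV - {0}) \<times> carrier Q,
   monoid.mult = (%(a,x) (b,y). (a * b * c (x,y),x \<otimes>\<^bsub>Q\<^esub> y)),one = (inverse (c (\<one>\<^bsub>Q\<^esub>,\<one>\<^bsub>Q\<^esub>)),\<one>\<^bsub>Q\<^esub>)\<rparr>"

lemma cocycle_ext_class:
 fixes c::"'a \<times> 'a => 'k::{alg_closed_field,field_char_0}"
 assumes Q: "group Q" and c: "c : carrier (cocycle_group Q)"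
 shows "EX io pj. central_ext Q (cocycle_ext Q c) io pj & c : extension_class Q (cocycle_ext Q c) io pj"
proof -
 interpret group Q by fact
 note C = cocycleD[OF c]
 define u where "u = c (\<one>\<^bsub>Q\<^esub>,\<one>\<^bsub>Q\<^esub>)"
 have u0: "u ~= 0" unfolding u_def using C(1) by simp
 have c1: "c (\<one>\<^bsub>Q\<^esub>,x) = u" "c (x,\<one>\<^bsub>Q\<^esub>) = u" if "x : carrier Q" for x
 proof -
  have "u * c (\<one>\<^bsub>Q\<^esub>,x) = c (\<one>\<^bsub>Q\<^esub>,x) * c (\<one>\<^bsub>Q\<^esub>,x)" using C(2)[of "\<one>\<^bsub>Q\<^esub>" "\<one>\<^bsub>Q\<^esub>" x] that by (simp add: u_def)
  thus "c (\<one>\<^bsub>Q\<^esub>,x) = u" using C(1)[of "\<one>\<^bsub>Q\<^esub>" x] that by simp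
  have "c (x,\<one>\<^bsub>Q\<^esub>) * c (x,\<one>\<^bsub>Q\<^esub>) = u * c (x,\<one>\<^bsub>Q\<^esub>)" using C(2)[of x "\<one>\<^bsub>Q\<^esub>" "\<one>\<^bsub>Q\<^esub>"] that by (simp add: u_def)
  thus "c (x,\<one>\<^bsub>Q\<^esub>) = u" using C(1)[of x "\<one>\<^bsub>Q\<^esub>"] that by simp
 qed
 let ?E = "cocycle_ext Q c"
 have E: "carrier ?E = (UNIV - {0}) \<times> carrier Q" "!!a x b y. (a,x) \<otimes>\<^bsub>?E\<^esub> (b,y) = (a * b * c (x,y),x \<otimes>\<^bsub>Q\<^esub> y)"
  "\<one>\<^bsub>?E\<^esub> = (inverse u,\<one>\<^bsub>Q\<^esub>)"
  by (auto simp: cocycle_ext_def u_def)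
 have gE: "group ?E"
 proof (rule groupI)
  fix p q r assume pqr: "p : carrier ?E" "q : carrier ?E" "r : carrier ?E"
  obtain a x b y d z where p: "p = (a,x)" "q = (b,y)" "r = (d,z)" by (metis surj_pair)
  have xyz: "x : carrier Q" "y : carrier Q" "z : carrier Q" using pqr by (auto simp: E p)
  have "a * b * c (x,y) * d * c (x \<otimes>\<^bsub>Q\<^esub> y,z) = a * (b * d * c (y,z)) * c (x,y \<otimes>\<^bsub>Q\<^esub> z)"
   using C(2)[OF xyz] by (metis (no_types,opaque_lifting) mult.assoc mult.commute)
  thus "p \<otimes>\<^bsub>?E\<^esub> q \<otimes>\<^bsub>?E\<^esub> r = p \<otimes>\<^bsub>?E\<^esub> (q \<otimes>\<^bsub>?E\<^esub> r)" using xyz by (simp add: p E m_assoc)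
 next
  fix p assume "p : carrier ?E"
  then obtain a x where p: "p = (a,x)" "a ~= 0" "x : carrier Q" by (auto simp: E)
  show "\<one>\<^bsub>?E\<^esub> \<otimes>\<^bsub>?E\<^esub> p = p" using p u0 c1 by (simp add: E)
  have "c (inv\<^bsub>Q\<^esub> x,x) ~= 0" using C(1) p by simp
  thus "EX q:carrier ?E. q \<otimes>\<^bsub>?E\<^esub> p = \<one>\<^bsub>?E\<^esub>"
   using p u0 by (intro bexI[of _ "(inverse (a * c (inv\<^bsub>Q\<^esub> x,x) * u),inv\<^bsub>Q\<^esub> x)"]) (auto simp: E field_simps)
 qed (use C(1) u0 in "auto simp: E")
 define io where "io a = (a / u,\<one>\<^bsub>Q\<^esub>)" for a
 have "central_ext Q ?E io snd"
 proof (rule central_ext.intro[OF _ Q])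
  show "central_extension Q ?E io snd"
   unfolding central_extension_def
  proof (intro conjI)
   show "group ?E" by fact
   show "io : mon kstar ?E" unfolding mon_def using u0
    by (auto simp: hom_def carrier_kstar io_def E u_def[symmetric] inj_on_def)
   show "snd : epi ?E Q" unfolding epi_def
    by (auto simp: hom_def E image_iff intro!: exI[of _ "1::'k"])
   show "io ` carrier kstar = kernel ?E Q snd"
   proof (rule Set.set_eqI,rule iffI)
    fix p assume "p : kernel ?E Q snd"
    hence "p = (fst p,\<one>\<^bsub>Q\<^esub>)" "fst p ~= 0" by (auto simp: kernel_def E)
    thus "p : io ` carrier kstar" using u0 by (intro image_eqI[of _ _ "fst p * u"]) (auto simp: io_def carrier_kstar)
   qed (use u0 in "auto simp: kernel_def E io_def carrier_kstar")
   show "ALL a:carrier kstar. ALL x:carrier ?E. io a \<otimes>\<^bsub>?E\<^esub> x = x \<otimes>\<^bsub>?E\<^esub> io a"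
    by (auto simp: E io_def c1)
  qed
 qed
 moreover have "c : extension_class Q ?E io snd"
  unfolding extension_class_def
  using c C(1) u0 by (auto simp: E io_def c1 intro!: bexI[of _ "%x. (1,x)"])
 ultimately show ?thesis by blast
qed

section \<open>The group \<open>\<mu>\<^bsub>2m\<^esub> G\<^sub>1\<close> and the cocycles of its characters\<close>

locale mu_setting =
 fixes ze::"nat => 'k::{alg_closed_field,field_char_0}" and m::nat and G1::"'k mat set"
 assumes compat: "compatible_generators ze" and m: "m > 0"
  and G1: "subgroup G1 (GL 2)" "G1 <= SL 2" "finite G1" "~comm_group (lin_group G1)"
begin

definition zz::'k where "zz = ze (2 * m)"

abbreviation M where "M \<equiv> mu_G1 m G1"

definition el::"nat => 'k mat => 'k mat" where "el i g = zz ^ i \<cdot>\<^sub>m g"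

definition neg::"'k mat => 'k mat" where "neg g = (-1) \<cdot>\<^sub>m g"

sublocale L: group "lin_group G1" by (rule group_lin_group[OF G1(1)])

lemma m2: "2 * m > 0" using m by simp

lemma zz: "zz ^ (2 * m) = 1" "zz ~= 0" "zz ^ i = 1 \<longleftrightarrow> 2 * m dvd i" "x ^ (2 * m) = 1 ==> EX i<2*m. x = zz ^ i"
 using compatible_generatorsD[OF compat m2] unfolding zz_def by blast+

lemma zz_m: "zz ^ m = -1"
proof -
 have "zz ^ m ~= 1" using zz(3)[of m] m by (auto dest: dvd_imp_le)
 moreover have "(zz ^ m)\<^sup>2 = 1" using zz(1) by (simp add: power_mult[symmetric] mult.commute)
 ultimately show ?thesis by (simp add: power2_eq_1_iff)
qed

lemma zz_powi_one: "zz powi n = 1 \<longleftrightarrow> int (2 * m) dvd n"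
proof -
 obtain k where "n = int k \<or> n = - int k" by (metis int_cases2)
 moreover have "zz powi int k = 1 \<longleftrightarrow> int (2 * m) dvd int k" using zz(3)[of k] by (simp only: power_int_of_nat int_dvd_int_iff)
 ultimately show ?thesis by (auto simp: power_int_minus)
qed

lemma zz_powi_m: "zz powi (int m * k) = (-1) powi k"
 using zz_m by (simp add: power_int_mult)

lemma sgn_cases: "(-1) powi k = (1::'k) \<or> (-1) powi k = (-1::'k)" for k::int
 by (simp add: power_int_minus_left)

lemma G1_carrier: "g : G1 ==> g : carrier_mat 2 2" and G1_det: "g : G1 ==> det g = 1"
 and G1_one [simp]: "I2 : G1" and G1_mult: "g : G1 ==> h : G1 ==> g * h : G1"
 using SL2_D G1(2) subgroup.one_closed[OF G1(1)] subgroup.m_closed[OF G1(1)] by auto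

lemma minus_one: "scalar (-1) : G1" by (rule minus_one_in_nonabelian[OF G1])

lemma neg_scalar: "neg (I2) = scalar (-1)" by (simp add: neg_def scalar_def)

lemma neg_closed: "g : G1 ==> neg g : G1"
 using G1_mult[OF minus_one,of g] G1_carrier[of g] by (simp add: scalar_mult neg_def)

lemma sgn_closed: "g : G1 ==> (-1) powi (k::int) \<cdot>\<^sub>m g : G1"
 using sgn_cases[of k] neg_closed[of g] by (auto simp: neg_def one_smult_mat)

text \<open>A scalar matrix of determinant one is \<open>\<plusminus>1\<close>, so the only ambiguity in \<open>\<zeta>\<^bsub>2m\<^esub>\<^sup>i g\<close> comes from
\<open>\<zeta>\<^bsub>2m\<^esub>\<^sup>m = -1\<close>.\<close>

lemma powi_smult_eq:
 assumes g: "g : G1" and h: "h : G1" and e: "zz powi i \<cdot>\<^sub>m g = zz powi j \<cdot>\<^sub>m h"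
 obtains k where "i = j + int m * k" "g = (-1) powi k \<cdot>\<^sub>m h"
proof -
 have "det (zz powi i \<cdot>\<^sub>m g) = det (zz powi j \<cdot>\<^sub>m h)" using e by simp
 hence "(zz powi i)\<^sup>2 = (zz powi j)\<^sup>2" using G1_carrier[OF g] G1_carrier[OF h] G1_det[OF g] G1_det[OF h] by simp
 moreover have dbl: "zz powi (2 * n) = (zz powi n)\<^sup>2" for n
 proof -
  have "zz powi (n + n) = zz powi n * zz powi n" by (rule power_int_add) (simp add: zz(2))
  thus ?thesis by (simp only: mult_2 power2_eq_square)
 qed
 moreover have "zz powi (2 * i - 2 * j) = zz powi (2 * i) / zz powi (2 * j)"
  by (rule power_int_diff) (simp add: zz(2))
 ultimately have "zz powi (2 * i - 2 * j) = 1" using zz(2) by simp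
 hence "int (2 * m) dvd 2 * i - 2 * j" by (simp only: zz_powi_one)
 then obtain k where "2 * i - 2 * j = int (2 * m) * k" by blast
 hence "2 * i = 2 * (j + int m * k)" by (simp add: algebra_simps)
 hence k: "i = j + int m * k" by simp
 have "zz powi i = zz powi j * (-1) powi k" unfolding k using zz(2) by (simp add: power_int_add zz_powi_m)
 hence "zz powi j \<cdot>\<^sub>m ((-1) powi k \<cdot>\<^sub>m g) = zz powi j \<cdot>\<^sub>m h" using e by (simp add: smult_smult_mat)
 hence "inverse (zz powi j) \<cdot>\<^sub>m (zz powi j \<cdot>\<^sub>m ((-1) powi k \<cdot>\<^sub>m g)) = inverse (zz powi j) \<cdot>\<^sub>m (zz powi j \<cdot>\<^sub>m h)" by simp
 moreover have "inverse (zz powi j) * (zz powi j * s) = s" for s using zz(2) by (simp add: mult.assoc[symmetric])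
 ultimately have "(-1) powi k \<cdot>\<^sub>m g = h" using zz(2) by (simp add: smult_smult_mat one_smult_mat)
 hence "(-1) powi k \<cdot>\<^sub>m h = ((-1) powi k * (-1) powi k) \<cdot>\<^sub>m g" by (auto simp: smult_smult_mat)
 also have "... = g" using sgn_cases[of k] by (auto simp: one_smult_mat)
 finally show thesis by (intro that[OF k]) simp
qed

lemma el_mult: "g : G1 ==> h : G1 ==> el i g * el j h = el (i + j) (g * h)"
 using G1_carrier[of g] G1_carrier[of h]
 by (simp add: el_def mult_smult_assoc_mat[of _ 2 2 _ 2] mult_smult_distrib[of _ 2 2 _ 2] smult_smult_mat power_add mult.commute)

lemma el_0: "el 0 g = g" by (simp add: el_def one_smult_mat)

lemma el_neg: "el (i + m) g = el i (neg g)"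
 by (simp add: el_def neg_def power_add zz_m smult_smult_mat)

lemma zz_power_root: "(zz ^ i) ^ (2 * m) = 1"
proof -
 have "(zz ^ i) ^ (2 * m) = (zz ^ (2 * m)) ^ i" by (simp only: power_mult[symmetric] mult.commute)
 thus ?thesis by (simp add: zz(1))
qed

lemma el_in_M: "g : G1 ==> el i g : M"
 unfolding mu_G1_def roots_group_def el_def using zz_power_root[of i] by auto

lemma M_iff: "x : M \<longleftrightarrow> (EX i<m. EX g:G1. x = el i g)"
proof
 assume "x : M"
 then obtain a g where g: "a ^ (2 * m) = 1" "g : G1" "x = a \<cdot>\<^sub>m g" by (auto simp: mu_G1_def roots_group_def)
 then obtain i where i: "i < 2 * m" "a = zz ^ i" using zz(4) by blast
 show "EX i<m. EX g:G1. x = el i g"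
 proof (cases "i < m")
  case True
  thus ?thesis using g i by (auto simp: el_def)
 next
  case False
  hence "x = el (i - m) (neg g)" using el_neg[of "i - m" g] g i by (simp add: el_def)
  moreover have "i - m < m" using i by simp
  ultimately show ?thesis using neg_closed g by blast
 qed
next
 assume "EX i<m. EX g:G1. x = el i g"
 thus "x : M" using el_in_M by blast
qed

lemma G1_sub_M: "G1 <= M" using el_in_M[of _ 0] by (auto simp: el_0)

lemma M_finite: "finite M"
proof (rule finite_subset)
 show "M <= (%(i,g). el i g) ` ({..<m} \<times> G1)" using M_iff by fastforce
qed (use G1(3) in auto)

lemma M_carrier: "x : M ==> x : carrier_mat 2 2"
 using M_iff G1_carrier by (auto simp: el_def)

lemma M_subgroup: "subgroup M (GL 2)"
proof -
 interpret GL: group "GL 2::'k mat monoid" by (rule group_GL)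
 have GLM: "x : carrier (GL 2)" if "x : M" for x
 proof -
  obtain i g where "g : G1" "x = el i g" using \<open>x : M\<close> M_iff by blast
  thus ?thesis using G1_carrier G1_det zz(2) by (simp add: carrier_GL el_def)
 qed
 show ?thesis
 proof (rule GL.subgroupI)
  fix x assume x: "x : M"
  then obtain i g where g: "i < m" "g : G1" "x = el i g" using M_iff by blast
  have ig: "inv\<^bsub>GL 2\<^esub> g : G1" using subgroup.m_inv_closed[OF G1(1) g(2)] .
  have gi: "inv\<^bsub>GL 2\<^esub> g * g = I2" using GL.l_inv subgroup.mem_carrier[OF G1(1) g(2)] by simp
  have "el (2 * m - i) (inv\<^bsub>GL 2\<^esub> g) * x = el (2 * m) (I2)"
   using el_mult[OF ig g(2),of "2 * m - i" i] gi g by simp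
  also have "... = I2" using zz(1) by (simp add: el_def one_smult_mat)
  finally have "inv\<^bsub>GL 2\<^esub> x = el (2 * m - i) (inv\<^bsub>GL 2\<^esub> g)"
   using GLM[OF x] GLM[OF el_in_M[OF ig]] by (intro GL.inv_equality) auto
  thus "inv\<^bsub>GL 2\<^esub> x : M" using el_in_M[OF ig] by simp
  fix y assume "y : M"
  then obtain j h where h: "h : G1" "y = el j h" using M_iff by blast
  show "x \<otimes>\<^bsub>GL 2\<^esub> y : M" using el_mult[OF g(2) h(1)] el_in_M[OF G1_mult[OF g(2) h(1)]] g h by simp
 qed (use GLM G1_sub_M G1_one in blast)+
qed

sublocale LM: group "lin_group M" by (rule group_lin_group[OF M_subgroup])

lemma el_eqD:
 assumes "g : G1" "h : G1" "el i g = el j h" "j <= i"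
 obtains k::nat where "i = j + m * k" "g = (-1) ^ k \<cdot>\<^sub>m h"
proof -
 have "zz powi int i \<cdot>\<^sub>m g = zz powi int j \<cdot>\<^sub>m h" using assms(3) by (simp add: el_def)
 then obtain k where k: "int i = int j + int m * k" "g = (-1) powi k \<cdot>\<^sub>m h"
  by (rule powi_smult_eq[OF assms(1,2)])
 have "k >= 0"
 proof (rule ccontr)
  assume "~k >= 0"
  hence "int m * k < 0" using m by (intro mult_pos_neg) auto
  thus False using k(1) assms(4) by simp
 qed
 then obtain l where l: "k = int l" by (metis nonneg_int_cases)
 hence "i = j + m * l" using k(1) by (metis of_nat_add of_nat_eq_iff of_nat_mult)
 thus thesis using that[of l] k(2) l by simp
qed

text \<open>The characters of \<open>G\<^sub>1/\<plusminus>1\<close> of order dividing \<open>m\<close>. These conditions make \<open>\<chi>(h)\<^sup>i\<close> a function of the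
elements \<open>\<zeta>\<^bsub>2m\<^esub>\<^sup>i g\<close> and \<open>\<zeta>\<^bsub>2m\<^esub>\<^sup>j h\<close> of \<open>G\<close>.\<close>

definition good::"('k mat => 'k) => bool" where
 "good ch \<longleftrightarrow> (ALL g:G1. ch g ~= 0) & (ALL g:G1. ALL h:G1. ch (g * h) = ch g * ch h) & ch (scalar (-1)) = 1 & (ALL g:G1. ch g ^ m = 1)"

lemma goodD:
 assumes "good ch"
 shows "g : G1 ==> ch g ~= 0" "g : G1 ==> h : G1 ==> ch (g * h) = ch g * ch h" "ch (scalar (-1)) = 1"
  "g : G1 ==> ch g ^ m = 1" "ch (I2) = 1" "g : G1 ==> ch (neg g) = ch g"
  "g : G1 ==> ch ((-1) ^ k \<cdot>\<^sub>m g) = ch g" "g : G1 ==> ch ((-1) powi n \<cdot>\<^sub>m g) = ch g"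
proof -
 show 1: "g : G1 ==> ch g ~= 0" "g : G1 ==> h : G1 ==> ch (g * h) = ch g * ch h" "ch (scalar (-1)) = 1"
  "g : G1 ==> ch g ^ m = 1" for g h
  using assms by (auto simp: good_def)
 show "ch (I2) = 1" using 1(2)[of "I2" "I2"] 1(1)[of "I2"] by simp
 have n: "ch (neg g) = ch g" if "g : G1" for g
  using 1(2)[OF minus_one that] 1(3) G1_carrier[OF that] by (simp add: scalar_mult neg_def)
 thus "g : G1 ==> ch (neg g) = ch g" .
 have s: "ch (s \<cdot>\<^sub>m g) = ch g" if "s = 1 \<or> s = -1" "g : G1" for s
  using n[OF that(2)] that(1) by (auto simp: neg_def one_smult_mat)
 have "(-1) ^ k = (1::'k) \<or> (-1) ^ k = (-1::'k)" by (cases "even k") auto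
 thus "g : G1 ==> ch ((-1) ^ k \<cdot>\<^sub>m g) = ch g" using s by blast
 show "g : G1 ==> ch ((-1) powi n \<cdot>\<^sub>m g) = ch g" using s sgn_cases by blast
qed

text \<open>Independent choices of \<open>i\<close> and \<open>g\<close> in \<open>x = \<zeta>\<^bsub>2m\<^esub>\<^sup>i g\<close>. The cocycle \<open>\<chi>(h)\<^sup>i\<close> built from them does not depend on
the choices and is bimultiplicative.\<close>

definition deg::"'k mat => nat" where "deg x = (SOME i. EX g:G1. x = el i g)"
definition part::"'k mat => 'k mat" where "part x = (SOME g. g : G1 & (EX i. x = el i g))"

definition cc::"('k mat => 'k) => 'k mat \<times> 'k mat => 'k" where
 "cc ch = (\<lambda>(x,y)\<in>M \<times> M. ch (part y) ^ deg x)"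

lemma cc_el:
 assumes ch: "good ch" and g: "g : G1" and h: "h : G1"
 shows "cc ch (el i g,el j h) = ch h ^ i"
proof -
 have "EX g':G1. el i g = el (deg (el i g)) g'"
  unfolding deg_def by (rule someI[of "%i'. EX g':G1. el i g = el i' g'" i]) (use g in blast)
 then obtain g' where g': "g' : G1" "el i g = el (deg (el i g)) g'" by blast
 have "part (el j h) : G1 & (EX i. el j h = el i (part (el j h)))"
  unfolding part_def by (rule someI[of "%h'. h' : G1 & (EX i. el j h = el i h')" h]) (use h in blast)
 then obtain j' where h': "part (el j h) : G1" "el j h = el j' (part (el j h))" by blast
 have 1: "ch a = ch b" if "a : G1" "b : G1" "el i a = el j b" for a b i j
 proof -
  have *: "ch a = ch b" if "a : G1" "b : G1" "el i a = el j b" "j <= i" for a b i j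
   by (rule el_eqD[OF that]) (use goodD(7)[OF ch that(2)] in simp)
  thus ?thesis using that by (metis nle_le)
 qed
 have 2: "c ^ i = c ^ j" if "a : G1" "b : G1" "el i a = el j b" "c ^ m = 1" for a b i j and c::'k
 proof -
  have *: "c ^ i = c ^ j" if "a : G1" "b : G1" "el i a = el j b" "j <= i" for a b i j
   by (rule el_eqD[OF that]) (use \<open>c ^ m = 1\<close> in "simp add: power_add power_mult")
  thus ?thesis using that by (metis nle_le)
 qed
 have "ch (part (el j h)) = ch h" using 1[OF h'(1) h h'(2)[symmetric]] .
 moreover have "ch h ^ deg (el i g) = ch h ^ i" using 2[OF g'(1) g g'(2)[symmetric] goodD(4)[OF ch h]] .
 ultimately show ?thesis using el_in_M g h by (simp add: cc_def)
qed

lemma M_cases: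
 assumes "x : M" obtains i g where "i < m" "g : G1" "x = el i g"
 using assms M_iff by blast

lemma cc_cocycle:
 assumes ch: "good ch"
 shows "cc ch : carrier (cocycle_group (lin_group M))"
proof (rule cocycleI)
 fix x y assume "x : carrier (lin_group M)" "y : carrier (lin_group M)"
 then obtain i g j h where *: "g : G1" "x = el i g" "h : G1" "y = el j h" by (metis M_cases carrier_lin_group)
 show "cc ch (x,y) ~= 0" using goodD(1)[OF ch *(3)] * by (simp add: cc_el[OF ch])
 fix z assume "z : carrier (lin_group M)"
 then obtain l u where **: "u : G1" "z = el l u" by (metis M_cases carrier_lin_group)
 show "cc ch (x,y) * cc ch (x \<otimes>\<^bsub>lin_group M\<^esub> y,z) = cc ch (y,z) * cc ch (x,y \<otimes>\<^bsub>lin_group M\<^esub> z)"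
  using * ** goodD(2)[OF ch *(3) **(1)]
  by (simp add: el_mult cc_el[OF ch] G1_mult power_add power_mult_distrib)
qed (simp add: cc_def)

section \<open>Homomorphisms \<open>\<mu>\<^sub>m \<rightarrow> (G\<^sub>1/\<plusminus>1)\<^sup>\<or>\<close>\<close>

lemma minus_one_group_eq: "minus_one_group = {I2,scalar (-1::'k)}"
proof -
 interpret GL: group "GL 2::'k mat monoid" by (rule group_GL)
 have sq: "scalar (-1) * scalar (-1) = (I2::'k mat)"
  by (simp add: scalar_mult) (simp add: scalar_def smult_smult_mat one_smult_mat)
 have sc: "scalar (-1::'k) : carrier (GL 2)" by (rule scalar_in_GL) simp
 have inv: "inv\<^bsub>GL 2\<^esub> scalar (-1) = (scalar (-1)::'k mat)"
  by (rule GL.inv_equality) (use sq sc in auto)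
 show ?thesis
 proof
  show "minus_one_group <= {I2,scalar (-1::'k)}"
  proof
   fix x::"'k mat" assume "x : minus_one_group"
   hence "x : generate (GL 2) {scalar (-1)}" by (simp add: minus_one_group_def)
   thus "x : {I2,scalar (-1)}"
    by (induction rule: generate.induct)
     (use inv sq left_mult_one_mat[OF scalar_carrier,of "-1::'k"] right_mult_one_mat[OF scalar_carrier,of "-1::'k"] in auto)
  qed
  show "{I2,scalar (-1::'k)} <= minus_one_group"
   using generate.one[of "GL 2" "{scalar (-1::'k)}"] generate.incl[of "scalar (-1::'k)" "{scalar (-1)}" "GL 2"]
   by (auto simp: minus_one_group_def)
 qed
qed

abbreviation N where "N \<equiv> minus_one_group::'k mat set"
abbreviation A where "A \<equiv> roots_group m::'k monoid"
abbreviation B where "B \<equiv> dual_group (lin_group G1 Mod N)::('k mat set => 'k) monoid"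

lemma coset_eq: "g : G1 ==> N #>\<^bsub>lin_group G1\<^esub> g = {g,neg g}"
 using G1_carrier[of g] by (auto simp: r_coset_def minus_one_group_eq scalar_mult neg_def)

lemma N_normal: "N \<lhd> lin_group G1"
proof -
 have sq: "scalar (-1) * scalar (-1) = (I2::'k mat)"
  by (simp add: scalar_mult) (simp add: scalar_def smult_smult_mat one_smult_mat)
 have "subgroup N (lin_group G1)"
 proof (rule L.subgroupI)
  show "N <= carrier (lin_group G1)" "N ~= {}" using minus_one by (auto simp: minus_one_group_eq)
  fix x assume x: "x : N"
  have "inv\<^bsub>lin_group G1\<^esub> x = x"
   by (rule L.inv_equality) (use x sq minus_one in "auto simp: minus_one_group_eq")
  thus "inv\<^bsub>lin_group G1\<^esub> x : N" using x by simp
  fix y assume y: "y : N"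
  show "x \<otimes>\<^bsub>lin_group G1\<^esub> y : N"
   using x y sq left_mult_one_mat[OF scalar_carrier,of "-1::'k"] right_mult_one_mat[OF scalar_carrier,of "-1::'k"]
   by (auto simp: minus_one_group_eq)
 qed
 thus ?thesis
 proof (rule L.normalI,intro ballI)
  fix g assume "g : carrier (lin_group G1)"
  hence g: "g : G1" by simp
  thus "N #>\<^bsub>lin_group G1\<^esub> g = g <#\<^bsub>lin_group G1\<^esub> N"
   unfolding coset_eq[OF g] using G1_carrier[OF g] by (auto simp: l_coset_def minus_one_group_eq scalar_mult neg_def)
 qed
qed

lemma carrier_Mod: "carrier (lin_group G1 Mod N) = {{g,neg g} | g. g : G1}"
 by (auto simp: FactGroup_def RCOSETS_def coset_eq)

lemma mult_Mod: "g : G1 ==> h : G1 ==> {g,neg g} \<otimes>\<^bsub>lin_group G1 Mod N\<^esub> {h,neg h} = {g * h,neg (g * h)}"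
 using normal.rcos_sum[OF N_normal,of g h] G1_mult[of g h] by (simp add: FactGroup_def coset_eq)

lemma carrier_B: "X : carrier B \<longleftrightarrow> X : extensional (carrier (lin_group G1 Mod N)) & (ALL g:G1. X {g,neg g} ~= 0) &
  (ALL g:G1. ALL h:G1. X {g * h,neg (g * h)} = X {g,neg g} * X {h,neg h})"
proof -
 have q: "(ALL Y:carrier (lin_group G1 Mod N). P Y) \<longleftrightarrow> (ALL g:G1. P {g,neg g})" for P
  unfolding carrier_Mod by blast
 have "X : carrier B \<longleftrightarrow> X : extensional (carrier (lin_group G1 Mod N)) & (ALL Y:carrier (lin_group G1 Mod N). X Y ~= 0) &
  (ALL Y:carrier (lin_group G1 Mod N). ALL Z:carrier (lin_group G1 Mod N). X (Y \<otimes>\<^bsub>lin_group G1 Mod N\<^esub> Z) = X Y * X Z)"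
  unfolding Hom_group_def hom_def carrier_kstar Pi_def by auto
 thus ?thesis unfolding q by (simp only: mult_Mod cong: ball_cong)
qed

lemma roots_A: "a : carrier A \<longleftrightarrow> a ^ m = 1" "a \<otimes>\<^bsub>A\<^esub> b = a * b"
 by (simp_all add: roots_group_def)

definition chi::"('k => 'k mat set => 'k) => 'k mat => 'k" where
 "chi = character_of ze m G1"

lemma chi_apply: "g : G1 ==> chi et g = et (ze m) {g,neg g}"
 by (simp add: chi_def character_of_def coset_eq)

lemma zeta_m: "ze m ^ m = 1" "ze m ^ i = ze m ^ j \<longleftrightarrow> i mod m = j mod m" "a ^ m = 1 ==> EX i. a = ze m ^ i" "ze m : carrier A"
 using compatible_generatorsD[OF compat m] root_power_eq_iff[OF compat m] by (auto simp: roots_A)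

lemma eta_power:
 assumes et: "et : carrier (Hom_group A B)" and g: "g : G1"
 shows "et (ze m ^ i) {g,neg g} = chi et g ^ i"
proof -
 have h: "et : hom A B" using et by (simp add: Hom_group_def)
 have X: "{g,neg g} : carrier (lin_group G1 Mod N)" using g by (auto simp: carrier_Mod)
 have zA: "ze m ^ i : carrier A" for i
 proof -
  have "(ze m ^ i) ^ m = (ze m ^ m) ^ i" by (simp only: power_mult[symmetric] mult.commute)
  thus ?thesis by (simp add: roots_A zeta_m(1))
 qed
 have mu: "et (a * b) {g,neg g} = et a {g,neg g} * et b {g,neg g}" if "a : carrier A" "b : carrier A" for a b
  using hom_mult[OF h that] X by (simp add: roots_A Hom_group_def)
 have one: "et 1 {g,neg g} = 1"
 proof -
  have "et 1 : carrier B" using hom_in_carrier[OF h,of 1] by (simp add: roots_A)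
  hence "et 1 {g,neg g} ~= 0" using g by (simp add: carrier_B)
  thus ?thesis using mu[of 1 1] by (simp add: roots_A)
 qed
 show ?thesis
 proof (induction i)
  case (Suc i)
  thus ?case using mu[OF zeta_m(4) zA[of i]] chi_apply[OF g] by simp
 qed (simp add: one)
qed

lemma chi_good:
 assumes et: "et : carrier (Hom_group A B)"
 shows "good (chi et)" "chi et : extensional G1"
proof -
 have h: "et : hom A B" using et by (simp add: Hom_group_def)
 have X: "et (ze m) : carrier B" using hom_in_carrier[OF h zeta_m(4)] .
 have "chi et (scalar (-1)) = chi et (I2)"
 proof -
  have nn: "neg (scalar (-1)) = I2" by (simp add: neg_def scalar_def smult_smult_mat one_smult_mat)
  show ?thesis by (simp add: chi_apply[OF minus_one] chi_apply[OF G1_one] nn neg_scalar insert_commute)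
 qed
 moreover have mu: "ALL g:G1. ALL h:G1. chi et (g * h) = chi et g * chi et h"
  using X by (simp add: carrier_B chi_apply G1_mult)
 moreover have nz: "ALL g:G1. chi et g ~= 0" using X by (simp add: carrier_B chi_apply)
 moreover have "chi et (I2) = 1"
 proof -
  have "chi et (I2 * I2) = chi et (I2) * chi et (I2)" using mu G1_one by blast
  thus ?thesis using bspec[OF nz G1_one] by simp
 qed
 moreover have "ALL g:G1. chi et g ^ m = 1"
 proof
  fix g assume g: "g : G1"
  have "chi et g ^ m = et (ze m ^ m) {g,neg g}" using eta_power[OF et g] by simp
  also have "... = et (ze m ^ 0) {g,neg g}" by (simp add: zeta_m(1))
  also have "... = chi et g ^ 0" by (rule eta_power[OF et g])
  finally show "chi et g ^ m = 1" by simp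
 qed
 ultimately show "good (chi et)" by (simp add: good_def)
 show "chi et : extensional G1" by (simp add: chi_def character_of_def)
qed

lemma chi_inj:
 assumes e: "et : carrier (Hom_group A B)" "et' : carrier (Hom_group A B)" and c: "!!g. g : G1 ==> chi et g = chi et' g"
 shows "et = et'"
proof (rule extensionalityI)
 show x: "et : extensional (carrier A)" "et' : extensional (carrier A)" using e by (auto simp: Hom_group_def)
 fix a assume a: "a : carrier A"
 then obtain i where i: "a = ze m ^ i" using zeta_m(3) by (auto simp: roots_A)
 have B: "et a : carrier B" "et' a : carrier B" using e a hom_in_carrier[of _ A B a] by (auto simp: Hom_group_def)
 show "et a = et' a"
 proof (rule extensionalityI)
  show "et a : extensional (carrier (lin_group G1 Mod N))" "et' a : extensional (carrier (lin_group G1 Mod N))"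
   using B carrier_B by blast+
  fix X assume "X : carrier (lin_group G1 Mod N)"
  then obtain g where g: "g : G1" "X = {g,neg g}" by (auto simp: carrier_Mod)
  show "et a X = et' a X" unfolding i g(2) using eta_power[OF e(1) g(1)] eta_power[OF e(2) g(1)] c[OF g(1)] by simp
 qed
qed

lemma chi_surj:
 assumes ch: "good ch"
 obtains et where "et : carrier (Hom_group A B)" "!!g. g : G1 ==> chi et g = ch g"
proof -
 define ex where "ex a = (SOME i. a = ze m ^ i)" for a
 have ex: "a = ze m ^ ex a" if "a ^ m = 1" for a
  unfolding ex_def by (rule someI_ex[OF zeta_m(3)[OF that]])
 define et where "et = (\<lambda>a\<in>carrier A. \<lambda>X\<in>carrier (lin_group G1 Mod N). ch (SOME g. g : X) ^ ex a)"
 have some: "ch (SOME h. h : {g,neg g}) = ch g" if "g : G1" for g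
  by (rule someI2[of _ g]) (use goodD(6)[OF ch that] in auto)
 have X: "{g,neg g} : carrier (lin_group G1 Mod N)" if "g : G1" for g using that by (auto simp: carrier_Mod)
 have ap: "et a {g,neg g} = ch g ^ ex a" if "a : carrier A" "g : G1" for a g
  using that X[OF that(2)] some[OF that(2)] by (simp add: et_def)
 have pw: "ch g ^ i = ch g ^ j" if "i mod m = j mod m" "g : G1" for i j g
 proof -
  have "ch g ^ i = ch g ^ (i mod m)" for i
  proof -
   have "ch g ^ i = ch g ^ (m * (i div m) + i mod m)" by simp
   thus ?thesis unfolding power_add power_mult goodD(4)[OF ch that(2)] by simp
  qed
  thus ?thesis using that(1) by metis
 qed
 have "et : hom A B"
 proof (rule homI)
  fix a assume a: "a : carrier A"
  show "et a : carrier B" unfolding carrier_B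
  proof (intro conjI ballI)
   show "et a : extensional (carrier (lin_group G1 Mod N))" using a by (simp add: et_def)
  qed (simp_all add: ap[OF a] G1_mult goodD(1,2)[OF ch] power_mult_distrib)
  fix b assume b: "b : carrier A"
  have ab: "a * b : carrier A" using a b by (simp add: roots_A power_mult_distrib)
  show "et (a \<otimes>\<^bsub>A\<^esub> b) = et a \<otimes>\<^bsub>B\<^esub> et b"
  proof (rule extensionalityI[of _ "carrier (lin_group G1 Mod N)"])
   show "et (a \<otimes>\<^bsub>A\<^esub> b) : extensional (carrier (lin_group G1 Mod N))" using ab by (simp add: et_def roots_A)
   show "et a \<otimes>\<^bsub>B\<^esub> et b : extensional (carrier (lin_group G1 Mod N))" by (simp add: Hom_group_def)
   fix X assume "X : carrier (lin_group G1 Mod N)"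
   then obtain g where g: "g : G1" "X = {g,neg g}" by (auto simp: carrier_Mod)
   have "ze m ^ (ex a + ex b) = ze m ^ ex (a * b)" using ex a b ab by (simp add: roots_A power_add)
   hence "ch g ^ ex (a * b) = ch g ^ (ex a + ex b)" using pw[OF _ g(1)] zeta_m(2) by metis
   thus "et (a \<otimes>\<^bsub>A\<^esub> b) X = (et a \<otimes>\<^bsub>B\<^esub> et b) X"
    using X[OF g(1)] ap[OF ab g(1)] ap[OF a g(1)] ap[OF b g(1)] by (simp add: Hom_group_def g(2) roots_A power_add)
  qed
 qed
 hence 1: "et : carrier (Hom_group A B)" by (simp add: Hom_group_def et_def)
 have "chi et g = ch g" if g: "g : G1" for g
 proof -
  have "ze m ^ ex (ze m) = ze m ^ 1" using ex[OF zeta_m(1)] by simp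
  hence "ch g ^ ex (ze m) = ch g ^ 1" using pw[OF _ g] zeta_m(2) by metis
  thus ?thesis using chi_apply[OF g] ap[OF zeta_m(4) g] by simp
 qed
 thus thesis using that 1 by blast
qed

lemma chi_mult:
 assumes "g : G1"
 shows "chi (et \<otimes>\<^bsub>Hom_group A B\<^esub> et') g = chi et g * chi et' g"
proof -
 have "{g,neg g} : carrier (lin_group G1 Mod N)" using assms by (auto simp: carrier_Mod)
 thus ?thesis using zeta_m(4) by (simp add: chi_apply[OF assms] Hom_group_def)
qed

end

context mu_setting
begin

section \<open>The extension attached to a character\<close>

context
 fixes ch::"'k mat => 'k"
 assumes ch: "good ch"
begin

abbreviation SD where "SD \<equiv> semidirect ch G1"

lemma carrier_SD: "(a,g,i) : carrier SD \<longleftrightarrow> a ~= 0 & g : G1"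
 and mult_SD: "(a,g,i) \<otimes>\<^bsub>SD\<^esub> (b,h,j) = (a * b * ch h powi i,g * h,i + j)"
 and one_SD: "\<one>\<^bsub>SD\<^esub> = (1,I2,0)"
 by (auto simp: semidirect_def carrier_kstar)

lemma chi_powi_m: "g : G1 ==> ch g powi (int m * k) = 1"
 using goodD(4)[OF ch,of g] by (simp add: power_int_mult)

lemma group_SD: "group SD"
proof (rule groupI)
 fix x y z assume xyz: "x : carrier SD" "y : carrier SD" "z : carrier SD"
 obtain a g i b h j c u l where e: "x = (a,g,i)" "y = (b,h,j)" "z = (c,u,l)" by (metis surj_pair)
 have G: "g : G1" "h : G1" "u : G1" and nz: "a ~= 0" "b ~= 0" "c ~= 0" using xyz by (auto simp: e carrier_SD)
 show "x \<otimes>\<^bsub>SD\<^esub> y : carrier SD" using G nz G1_mult goodD(1)[OF ch] by (simp add: e carrier_SD mult_SD)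
 have "ch u powi (i + j) = ch u powi i * ch u powi j" using goodD(1)[OF ch G(3)] by (simp add: power_int_add)
 moreover have "ch (h * u) powi i = ch h powi i * ch u powi i" using goodD(2)[OF ch G(2,3)] by (simp add: power_int_mult_distrib)
 moreover have "g * h * u = g * (h * u)" using G1_carrier[OF G(1)] G1_carrier[OF G(2)] G1_carrier[OF G(3)]
  by (simp add: assoc_mult_mat[of _ 2 2 _ 2 _ 2])
 ultimately show "x \<otimes>\<^bsub>SD\<^esub> y \<otimes>\<^bsub>SD\<^esub> z = x \<otimes>\<^bsub>SD\<^esub> (y \<otimes>\<^bsub>SD\<^esub> z)" by (simp add: e mult_SD mult_ac add.assoc)
next
 fix x assume x: "x : carrier SD"
 obtain a g i where e: "x = (a,g,i)" by (metis surj_pair)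
 have g: "g : G1" "a ~= 0" using x by (auto simp: e carrier_SD)
 show "\<one>\<^bsub>SD\<^esub> \<otimes>\<^bsub>SD\<^esub> x = x" using G1_carrier[OF g(1)] by (simp add: e mult_SD one_SD)
 define h where "h = inv\<^bsub>lin_group G1\<^esub> g"
 have h: "h : G1" "h * g = I2" using L.inv_closed[of g] L.l_inv[of g] g by (simp_all add: h_def)
 have "inverse a * ch g powi i * a * inverse (ch g powi i) = 1"
  using g(2) goodD(1)[OF ch g(1)] by (simp add: field_simps)
 hence "(inverse a * ch g powi i,h,- i) \<otimes>\<^bsub>SD\<^esub> x = \<one>\<^bsub>SD\<^esub>"
  using h(2) by (simp add: e mult_SD one_SD power_int_minus)
 moreover have "(inverse a * ch g powi i,h,- i) : carrier SD" using h g goodD(1)[OF ch g(1)] by (simp add: carrier_SD)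
 ultimately show "EX y:carrier SD. y \<otimes>\<^bsub>SD\<^esub> x = \<one>\<^bsub>SD\<^esub>" by blast
qed (simp add: one_SD carrier_SD)

text \<open>The \<open>k\<close>-th power of the relator \<open>z\<^sup>m (-1)\<^sup>-\<^sup>1\<close>. It is central because \<open>\<chi>\<^sup>m = 1\<close> and \<open>\<chi>(-1) = 1\<close>, so
these powers already form the normal closure.\<close>

definition rr::"int => 'k \<times> 'k mat \<times> int" where
 "rr k = (1,(-1) powi k \<cdot>\<^sub>m I2,int m * k)"

lemma rr_carrier: "rr k : carrier SD"
 using sgn_closed[OF G1_one] by (simp add: rr_def carrier_SD)

lemma rr_left: "a ~= 0 ==> g : G1 ==> rr k \<otimes>\<^bsub>SD\<^esub> (a,g,i) = (a,(-1) powi k \<cdot>\<^sub>m g,i + int m * k)"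
 using G1_carrier[of g] chi_powi_m[of g k] by (simp add: rr_def mult_SD mult_smult_assoc_mat[of _ 2 2 _ 2] add.commute)

lemma rr_right: "a ~= 0 ==> g : G1 ==> (a,g,i) \<otimes>\<^bsub>SD\<^esub> rr k = (a,(-1) powi k \<cdot>\<^sub>m g,i + int m * k)"
 using G1_carrier[of g] goodD(8)[OF ch G1_one,of k] goodD(5)[OF ch]
 by (simp add: rr_def mult_SD mult_smult_distrib[of _ 2 2 _ 2])

lemma rr_add: "rr k \<otimes>\<^bsub>SD\<^esub> rr l = rr (k + l)"
proof -
 have "rr k \<otimes>\<^bsub>SD\<^esub> rr l = (1,(-1) powi k \<cdot>\<^sub>m ((-1) powi l \<cdot>\<^sub>m I2),int m * l + int m * k)"
  unfolding rr_def[of l] using sgn_closed[OF G1_one,of l] by (intro rr_left) auto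
 thus ?thesis by (simp add: rr_def smult_smult_mat power_int_add algebra_simps)
qed

lemma rr_0: "rr 0 = \<one>\<^bsub>SD\<^esub>" by (simp add: rr_def one_SD one_smult_mat)

lemma rr_inv: "inv\<^bsub>SD\<^esub> rr k = rr (- k)"
 by (rule group.inv_equality[OF group_SD]) (simp_all add: rr_add rr_0 rr_carrier)

lemma R_normal: "range rr \<lhd> SD"
proof -
 interpret SD: group SD by (rule group_SD)
 have "subgroup (range rr) SD"
  by (rule SD.subgroupI) (use rr_carrier rr_inv rr_add in auto)
 thus ?thesis
 proof (rule SD.normalI,intro ballI)
  fix x assume x: "x : carrier SD"
  obtain a g i where e: "x = (a,g,i)" by (metis surj_pair)
  have "rr k \<otimes>\<^bsub>SD\<^esub> x = x \<otimes>\<^bsub>SD\<^esub> rr k" for k using x rr_left[of a g k i] rr_right[of a g i k] by (simp add: e carrier_SD)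
  thus "range rr #>\<^bsub>SD\<^esub> x = x <#\<^bsub>SD\<^esub> range rr" by (auto simp: r_coset_def l_coset_def)
 qed
qed

lemma relators_eq: "relators m ch G1 = range rr"
proof -
 interpret SD: group SD by (rule group_SD)
 have "(1,scalar (-1),0) \<otimes>\<^bsub>SD\<^esub> (1,scalar (-1),0) = \<one>\<^bsub>SD\<^esub>"
  by (simp add: mult_SD one_SD scalar_mult) (simp add: scalar_def smult_smult_mat one_smult_mat)
 hence i: "inv\<^bsub>SD\<^esub> (1,scalar (-1),0) = (1,scalar (-1),0)"
  using minus_one by (intro SD.inv_equality) (auto simp: carrier_SD)
 have r1: "(1,I2,int m) \<otimes>\<^bsub>SD\<^esub> inv\<^bsub>SD\<^esub> (1,scalar (-1),0) = rr 1"
  unfolding i using goodD(3)[OF ch] left_mult_one_mat[OF scalar_carrier,of "-1::'k"]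
  by (simp add: mult_SD rr_def) (simp add: scalar_def)
 have "rr k : H" if H: "H \<lhd> SD" "rr 1 : H" for H k
 proof -
  interpret H: normal H SD by fact
  have n: "rr (int n) : H" for n
  proof (induction n)
   case (Suc n)
   have "rr (int (Suc n)) = rr (int n) \<otimes>\<^bsub>SD\<^esub> rr 1" unfolding rr_add by (simp add: add.commute)
   thus ?case using Suc H(2) H.m_closed by simp
  qed (use rr_0 H.one_closed in simp)
  show ?thesis
  proof (cases k)
   case (nonneg n)
   thus ?thesis using n by simp
  next
   case (neg n)
   thus ?thesis using H.m_inv_closed[OF n[of "Suc n"]] rr_inv by simp
  qed
 qed
 note * = this
 show ?thesis unfolding relators_def normal_closure_def r1
 proof (rule subset_antisym)
  show "\<Inter> {N. N \<lhd> SD & {rr 1} <= N} <= range rr" by (rule Inter_lower) (use R_normal in simp)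
  show "range rr <= \<Inter> {N. N \<lhd> SD & {rr 1} <= N}" by (rule Inter_greatest) (use * in "simp add: image_subset_iff")
 qed
qed

definition qq::"'k => 'k mat => int => ('k \<times> 'k mat \<times> int) set" where
 "qq a g i = range rr #>\<^bsub>SD\<^esub> (a,g,i)"

lemma qq_eq_set: "a ~= 0 ==> g : G1 ==> qq a g i = {(a,(-1) powi k \<cdot>\<^sub>m g,i + int m * k) | k. True}"
 unfolding qq_def r_coset_def by (auto simp: rr_left)

lemma sgn_smult: "(-1::'k) powi k \<cdot>\<^sub>m ((-1) powi l \<cdot>\<^sub>m g) = (-1) powi (k + l) \<cdot>\<^sub>m g"
 by (simp add: smult_smult_mat power_int_add)

lemma qq_eq_iff:
 assumes "a ~= 0" "g : G1" "b ~= 0" "h : G1"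
 shows "qq a g i = qq b h j \<longleftrightarrow> a = b & zz powi i \<cdot>\<^sub>m g = zz powi j \<cdot>\<^sub>m h"
proof
 assume e: "qq a g i = qq b h j"
 have "(a,g,i) : qq a g i" unfolding qq_eq_set[OF assms(1,2)] by (auto intro!: exI[of _ 0] simp: one_smult_mat)
 hence "(a,g,i) : qq b h j" by (simp add: e)
 then obtain k where k: "a = b" "g = (-1) powi k \<cdot>\<^sub>m h" "i = j + int m * k" unfolding qq_eq_set[OF assms(3,4)] by blast
 have "zz powi i = zz powi j * (-1) powi k" unfolding k(3) using zz(2) by (simp add: power_int_add zz_powi_m)
 moreover have "(-1::'k) powi k * (-1) powi k = 1" using sgn_cases[of k] by auto
 ultimately have "zz powi i \<cdot>\<^sub>m g = zz powi j \<cdot>\<^sub>m h" by (simp add: k(2) smult_smult_mat mult.assoc)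
 thus "a = b & zz powi i \<cdot>\<^sub>m g = zz powi j \<cdot>\<^sub>m h" using k by simp
next
 assume e: "a = b & zz powi i \<cdot>\<^sub>m g = zz powi j \<cdot>\<^sub>m h"
 then obtain k where k: "i = j + int m * k" "g = (-1) powi k \<cdot>\<^sub>m h" using powi_smult_eq[OF assms(2,4)] by blast
 have *: "(a,(-1) powi l \<cdot>\<^sub>m g,i + int m * l) = (a,(-1) powi (l + k) \<cdot>\<^sub>m h,j + int m * (l + k))" for l
  by (simp add: k sgn_smult algebra_simps)
 have "qq a g i = {(a,(-1) powi (l + k) \<cdot>\<^sub>m h,j + int m * (l + k)) | l. True}" unfolding qq_eq_set[OF assms(1,2)] * ..
 also have "... = qq a h j" unfolding qq_eq_set[OF assms(1,4)]
 proof (intro Collect_cong iffI)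
  fix x assume "EX l. x = (a,(-1) powi l \<cdot>\<^sub>m h,j + int m * l) & True"
  then obtain l where "x = (a,(-1) powi l \<cdot>\<^sub>m h,j + int m * l)" by blast
  thus "EX l. x = (a,(-1) powi (l + k) \<cdot>\<^sub>m h,j + int m * (l + k)) & True" by (intro exI[of _ "l - k"]) simp
 qed blast
 finally show "qq a g i = qq b h j" using e by simp
qed

abbreviation EG where "EG \<equiv> ext_group m ch G1"

lemma carrier_EG: "X : carrier EG \<longleftrightarrow> (EX a g i. a ~= 0 & g : G1 & X = qq a g i)"
proof -
 have "X : carrier EG \<longleftrightarrow> (EX x:carrier SD. X = range rr #>\<^bsub>SD\<^esub> x)"
  by (auto simp: ext_group_def relators_eq FactGroup_def RCOSETS_def)
 also have "... \<longleftrightarrow> (EX a g i. a ~= 0 & g : G1 & X = qq a g i)"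
  unfolding qq_def by (metis carrier_SD surj_pair)
 finally show ?thesis .
qed

lemma mult_EG: "a ~= 0 ==> g : G1 ==> b ~= 0 ==> h : G1 ==>
  qq a g i \<otimes>\<^bsub>EG\<^esub> qq b h j = qq (a * b * ch h powi i) (g * h) (i + j)"
 using normal.rcos_sum[OF R_normal,of "(a,g,i)" "(b,h,j)"]
 by (simp add: ext_group_def relators_eq FactGroup_def qq_def carrier_SD mult_SD)

lemma proj_EG: "a ~= 0 ==> g : G1 ==> ext_proj ze m (qq a g i) = zz powi i \<cdot>\<^sub>m g"
proof -
 assume ag: "a ~= 0" "g : G1"
 have "zz powi (i + int m * k) \<cdot>\<^sub>m ((-1) powi k \<cdot>\<^sub>m g) = zz powi i \<cdot>\<^sub>m g" for k
 proof -
  have "(-1::'k) powi k * (-1) powi k = 1" using sgn_cases[of k] by auto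
  thus ?thesis using zz(2) by (simp add: power_int_add zz_powi_m smult_smult_mat mult.assoc)
 qed
 hence "(%(a,g,i). (ze (2 * m) powi i) \<cdot>\<^sub>m g) ` qq a g i = {zz powi i \<cdot>\<^sub>m g}"
  unfolding qq_eq_set[OF ag] zz_def[symmetric] by (force simp: image_iff)
 thus ?thesis by (simp add: ext_proj_def)
qed

lemma incl_EG: "ext_incl m ch G1 a = qq a (I2) 0"
 by (simp add: ext_incl_def relators_eq qq_def)

lemma powi_el: "g : G1 ==> zz powi i \<cdot>\<^sub>m g : M"
proof -
 assume g: "g : G1"
 have "(zz powi i) ^ (2 * m) = (zz ^ (2 * m)) powi i"
  by (simp only: power_int_of_nat[symmetric] power_int_mult[symmetric] mult.commute)
 thus ?thesis using g zz(1) unfolding mu_G1_def roots_group_def by auto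
qed

lemma EG_central_ext: "central_ext (lin_group M) EG (ext_incl m ch G1) (ext_proj ze m)"
proof (rule central_ext.intro[OF _ LM.is_group])
 show "central_extension (lin_group M) EG (ext_incl m ch G1) (ext_proj ze m)"
  unfolding central_extension_def
 proof (intro conjI)
  show "group EG" unfolding ext_group_def relators_eq by (rule normal.factorgroup_is_group[OF R_normal])
  have one: "\<one>\<^bsub>EG\<^esub> = qq 1 (I2) 0"
   using group.coset_mult_one[OF group_SD,of "range rr"] rr_carrier
   by (auto simp: ext_group_def relators_eq FactGroup_def qq_def one_SD[symmetric])
  show "ext_incl m ch G1 : mon kstar EG"
   unfolding mon_def
  proof (intro CollectI conjI homI inj_onI)
   fix a b::'k assume "a : carrier kstar" "b : carrier kstar"
   hence ab: "a ~= 0" "b ~= 0" by (auto simp: carrier_kstar)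
   show "ext_incl m ch G1 a : carrier EG" unfolding incl_EG carrier_EG using ab G1_one by blast
   show "ext_incl m ch G1 (a \<otimes>\<^bsub>kstar\<^esub> b) = ext_incl m ch G1 a \<otimes>\<^bsub>EG\<^esub> ext_incl m ch G1 b"
    using ab by (simp add: incl_EG mult_EG)
   assume "ext_incl m ch G1 a = ext_incl m ch G1 b"
   thus "a = b" using ab by (simp add: incl_EG qq_eq_iff)
  qed
  show "ext_proj ze m : epi EG (lin_group M)"
   unfolding epi_def
  proof (intro CollectI conjI homI)
   fix X Y assume "X : carrier EG" "Y : carrier EG"
   then obtain a g i b h j where e: "a ~= 0" "g : G1" "X = qq a g i" "b ~= 0" "h : G1" "Y = qq b h j" by (metis carrier_EG)
   show "ext_proj ze m X : carrier (lin_group M)" using e powi_el by (simp add: proj_EG)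
   have nz: "a * b * ch h powi i ~= 0" using e goodD(1)[OF ch e(5)] by simp
   show "ext_proj ze m (X \<otimes>\<^bsub>EG\<^esub> Y) = ext_proj ze m X \<otimes>\<^bsub>lin_group M\<^esub> ext_proj ze m Y"
    using e proj_EG[OF nz G1_mult[OF e(2,5)],of "i + j"] G1_carrier[OF e(2)] G1_carrier[OF e(5)] zz(2)
    by (simp add: mult_EG proj_EG power_int_add mult_smult_assoc_mat[of _ 2 2 _ 2] mult_smult_distrib[of _ 2 2 _ 2] smult_smult_mat mult.commute)
  next
   show "ext_proj ze m ` carrier EG = carrier (lin_group M)"
   proof
    show "ext_proj ze m ` carrier EG <= carrier (lin_group M)" using powi_el proj_EG by (auto simp: carrier_EG)
    show "carrier (lin_group M) <= ext_proj ze m ` carrier EG"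
    proof
     fix x assume "x : carrier (lin_group M)"
     then obtain i g where g: "g : G1" "x = el i g" by (metis M_cases carrier_lin_group)
     have "qq 1 g (int i) : carrier EG"
      unfolding carrier_EG by (rule exI[of _ 1],rule exI[of _ g],rule exI[of _ "int i"]) (simp add: g(1))
     moreover have "x = ext_proj ze m (qq 1 g (int i))" using g proj_EG[of 1 g "int i"] by (simp add: el_def)
     ultimately show "x : ext_proj ze m ` carrier EG" by (rule rev_image_eqI)
    qed
   qed
  qed
  show "ext_incl m ch G1 ` carrier kstar = kernel EG (lin_group M) (ext_proj ze m)"
  proof (rule Set.set_eqI,rule iffI)
   fix X assume "X : ext_incl m ch G1 ` carrier kstar"
   then obtain a where a: "a ~= 0" "X = qq a (I2) 0" by (auto simp: carrier_kstar incl_EG)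
   have "X : carrier EG" unfolding carrier_EG a(2) using a(1) G1_one by blast
   thus "X : kernel EG (lin_group M) (ext_proj ze m)" using a proj_EG[OF a(1) G1_one,of 0] by (simp add: kernel_def one_smult_mat)
  next
   fix X assume "X : kernel EG (lin_group M) (ext_proj ze m)"
   then obtain a g i where e: "a ~= 0" "g : G1" "X = qq a g i" "zz powi i \<cdot>\<^sub>m g = I2"
    by (auto simp: kernel_def carrier_EG proj_EG)
   have "X = qq a (I2) 0" using e qq_eq_iff[OF e(1,2,1) G1_one,of i 0] by (simp add: one_smult_mat)
   thus "X : ext_incl m ch G1 ` carrier kstar" using e by (auto simp: incl_EG carrier_kstar)
  qed
  show "ALL a:carrier kstar. ALL X:carrier EG. ext_incl m ch G1 a \<otimes>\<^bsub>EG\<^esub> X = X \<otimes>\<^bsub>EG\<^esub> ext_incl m ch G1 a"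
  proof (intro ballI)
   fix a::'k and X assume a: "a : carrier kstar" and "X : carrier EG"
   then obtain b h j where e: "b ~= 0" "h : G1" "X = qq b h j" by (metis carrier_EG)
   show "ext_incl m ch G1 a \<otimes>\<^bsub>EG\<^esub> X = X \<otimes>\<^bsub>EG\<^esub> ext_incl m ch G1 a"
    using a e G1_carrier[OF e(2)] goodD(5)[OF ch] by (simp add: incl_EG mult_EG carrier_kstar mult.commute)
  qed
 qed
qed

text \<open>The section \<open>\<zeta>\<^bsub>2m\<^esub>\<^sup>i g \<mapsto> z\<^sup>i g\<close> of the extension given by generators and relations has this cocycle.\<close>

lemma cc_in_EG_class: "cc ch : extension_class (lin_group M) EG (ext_incl m ch G1) (ext_proj ze m)"
proof -
 have "EX i g. g : G1 & x = el i g" if "x : M" for x using that M_iff by blast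
 then obtain di pg where r: "!!x. x : M ==> pg x : G1 & x = el (di x) (pg x)" by metis
 define s where "s x = qq 1 (pg x) (int (di x))" for x
 have s1: "s : carrier (lin_group M) \<rightarrow> carrier EG"
 proof (rule funcsetI)
  fix x assume "x : carrier (lin_group M)"
  hence x: "pg x : G1" using r[of x] by simp
  show "s x : carrier EG"
   unfolding carrier_EG s_def by (rule exI[of _ 1],rule exI[of _ "pg x"],rule exI[of _ "int (di x)"]) (simp add: x)
 qed
 have s2: "ext_proj ze m (s x) = x" if "x : M" for x
  using r[OF that] by (simp add: s_def proj_EG el_def)
 have s3: "s x \<otimes>\<^bsub>EG\<^esub> s y = ext_incl m ch G1 (cc ch (x,y)) \<otimes>\<^bsub>EG\<^esub> s (x * y)" if x: "x : M" and y: "y : M" for x y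
 proof -
  note rx = r[OF x] and ry = r[OF y]
  have xy: "x * y : M" using LM.m_closed[of x y] x y by simp
  note rxy = r[OF xy]
  have c: "cc ch (x,y) = ch (pg y) ^ di x" using cc_el[OF ch,of "pg x" "pg y" "di x" "di y"] rx ry by metis
  have nz: "ch (pg y) ^ di x ~= 0" using goodD(1)[OF ch] ry by simp
  have "s x \<otimes>\<^bsub>EG\<^esub> s y = qq (ch (pg y) ^ di x) (pg x * pg y) (int (di x) + int (di y))"
   using rx ry by (simp add: s_def mult_EG)
  also have "... = qq (ch (pg y) ^ di x) (pg (x * y)) (int (di (x * y)))"
  proof -
   have "zz powi (int (di x) + int (di y)) \<cdot>\<^sub>m (pg x * pg y) = el (di x + di y) (pg x * pg y)"
    by (simp add: el_def flip: of_nat_add)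
   also have "... = x * y" using el_mult[of "pg x" "pg y" "di x" "di y"] rx ry by metis
   also have "... = zz powi int (di (x * y)) \<cdot>\<^sub>m pg (x * y)" using rxy by (simp add: el_def)
   finally show ?thesis using qq_eq_iff[OF nz _ nz] rx ry rxy G1_mult by simp
  qed
  also have "... = ext_incl m ch G1 (cc ch (x,y)) \<otimes>\<^bsub>EG\<^esub> s (x * y)"
   unfolding c incl_EG s_def using mult_EG[OF nz G1_one _ conjunct1[OF rxy],of 1 0 "int (di (x * y))"]
    left_mult_one_mat[OF G1_carrier[OF conjunct1[OF rxy]]] by simp
  finally show ?thesis .
 qed
 show ?thesis unfolding extension_class_def
  by (intro CollectI conjI cc_cocycle[OF ch] bexI[of _ s] ballI s1) (use s2 s3 in simp_all)
qed

end

lemma class_of_hom_eq: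
 assumes et: "et : carrier (Hom_group A B)"
 shows "class_of_hom ze m G1 et = coboundaries (lin_group M) #>\<^bsub>cocycle_group (lin_group M)\<^esub> cc (chi et)"
 unfolding class_of_hom_def Let_def chi_def[symmetric]
 by (rule central_ext.extension_class_coset[OF EG_central_ext cc_in_EG_class]) (rule chi_good(1)[OF et])+

text \<open>Every extension of \<open>\<mu>\<^bsub>2m\<^esub> G\<^sub>1\<close> splits over \<open>G\<^sub>1\<close>; conjugation with a lift of \<open>\<zeta>\<^bsub>2m\<^esub>\<close> changes the splitting by a
  character.\<close>

lemma extension_class_contains_cc:
 fixes E::"('e,'y) monoid_scheme" (structure)
 assumes E: "central_ext (lin_group M) E io pj" and cE: "c : extension_class (lin_group M) E io pj"
 obtains ch where "good ch" "c : coboundaries (lin_group M) #>\<^bsub>cocycle_group (lin_group M)\<^esub> cc ch"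
proof -
 interpret E: central_ext "lin_group M" E io pj by (rule E)
 have sub: "subgroup G1 (lin_group M)"
  unfolding lin_group_def by (rule group.subgroup_incl[OF group_GL G1(1) M_subgroup G1_sub_M])
 have eqG: "(lin_group M)\<lparr>carrier := G1\<rparr> = lin_group G1" by (simp add: lin_group_def)
 interpret R: central_ext "lin_group G1" "E\<lparr>carrier := E.preimage G1\<rparr>" io pj
  using E.restrict_central_ext[OF sub] unfolding eqG .
 obtain de where "R.retraction 1 de"
  using SL2_extension_retraction[OF compat G1(1-3) R.central_ext_axioms] by blast
 hence de: "de : hom (E\<lparr>carrier := E.preimage G1\<rparr>) kstar" "!!a. a ~= 0 ==> de (io a) = a"
  by (auto simp: R.retraction_def)
 have dem: "de (x \<otimes> y) = de x * de y" if "x : E.preimage G1" "y : E.preimage G1" for x y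
  using hom_mult[OF de(1),of x y] that by simp
 have denz: "de x ~= 0" if "x : E.preimage G1" for x using hom_in_carrier[OF de(1),of x] that by (simp add: carrier_kstar)
 have pre: "x : E.preimage G1 \<longleftrightarrow> x : carrier E & pj x : G1" for x by (simp add: E.preimage_def)
 have iopre: "io a : E.preimage G1" if "a ~= 0" for a using that by (simp add: pre)
 have "EX y. y : carrier E & pj y = g & de y = 1" if g: "g : G1" for g
 proof -
  have "g : M" using G1_sub_M g by blast
  then obtain y where y: "y : carrier E" "pj y = g" using E.pi_surj[of g] by auto
  have yp: "y : E.preimage G1" using y g by (simp add: pre)
  have nz: "inverse (de y) ~= 0" using denz[OF yp] by simp
  have "de (io (inverse (de y)) \<otimes> y) = 1" using dem[OF iopre[OF nz] yp] de(2)[OF nz] denz[OF yp] by simp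
  moreover have "pj (io (inverse (de y)) \<otimes> y) = g" using E.pi_mult[OF E.iota_closed[OF nz] y(1)] E.pi_iota[OF nz] y(2) G1_carrier[OF g] by simp
  ultimately show ?thesis using y(1) nz by (intro exI[of _ "io (inverse (de y)) \<otimes> y"]) simp
 qed
 then obtain t where t: "!!g. g : G1 ==> t g : carrier E" "!!g. g : G1 ==> pj (t g) = g" "!!g. g : G1 ==> de (t g) = 1"
  by metis
 have tp: "t g : E.preimage G1" if "g : G1" for g using t that by (simp add: pre)
 have tm: "t g \<otimes> t h = t (g * h)" if g: "g : G1" and h: "h : G1" for g h
 proof -
  have gh: "g * h : G1" using G1_mult g h .
  obtain a where a: "a ~= 0" "t g \<otimes> t h = io a \<otimes> t (g * h)"
   by (rule E.fiber[of "t g \<otimes> t h" "t (g * h)"]) (use t(1)[OF g] t(1)[OF h] t(1)[OF gh] t(2)[OF g] t(2)[OF h] t(2)[OF gh] in auto)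
  have "de (t g \<otimes> t h) = 1" using dem[OF tp[OF g] tp[OF h]] t(3)[OF g] t(3)[OF h] by simp
  hence "a = 1" using a dem[OF iopre[OF a(1)] tp[OF gh]] de(2)[OF a(1)] t(3)[OF gh] by simp
  thus ?thesis using a(2) t(1)[OF gh] by (simp add: E.iota_one)
 qed
 have cancel: "a = b" if "a ~= 0" "b ~= 0" "x : carrier E" "io a \<otimes> x = io b \<otimes> x" for a b x
  using that E.E.right_cancel[OF that(3) E.iota_closed[OF that(1)] E.iota_closed[OF that(2)]] E.iota_inj[OF that(1,2)] by simp
 obtain z0 where z0: "z0 : carrier E" "pj z0 = el 1 (I2)" using E.pi_surj[of "el 1 (I2)"] el_in_M[OF G1_one] by auto
 have "EX a. a ~= 0 & z0 \<otimes> t g = io a \<otimes> (t g \<otimes> z0)" if g: "g : G1" for g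
 proof -
  have "pj (z0 \<otimes> t g) = pj (t g \<otimes> z0)"
   using z0 t(1)[OF g] t(2)[OF g] el_mult[OF G1_one g,of 1 0] el_mult[OF g G1_one,of 0 1] G1_carrier[OF g] by (simp add: el_0)
  thus ?thesis by (metis E.fiber E.E.m_closed t(1)[OF g] z0(1))
 qed
 then obtain ch where ch: "!!g. g : G1 ==> ch g ~= 0" "!!g. g : G1 ==> z0 \<otimes> t g = io (ch g) \<otimes> (t g \<otimes> z0)"
  by metis
 have pjpow: "pj (z0 [^] (i::nat)) = el i (I2)" for i
 proof (induction i)
  case 0
  thus ?case by (simp add: el_0)
 next
  case (Suc i)
  thus ?case using z0 el_mult[OF G1_one G1_one,of i 1] by simp
 qed
 obtain a where a: "a ~= 0" "z0 [^] m = io a \<otimes> t (scalar (-1))"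
  by (rule E.fiber[of "z0 [^] m" "t (scalar (-1))"])
   (use z0 t(1)[OF minus_one] t(2)[OF minus_one] pjpow[of m] el_neg[of 0 "I2"] in "auto simp: neg_scalar el_0")
 \<comment> \<open>With this factor the \<open>m\<close>-th power of the rescaled lift is the lift of \<open>-1\<close>.\<close>
 obtain b where b: "b ^ m = inverse a" using nth_root_exists[OF m] by metis
 have b0: "b ~= 0" using b a(1) m by (auto simp: power_0_left)
 define z where "z = io b \<otimes> z0"
 have z: "z : carrier E" using z0 b0 by (simp add: z_def)
 have zm: "z [^] m = t (scalar (-1))"
 proof -
  have "z [^] m = io b [^] m \<otimes> z0 [^] m" unfolding z_def
   by (rule E.E.pow_mult_distrib) (use E.iota_central b0 z0 in auto)
  also have "... = io (b ^ m * a) \<otimes> t (scalar (-1))"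
   using b0 a t(1)[OF minus_one] E.iota_mult_left[of "b ^ m" a "t (scalar (-1))"] by (simp add: E.iota_power[symmetric])
  finally show ?thesis using b a(1) t(1)[OF minus_one] by (simp add: E.iota_one)
 qed
 have zt: "z \<otimes> t g = io (ch g) \<otimes> (t g \<otimes> z)" if g: "g : G1" for g
 proof -
  note tg = t(1)[OF g]
  have "z \<otimes> t g = io b \<otimes> (io (ch g) \<otimes> (t g \<otimes> z0))"
   unfolding ch(2)[OF g,symmetric] z_def by (rule E.E.m_assoc) (use b0 z0 tg in auto)
  also have "... = io (ch g) \<otimes> (io b \<otimes> (t g \<otimes> z0))"
   by (rule E.mult_iota_left) (use b0 z0 tg ch(1)[OF g] in auto)
  also have "io b \<otimes> (t g \<otimes> z0) = t g \<otimes> z" unfolding z_def by (rule E.mult_iota_left[symmetric]) (use b0 z0 tg in auto)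
  finally show ?thesis .
 qed
 have zpt: "z [^] i \<otimes> t g = io (ch g ^ i) \<otimes> (t g \<otimes> z [^] i)" if g: "g : G1" for g and i::nat
 proof (induction i)
  case 0
  thus ?case using t(1)[OF g] by (simp add: E.iota_one)
 next
  case (Suc i)
  note tg = t(1)[OF g]
  have zi: "z [^] i : carrier E" using z by simp
  have nz: "ch g ~= 0" "ch g ^ i ~= 0" using ch(1)[OF g] by auto
  have "z [^] Suc i \<otimes> t g = z [^] i \<otimes> (z \<otimes> t g)" using zi z tg by (simp add: E.E.m_assoc)
  also have "... = io (ch g) \<otimes> (z [^] i \<otimes> (t g \<otimes> z))"
   unfolding zt[OF g] by (rule E.mult_iota_left) (use nz zi z tg in auto)
  also have "z [^] i \<otimes> (t g \<otimes> z) = (z [^] i \<otimes> t g) \<otimes> z" by (rule E.E.m_assoc[symmetric]) (use zi z tg in auto)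
  also have "... = io (ch g ^ i) \<otimes> (t g \<otimes> z [^] i \<otimes> z)" unfolding Suc by (rule E.E.m_assoc) (use nz zi z tg in auto)
  also have "t g \<otimes> z [^] i \<otimes> z = t g \<otimes> z [^] Suc i" using zi z tg by (simp add: E.E.m_assoc)
  also have "io (ch g) \<otimes> (io (ch g ^ i) \<otimes> (t g \<otimes> z [^] Suc i)) = io (ch g * ch g ^ i) \<otimes> (t g \<otimes> z [^] Suc i)"
   by (rule E.iota_mult_left) (use nz zi z tg in auto)
  finally show ?case by simp
 qed
 have tg1: "io 1 \<otimes> x = x" if "x : carrier E" for x using that by (simp add: E.iota_one)
 have good: "good ch"
  unfolding good_def
 proof (intro conjI ballI)
  fix g assume g: "g : G1"
  note tg = t(1)[OF g]
  show "ch g ~= 0" by (rule ch(1)[OF g])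
  have ng: "scalar (-1) * g = g * scalar (-1)" using G1_carrier[OF g] by (simp add: scalar_mult)
  have "io (ch g ^ m) \<otimes> (t g \<otimes> z [^] m) = z [^] m \<otimes> t g" by (rule zpt[OF g,symmetric])
  also have "... = t (scalar (-1) * g)" unfolding zm by (rule tm[OF minus_one g])
  also have "... = t g \<otimes> z [^] m" unfolding ng zm by (rule tm[OF g minus_one,symmetric])
  also have "... = io 1 \<otimes> (t g \<otimes> z [^] m)" by (rule tg1[symmetric]) (use tg z in auto)
  finally show "ch g ^ m = 1"
   by (rule cancel[rotated 3]) (use ch(1)[OF g] tg z in auto)
  fix h assume h: "h : G1"
  note th = t(1)[OF h] and gh = G1_mult[OF g h]
  have nz: "ch g ~= 0" "ch h ~= 0" using ch(1) g h by auto
  have "io (ch (g * h)) \<otimes> (t (g * h) \<otimes> z) = z \<otimes> (t g \<otimes> t h)" unfolding tm[OF g h] zt[OF gh] ..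
  also have "... = (z \<otimes> t g) \<otimes> t h" by (rule E.E.m_assoc[symmetric]) (use z tg th in auto)
  also have "... = io (ch g) \<otimes> (t g \<otimes> (z \<otimes> t h))" unfolding zt[OF g] using nz z tg th by (simp add: E.E.m_assoc)
  also have "t g \<otimes> (z \<otimes> t h) = io (ch h) \<otimes> (t g \<otimes> (t h \<otimes> z))" unfolding zt[OF h] by (rule E.mult_iota_left) (use nz z tg th in auto)
  also have "t g \<otimes> (t h \<otimes> z) = t (g * h) \<otimes> z" unfolding tm[OF g h,symmetric] by (rule E.E.m_assoc[symmetric]) (use z tg th in auto)
  also have "io (ch g) \<otimes> (io (ch h) \<otimes> (t (g * h) \<otimes> z)) = io (ch g * ch h) \<otimes> (t (g * h) \<otimes> z)"
   by (rule E.iota_mult_left) (use nz z t(1)[OF gh] in auto)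
  finally show "ch (g * h) = ch g * ch h" by (rule cancel[rotated 3]) (use nz ch(1)[OF gh] t(1)[OF gh] z in auto)
 next
  have "io (ch (scalar (-1))) \<otimes> (t (scalar (-1)) \<otimes> z) = z \<otimes> z [^] m" unfolding zm zt[OF minus_one] ..
  also have "... = io 1 \<otimes> (t (scalar (-1)) \<otimes> z)"
   unfolding zm[symmetric] using z tg1[of "z [^] m \<otimes> z"] E.E.nat_pow_Suc2[OF z,of m] by simp
  finally show "ch (scalar (-1)) = 1" by (rule cancel[rotated 3]) (use ch(1)[OF minus_one] t(1)[OF minus_one] z in auto)
 qed
 have "EX i g. g : G1 & x = el i g" if "x : M" for x using that M_iff by blast
 then obtain di pg where r: "!!x. x : M ==> pg x : G1 & x = el (di x) (pg x)" by metis
 define s where "s x = t (pg x) \<otimes> z [^] di x" for x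
 have sel: "t g \<otimes> z [^] i = t h \<otimes> z [^] j" if gh: "g : G1" "h : G1" and e: "el i g = el j h" for g h i j
 proof -
  have *: "t g \<otimes> z [^] i = t h \<otimes> z [^] j" if gh: "g : G1" "h : G1" and e: "el i g = el j h" "j <= i" for g h i j
  proof -
   obtain k where k: "i = j + m * k" "g = (-1) ^ k \<cdot>\<^sub>m h" using el_eqD[OF gh e] by blast
   have tk: "t g' \<otimes> z [^] (m * k) = t ((-1) ^ k \<cdot>\<^sub>m g')" if "g' : G1" for g' k
    using that
   proof (induction k arbitrary: g')
    case 0
    thus ?case using t(1)[OF 0] by (simp add: one_smult_mat)
   next
    case (Suc k)
    have "z [^] (m * Suc k) = z [^] m \<otimes> z [^] (m * k)" using z by (simp add: E.E.nat_pow_mult)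
    hence "t g' \<otimes> z [^] (m * Suc k) = (t g' \<otimes> t (scalar (-1))) \<otimes> z [^] (m * k)"
     using z t(1)[OF Suc.prems] t(1)[OF minus_one] by (simp add: zm E.E.m_assoc)
    also have "... = t (neg g') \<otimes> z [^] (m * k)"
     unfolding tm[OF Suc.prems minus_one] using G1_carrier[OF Suc.prems] by (simp add: scalar_mult neg_def)
    also have "... = t ((-1) ^ Suc k \<cdot>\<^sub>m g')" unfolding Suc.IH[OF neg_closed[OF Suc.prems]] by (simp add: neg_def smult_smult_mat mult.commute)
    finally show ?case .
   qed
   have "(-1) ^ k \<cdot>\<^sub>m g = h" unfolding k(2) by (simp add: smult_smult_mat one_smult_mat flip: power_mult_distrib)
   moreover have "z [^] i = z [^] (m * k) \<otimes> z [^] j" unfolding k(1) using z by (simp add: E.E.nat_pow_mult add.commute)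
   ultimately show ?thesis using tk[OF gh(1),of k] t(1)[OF gh(1)] z by (simp add: E.E.m_assoc[symmetric])
  qed
  show ?thesis using *[OF gh e] *[OF gh(2,1) e[symmetric]] by (metis nle_le)
 qed
 have s_el: "s (el i g) = t g \<otimes> z [^] i" if "g : G1" for g i
  unfolding s_def using sel[of "pg (el i g)" g "di (el i g)" i] r[OF el_in_M[OF that]] that by metis
 have "cc ch : extension_class (lin_group M) E io pj"
  unfolding extension_class_def
 proof (intro CollectI conjI cc_cocycle[OF good] bexI[of _ s] ballI)
  have pjz: "pj (z [^] (i::nat)) = el i (I2)" for i
  proof (induction i)
   case 0
   thus ?case by (simp add: el_0)
  next
   case (Suc i)
   have "pj z = el 1 (I2)" unfolding z_def using E.pi_mult[OF E.iota_closed[OF b0] z0(1)] E.pi_iota[OF b0] z0(2) left_mult_one_mat[OF M_carrier[OF el_in_M[OF G1_one]],of 1] by simp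
   thus ?case using Suc z el_mult[OF G1_one G1_one,of i 1] by simp
  qed
  show "s : carrier (lin_group M) \<rightarrow> carrier E" using r t(1) z by (auto simp: s_def)
  fix x assume "x : carrier (lin_group M)"
  then obtain i g where x: "g : G1" "x = el i g" by (metis M_cases carrier_lin_group)
  show "pj (s x) = x"
   unfolding x(2) s_el[OF x(1)] using z t(1)[OF x(1)] t(2)[OF x(1)] pjz[of i] el_mult[OF x(1) G1_one,of 0 i] G1_carrier[OF x(1)] by (simp add: el_0)
  fix y assume "y : carrier (lin_group M)"
  then obtain j h where y: "h : G1" "y = el j h" by (metis M_cases carrier_lin_group)
  have zi: "z [^] i : carrier E" "z [^] j : carrier E" using z by auto
  note tg = t(1)[OF x(1)] and th = t(1)[OF y(1)]
  have nz: "ch h ^ i ~= 0" using ch(1)[OF y(1)] by simp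
  have "s x \<otimes> s y = t g \<otimes> ((z [^] i \<otimes> t h) \<otimes> z [^] j)"
   unfolding x(2) y(2) s_el[OF x(1)] s_el[OF y(1)] using zi tg th by (simp add: E.E.m_assoc)
  also have "(z [^] i \<otimes> t h) \<otimes> z [^] j = io (ch h ^ i) \<otimes> (t h \<otimes> z [^] (i + j))"
   unfolding zpt[OF y(1)] using zi th nz z by (simp add: E.E.m_assoc E.E.nat_pow_mult)
  also have "t g \<otimes> (io (ch h ^ i) \<otimes> (t h \<otimes> z [^] (i + j))) = io (ch h ^ i) \<otimes> (t g \<otimes> (t h \<otimes> z [^] (i + j)))"
   by (rule E.mult_iota_left) (use nz tg th z in auto)
  also have "t g \<otimes> (t h \<otimes> z [^] (i + j)) = s (x * y)"
   unfolding x(2) y(2) el_mult[OF x(1) y(1)] s_el[OF G1_mult[OF x(1) y(1)]] tm[OF x(1) y(1),symmetric]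
   by (rule E.E.m_assoc[symmetric]) (use tg th z in auto)
  finally show "s x \<otimes> s y = io (cc ch (x,y)) \<otimes> s (x \<otimes>\<^bsub>lin_group M\<^esub> y)"
   unfolding x(2) y(2) cc_el[OF good x(1) y(1)] by simp
 qed
 hence "c : coboundaries (lin_group M) #>\<^bsub>cocycle_group (lin_group M)\<^esub> cc ch"
  using E.extension_class_coset cE by blast
 thus thesis using that good by blast
qed

lemma cocycle_is_cc:
 assumes c: "c : carrier (cocycle_group (lin_group M))"
 obtains ch where "good ch" "c : coboundaries (lin_group M) #>\<^bsub>cocycle_group (lin_group M)\<^esub> cc ch"
 using cocycle_ext_class[OF LM.is_group c] extension_class_contains_cc by metis

text \<open>Injectivity: a coboundary is symmetric on commuting elements, whereas the cocycle of \<open>\<chi>\<close> takes the values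
\<open>\<chi>(g)\<close> and \<open>1\<close> on \<open>(\<zeta>\<^bsub>2m\<^esub>, g)\<close> and \<open>(g, \<zeta>\<^bsub>2m\<^esub>)\<close>.\<close>

theorem class_of_hom_iso: "class_of_hom ze m G1 : iso (Hom_group A B) (H2 (lin_group M))"
proof -
 interpret C: comm_group "cocycle_group (lin_group M)::('k mat \<times> 'k mat => 'k) monoid" by (rule cocycle_comm_group[OF LM.is_group])
 let ?D = "coboundaries (lin_group M)::('k mat \<times> 'k mat => 'k) set" and ?C = "cocycle_group (lin_group M)::('k mat \<times> 'k mat => 'k) monoid"
 have D: "subgroup ?D ?C" by (rule coboundaries_subgroup[OF LM.is_group])
 have Dn: "?D \<lhd> ?C" by (rule C.subgroup_imp_normal[OF D])
 have cc: "cc (chi et) : carrier ?C" if "et : carrier (Hom_group A B)" for et by (rule cc_cocycle[OF chi_good(1)[OF that]])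
 have multc: "cc (chi (et \<otimes>\<^bsub>Hom_group A B\<^esub> et')) = cc (chi et) \<otimes>\<^bsub>?C\<^esub> cc (chi et')"
  if e: "et : carrier (Hom_group A B)" "et' : carrier (Hom_group A B)" "et \<otimes>\<^bsub>Hom_group A B\<^esub> et' : carrier (Hom_group A B)" for et et'
 proof (rule extensionalityI[of _ "M \<times> M"])
  fix p assume "p : M \<times> M"
  then obtain i g j h where p: "g : G1" "h : G1" "p = (el i g,el j h)" by (metis M_cases mem_Sigma_iff surj_pair)
  show "cc (chi (et \<otimes>\<^bsub>Hom_group A B\<^esub> et')) p = (cc (chi et) \<otimes>\<^bsub>?C\<^esub> cc (chi et')) p"
   using p el_in_M[OF p(1)] el_in_M[OF p(2)] cc_el[OF chi_good(1)[OF e(1)] p(1,2)] cc_el[OF chi_good(1)[OF e(2)] p(1,2)] cc_el[OF chi_good(1)[OF e(3)] p(1,2)]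
   by (simp add: chi_mult[OF p(2)] power_mult_distrib)
 qed (auto simp: cc_def)
 have mH: "et \<otimes>\<^bsub>Hom_group A B\<^esub> et' : carrier (Hom_group A B)"
  if e: "et : carrier (Hom_group A B)" "et' : carrier (Hom_group A B)" for et et'
 proof -
  have g: "good (%g. chi et g * chi et' g)"
   using chi_good(1)[OF e(1)] chi_good(1)[OF e(2)] unfolding good_def by (simp add: power_mult_distrib mult_ac)
  obtain \<theta> where \<theta>: "\<theta> : carrier (Hom_group A B)" "!!g. g : G1 ==> chi \<theta> g = chi et g * chi et' g" using chi_surj[OF g] by blast
  have "\<theta> = et \<otimes>\<^bsub>Hom_group A B\<^esub> et'"
  proof (rule extensionalityI[of _ "carrier A"])
   show "\<theta> : extensional (carrier A)" using \<theta>(1) by (simp add: Hom_group_def)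
   show "et \<otimes>\<^bsub>Hom_group A B\<^esub> et' : extensional (carrier A)" by (simp add: Hom_group_def)
   fix a assume a: "a : carrier A"
   then obtain i where i: "a = ze m ^ i" using zeta_m(3) by (auto simp: roots_A)
   show "\<theta> a = (et \<otimes>\<^bsub>Hom_group A B\<^esub> et') a"
   proof (rule extensionalityI[of _ "carrier (lin_group G1 Mod N)"])
    have "\<theta> a : carrier B" using \<theta>(1) a hom_in_carrier[of \<theta> A B a] by (simp add: Hom_group_def)
    thus "\<theta> a : extensional (carrier (lin_group G1 Mod N))" using carrier_B by blast
    show "(et \<otimes>\<^bsub>Hom_group A B\<^esub> et') a : extensional (carrier (lin_group G1 Mod N))" using a by (simp add: Hom_group_def)
    fix X assume X: "X : carrier (lin_group G1 Mod N)"
    then obtain g where gX: "g : G1" "X = {g,neg g}" by (auto simp: carrier_Mod)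
    have "\<theta> a X = et a X * et' a X"
     unfolding i gX(2) eta_power[OF \<theta>(1) gX(1)] eta_power[OF e(1) gX(1)] eta_power[OF e(2) gX(1)] \<theta>(2)[OF gX(1)] by (simp add: power_mult_distrib)
    thus "\<theta> a X = (et \<otimes>\<^bsub>Hom_group A B\<^esub> et') a X" using a X by (simp add: Hom_group_def)
   qed
  qed
  thus ?thesis using \<theta>(1) by simp
 qed
 have clsH: "class_of_hom ze m G1 et : carrier (H2 (lin_group M))" if "et : carrier (Hom_group A B)" for et
  unfolding class_of_hom_eq[OF that] H2_def FactGroup_def RCOSETS_def using cc[OF that] by auto
 show ?thesis
  unfolding iso_def
 proof (intro CollectI conjI homI)
  fix et et' assume e: "et : carrier (Hom_group A B)" "et' : carrier (Hom_group A B)"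
  show "class_of_hom ze m G1 et : carrier (H2 (lin_group M))" by (rule clsH[OF e(1)])
  show "class_of_hom ze m G1 (et \<otimes>\<^bsub>Hom_group A B\<^esub> et') = class_of_hom ze m G1 et \<otimes>\<^bsub>H2 (lin_group M)\<^esub> class_of_hom ze m G1 et'"
   unfolding class_of_hom_eq[OF e(1)] class_of_hom_eq[OF e(2)] class_of_hom_eq[OF mH[OF e]] multc[OF e mH[OF e]]
   using normal.rcos_sum[OF Dn cc[OF e(1)] cc[OF e(2)]] by (simp add: H2_def FactGroup_def)
 next
  show "bij_betw (class_of_hom ze m G1) (carrier (Hom_group A B)) (carrier (H2 (lin_group M)))"
   unfolding bij_betw_def
  proof
   show "inj_on (class_of_hom ze m G1) (carrier (Hom_group A B))"
   proof (rule inj_onI)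
    fix et et' assume e: "et : carrier (Hom_group A B)" "et' : carrier (Hom_group A B)" "class_of_hom ze m G1 et = class_of_hom ze m G1 et'"
    have "cc (chi et) : ?D #>\<^bsub>?C\<^esub> cc (chi et')"
     using C.rcos_self[OF cc[OF e(1)] D] e(3) class_of_hom_eq[OF e(1)] class_of_hom_eq[OF e(2)] by simp
    then obtain f where f: "ALL x:M. f x ~= 0" "cc (chi et) = boundary (lin_group M) f \<otimes>\<^bsub>?C\<^esub> cc (chi et')"
     unfolding r_coset_def coboundaries_eq by auto
    note g1 = chi_good(1)[OF e(1)] and g2 = chi_good(1)[OF e(2)]
    show "et = et'"
    proof (rule chi_inj[OF e(1,2)])
     fix g assume g: "g : G1"
     let ?z = "el 1 (I2)" and ?g = "el 0 g"
     have zM: "?z : M" "?g : M" using el_in_M g G1_one by blast+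
     have com: "?z * ?g = ?g * ?z" using el_mult[OF G1_one g,of 1 0] el_mult[OF g G1_one,of 0 1] G1_carrier[OF g] by simp
     have v: "cc (chi et) p = boundary (lin_group M) f p * cc (chi et') p" if "p : M \<times> M" for p
      using fun_cong[OF f(2),of p] that by simp
     have sym: "boundary (lin_group M) f (?z,?g) = boundary (lin_group M) f (?g,?z)"
      using zM com by (simp add: boundary_apply mult.commute)
     have "chi et g ^ 1 = boundary (lin_group M) f (?z,?g) * chi et' g ^ 1"
      using v[of "(?z,?g)"] zM cc_el[OF g1 G1_one g,of 1 0] cc_el[OF g2 G1_one g,of 1 0] by simp
     moreover have "1 = boundary (lin_group M) f (?g,?z) * 1"
      using v[of "(?g,?z)"] zM cc_el[OF g1 g G1_one,of 0 1] cc_el[OF g2 g G1_one,of 0 1] by simp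
     ultimately show "chi et g = chi et' g" using sym by simp
    qed
   qed
   show "class_of_hom ze m G1 ` carrier (Hom_group A B) = carrier (H2 (lin_group M))"
   proof
    show "class_of_hom ze m G1 ` carrier (Hom_group A B) <= carrier (H2 (lin_group M))" using clsH by blast
    show "carrier (H2 (lin_group M)) <= class_of_hom ze m G1 ` carrier (Hom_group A B)"
    proof
     fix X::"('k mat \<times> 'k mat => 'k) set" assume "X : carrier (H2 (lin_group M))"
     then obtain c where c: "c : carrier ?C" "X = ?D #>\<^bsub>?C\<^esub> c" by (auto simp: H2_def FactGroup_def RCOSETS_def)
     obtain ch where ch: "good ch" "c : ?D #>\<^bsub>?C\<^esub> cc ch" using cocycle_is_cc[OF c(1)] by blast
     obtain et where et: "et : carrier (Hom_group A B)" "!!g. g : G1 ==> chi et g = ch g" using chi_surj[OF ch(1)] by blast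
     have "cc (chi et) = cc ch"
     proof (rule extensionalityI[of _ "M \<times> M"])
      fix p assume "p : M \<times> M"
      then obtain i g j h where p: "g : G1" "h : G1" "p = (el i g,el j h)" by (metis M_cases mem_Sigma_iff surj_pair)
      show "cc (chi et) p = cc ch p" unfolding p(3) cc_el[OF chi_good(1)[OF et(1)] p(1,2)] cc_el[OF ch(1) p(1,2)] using et(2)[OF p(2)] by simp
     qed (auto simp: cc_def)
     hence "X = class_of_hom ze m G1 et"
      unfolding c(2) class_of_hom_eq[OF et(1)] using C.repr_independence[OF ch(2) cc_cocycle[OF ch(1)] D] by simp
     thus "X : class_of_hom ze m G1 ` carrier (Hom_group A B)" using et(1) by blast
    qed
   qed
  qed
 qed
qed

end

text \<open>An extension of \<open>\<mu>\<^bsub>2m\<^esub> G\<^sub>1\<close> in the class of \<open>\<chi>\<close>, with a section \<open>s\<close> realising the cocycle of \<open>\<chi>\<close>. Thus \<open>s\<close> is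
multiplicative except for \<open>s(\<zeta>\<^bsub>2m\<^esub>) s(g) = \<chi>(g) s(g) s(\<zeta>\<^bsub>2m\<^esub>)\<close>.\<close>

locale mckay_setting = mu_setting ze m G1 + X: central_ext "lin_group (mu_G1 m G1)" E io pj
 for ze::"nat => 'k::{alg_closed_field,field_char_0}" and m and G1 and E::"'e monoid" (structure) and io::"'k => 'e" and pj::"'e => 'k mat" +
 fixes ch::"'k mat => 'k" and s::"'k mat => 'e" and g1::"'k mat" and e::nat
 assumes ch: "good ch"
  and s_closed: "x : M ==> s x : carrier E" and pi_s: "x : M ==> pj (s x) = x"
  and s_mult: "x : M ==> y : M ==> s x \<otimes> s y = io (cc ch (x,y)) \<otimes> s (x * y)"
  and e: "e > 0" "e dvd m" and ch_e: "g : G1 ==> ch g ^ e = 1"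
  and g1: "g1 : G1" "ch g1 = ze e" "g1 [^]\<^bsub>lin_group G1\<^esub> e = scalar (- 1)"
begin

section \<open>The kernel of the character and its preimage\<close>

definition H::"'k mat set" where "H = {g : G1. ch g = 1}"

text \<open>The extension of \<open>\<chi>\<close> to \<open>\<mu>\<^bsub>2m\<^esub> G\<^sub>1\<close> which is trivial on \<open>\<mu>\<^bsub>2m\<^esub>\<close>; its kernel is \<open>\<mu>\<^bsub>2m\<^esub> H\<close>.\<close>

definition chiM::"'k mat => 'k" where "chiM x = cc ch (el 1 I2,x)"

definition MH::"'k mat set" where "MH = {x : M. chiM x = 1}"

definition gp::"nat => 'k mat" where "gp a = g1 [^]\<^bsub>lin_group G1\<^esub> a"

abbreviation gi::"'k mat => 'k mat" where "gi u \<equiv> inv\<^bsub>lin_group G1\<^esub> u"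

lemma chiM_el: "g : G1 ==> chiM (el i g) = ch g"
 using cc_el[OF ch G1_one,of g 1 i] by (simp add: chiM_def)

lemma chiM_G1: "g : G1 ==> chiM g = ch g" using chiM_el[of g 0] by (simp add: el_0)

lemma chiM_mult: "x : M ==> y : M ==> chiM (x * y) = chiM x * chiM y"
proof -
 assume "x : M" "y : M"
 then obtain i g j h where a: "g : G1" "x = el i g" "h : G1" "y = el j h" by (metis M_cases)
 thus ?thesis using goodD(2)[OF ch a(1,3)] G1_mult[OF a(1,3)] by (simp add: el_mult chiM_el)
qed

lemma chiM_props: "x : M ==> chiM x ~= 0" "x : M ==> chiM x ^ e = 1"
proof -
 assume "x : M"
 then obtain i g where a: "g : G1" "x = el i g" by (metis M_cases)
 show "chiM x ~= 0" "chiM x ^ e = 1" using a goodD(1)[OF ch a(1)] ch_e[OF a(1)] by (simp_all add: chiM_el)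
qed

lemma chiM_one: "chiM (I2) = 1" using chiM_G1[OF G1_one] goodD(5)[OF ch] by simp

lemma MM: "x : M ==> y : M ==> x * y : M" using LM.m_closed[of x y] by simp

lemma M_one: "I2 : M" using G1_sub_M G1_one by blast

lemma gi_closed: "u : G1 ==> gi u : G1" and gi_left: "u : G1 ==> gi u * u = I2" and gi_right: "u : G1 ==> u * gi u = I2"
 using L.inv_closed[of u] L.l_inv[of u] L.r_inv[of u] by simp_all

lemma chi_gi: "u : G1 ==> ch (gi u) = inverse (ch u)"
 using goodD(2)[OF ch gi_closed[of u],of u] goodD(5)[OF ch] goodD(1)[OF ch,of u] gi_left[of u]
 by (simp add: field_simps)

lemma GM: "g : G1 ==> g : M" using G1_sub_M by blast

lemma gi_M: "u : G1 ==> inv\<^bsub>lin_group M\<^esub> u = gi u"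
 by (rule LM.inv_equality) (use gi_left gi_closed GM in auto)

lemma gp_closed: "gp a : G1" using L.nat_pow_closed[of g1 a] g1(1) by (simp add: gp_def)

lemma gp_0: "gp 0 = I2" and gp_Suc: "gp (Suc a) = gp a * g1" and gp_add: "gp (a + b) = gp a * gp b" and gp_e: "gp e = scalar (-1)"
 using g1 L.nat_pow_mult[of g1 a b] by (simp_all add: gp_def)

lemma chi_gp: "ch (gp a) = ze e ^ a"
proof (induction a)
 case (Suc a)
 thus ?case using goodD(2)[OF ch gp_closed g1(1),of a] g1(2) by (simp add: gp_Suc)
qed (simp add: gp_0 goodD(5)[OF ch])

lemma MH_el: "g : G1 ==> el i g : MH \<longleftrightarrow> g : H"
 using el_in_M[of g i] by (simp add: MH_def H_def chiM_el)

lemma MH_cases: "x : MH ==> EX i<m. EX h:H. x = el i h"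
proof -
 assume x: "x : MH"
 then obtain i g where a: "i < m" "g : G1" "x = el i g" using M_iff[of x] by (auto simp: MH_def)
 hence "g : H" using x MH_el by simp
 thus ?thesis using a by blast
qed

lemma H_G1: "h : H ==> h : G1" and MH_M: "x : MH ==> x : M" by (simp_all add: H_def MH_def)

lemma H_MH: "h : H ==> h : MH" using MH_el[of h 0] by (simp add: el_0 H_def)

lemma subgroup_H: "subgroup H (lin_group G1)"
proof (rule L.subgroupI)
 have "I2 : H" using goodD(5)[OF ch] by (simp add: H_def)
 thus "H ~= {}" by blast
 fix h assume "h : H"
 thus "gi h : H" using gi_closed[of h] chi_gi[of h] by (simp add: H_def)
qed (auto simp: H_def G1_mult goodD(2)[OF ch])

lemma H_GL: "subgroup H (GL 2)"
 using group.incl_subgroup[OF group_GL G1(1)] subgroup_H by (simp add: lin_group_def)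

lemma H_finite: "finite H" using G1(3) by (simp add: H_def)

lemma subgroup_MH: "subgroup MH (lin_group M)"
proof (rule LM.subgroupI)
 show "MH ~= {}" using M_one chiM_one by (auto simp: MH_def)
 fix x assume x: "x : MH"
 have xM: "x : M" and c: "chiM x = 1" using x by (auto simp: MH_def)
 have i: "inv\<^bsub>lin_group M\<^esub> x : M" "inv\<^bsub>lin_group M\<^esub> x * x = I2" using LM.inv_closed[of x] LM.l_inv[of x] xM by auto
 show "inv\<^bsub>lin_group M\<^esub> x : MH" using chiM_mult[OF i(1) xM] i c chiM_one by (simp add: MH_def)
qed (auto simp: MH_def MM chiM_mult)

lemma MH_GL: "subgroup MH (GL 2)"
 using group.incl_subgroup[OF group_GL M_subgroup] subgroup_MH by (simp add: lin_group_def)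

lemma MH_finite: "finite MH" using M_finite by (simp add: MH_def)

sublocale LH: group "lin_group H" by (rule group_lin_group[OF H_GL])
sublocale LMH: group "lin_group MH" by (rule group_lin_group[OF MH_GL])

lemma MH_one: "I2 : MH" and MH_mult: "x : MH ==> y : MH ==> x * y : MH"
 using LMH.one_closed LMH.m_closed[of x y] by simp_all

lemma H_one: "I2 : H" and H_mult: "x : H ==> y : H ==> x * y : H"
 using LH.one_closed LH.m_closed[of x y] by simp_all

lemma minus_one_H: "scalar (-1) : H" using minus_one goodD(3)[OF ch] by (simp add: H_def)

lemma neg_H: "h : H ==> neg h : H" using neg_closed goodD(6)[OF ch] by (simp add: H_def)

lemma inv_LH: "h : H ==> inv\<^bsub>lin_group H\<^esub> h = gi h"
 using L.m_inv_consistent[OF subgroup_H,of h] by (simp add: lin_group_def)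

section \<open>The section over the preimage\<close>

lemma s_el_mult:
 assumes "g : G1" "h : G1"
 shows "s (el i g) \<otimes> s (el j h) = io (ch h ^ i) \<otimes> s (el (i + j) (g * h))"
 using s_mult[OF el_in_M[OF assms(1)] el_in_M[OF assms(2)],of i j] cc_el[OF ch assms] el_mult[OF assms] by simp

text \<open>As \<open>\<chi>\<close> is trivial on \<open>H\<close>, the preimage of \<open>\<mu>\<^bsub>2m\<^esub> H\<close> is the direct product of \<open>k\<^sup>*\<close> and \<open>\<mu>\<^bsub>2m\<^esub> H\<close>.\<close>

lemma s_mult_MH: "x : M ==> y : MH ==> s x \<otimes> s y = s (x * y)"
proof -
 assume x: "x : M" and y: "y : MH"
 obtain i g where g: "g : G1" "x = el i g" using x by (metis M_cases)
 obtain j h where h: "h : H" "y = el j h" using MH_cases[OF y] by blast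
 have "io 1 \<otimes> s (x * y) = s (x * y)" using s_closed[OF MM[OF x MH_M[OF y]]] by (simp add: X.iota_one)
 thus ?thesis using s_mult[OF x MH_M[OF y]] cc_el[OF ch g(1) H_G1[OF h(1)],of i j] h g by (simp add: H_def)
qed

lemma s_one: "s (I2) = \<one>"
 using s_mult_MH[OF M_one MH_one] s_closed[OF M_one] X.E.l_cancel_one[of "s (I2)" "s (I2)"] by simp

lemma s_G1_mult: "u : G1 ==> x : M ==> s u \<otimes> s x = s (u * x)"
proof -
 assume u: "u : G1" and x: "x : M"
 obtain j h where h: "h : G1" "x = el j h" using x by (metis M_cases)
 have "io 1 \<otimes> s (u * x) = s (u * x)" using s_closed[OF MM[OF GM[OF u] x]] by (simp add: X.iota_one)
 thus ?thesis using s_el_mult[OF u h(1),of 0 j] h el_mult[OF u h(1),of 0 j] by (simp add: el_0)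
qed

lemma s_conj:
 assumes u: "u : G1" and x: "x : M"
 shows "inv (s u) \<otimes> s x \<otimes> s u = io (cc ch (x,u)) \<otimes> s (gi u * x * u)" "cc ch (x,u) ~= 0" "gi u * x * u : M"
proof -
 obtain i g where g: "g : G1" "x = el i g" using x by (metis M_cases)
 show c: "cc ch (x,u) ~= 0" using cc_el[OF ch g(1) u,of i 0] goodD(1)[OF ch u] g by (simp add: el_0)
 have uM: "u : M" "gi u : M" using GM u gi_closed by auto
 show k: "gi u * x * u : M" using MM uM x by blast
 note cm = M_carrier[OF uM(1)] M_carrier[OF uM(2)] M_carrier[OF x]
 have "u * (gi u * x * u) = (u * gi u) * x * u" using cm by (simp add: assoc_mult_mat[of _ 2 2 _ 2 _ 2])
 hence uk: "u * (gi u * x * u) = x * u" using cm gi_right[OF u] by simp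
 have su: "s u : carrier E" "s x : carrier E" "s (gi u * x * u) : carrier E" using s_closed uM x k by auto
 have "s x \<otimes> s u = io (cc ch (x,u)) \<otimes> (s u \<otimes> s (gi u * x * u))"
  using s_mult[OF x uM(1)] s_G1_mult[OF u k] uk by simp
 also have "... = s u \<otimes> (io (cc ch (x,u)) \<otimes> s (gi u * x * u))" by (rule X.mult_iota_left[symmetric]) (use c su in auto)
 finally have "inv (s u) \<otimes> (s x \<otimes> s u) = io (cc ch (x,u)) \<otimes> s (gi u * x * u)"
  using su c by (simp add: X.E.m_assoc[symmetric])
 thus "inv (s u) \<otimes> s x \<otimes> s u = io (cc ch (x,u)) \<otimes> s (gi u * x * u)" using su by (simp add: X.E.m_assoc)
qed

text \<open>The coordinate of \<open>y\<close> in \<open>k\<^sup>*\<close> with respect to the section \<open>s\<close>.\<close>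

definition co::"'e => 'k" where "co y = (THE a. a ~= 0 & y = io a \<otimes> s (pj y))"

lemma pi_iota_s: "a ~= 0 ==> x : M ==> pj (io a \<otimes> s x) = x"
 using X.pi_mult[OF X.iota_closed s_closed,of a x] pi_s[of x] M_carrier[of x] by simp

lemma co_eq: "a ~= 0 ==> x : M ==> co (io a \<otimes> s x) = a"
proof -
 assume a: "a ~= 0" "x : M"
 have "b = a" if b: "b ~= 0" "io a \<otimes> s x = io b \<otimes> s x" for b
  using X.E.right_cancel[OF s_closed[OF a(2)] X.iota_closed[OF a(1)] X.iota_closed[OF b(1)]] b(2) X.iota_inj[OF a(1) b(1)] by simp
 thus ?thesis unfolding co_def pi_iota_s[OF a] using a(1) by blast
qed

lemma decomp:
 assumes "y : carrier E"
 shows "co y ~= 0" "y = io (co y) \<otimes> s (pj y)" "pj y : M"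
proof -
 show p: "pj y : M" using X.pi_closed[OF assms] by simp
 obtain a where "a ~= 0" "y = io a \<otimes> s (pj y)" by (rule X.fiber[OF assms s_closed[OF p]]) (use pi_s[OF p] in auto)
 thus "co y ~= 0" "y = io (co y) \<otimes> s (pj y)" using co_eq[OF _ p] by metis+
qed

lemma co_iota: "a ~= 0 ==> co (io a) = a" using co_eq[OF _ M_one,of a] by (simp add: s_one)

lemma central_char_E: "central_char E (io ` {a. a ~= 0}) co (s ` M)"
proof (intro central_char.intro central_char_axioms.intro X.E.is_group)
 show "finite (s ` M)" "s ` M ~= {}" using M_finite M_one by auto
 show "x : s ` M ==> x : carrier E" for x using s_closed by auto
 show "a : io ` {a. a ~= 0} ==> a : carrier E" "a : io ` {a. a ~= 0} ==> co a ~= 0" for a using co_iota by auto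
 fix y assume y: "y : carrier E"
 note d = decomp[OF y]
 have yM: "inv\<^bsub>lin_group M\<^esub> pj y : M" using LM.inv_closed[of "pj y"] d(3) by simp
 define p where "p z = s (pj y * pj z)" for z
 have "bij_betw p (s ` M) (s ` M)"
 proof (rule bij_betw_byWitness[where f' = "%z. s (inv\<^bsub>lin_group M\<^esub> pj y * pj z)"])
  have 1: "inv\<^bsub>lin_group M\<^esub> pj y * (pj y * x) = x" "pj y * (inv\<^bsub>lin_group M\<^esub> pj y * x) = x" if "x : M" for x
   using LM.inv_solve_left[of "pj y" ] LM.m_assoc[of "inv\<^bsub>lin_group M\<^esub> pj y" "pj y" x] LM.m_assoc[of "pj y" "inv\<^bsub>lin_group M\<^esub> pj y" x]
    LM.l_inv[of "pj y"] LM.r_inv[of "pj y"] LM.l_one[of x] that d(3) yM by auto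
  show "ALL z:s ` M. s (inv\<^bsub>lin_group M\<^esub> pj y * pj (p z)) = z" using 1 pi_s MM d(3) by (auto simp: p_def)
  show "ALL z:s ` M. p (s (inv\<^bsub>lin_group M\<^esub> pj y * pj z)) = z" using 1 pi_s MM yM by (auto simp: p_def)
  show "p ` s ` M <= s ` M" using MM d(3) pi_s by (auto simp: p_def)
  show "(%z. s (inv\<^bsub>lin_group M\<^esub> pj y * pj z)) ` s ` M <= s ` M" using MM yM pi_s by auto
 qed
 moreover have "EX a:io ` {a. a ~= 0}. y \<otimes> z = a \<otimes> p z" if z: "z : s ` M" for z
 proof -
  obtain x where x: "x : M" "z = s x" using z by blast
  have c: "cc ch (pj y,x) ~= 0"
  proof -
   obtain i g j h where a: "g : G1" "pj y = el i g" "h : G1" "x = el j h" using d(3) x(1) by (metis M_cases)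
   show ?thesis using cc_el[OF ch a(1,3),of i j] goodD(1)[OF ch a(3)] a by simp
  qed
  have "y \<otimes> z = io (co y) \<otimes> (s (pj y) \<otimes> s x)"
   using d(2) X.E.m_assoc[of "io (co y)" "s (pj y)" "s x"] d(1) s_closed[OF d(3)] s_closed[OF x(1)] x(2) by simp
  also have "... = io (co y * cc ch (pj y,x)) \<otimes> s (pj y * x)"
   unfolding s_mult[OF d(3) x(1)] by (rule X.iota_mult_left) (use d c s_closed MM x in auto)
  finally have "y \<otimes> z = io (co y * cc ch (pj y,x)) \<otimes> p z" using x pi_s[OF x(1)] by (simp add: p_def)
  moreover have "io (co y * cc ch (pj y,x)) : io ` {a. a ~= 0}" using d(1) c by simp
  ultimately show ?thesis by blast
 qed
 ultimately show "EX p. bij_betw p (s ` M) (s ` M) & (ALL z:s ` M. EX a:io ` {a. a ~= 0}. y \<otimes> z = a \<otimes> p z)" by blast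
qed

sublocale CE: central_char E "io ` {a. a ~= 0}" co "s ` M" by (rule central_char_E)
sublocale CH: central_char "lin_group H" "{I2}" "%_. 1::'k" H by (rule lin_group_central_char[OF H_GL H_finite])
sublocale CM: central_char "lin_group MH" "{I2}" "%_. 1::'k" MH by (rule lin_group_central_char[OF MH_GL MH_finite])

lemma CE_ip: "CE.ip La Th = (\<Sum>x\<in>M. trace (snd La (inv s x)) * trace (snd Th (s x)))"
proof -
 have "inj_on s M" by (rule inj_on_inverseI[of _ pj]) (rule pi_s)
 thus ?thesis unfolding CE.ip_def by (simp add: sum.reindex)
qed

lemma CH_weighted: "tau : reps (lin_group H) ==> CH.weighted tau"
 using repsD(4)[of "fst tau" "snd tau",OF _ LH.is_group] by (simp add: CH.weighted_def one_smult_mat)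

lemma CM_weighted: "tau : reps (lin_group MH) ==> CM.weighted tau"
 using repsD(4)[of "fst tau" "snd tau",OF _ LMH.is_group] by (simp add: CM.weighted_def one_smult_mat)

section \<open>Induction from the preimage of the kernel\<close>

abbreviation BB where "BB \<equiv> X.preimage MH"

lemma B_iff: "y : BB \<longleftrightarrow> y : carrier E & pj y : MH" by (simp add: X.preimage_def)

lemma B_subgroup: "subgroup BB E" by (rule X.preimage_subgroup[OF subgroup_MH])

lemma co_mult: "y : carrier E ==> y' : BB ==> co (y \<otimes> y') = co y * co y'"
proof -
 assume y: "y : carrier E" and "y' : BB"
 hence y': "y' : carrier E" "pj y' : MH" by (simp_all add: B_iff)
 note d = decomp[OF y] and d' = decomp[OF y'(1)]
 have "y \<otimes> y' = (io (co y) \<otimes> s (pj y)) \<otimes> (io (co y') \<otimes> s (pj y'))" using d(2) d'(2) by simp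
 also have "... = io (co y * co y') \<otimes> (s (pj y) \<otimes> s (pj y'))" by (rule X.iota_mult_mult) (use d d' s_closed in auto)
 also have "s (pj y) \<otimes> s (pj y') = s (pj y * pj y')" by (rule s_mult_MH[OF d(3) y'(2)])
 finally show ?thesis using co_eq[OF _ MM[OF d(3) d'(3)],of "co y * co y'"] d(1) d'(1) by simp
qed

text \<open>A representation of \<open>\<mu>\<^bsub>2m\<^esub> H\<close> as one of its preimage in \<open>E\<close>, with \<open>k\<^sup>*\<close> acting by scalars.\<close>

definition ext::"('k mat,'k) rep => 'e => 'k mat" where
 "ext mm y = co y \<cdot>\<^sub>m snd mm (pj y)"

lemma ext_reps:
 assumes "mm : reps (lin_group MH)"
 shows "(fst mm,ext mm) : reps (E\<lparr>carrier := BB\<rparr>)"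
proof (rule repsI)
 note r = repsD[of "fst mm" "snd mm",OF _ LMH.is_group]
 show "group (E\<lparr>carrier := BB\<rparr>)" by (rule X.E.subgroup_imp_group[OF B_subgroup])
 show "ext mm g : carrier_mat (fst mm) (fst mm)" if "g : carrier (E\<lparr>carrier := BB\<rparr>)" for g
  using r(2)[of "pj g"] assms that by (simp add: ext_def B_iff)
 show "ext mm \<one>\<^bsub>E\<lparr>carrier := BB\<rparr>\<^esub> = 1\<^sub>m (fst mm)"
  using r(4) assms co_iota[of 1] by (simp add: ext_def X.iota_one one_smult_mat)
 fix g h assume "g : carrier (E\<lparr>carrier := BB\<rparr>)" "h : carrier (E\<lparr>carrier := BB\<rparr>)"
 hence gh: "g : BB" "h : BB" by auto
 have gh': "g : carrier E" "h : carrier E" "pj g : MH" "pj h : MH" using gh by (simp_all add: B_iff)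
 have cm: "snd mm (pj g) : carrier_mat (fst mm) (fst mm)" "snd mm (pj h) : carrier_mat (fst mm) (fst mm)" using r(2) assms gh' by simp_all
 have "snd mm (pj g * pj h) = snd mm (pj g) * snd mm (pj h)" using r(3)[of "pj g" "pj h"] assms gh' by simp
 moreover have "ext mm g * ext mm h = co g \<cdot>\<^sub>m (snd mm (pj g) * (co h \<cdot>\<^sub>m snd mm (pj h)))"
  unfolding ext_def by (rule mult_smult_assoc_mat[OF cm(1) smult_carrier_mat[OF cm(2)]])
 ultimately show "ext mm (g \<otimes>\<^bsub>E\<lparr>carrier := BB\<rparr>\<^esub> h) = ext mm g * ext mm h"
  using co_mult[OF gh'(1) gh(2)] gh' by (simp add: ext_def mult_smult_distrib[OF cm] smult_smult_mat)
qed

definition tt::"nat => 'e" where "tt a = s (gp a)"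

lemma tt_closed: "tt a : carrier E" using s_closed[OF GM[OF gp_closed]] by (simp add: tt_def)

text \<open>The values \<open>\<chi>(g\<^sub>1\<^sup>a) = \<zeta>\<^sub>e\<^sup>a\<close>, \<open>a < e\<close>, exhaust those of \<open>\<chi>\<close>, so the powers of \<open>g\<^sub>1\<close> represent the cosets of the
kernel.\<close>

lemma transversal_E: "transversal E BB tt e"
proof (intro transversal.intro transversal_axioms.intro X.E.is_group B_subgroup tt_closed)
 fix y assume y: "y : carrier E"
 have yM: "pj y : M" by (rule decomp(3)[OF y])
 have *: "inv (tt a) \<otimes> y : BB \<longleftrightarrow> chiM (pj y) = ze e ^ a" for a
 proof -
  have f1: "pj (inv (tt a) \<otimes> y) = gi (gp a) * pj y"
   using y tt_closed[of a] pi_s[OF GM[OF gp_closed]] gi_M[OF gp_closed,of a] by (simp add: tt_def)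
  have f2: "gi (gp a) * pj y : M" using MM GM gi_closed gp_closed yM by blast
  have f3: "chiM (gi (gp a) * pj y) = inverse (ze e ^ a) * chiM (pj y)"
   using chiM_mult[OF GM[OF gi_closed[OF gp_closed]] yM] chiM_G1[OF gi_closed[OF gp_closed]] chi_gi[OF gp_closed] chi_gp by simp
  have "ze e ^ a ~= 0" using compatible_generatorsD(4)[OF compat e(1)] by simp
  hence f5: "inverse (ze e ^ a) * chiM (pj y) = 1 \<longleftrightarrow> chiM (pj y) = ze e ^ a" by (auto simp: field_simps)
  have f6: "inv tt a \<otimes> y : carrier E" using y tt_closed[of a] by simp
  show ?thesis unfolding B_iff unfolding MH_def f1 mem_Collect_eq f3 f5 using f2 f6 by blast
 qed
 obtain a where a: "a < e" "chiM (pj y) = ze e ^ a" using compatible_generatorsD(2)[OF compat e(1) chiM_props(2)[OF yM]] by blast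
 have "b = a" if "b < e" "chiM (pj y) = ze e ^ b" for b
  using that a root_power_eq_iff[OF compat e(1),of a b] by simp
 thus "EX! a. a < e & inv (tt a) \<otimes> y : BB" unfolding * using a by blast
qed

definition Ind::"('k mat,'k) rep => ('e,'k) rep" where
 "Ind mm = induced E BB tt e (fst mm,ext mm)"

sublocale T: transversal E BB tt e by (rule transversal_E)

lemma iota_B: "a ~= 0 ==> io a : BB" using MH_one by (simp add: B_iff)

lemma fst_Ind: "fst (Ind mm) = e * fst mm" by (simp add: Ind_def induced_def)

lemma Ind_weighted:
 assumes mm: "mm : reps (lin_group MH)"
 shows "CE.weighted (Ind mm)"
 unfolding CE.weighted_def
proof (intro conjI ballI)
 show "Ind mm : reps E" unfolding Ind_def by (rule T.induced_in_reps[OF ext_reps[OF mm]])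
 fix y assume "y : io ` {a. a ~= 0}"
 then obtain a where a: "a ~= 0" "y = io a" by blast
 have "snd mm (I2) = 1\<^sub>m (fst mm)" using repsD(4)[of "fst mm" "snd mm",OF _ LMH.is_group] mm by simp
 hence "ext mm y = a \<cdot>\<^sub>m 1\<^sub>m (fst mm)" using a co_iota by (simp add: ext_def)
 hence "snd (Ind mm) y = a \<cdot>\<^sub>m 1\<^sub>m (e * fst mm)"
  unfolding Ind_def by (intro T.induced_central[OF ext_reps[OF mm]]) (use a iota_B X.iota_central in auto)
 thus "snd (Ind mm) y = co y \<cdot>\<^sub>m 1\<^sub>m (fst (Ind mm))" using a co_iota by (simp add: fst_Ind)
qed

abbreviation cj::"nat => 'k mat => 'k mat" where "cj a x \<equiv> gi (gp a) * x * gp a"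

lemma tt_conj: "x : M ==> inv (tt a) \<otimes> s x \<otimes> tt a = io (cc ch (x,gp a)) \<otimes> s (cj a x)"
 "x : M ==> cc ch (x,gp a) ~= 0" "x : M ==> cj a x : M"
 using s_conj[OF gp_closed,of x a] by (simp_all add: tt_def)

lemma cj_MH: "x : M ==> cj a x : MH \<longleftrightarrow> x : MH"
proof -
 assume x: "x : M"
 note g = gp_closed[of a] gi_closed[OF gp_closed[of a]]
 have "chiM (cj a x) = chiM x"
  using chiM_mult[OF MM[OF GM[OF g(2)] x] GM[OF g(1)]] chiM_mult[OF GM[OF g(2)] x] chiM_G1[OF g(1)] chiM_G1[OF g(2)] chi_gi[OF g(1)]
   goodD(1)[OF ch g(1)] by simp
 thus ?thesis using x tt_conj(3)[OF x] by (simp add: MH_def)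
qed

lemma Ind_trace:
 assumes mm: "mm : reps (lin_group MH)" and x: "x : MH"
 shows "trace (snd (Ind mm) (s x)) = (\<Sum>a<e. cc ch (x,gp a) * trace (snd mm (cj a x)))"
proof -
 note xM = MH_M[OF x]
 have "(if inv (tt a) \<otimes> s x \<otimes> tt a : BB then trace (ext mm (inv (tt a) \<otimes> s x \<otimes> tt a)) else 0)
  = cc ch (x,gp a) * trace (snd mm (cj a x))" for a
 proof -
  note c = tt_conj[OF xM,of a]
  have k: "cj a x : MH" using cj_MH[OF xM] x by simp
  have "io (cc ch (x,gp a)) \<otimes> s (cj a x) : BB" using c k s_closed[OF c(3)] pi_iota_s[OF c(2,3)] by (simp add: B_iff)
  moreover have "snd mm (cj a x) : carrier_mat (fst mm) (fst mm)" using repsD(2)[of "fst mm" "snd mm",OF _ LMH.is_group] mm k by simp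
  ultimately show ?thesis unfolding c(1) using c by (simp add: ext_def co_eq pi_iota_s trace_smult)
 qed
 thus ?thesis unfolding Ind_def T.trace_induced[OF ext_reps[OF mm] s_closed[OF xM]] by simp
qed

lemma cj_bij: "bij_betw (cj a) M M"
proof -
 have g: "gp a : M" "gi (gp a) : M" using GM gp_closed gi_closed by auto
 note cm = M_carrier[OF g(1)] M_carrier[OF g(2)]
 have 1: "gp a * (cj a x) * gi (gp a) = x" "cj a (gp a * x * gi (gp a)) = x" if x: "x : M" for x
 proof -
  note cx = M_carrier[OF x]
  have "gp a * (cj a x) * gi (gp a) = (gp a * gi (gp a)) * x * (gp a * gi (gp a))"
   using cm cx by (simp add: assoc_mult_mat[of _ 2 2 _ 2 _ 2])
  thus "gp a * (cj a x) * gi (gp a) = x" using gi_right[OF gp_closed] cx by simp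
  have "cj a (gp a * x * gi (gp a)) = (gi (gp a) * gp a) * x * (gi (gp a) * gp a)"
   using cm cx by (simp add: assoc_mult_mat[of _ 2 2 _ 2 _ 2])
  thus "cj a (gp a * x * gi (gp a)) = x" using gi_left[OF gp_closed] cx by simp
 qed
 show ?thesis
  by (rule bij_betw_byWitness[where f' = "%x. gp a * x * gi (gp a)"]) (use 1 MM g in auto)
qed

text \<open>Frobenius reciprocity: in the trace of the induced representation each \<open>t\<^sub>a\<close> contributes the same sum, since the
trace of the other factor is invariant under conjugation with \<open>t\<^sub>a\<close>.\<close>

theorem frobenius:
 assumes mm: "mm : reps (lin_group MH)" and La: "CE.weighted La"
 shows "CE.ip (Ind mm) La = of_nat e * CM.ip mm (fst La,%x. snd La (s x))"
proof -
 define f where "f x = (if x : MH then trace (snd mm (inv\<^bsub>lin_group MH\<^esub> x)) * trace (snd La (s x)) else 0)" for x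
 have Lar: "(fst La,snd La) : reps E" using La by (simp add: CE.weighted_def)
 note r = repsD[OF Lar X.E.is_group]
 have "trace (snd (Ind mm) (inv s x)) * trace (snd La (s x)) = (\<Sum>a<e. f (cj a x))" if x: "x : M" for x
 proof -
  have "(if inv (tt a) \<otimes> inv s x \<otimes> tt a : BB then trace (ext mm (inv (tt a) \<otimes> inv s x \<otimes> tt a)) else 0) * trace (snd La (s x)) = f (cj a x)" for a
  proof -
   note c = tt_conj[OF x,of a] and sx = s_closed[OF x] and t = tt_closed[of a]
   have sk: "s (cj a x) : carrier E" by (rule s_closed[OF c(3)])
   define y where "y = inv (tt a) \<otimes> s x \<otimes> tt a"
   have y: "y : carrier E" using sx t by (simp add: y_def)
   have iy: "inv (tt a) \<otimes> inv s x \<otimes> tt a = inv y" using sx t by (simp add: y_def X.E.inv_mult_group X.E.m_assoc)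
   have yB: "inv y : BB \<longleftrightarrow> cj a x : MH"
   proof -
    have "inv y : BB \<longleftrightarrow> y : BB" using subgroup.m_inv_closed[OF B_subgroup,of y] subgroup.m_inv_closed[OF B_subgroup,of "inv y"] y by auto
    thus ?thesis using y pi_iota_s[OF c(2,3)] c(1) by (simp add: B_iff y_def)
   qed
   have "snd La (s x) * snd La (tt a) = snd La (tt a) * snd La y"
    using r(3)[OF sx t] r(3)[OF t y] sx t by (simp add: y_def X.E.m_assoc[symmetric])
   hence "trace (snd La (s x)) = trace (snd La y)"
    using trace_conj[OF r(1)[OF t] r(2)[OF y] r(2)[OF sx]] by simp
   also have "... = cc ch (x,gp a) * trace (snd La (s (cj a x)))"
    using CE.weightedD(2)[of "fst La" "snd La" "io (cc ch (x,gp a))" "s (cj a x)"] La c sk co_iota r(2)[OF sk] by (simp add: y_def trace_smult)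
   finally have tr: "trace (snd La (s x)) = cc ch (x,gp a) * trace (snd La (s (cj a x)))" .
   show ?thesis
   proof (cases "cj a x : MH")
    case True
    let ?k = "cj a x" and ?c = "cc ch (x,gp a)"
    have ik: "inv\<^bsub>lin_group MH\<^esub> ?k : MH" "?k * inv\<^bsub>lin_group MH\<^esub> ?k = I2" using LMH.inv_closed[of ?k] LMH.r_inv[of ?k] True by auto
    have "y \<otimes> (io (inverse ?c) \<otimes> s (inv\<^bsub>lin_group MH\<^esub> ?k)) = io (?c * inverse ?c) \<otimes> (s ?k \<otimes> s (inv\<^bsub>lin_group MH\<^esub> ?k))"
     unfolding y_def c(1) by (rule X.iota_mult_mult) (use c sk s_closed MH_M ik in auto)
    also have "... = \<one>" using s_mult_MH[OF c(3) ik(1)] ik(2) c(2) by (simp add: s_one X.iota_one)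
    finally have "inv y = io (inverse ?c) \<otimes> s (inv\<^bsub>lin_group MH\<^esub> ?k)"
     using X.E.inv_unique'[OF y] X.E.inv_equality y c(2) s_closed[OF MH_M[OF ik(1)]] X.E.inv_comm by (metis X.E.inv_char X.E.m_closed X.iota_closed inverse_nonzero_iff_nonzero)
    hence "ext mm (inv y) = inverse ?c \<cdot>\<^sub>m snd mm (inv\<^bsub>lin_group MH\<^esub> ?k)" using c(2) MH_M[OF ik(1)] by (simp add: ext_def co_eq pi_iota_s)
    moreover have "snd mm (inv\<^bsub>lin_group MH\<^esub> ?k) : carrier_mat (fst mm) (fst mm)" using repsD(2)[of "fst mm" "snd mm",OF _ LMH.is_group] mm ik by simp
    ultimately have "trace (ext mm (inv y)) = inverse ?c * trace (snd mm (inv\<^bsub>lin_group MH\<^esub> ?k))" by (simp add: trace_smult)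
    thus ?thesis unfolding iy tr f_def using True yB c(2) by simp
   next
    case False
    thus ?thesis unfolding iy using yB by (simp add: f_def)
   qed
  qed
  thus ?thesis
   unfolding Ind_def T.trace_induced[OF ext_reps[OF mm] X.E.inv_closed[OF s_closed[OF x]]] sum_distrib_right by simp
 qed
 hence "CE.ip (Ind mm) La = (\<Sum>x\<in>M. \<Sum>a<e. f (cj a x))" by (simp add: CE_ip)
 also have "... = (\<Sum>a<e. \<Sum>x\<in>M. f (cj a x))" by (rule sum.swap)
 also have "... = (\<Sum>a<e. \<Sum>x\<in>M. f x)" by (intro sum.cong refl sum.reindex_bij_betw[OF cj_bij])
 also have "(\<Sum>x\<in>M. f x) = (\<Sum>x\<in>MH. f x)"
  by (rule sum.mono_neutral_right) (use M_finite in "auto simp: MH_def f_def")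
 also have "... = CM.ip mm (fst La,%x. snd La (s x))" by (simp add: CM.ip_def f_def)
 finally show ?thesis by simp
qed

end

lemma tensor_reps:
 fixes La Th::"('g,'k::field) rep"
 assumes F: "group F" and L: "La : reps F" and T: "Th : reps F"
 shows "tensor_rep La Th : reps F"
proof -
 obtain n si n' tau where e: "La = (n,si)" "Th = (n',tau)" by (metis surj_pair)
 note r = repsD[OF L[unfolded e] F] and r' = repsD[OF T[unfolded e] F]
 have "(n * n',%g. kronecker (si g) (tau g)) : reps F"
 proof (rule repsI[OF F])
  show "kronecker (si \<one>\<^bsub>F\<^esub>) (tau \<one>\<^bsub>F\<^esub>) = 1\<^sub>m (n * n')" using r(4) r'(4) by (simp add: kronecker_one)
  fix g assume g: "g : carrier F"
  show "kronecker (si g) (tau g) : carrier_mat (n * n') (n * n')" using r(2)[OF g] r'(2)[OF g] by simp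
  fix h assume h: "h : carrier F"
  show "kronecker (si (g \<otimes>\<^bsub>F\<^esub> h)) (tau (g \<otimes>\<^bsub>F\<^esub> h)) = kronecker (si g) (tau g) * kronecker (si h) (tau h)"
   unfolding r(3)[OF g h] r'(3)[OF g h] by (rule kronecker_mult[OF r(2)[OF g] r(2)[OF h] r'(2)[OF g] r'(2)[OF h],symmetric])
 qed
 thus ?thesis by (simp add: e tensor_rep_def)
qed

lemma tensor_trace:
 fixes La Th::"('g,'k::field) rep"
 assumes F: "group F" and L: "La : reps F" and T: "Th : reps F" and g: "g : carrier F"
 shows "trace (snd (tensor_rep La Th) g) = trace (snd La g) * trace (snd Th g)"
proof -
 obtain n si n' tau where e: "La = (n,si)" "Th = (n',tau)" by (metis surj_pair)
 show ?thesis using trace_kronecker[OF repsD(2)[OF L[unfolded e] F g] repsD(2)[OF T[unfolded e] F g]] by (simp add: e tensor_rep_def)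
qed

context mckay_setting
begin

text \<open>The shift \<open>2m/e\<close>: conjugation with \<open>g\<^sub>1\<close> multiplies the lift of \<open>\<zeta>\<^bsub>2m\<^esub>\<close> by \<open>\<zeta>\<^sub>e = \<zeta>\<^bsub>2m\<^esub>\<^bsup>2m/e\<^esup>\<close>.\<close>

definition r::nat where "r = 2 * m div e"

lemma r: "r * e = 2 * m" "even r" "r > 0" "zz ^ r = ze e"
proof -
 obtain k where k: "m = e * k" using e(2) by blast
 have "2 * m = e * (2 * k)" by (simp add: k)
 hence "r = e * (2 * k) div e" by (simp only: r_def)
 hence rk: "r = 2 * k" using e(1) by simp
 show "r * e = 2 * m" "even r" "r > 0" using rk k m by auto
 have "e * r = 2 * m" using \<open>r * e = 2 * m\<close> by (simp add: mult.commute)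
 hence "zz = ze (e * r)" by (simp add: zz_def)
 thus "zz ^ r = ze e" using compatible_generatorsD(5)[OF compat e(1) \<open>r > 0\<close>] by simp
qed

lemma zz_powi_power_m: "(zz powi n) ^ m = (-1) powi n"
proof -
 have "(zz powi n) ^ m = zz powi (n * int m)" by (simp only: power_int_of_nat[symmetric] power_int_mult)
 thus ?thesis using zz_powi_m[of n] by (simp add: mult.commute)
qed

lemma zz_powi_power_2m: "(zz powi n) ^ (2 * m) = 1"
 using sgn_cases[of n] by (auto simp: mult.commute[of 2] power_mult zz_powi_power_m)

lemma geometric:
 assumes "even n"
 shows "(\<Sum>i<m. (zz powi n) ^ i) = (if int (2 * m) dvd n then of_nat m else 0)"
proof (cases "zz powi n = 1")
 case True
 thus ?thesis using zz_powi_one[of n] by simp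
next
 case False
 have "(zz powi n) ^ m = 1" using assms by (simp add: zz_powi_power_m power_int_minus_left)
 thus ?thesis using False zz_powi_one[of n] geometric_sum[OF False,of m] by simp
qed

section \<open>Representations of the preimage of the kernel\<close>

text \<open>The parity of \<open>j\<close> matches the scalar by which \<open>-1\<close> acts on \<open>l\<close>.\<close>

definition par::"('k mat,'k) rep => int => bool" where
 "par l j \<longleftrightarrow> l : reps (lin_group H) & snd l (scalar (-1)) = (-1) powi j \<cdot>\<^sub>m 1\<^sub>m (fst l)"

lemma par_reps: "par l j ==> l : reps (lin_group H)" by (simp add: par_def)

lemma repsH:
 assumes "l : reps (lin_group H)"
 shows "h : H ==> snd l h : carrier_mat (fst l) (fst l)" "h : H ==> h' : H ==> snd l (h * h') = snd l h * snd l h'" "snd l (I2) = 1\<^sub>m (fst l)"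
 using repsD[of "fst l" "snd l",OF _ LH.is_group] assms by auto

lemma H_carrier: "h : H ==> h : carrier_mat 2 2" using G1_carrier H_G1 by blast

lemma par_neg:
 assumes "par l j" "h : H"
 shows "snd l (neg h) = (-1) powi j \<cdot>\<^sub>m snd l h"
proof -
 note R = repsH[OF par_reps[OF assms(1)]]
 have "neg h = scalar (-1) * h" using H_carrier[OF assms(2)] by (simp add: scalar_mult neg_def)
 hence "snd l (neg h) = ((-1) powi j \<cdot>\<^sub>m 1\<^sub>m (fst l)) * snd l h"
  using R(2)[OF minus_one_H assms(2)] assms(1) by (simp add: par_def)
 also have "... = (-1) powi j \<cdot>\<^sub>m snd l h"
  using mult_smult_assoc_mat[OF one_carrier_mat R(1)[OF assms(2)]] left_mult_one_mat[OF R(1)[OF assms(2)]] by simp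
 finally show ?thesis .
qed

lemma neg_neg: "neg (neg g) = g" by (simp add: neg_def smult_smult_mat one_smult_mat)

lemma par_sgn:
 assumes "par l j" "h : H"
 shows "snd l ((-1) ^ k \<cdot>\<^sub>m h) = ((-1) powi j) ^ k \<cdot>\<^sub>m snd l h"
proof (cases "even k")
 case True
 then obtain n where "k = 2 * n" by blast
 thus ?thesis using sgn_cases[of j] by (auto simp: one_smult_mat power_mult)
next
 case False
 then obtain n where n: "k = Suc (2 * n)" by (metis oddE Suc_eq_plus1)
 have "((-1) powi j::'k) ^ k = (-1) powi j" using sgn_cases[of j] by (auto simp: n power_mult)
 thus ?thesis using par_neg[OF assms] by (simp add: neg_def n power_mult)
qed

text \<open>The two descriptions of \<open>-1\<close>, as \<open>\<zeta>\<^bsub>2m\<^esub>\<^sup>m\<close> and as an element of \<open>H\<close>, act alike by the parity condition.\<close>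

lemma lift_wd:
 assumes l: "par l j" and g: "g : H" "h : H" and eq: "el i g = el i' h"
 shows "(zz powi j) ^ i \<cdot>\<^sub>m snd l g = (zz powi j) ^ i' \<cdot>\<^sub>m snd l h"
proof -
 have *: "(zz powi j) ^ i \<cdot>\<^sub>m snd l g = (zz powi j) ^ i' \<cdot>\<^sub>m snd l h"
  if a: "g : H" "h : H" "el i g = el i' h" "i' <= i" for g h i i'
 proof -
  obtain k where k: "i = i' + m * k" "g = (-1) ^ k \<cdot>\<^sub>m h" using el_eqD[OF H_G1[OF a(1)] H_G1[OF a(2)] a(3,4)] by blast
  have "((-1::'k) powi j) ^ k * ((-1) powi j) ^ k = 1"
   using sgn_cases[of j] by (auto simp flip: power_mult_distrib)
  thus ?thesis
   using par_sgn[OF l a(2),of k] by (simp add: k power_add power_mult zz_powi_power_m smult_smult_mat mult.assoc)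
 qed
 show ?thesis using *[OF g eq] *[OF g(2,1) eq[symmetric]] by (metis nle_le)
qed

text \<open>The representation of \<open>\<mu>\<^bsub>2m\<^esub> H\<close> given by \<open>l\<close> on \<open>H\<close> and by the scalar \<open>\<zeta>\<^bsub>2m\<^esub>\<^sup>j\<close> at \<open>\<zeta>\<^bsub>2m\<^esub>\<close>.\<close>

definition lift::"('k mat,'k) rep => int => ('k mat,'k) rep" where
 "lift l j = (fst l,%x. THE A. EX i h. h : H & x = el i h & A = (zz powi j) ^ i \<cdot>\<^sub>m snd l h)"

lemma lift_el:
 assumes l: "par l j" and h: "h : H"
 shows "snd (lift l j) (el i h) = (zz powi j) ^ i \<cdot>\<^sub>m snd l h"
 unfolding lift_def snd_conv
proof (rule the_equality)
 show "EX i' h'. h' : H & el i h = el i' h' & (zz powi j) ^ i \<cdot>\<^sub>m snd l h = (zz powi j) ^ i' \<cdot>\<^sub>m snd l h'" using h by blast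
 fix X assume "EX i' h'. h' : H & el i h = el i' h' & X = (zz powi j) ^ i' \<cdot>\<^sub>m snd l h'"
 then obtain i' h' where a: "h' : H" "el i h = el i' h'" "X = (zz powi j) ^ i' \<cdot>\<^sub>m snd l h'" by blast
 thus "X = (zz powi j) ^ i \<cdot>\<^sub>m snd l h" using lift_wd[OF l h a(1,2)] by simp
qed

lemma lift_reps:
 assumes l: "par l j"
 shows "lift l j : reps (lin_group MH)"
proof -
 note R = repsH[OF par_reps[OF l]]
 have "(fst l,snd (lift l j)) : reps (lin_group MH)"
 proof (rule repsI[OF LMH.is_group])
  show "snd (lift l j) \<one>\<^bsub>lin_group MH\<^esub> = 1\<^sub>m (fst l)" using lift_el[OF l H_one,of 0] R(3) by (simp add: el_0 one_smult_mat)
  fix x assume "x : carrier (lin_group MH)"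
  then obtain i h where x: "h : H" "x = el i h" using MH_cases[of x] by auto
  show "snd (lift l j) x : carrier_mat (fst l) (fst l)" using R(1)[OF x(1)] lift_el[OF l x(1)] x by simp
  fix y assume "y : carrier (lin_group MH)"
  then obtain i' h' where y: "h' : H" "y = el i' h'" using MH_cases[of y] by auto
  note c = R(1)[OF x(1)] R(1)[OF y(1)]
  have "snd (lift l j) x * snd (lift l j) y = (zz powi j) ^ i \<cdot>\<^sub>m (snd l h * ((zz powi j) ^ i' \<cdot>\<^sub>m snd l h'))"
   unfolding x(2) y(2) lift_el[OF l x(1)] lift_el[OF l y(1)] by (rule mult_smult_assoc_mat[OF c(1) smult_carrier_mat[OF c(2)]])
  thus "snd (lift l j) (x \<otimes>\<^bsub>lin_group MH\<^esub> y) = snd (lift l j) x * snd (lift l j) y"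
   using lift_el[OF l H_mult[OF x(1) y(1)],of "i + i'"] el_mult[OF H_G1[OF x(1)] H_G1[OF y(1)],of i i'] R(2)[OF x(1) y(1)] x y
   by (simp add: mult_smult_distrib[OF c] smult_smult_mat power_add)
 qed
 thus ?thesis by (simp add: lift_def)
qed

lemma MH_bij: "bij_betw (%(i,h). el i h) ({..<m} \<times> H) MH"
proof (rule bij_betw_imageI)
 have *: "i = i' & h = h'" if a: "h : H" "h' : H" "i < m" "el i h = el i' h'" "i' <= i" for i i' h h'
 proof -
  obtain k where k: "i = i' + m * k" "h = (-1) ^ k \<cdot>\<^sub>m h'" using el_eqD[OF H_G1[OF a(1)] H_G1[OF a(2)] a(4,5)] by blast
  have "k = 0" using k(1) a(3) by (cases k) auto
  thus ?thesis using k by (simp add: one_smult_mat)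
 qed
 show "inj_on (%(i,h). el i h) ({..<m} \<times> H)"
 proof (rule inj_onI)
  fix p q assume pq: "p : {..<m} \<times> H" "q : {..<m} \<times> H" "(case p of (i,h) => el i h) = (case q of (i,h) => el i h)"
  obtain i h i' h' where c: "p = (i,h)" "q = (i',h')" by (metis surj_pair)
  have a: "i < m" "h : H" "i' < m" "h' : H" "el i h = el i' h'" using pq by (simp_all add: c)
  show "p = q"
  proof (cases "i' <= i")
   case True
   thus ?thesis using *[OF a(2,4,1,5)] by (simp add: c)
  next
   case False
   thus ?thesis using *[OF a(4,2,3) a(5)[symmetric]] by (simp add: c)
  qed
 qed
 show "(%(i,h). el i h) ` ({..<m} \<times> H) = MH"
 proof
  show "(%(i,h). el i h) ` ({..<m} \<times> H) <= MH" using MH_el H_G1 by auto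
  show "MH <= (%(i,h). el i h) ` ({..<m} \<times> H)" using MH_cases by force
 qed
qed

lemma sum_MH: "(\<Sum>x\<in>MH. f x) = (\<Sum>i<m. \<Sum>h\<in>H. f (el i h))"
proof -
 have "(\<Sum>x\<in>MH. f x) = (\<Sum>p\<in>{..<m} \<times> H. f (case p of (i,h) => el i h))" by (rule sum.reindex_bij_betw[OF MH_bij,symmetric])
 also have "... = (\<Sum>i<m. \<Sum>h\<in>H. f (el i h))" unfolding sum.cartesian_product by (rule sum.cong) auto
 finally show ?thesis .
qed

lemma card_MH: "card MH = m * card H"
 using bij_betw_same_card[OF MH_bij] by (simp add: card_cartesian_product)

lemma card_sM: "card (s ` M) = e * m * card H"
proof -
 have "bij_betw (%(a,x). gp a * x) ({..<e} \<times> MH) M"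
 proof (rule bij_betw_imageI)
  have c: "chiM (gp a * x) = ze e ^ a" if "x : MH" for a x
   using chiM_mult[OF GM[OF gp_closed] MH_M[OF that]] chiM_G1[OF gp_closed] chi_gp that by (simp add: MH_def)
  show "inj_on (%(a,x). gp a * x) ({..<e} \<times> MH)"
  proof (rule inj_onI)
   fix p q assume pq: "p : {..<e} \<times> MH" "q : {..<e} \<times> MH" "(case p of (a,x) => gp a * x) = (case q of (a,x) => gp a * x)"
   obtain a x b y where cs: "p = (a,x)" "q = (b,y)" by (metis surj_pair)
   have a: "a < e" "x : MH" "b < e" "y : MH" "gp a * x = gp b * y" using pq by (simp_all add: cs)
   have cancel: "gi (gp a) * (gp a * x) = x" if x: "x : MH" for x
    using M_carrier[OF GM[OF gp_closed[of a]]] M_carrier[OF GM[OF gi_closed[OF gp_closed[of a]]]] M_carrier[OF MH_M[OF x]] gi_left[OF gp_closed,of a]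
    by (simp add: assoc_mult_mat[of _ 2 2 _ 2 _ 2,symmetric])
   have "ze e ^ a = ze e ^ b" using c[OF a(2),of a] c[OF a(4),of b] a(5) by simp
   hence ab: "a = b" using root_power_eq_iff[OF compat e(1),of a b] a(1,3) by simp
   have "x = gi (gp a) * (gp a * x)" by (rule cancel[OF a(2),symmetric])
   also have "... = gi (gp a) * (gp a * y)" by (rule arg_cong[where f = "%w. gi (gp a) * w"],rule a(5)[folded ab])
   also have "... = y" by (rule cancel[OF a(4)])
   finally have "x = y" .
   thus "p = q" using ab by (simp add: cs)
  qed
  show "(%(a,x). gp a * x) ` ({..<e} \<times> MH) = M"
  proof
   show "(%(a,x). gp a * x) ` ({..<e} \<times> MH) <= M" using MM GM[OF gp_closed] MH_M by auto
   show "M <= (%(a,x). gp a * x) ` ({..<e} \<times> MH)"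
   proof
    fix x assume x: "x : M"
    obtain a where a: "a < e" "chiM x = ze e ^ a" using compatible_generatorsD(2)[OF compat e(1) chiM_props(2)[OF x]] by blast
    note g = GM[OF gp_closed[of a]] GM[OF gi_closed[OF gp_closed[of a]]]
    have "chiM (gi (gp a) * x) = 1"
     using chiM_mult[OF g(2) x] chiM_G1[OF gi_closed[OF gp_closed]] chi_gi[OF gp_closed] chi_gp a compatible_generatorsD(4)[OF compat e(1)] by simp
    hence "gi (gp a) * x : MH" using MM[OF g(2) x] by (simp add: MH_def)
    moreover have "gp a * (gi (gp a) * x) = x"
     using M_carrier[OF g(1)] M_carrier[OF g(2)] M_carrier[OF x] gi_right[OF gp_closed,of a] by (simp add: assoc_mult_mat[of _ 2 2 _ 2 _ 2,symmetric])
    ultimately show "x : (%(a,x). gp a * x) ` ({..<e} \<times> MH)" using a(1) by (intro image_eqI[of _ _ "(a,gi (gp a) * x)"]) auto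
   qed
  qed
 qed
 hence "card M = e * card MH" by (metis bij_betw_same_card card_cartesian_product card_lessThan)
 moreover have "card (s ` M) = card M" by (rule card_image,rule inj_on_inverseI[of _ pj]) (rule pi_s)
 ultimately show ?thesis by (simp add: card_MH)
qed

lemma card_nonzero: "of_nat e ~= (0::'k)" "of_nat m ~= (0::'k)" "of_nat (card H) ~= (0::'k)"
 using e(1) m H_finite H_one by auto

lemma inv_el: "h : H ==> inv\<^bsub>lin_group MH\<^esub> (el i h) = el (i * (2 * m - 1)) (gi h)"
proof (rule LMH.inv_equality)
 assume h: "h : H"
 have g: "gi h : H" using LH.inv_closed[of h] inv_LH[OF h] h by simp
 show "el i h : carrier (lin_group MH)" "el (i * (2 * m - 1)) (gi h) : carrier (lin_group MH)" using MH_el H_G1 h g by auto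
 have "zz ^ (i * (2 * m - 1) + i) = 1" unfolding mult_pred_add[OF m2] by (simp only: power_mult[of _ "2 * m" i] zz(1) power_one)
 thus "el (i * (2 * m - 1)) (gi h) \<otimes>\<^bsub>lin_group MH\<^esub> el i h = \<one>\<^bsub>lin_group MH\<^esub>"
  using el_mult[OF H_G1[OF g] H_G1[OF h],of "i * (2 * m - 1)" i] gi_left[OF H_G1[OF h]] by (simp add: el_def one_smult_mat)
qed

lemma gi_H: "h : H ==> gi h : H" using LH.inv_closed[of h] inv_LH[of h] by simp

lemma lift_inv_trace:
 assumes l: "par l j" and h: "h : H"
 shows "trace (snd (lift l j) (inv\<^bsub>lin_group MH\<^esub> (el i h))) = (zz powi (- j)) ^ i * trace (snd l (gi h))"
proof -
 have "(zz powi j) ^ (i * (2 * m - 1)) * (zz powi j) ^ i = 1"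
  unfolding power_add[symmetric] mult_pred_add[OF m2] by (simp only: power_mult[of _ "2 * m" i] zz_powi_power_2m power_one)
 hence "(zz powi j) ^ (i * (2 * m - 1)) = (zz powi (- j)) ^ i"
  using zz(2) by (simp add: power_int_minus power_inverse field_simps)
 thus ?thesis
  using repsH(1)[OF par_reps[OF l] gi_H[OF h]] by (simp add: inv_el[OF h] lift_el[OF l gi_H[OF h]] trace_smult)
qed

lemma neg_mult_neg: "x : carrier_mat 2 2 ==> y : carrier_mat 2 2 ==> neg x * neg y = x * y"
 unfolding neg_def
 by (simp add: mult_smult_assoc_mat[of x 2 2 "(-1) \<cdot>\<^sub>m y" 2] mult_smult_distrib[of x 2 2 y 2] smult_smult_mat one_smult_mat)

lemma gi_neg: "h : G1 ==> gi (neg h) = neg (gi h)"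
proof (rule L.inv_equality)
 assume h: "h : G1"
 show "neg (gi h) \<otimes>\<^bsub>lin_group G1\<^esub> neg h = \<one>\<^bsub>lin_group G1\<^esub>"
  using neg_mult_neg[OF G1_carrier[OF gi_closed[OF h]] G1_carrier[OF h]] gi_left[OF h] by simp
qed (use neg_closed gi_closed in auto)


text \<open>By Frobenius reciprocity the inner product is a sum over \<open>\<zeta>\<^bsub>2m\<^esub>\<^sup>i h\<close>. The sum over \<open>i < m\<close> is geometric with ratio a
power of \<open>\<zeta>\<^bsub>2m\<^esub>\<close>. For an even exponent it vanishes unless \<open>2m\<close> divides the exponent; for an odd one the sum over
\<open>h\<close> vanishes instead, the terms of \<open>h\<close> and \<open>-h\<close> cancelling.\<close>

theorem ip_lift:
 assumes l: "par l j'" and w: "CE.weighted La"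
  and tr: "!!i h. h : H ==> trace (snd La (s (el i h))) = (\<Sum>b<e. (zz powi (q + int (r * b))) ^ i * T b h)"
  and T: "!!b h. h : H ==> T b (neg h) = (-1) powi q * T b h"
 shows "CE.ip (Ind (lift l j')) La
  = of_nat (e * m) * (\<Sum>b<e. if int (2 * m) dvd q + int (r * b) - j' then \<Sum>h\<in>H. trace (snd l (gi h)) * T b h else 0)"
proof -
 define X where "X h = trace (snd l (gi h))" for h
 define n where "n b = q + int (r * b) - j'" for b
 have zp: "(zz powi (- j')) ^ i * (zz powi (q + int (r * b))) ^ i = (zz powi n b) ^ i" for i b
  using zz(2) by (simp add: n_def power_mult_distrib[symmetric] power_int_add[symmetric])
 have "CE.ip (Ind (lift l j')) La = of_nat e * CM.ip (lift l j') (fst La,%x. snd La (s x))" by (rule frobenius[OF lift_reps[OF l] w])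
 also have "CM.ip (lift l j') (fst La,%x. snd La (s x)) = (\<Sum>i<m. \<Sum>h\<in>H. (zz powi (- j')) ^ i * X h * (\<Sum>b<e. (zz powi (q + int (r * b))) ^ i * T b h))"
  unfolding CM.ip_def sum_MH by (intro sum.cong refl) (simp add: lift_inv_trace[OF l] tr X_def)
 also have "... = (\<Sum>i<m. \<Sum>h\<in>H. \<Sum>b<e. (zz powi n b) ^ i * (X h * T b h))"
  unfolding sum_distrib_left zp[symmetric] by (intro sum.cong refl) (simp add: mult_ac)
 also have "... = (\<Sum>i<m. \<Sum>b<e. \<Sum>h\<in>H. (zz powi n b) ^ i * (X h * T b h))" by (intro sum.cong refl sum.swap)
 also have "... = (\<Sum>b<e. \<Sum>i<m. \<Sum>h\<in>H. (zz powi n b) ^ i * (X h * T b h))" by (rule sum.swap)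
 also have "... = (\<Sum>b<e. (\<Sum>i<m. (zz powi n b) ^ i) * (\<Sum>h\<in>H. X h * T b h))"
  by (intro sum.cong refl) (simp add: sum_product)
 also have "... = (\<Sum>b<e. of_nat m * (if int (2 * m) dvd n b then \<Sum>h\<in>H. X h * T b h else 0))"
 proof (intro sum.cong refl)
  fix b
  show "(\<Sum>i<m. (zz powi n b) ^ i) * (\<Sum>h\<in>H. X h * T b h) = of_nat m * (if int (2 * m) dvd n b then \<Sum>h\<in>H. X h * T b h else 0)"
  proof (cases "even (n b)")
   case True
   thus ?thesis by (simp add: geometric)
  next
   case False
   have nd: "~int (2 * m) dvd n b"
   proof
    assume "int (2 * m) dvd n b"
    moreover have "(2::int) dvd int (2 * m)" by simp
    ultimately show False using False dvd_trans by blast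
   qed
   have "odd (j' + q)" using False r(2) by (simp add: n_def)
   hence sg: "(-1::'k) powi j' * (-1) powi q = -1" by (simp add: power_int_add[symmetric] power_int_minus_left)
   have "(\<Sum>h\<in>H. X h * T b h) = (\<Sum>h\<in>H. X (neg h) * T b (neg h))"
    by (rule sum.reindex_bij_betw[symmetric],rule bij_betw_byWitness[where f' = neg]) (use neg_H neg_neg in auto)
   also have "... = (\<Sum>h\<in>H. - (X h * T b h))"
   proof (intro sum.cong refl)
    fix h assume h: "h : H"
    have "X (neg h) = (-1) powi j' * X h"
     using par_neg[OF l gi_H[OF h]] repsH(1)[OF par_reps[OF l] gi_H[OF h]] by (simp add: X_def gi_neg[OF H_G1[OF h]] trace_smult)
    hence "X (neg h) * T b (neg h) = ((-1) powi j' * (-1) powi q) * (X h * T b h)" using T[OF h] by (simp add: mult_ac)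
    thus "X (neg h) * T b (neg h) = - (X h * T b h)" unfolding sg by simp
   qed
   finally have "(\<Sum>h\<in>H. X h * T b h) = - (\<Sum>h\<in>H. X h * T b h)" by (simp add: sum_negf)
   hence "(\<Sum>h\<in>H. X h * T b h) + (\<Sum>h\<in>H. X h * T b h) = - (\<Sum>h\<in>H. X h * T b h) + (\<Sum>h\<in>H. X h * T b h)"
    by (rule arg_cong[where f = "%y. y + (\<Sum>h\<in>H. X h * T b h)"])
   hence "2 * (\<Sum>h\<in>H. X h * T b h) = 0" by (simp only: mult_2 add.left_inverse)
   hence "(\<Sum>h\<in>H. X h * T b h) = 0" by simp
   thus ?thesis using nd by simp
  qed
 qed
 finally show ?thesis unfolding sum_distrib_left[symmetric] n_def X_def of_nat_mult mult.assoc .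
qed

section \<open>The induced representations\<close>

definition II::"('k mat,'k) rep => int => ('e,'k) rep" where "II l j = Ind (lift l j)"

text \<open>The effect of the \<open>b\<close>-th power of \<open>\<rho>\<close>.\<close>

definition twist::"nat => ('k mat,'k) rep => ('k mat,'k) rep" where "twist b l = (fst l,%h. snd l (cj b h))"

lemma II_weighted: "par l j ==> CE.weighted (II l j)"
 unfolding II_def by (rule Ind_weighted[OF lift_reps])

lemma cj_H: "h : H ==> cj b h : H"
proof -
 assume h: "h : H"
 have "cj b h : G1" using G1_mult gi_closed gp_closed H_G1[OF h] by blast
 moreover have "cj b h : MH" using cj_MH[OF GM[OF H_G1[OF h]]] H_MH[OF h] by simp
 ultimately show ?thesis using MH_el[of "cj b h" 0] by (simp add: el_0)
qed

lemma cj_smult: "h : H ==> cj b (c \<cdot>\<^sub>m h) = c \<cdot>\<^sub>m cj b h"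
proof -
 assume h: "h : H"
 note g = G1_carrier[OF gp_closed[of b]] G1_carrier[OF gi_closed[OF gp_closed[of b]]] H_carrier[OF h]
 show ?thesis using mult_smult_distrib[OF g(2,3)] mult_smult_assoc_mat[OF mult_carrier_mat[OF g(2,3)] g(1)] by simp
qed

lemma cj_mult: "x : H ==> y : H ==> cj b (x * y) = cj b x * cj b y"
proof -
 assume x: "x : H" and y: "y : H"
 note g = G1_carrier[OF gp_closed[of b]] G1_carrier[OF gi_closed[OF gp_closed[of b]]] H_carrier[OF x] H_carrier[OF y]
 have "cj b x * cj b y = gi (gp b) * x * ((gp b * gi (gp b)) * y * gp b)"
  using g by (simp add: assoc_mult_mat[of _ 2 2 _ 2 _ 2])
 also have "... = cj b (x * y)" using g gi_right[OF gp_closed,of b] by (simp add: assoc_mult_mat[of _ 2 2 _ 2 _ 2])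
 finally show ?thesis ..
qed

lemma cj_one: "cj b (I2) = I2"
 using gi_left[OF gp_closed,of b] G1_carrier[OF gi_closed[OF gp_closed[of b]]] by simp

lemma twist_reps: "l : reps (lin_group H) ==> twist b l : reps (lin_group H)"
proof -
 assume l: "l : reps (lin_group H)"
 note R = repsH[OF l]
 have "(fst l,%h. snd l (cj b h)) : reps (lin_group H)"
 proof (rule repsI[OF LH.is_group])
  show "snd l (cj b \<one>\<^bsub>lin_group H\<^esub>) = 1\<^sub>m (fst l)" using R(3) cj_one[of b] by simp
  fix g assume "g : carrier (lin_group H)"
  hence g: "g : H" by simp
  show "snd l (cj b g) : carrier_mat (fst l) (fst l)" by (rule R(1)[OF cj_H[OF g]])
  fix h assume "h : carrier (lin_group H)"
  hence h: "h : H" by simp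
  show "snd l (cj b (g \<otimes>\<^bsub>lin_group H\<^esub> h)) = snd l (cj b g) * snd l (cj b h)"
   using R(2)[OF cj_H[OF g] cj_H[OF h],of b b] cj_mult[OF g h,of b] by simp
 qed
 thus ?thesis by (simp add: twist_def)
qed

lemma twist_par: "par l j ==> even (j' - j) ==> par (twist b l) j'"
proof -
 assume l: "par l j" and e: "even (j' - j)"
 have "cj b (scalar (-1)) = scalar (-1)" using cj_smult[OF H_one,of b "-1"] cj_one[of b] by (simp add: scalar_def)
 moreover have "(-1::'k) powi j' = (-1) powi j" using e by (simp add: power_int_minus_left)
 ultimately show ?thesis using l twist_reps[OF par_reps[OF l]] by (simp add: par_def twist_def)
qed

lemma II_trace:
 assumes l: "par l j" and h: "h : H"
 shows "trace (snd (II l j) (s (el i h))) = (\<Sum>a<e. (zz powi (j + int (r * a))) ^ i * trace (snd (twist a l) h))"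
proof -
 have x: "el i h : MH" using MH_el H_G1 h by simp
 have "cc ch (el i h,gp a) * trace (snd (lift l j) (cj a (el i h))) = (zz powi (j + int (r * a))) ^ i * trace (snd (twist a l) h)" for a
 proof -
  have c: "cc ch (el i h,gp a) = (zz ^ (r * a)) ^ i"
   using cc_el[OF ch H_G1[OF h] gp_closed,of i 0 a] by (simp add: el_0 chi_gp r(4)[symmetric] power_mult)
  have k: "cj a (el i h) = el i (cj a h)" unfolding el_def by (rule cj_smult[OF h])
  have "zz powi (j + int (r * a)) = zz powi j * zz ^ (r * a)" unfolding power_int_add[OF disjI1[OF zz(2)]] power_int_of_nat ..
  thus ?thesis
   unfolding k lift_el[OF l cj_H[OF h]] c using repsH(1)[OF par_reps[OF l] cj_H[OF h,of a]]
   by (simp add: trace_smult twist_def power_mult_distrib)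
 qed
 thus ?thesis unfolding II_def Ind_trace[OF lift_reps[OF l] x] by simp
qed

lemma CH_ip: "CH.ip l l' = (\<Sum>h\<in>H. trace (snd l (gi h)) * trace (snd l' h))"
 unfolding CH.ip_def by (rule sum.cong) (simp_all add: inv_LH)

lemma ip_II:
 assumes l: "par l' j'" and l': "par l j"
 shows "CE.ip (II l' j') (II l j)
  = of_nat (e * m) * (\<Sum>b<e. if int (2 * m) dvd j + int (r * b) - j' then CH.ip l' (twist b l) else 0)"
 unfolding CH_ip II_def[of l' j']
proof (rule ip_lift[OF l II_weighted[OF l'] II_trace[OF l']])
 fix b h assume h: "h : H"
 show "trace (snd (twist b l) (neg h)) = (-1) powi j * trace (snd (twist b l) h)"
  using par_neg[OF twist_par[OF l',of j b] h] repsH(1)[OF twist_reps[OF par_reps[OF l']] h,of b] by (simp add: trace_smult twist_def)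
qed

lemma V_reps: "(2,pj) : reps E"
proof (rule repsI[OF X.E.is_group])
 show "pj \<one> = I2" using X.pi_one by simp
 fix y assume y: "y : carrier E"
 show "pj y : carrier_mat 2 2" using X.pi_closed[OF y] M_carrier by simp
 fix z assume z: "z : carrier E"
 show "pj (y \<otimes> z) = pj y * pj z" using X.pi_mult[OF y z] by simp
qed

lemma VH_reps: "(2,%h. h) : reps (lin_group H)"
 by (rule repsI[OF LH.is_group]) (use H_carrier in auto)

lemma tensor_weighted: "CE.weighted La ==> CE.weighted (tensor_rep La (2,pj))"
proof -
 assume w: "CE.weighted La"
 obtain n si where L: "La = (n,si)" by (cases La)
 have "kronecker (si (io a)) (pj (io a)) = co (io a) \<cdot>\<^sub>m 1\<^sub>m (n * 2)" if a: "a ~= 0" for a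
  using CE.weightedD(4)[OF w[unfolded L],of "io a"] a by (simp add: kronecker_smult_left kronecker_one)
 thus ?thesis using tensor_reps[OF X.E.is_group _ V_reps,of La] w by (auto simp: CE.weighted_def L tensor_rep_def)
qed

lemma ip_tensor_sum:
 assumes l: "par l' j'" and l': "par l j"
 shows "CE.ip (II l' j') (tensor_rep (II l j) (2,pj))
  = of_nat (e * m) * (\<Sum>b<e. if int (2 * m) dvd (j + 1) + int (r * b) - j' then \<Sum>h\<in>H. trace (snd l' (gi h)) * (trace (snd (twist b l) h) * trace h) else 0)"
proof -
 let ?T = "%b h. trace (snd (twist b l) h) * trace h"
 have nt: "trace (neg h) = - trace h" if "h : H" for h using H_carrier[OF that] by (simp add: neg_def trace_smult)
 show ?thesis
  unfolding II_def[of l' j']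
 proof (rule ip_lift[OF l tensor_weighted[OF II_weighted[OF l']]])
  fix i h assume h: "h : H"
  have hM: "el i h : M" using el_in_M[OF H_G1[OF h]] .
  have t: "trace (pj (s (el i h))) = zz ^ i * trace h" using pi_s[OF hM] H_carrier[OF h] by (simp add: el_def trace_smult)
  have W: "II l j : reps E" using II_weighted[OF l'] by (simp add: CE.weighted_def)
  have "trace (snd (tensor_rep (II l j) (2,pj)) (s (el i h))) = trace (snd (II l j) (s (el i h))) * (zz ^ i * trace h)"
   using tensor_trace[OF X.E.is_group W V_reps s_closed[OF hM]] t by simp
  also have "... = (\<Sum>b<e. (zz powi (j + 1 + int (r * b))) ^ i * ?T b h)"
   unfolding II_trace[OF l' h] sum_distrib_right
  proof (intro sum.cong refl)
   fix b
   have "zz powi (j + 1 + int (r * b)) = zz powi (j + int (r * b)) * zz"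
    using zz(2) power_int_add_1[of zz "j + int (r * b)"] by (simp add: ac_simps)
   thus "(zz powi (j + int (r * b))) ^ i * trace (snd (twist b l) h) * (zz ^ i * trace h) = (zz powi (j + 1 + int (r * b))) ^ i * ?T b h"
    by (simp add: power_mult_distrib mult_ac)
  qed
  finally show "trace (snd (tensor_rep (II l j) (2,pj)) (s (el i h))) = (\<Sum>b<e. (zz powi (j + 1 + int (r * b))) ^ i * ?T b h)" .
  fix b
  show "?T b (neg h) = (-1) powi (j + 1) * ?T b h"
   using par_neg[OF twist_par[OF l',of j b] h] repsH(1)[OF twist_reps[OF par_reps[OF l']] h,of b] nt[OF h]
   by (simp add: trace_smult twist_def power_int_add_1)
 qed
qed

text \<open>The natural representation restricts to \<open>\<zeta>\<^bsub>2m\<^esub>\<close> as the scalar \<open>\<zeta>\<^bsub>2m\<^esub>\<close>, so tensoring with it raises \<open>j\<close> by one and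
only the summand \<open>b = 0\<close> remains.\<close>

lemma ip_tensor:
 assumes l: "par l' (j + 1)" and l': "par l j"
 shows "CE.ip (II l' (j + 1)) (tensor_rep (II l j) (2,pj)) = of_nat (e * m) * CH.ip l' (tensor_rep l (2,%h. h))"
proof -
 let ?T = "%b h. trace (snd (twist b l) h) * trace h"
 note ip_tensor_sum[OF l l']
 also have "(\<Sum>b<e. if int (2 * m) dvd (j + 1) + int (r * b) - (j + 1) then \<Sum>h\<in>H. trace (snd l' (gi h)) * ?T b h else 0)
   = (\<Sum>b<e. if b = 0 then \<Sum>h\<in>H. trace (snd l' (gi h)) * ?T b h else 0)"
 proof (intro sum.cong refl)
  fix b assume "b : {..<e}"
  hence "r * b < 2 * m" using r(1,3) by (metis lessThan_iff mult_less_cancel1)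
  moreover have "(int (2 * m) dvd (j + 1) + int (r * b) - (j + 1)) \<longleftrightarrow> 2 * m dvd r * b" by (simp flip: int_dvd_int_iff)
  moreover have "r * b = 0 \<longleftrightarrow> b = 0" using r(3) by simp
  ultimately have "(int (2 * m) dvd (j + 1) + int (r * b) - (j + 1)) \<longleftrightarrow> b = 0" by (metis dvd_0_right nat_dvd_not_less neq0_conv)
  thus "(if int (2 * m) dvd (j + 1) + int (r * b) - (j + 1) then \<Sum>h\<in>H. trace (snd l' (gi h)) * ?T b h else 0)
   = (if b = 0 then \<Sum>h\<in>H. trace (snd l' (gi h)) * ?T b h else 0)" by simp
 qed
 also have "... = (\<Sum>h\<in>H. trace (snd l' (gi h)) * ?T 0 h)" using e(1) by simp
 also have "... = CH.ip l' (tensor_rep l (2,%h. h))"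
  unfolding CH_ip
 proof (intro sum.cong refl)
  fix h assume h: "h : H"
  have "cj 0 h = h" using gi_left[OF G1_one] H_carrier[OF h] G1_carrier[OF gi_closed[OF G1_one]] by (simp add: gp_0)
  thus "trace (snd l' (gi h)) * ?T 0 h = trace (snd l' (gi h)) * trace (snd (tensor_rep l (2,%h. h)) h)"
   using tensor_trace[OF LH.is_group par_reps[OF l'] VH_reps,of h] h by (simp add: twist_def)
 qed
 finally show ?thesis .
qed

end

lemma rep_iso_same:
 fixes L L'::"('g,'k::field) rep"
 assumes F: "group F" and L: "L : reps F" and eq: "fst L' = fst L" "!!g. g : carrier F ==> snd L' g = snd L g"
 shows "rep_iso F L L'"
proof -
 obtain n si n' tau where e: "L = (n,si)" "L' = (n',tau)" by (metis surj_pair)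
 have "rep_iso F (n,si) (n,tau)"
 proof (rule rep_isoI[of "1\<^sub>m n"])
  show "1\<^sub>m n : carrier (GL n::'k mat monoid)" by (simp add: carrier_GL)
  fix g assume g: "g : carrier F"
  show "1\<^sub>m n * si g = tau g * 1\<^sub>m n" using repsD(2)[OF L[unfolded e] F g] eq(2)[OF g] by (simp add: e)
 qed
 thus ?thesis using eq(1) by (simp add: e)
qed

lemma iso_class_self: "L : reps F ==> group F ==> L : iso_class F (L::('g,'k::field) rep)"
 unfolding iso_class_def using rep_iso_refl by blast

lemma irreducible_reps: "irreducible_rep F L ==> L : reps F"
 using irreducible_repD(1)[of F "fst L" "snd L"] by simp

context mckay_setting
begin

text \<open>The vertices of \<open>(\<int> \<times> \<Delta>\<^sub>H)\<^sup>e\<^sup>v\<close> are the pairs of such an integer \<open>j\<close> and the class of \<open>l\<close>.\<close>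

definition vd::"('k mat,'k) rep => int => bool" where "vd l j \<longleftrightarrow> irreducible_rep (lin_group H) l & par l j"

abbreviation cH where "cH l \<equiv> iso_class (lin_group H) l"

lemma vdD: "vd l j ==> irreducible_rep (lin_group H) l" "vd l j ==> par l j" "vd l j ==> l : reps (lin_group H)"
 by (auto simp: vd_def par_def)

lemma dvd_small: "b < e ==> int (2 * m) dvd int (r * b) \<longleftrightarrow> b = 0"
proof -
 assume "b < e"
 hence "r * b < 2 * m" using r(1,3) by (metis mult_less_cancel1)
 moreover have "r * b = 0 \<longleftrightarrow> b = 0" using r(3) by simp
 ultimately show ?thesis unfolding int_dvd_int_iff by (metis dvd_0_right nat_dvd_not_less neq0_conv)
qed

lemma cj_0: "h : H ==> cj 0 h = h"
 using gi_left[OF G1_one] H_carrier[of h] G1_carrier[OF gi_closed[OF G1_one]] by (simp add: gp_0)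

lemma CH_ip_cong: "(!!h. h : H ==> trace (snd l' h) = trace (snd l'' h)) ==> CH.ip l l' = CH.ip l l''"
 unfolding CH.ip_def by (rule sum.cong) auto

lemma ip_II_same:
 assumes "par l' j" "par l j"
 shows "CE.ip (II l' j) (II l j) = of_nat (e * m) * CH.ip l' l"
proof -
 have "(\<Sum>b<e. if int (2 * m) dvd j + int (r * b) - j then CH.ip l' (twist b l) else 0) = (\<Sum>b<e. if b = 0 then CH.ip l' (twist b l) else 0)"
  by (intro sum.cong refl) (use dvd_small in simp)
 also have "... = CH.ip l' (twist 0 l)" using e(1) by simp
 also have "... = CH.ip l' l" by (rule CH_ip_cong) (simp add: twist_def cj_0)
 finally show ?thesis unfolding ip_II[OF assms] by simp
qed

lemma orth: "vd l j ==> vd l' j' ==> CH.ip l l' = (if rep_iso (lin_group H) l l' then of_nat (card H) else 0)"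
 using CH.orthogonality vdD CH_weighted by blast

lemma orth_irr: "irreducible_rep (lin_group H) l ==> irreducible_rep (lin_group H) l' ==> CH.ip l l' = (if rep_iso (lin_group H) l l' then of_nat (card H) else 0)"
 using CH.orthogonality irreducible_reps CH_weighted by blast

lemma II_irreducible: "vd l j ==> irreducible_rep E (II l j)"
proof -
 assume l: "vd l j"
 have "CE.ip (II l j) (II l j) = of_nat (card (s ` M))"
  unfolding ip_II_same[OF vdD(2)[OF l] vdD(2)[OF l]] orth[OF l l] card_sM
  using rep_iso_refl[OF vdD(3)[OF l] LH.is_group] by simp
 thus ?thesis by (rule CE.irreducible_criterion[OF II_weighted[OF vdD(2)[OF l]]])
qed

lemma II_reps: "par l j ==> II l j : reps E" using II_weighted by (simp add: CE.weighted_def)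

lemma II_orth: "vd l j ==> vd l' j' ==> CE.ip (II l j) (II l' j') ~= 0 \<longleftrightarrow> rep_iso E (II l j) (II l' j')"
 using CE.orthogonality[OF II_irreducible II_weighted II_irreducible II_weighted,of l j l' j'] vdD(2) CE.card_S by simp

lemma II_cong: "vd l j ==> vd l' j ==> rep_iso (lin_group H) l l' ==> rep_iso E (II l j) (II l' j)"
 using II_orth[of l j l' j] ip_II_same[of l j l'] orth[of l j l' j] vdD(2) card_nonzero by simp

theorem II_mult:
 assumes l': "vd l' (j + 1)" and l: "vd l j"
 shows "multiplicity_in E (iso_class E (II l' (j + 1))) (tensor_rep (II l j) (2,pj)) = multiplicity_in (lin_group H) (cH l') (tensor_rep l (2,%h. h))"
  (is "?a = ?b")
proof -
 have "of_nat ?a * of_nat (card (s ` M)) = CE.ip (II l' (j + 1)) (tensor_rep (II l j) (2,pj))"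
  by (rule CE.multiplicity_ip[OF II_irreducible[OF l'] II_weighted[OF vdD(2)[OF l']] tensor_weighted[OF II_weighted[OF vdD(2)[OF l]]]])
 also have "... = of_nat (e * m) * CH.ip l' (tensor_rep l (2,%h. h))" by (rule ip_tensor[OF vdD(2)[OF l'] vdD(2)[OF l]])
 also have "CH.ip l' (tensor_rep l (2,%h. h)) = of_nat ?b * of_nat (card H)"
  by (rule CH.multiplicity_ip[OF vdD(1)[OF l'] CH_weighted[OF vdD(3)[OF l']] CH_weighted[OF tensor_reps[OF LH.is_group vdD(3)[OF l] VH_reps]],symmetric])
 finally have "of_nat (?a * (e * m * card H)) = (of_nat (?b * (e * m * card H))::'k)" by (simp add: card_sM mult_ac)
 hence "?a * (e * m * card H) = ?b * (e * m * card H)" unfolding of_nat_eq_iff .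
 moreover have "e * m * card H ~= 0" using card_nonzero by auto
 ultimately show ?thesis by simp
qed

section \<open>Conjugation of representations\<close>

lemma cj_comp: "h : H ==> cj a (cj b h) = cj (b + a) h"
proof -
 assume h: "h : H"
 have i: "gi (gp (b + a)) = gi (gp a) * gi (gp b)" using L.inv_mult_group[of "gp b" "gp a"] gp_closed by (simp add: gp_add)
 show ?thesis unfolding i[unfolded gp_add] gp_add
  using G1_carrier[OF gp_closed[of a]] G1_carrier[OF gp_closed[of b]] G1_carrier[OF gi_closed[OF gp_closed[of a]]] G1_carrier[OF gi_closed[OF gp_closed[of b]]] H_carrier[OF h]
  by (simp add: assoc_mult_mat[of _ 2 2 _ 2 _ 2])
qed

lemma cj_e: "h : H ==> cj e h = h"
proof -
 assume h: "h : H"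
 have g: "gp e = neg (I2)" by (simp add: gp_e neg_scalar)
 have gi1: "gi (I2) = I2" using L.inv_one by simp
 have "cj e h = neg (I2) * h * neg (I2)" unfolding g gi_neg[OF G1_one] gi1 ..
 also have "neg (I2) * h = neg h" unfolding neg_scalar using H_carrier[OF h] by (simp add: scalar_mult neg_def)
 also have "neg h * neg (I2) = h" using neg_mult_neg[OF H_carrier[OF h] one_carrier_mat] H_carrier[OF h] by simp
 finally show ?thesis .
qed

lemma cj_mod: "h : H ==> cj a h = cj (a mod e) h"
proof -
 assume h: "h : H"
 have "cj (a mod e + k * e) h = cj (a mod e) h" for k
 proof (induction k)
  case (Suc k)
  have "cj (a mod e + Suc k * e) h = cj e (cj (a mod e + k * e) h)" unfolding cj_comp[OF h] by (simp add: ac_simps)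
  thus ?case using cj_e[OF cj_H[OF h]] Suc by simp
 qed simp
 from this[of "a div e"] show ?thesis by (simp add: ac_simps)
qed

lemma twist_class_cong:
 assumes l: "l : reps (lin_group H)" and eq: "a mod e = b mod e"
 shows "cH (twist a l) = cH (twist b l)"
proof -
 have "rep_iso (lin_group H) (twist a l) (twist b l)"
 proof (rule rep_iso_same[OF LH.is_group twist_reps[OF l]])
  fix h assume "h : carrier (lin_group H)"
  hence h: "h : H" by simp
  show "snd (twist b l) h = snd (twist a l) h" using cj_mod[OF h,of a] cj_mod[OF h,of b] eq by (simp add: twist_def)
 qed (simp add: twist_def)
 thus ?thesis using iso_class_eq_iff[OF LH.is_group twist_reps[OF l] twist_reps[OF l]] by blast
qed

lemma twist_twist:
 assumes l: "l : reps (lin_group H)"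
 shows "cH (twist b (twist a l)) = cH (twist (a + b) l)"
proof -
 have "rep_iso (lin_group H) (twist b (twist a l)) (twist (a + b) l)"
 proof (rule rep_iso_same[OF LH.is_group twist_reps[OF twist_reps[OF l]]])
  fix h assume "h : carrier (lin_group H)"
  hence h: "h : H" by simp
  show "snd (twist (a + b) l) h = snd (twist b (twist a l)) h" using cj_comp[OF h,of a b] by (simp add: twist_def add.commute)
 qed (simp add: twist_def)
 thus ?thesis using iso_class_eq_iff[OF LH.is_group twist_reps[OF twist_reps[OF l]] twist_reps[OF l]] by blast
qed

lemma twist_0: "l : reps (lin_group H) ==> cH (twist 0 l) = cH l"
proof -
 assume l: "l : reps (lin_group H)"
 have "rep_iso (lin_group H) l (twist 0 l)"
  by (rule rep_iso_same[OF LH.is_group l]) (simp_all add: twist_def cj_0)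
 thus ?thesis using iso_class_eq_iff[OF LH.is_group l twist_reps[OF l]] by blast
qed

lemma twist_cong:
 assumes l: "l : reps (lin_group H)" "l' : reps (lin_group H)" and i: "rep_iso (lin_group H) l l'"
 shows "rep_iso (lin_group H) (twist b l) (twist b l')"
proof -
 obtain n si n' tau where c: "l = (n,si)" "l' = (n',tau)" by (metis surj_pair)
 obtain P where P: "n = n'" "P : carrier (GL n)" "!!g. g : H ==> P * si g = tau g * P" using i by (auto simp: c rep_iso_def)
 show ?thesis unfolding c twist_def fst_conv snd_conv P(1)[symmetric]
  by (rule rep_isoI[OF P(2)]) (use P(3) cj_H in simp)
qed

lemma twist_irreducible:
 assumes l: "irreducible_rep (lin_group H) l"
 shows "irreducible_rep (lin_group H) (twist b l)"
proof -
 obtain n si where c: "l = (n,si)" by (cases l)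
 note I = irreducible_repD[OF l[unfolded c]]
 have r: "(n,%h. si (cj b h)) : reps (lin_group H)" using twist_reps[OF irreducible_reps[OF l],of b] by (simp add: twist_def c)
 have surj: "EX x:H. cj b x = g" if g: "g : H" for g
 proof -
  let ?x = "gp b * g * gi (gp b)"
  note cm = G1_carrier[OF gp_closed[of b]] G1_carrier[OF gi_closed[OF gp_closed[of b]]] H_carrier[OF g]
  have x1: "?x : G1" using G1_mult gp_closed gi_closed H_G1[OF g] by blast
  have "cj b ?x = (gi (gp b) * gp b) * g * (gi (gp b) * gp b)" using cm by (simp add: assoc_mult_mat[of _ 2 2 _ 2 _ 2])
  hence x2: "cj b ?x = g" using gi_left[OF gp_closed] cm by simp
  hence "?x : MH" using cj_MH[OF GM[OF x1],of b] H_MH[OF g] by simp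
  hence "?x : H" using MH_el[OF x1,of 0] by (simp add: el_0)
  thus ?thesis using x2 by blast
 qed
 have "W = {0\<^sub>v n} \<or> W = carrier_vec n"
  if W: "subspace class_ring W (module_vec TYPE('k) n)" and inv: "ALL g:H. ALL w:W. si (cj b g) *\<^sub>v w : W" for W
 proof (rule I(3)[OF W])
  fix g w assume "g : carrier (lin_group H)" and w: "w : W"
  then obtain x where "x : H" "cj b x = g" using surj by auto
  thus "si g *\<^sub>v w : W" using inv w by blast
 qed
 thus ?thesis using r I(2) by (simp add: irreducible_rep_def twist_def c)
qed

lemma twist_vd: "vd l j ==> even (j' - j) ==> vd (twist b l) j'"
 using twist_irreducible[of l b] twist_par[of l j j' b] by (simp add: vd_def)

lemma conj_verts_class:
 assumes l: "l : reps (lin_group H)"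
 shows "conj_verts H g1 (cH l) = cH (twist 1 l)"
proof -
 have gi1: "inv\<^bsub>GL 2\<^esub> g1 = gi g1"
  using group.m_inv_consistent[OF group_GL G1(1) g1(1)] by (simp add: lin_group_def)
 have gp1: "gp 1 = g1" using gp_Suc[of 0] G1_carrier[OF g1(1)] by (simp add: gp_0)
 have eq: "iso_class (lin_group H) (n,%h. si (inv\<^bsub>GL 2\<^esub> g1 * h * g1)) = cH (twist 1 l)" if "(n,si) : cH l" for n si
 proof -
  have s: "(n,si) : reps (lin_group H)" "rep_iso (lin_group H) l (n,si)" using that by (auto simp: iso_class_def)
  have t: "(n,%h. si (inv\<^bsub>GL 2\<^esub> g1 * h * g1)) = twist 1 (n,si)" by (simp add: twist_def gi1 gp1[simplified])
  have "cH (twist 1 l) = cH (twist 1 (n,si))"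
   using iso_class_eq_iff[OF LH.is_group twist_reps[OF l] twist_reps[OF s(1)],of 1 1] twist_cong[OF l s,of 1] by blast
  thus ?thesis unfolding t by (rule sym)
 qed
 have self: "l : cH l" by (rule iso_class_self[OF l LH.is_group])
 show ?thesis
  unfolding conj_verts_def
 proof (rule subset_antisym)
  show "(\<Union>(n,si)\<in>cH l. iso_class (lin_group H) (n,%h. si (inv\<^bsub>GL 2\<^esub> g1 * h * g1))) <= cH (twist 1 l)"
  proof (rule UN_least)
   fix p assume p: "p : cH l"
   show "(case p of (n,si) => iso_class (lin_group H) (n,%h. si (inv\<^bsub>GL 2\<^esub> g1 * h * g1))) <= cH (twist 1 l)"
    using eq[of "fst p" "snd p"] p by (simp add: case_prod_beta)
  qed
  have "cH (twist 1 l) = (case l of (n,si) => iso_class (lin_group H) (n,%h. si (inv\<^bsub>GL 2\<^esub> g1 * h * g1)))"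
   using eq[of "fst l" "snd l"] self by (simp add: case_prod_beta)
  thus "cH (twist 1 l) <= (\<Union>(n,si)\<in>cH l. iso_class (lin_group H) (n,%h. si (inv\<^bsub>GL 2\<^esub> g1 * h * g1)))"
   using UN_upper[OF self] by metis
 qed
qed

lemma conj_verts_power: "l : reps (lin_group H) ==> (conj_verts H g1 ^^ n) (cH l) = cH (twist n l)"
proof (induction n)
 case 0
 thus ?case by (simp add: twist_0)
next
 case (Suc n)
 thus ?case using conj_verts_class[OF twist_reps] twist_twist[of l 1 n] by simp
qed

section \<open>Isomorphisms between induced representations\<close>

text \<open>A nonzero inner product needs a nonzero summand, which by orthogonality over \<open>H\<close> is an isomorphism with a twist.\<close>

lemma II_iso_imp:
 assumes l': "vd l' j'" and l: "vd l j" and i: "rep_iso E (II l' j') (II l j)"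
 obtains b where "b < e" "int (2 * m) dvd j + int (r * b) - j'" "cH l' = cH (twist b l)"
proof -
 have "CE.ip (II l' j') (II l j) ~= 0" using II_orth[OF l' l] i by simp
 hence nz: "(\<Sum>b<e. if int (2 * m) dvd j + int (r * b) - j' then CH.ip l' (twist b l) else 0) ~= 0"
  unfolding ip_II[OF vdD(2)[OF l'] vdD(2)[OF l]] by auto
 have "EX b:{..<e}. (if int (2 * m) dvd j + int (r * b) - j' then CH.ip l' (twist b l) else 0) ~= 0"
 proof (rule ccontr)
  assume "~?thesis"
  hence "(\<Sum>b<e. if int (2 * m) dvd j + int (r * b) - j' then CH.ip l' (twist b l) else 0) = 0" by (intro sum.neutral) blast
  thus False using nz by simp
 qed
 then obtain b where b: "b < e" "(if int (2 * m) dvd j + int (r * b) - j' then CH.ip l' (twist b l) else 0) ~= 0" by blast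
 have d: "int (2 * m) dvd j + int (r * b) - j'" and n: "CH.ip l' (twist b l) ~= 0" using b(2) by (auto split: if_splits)
 have "rep_iso (lin_group H) l' (twist b l)" using n orth_irr[OF vdD(1)[OF l'] twist_irreducible[OF vdD(1)[OF l]],of b] by (auto split: if_splits)
 hence "cH l' = cH (twist b l)" using iso_class_eq_iff[OF LH.is_group vdD(3)[OF l'] twist_reps[OF vdD(3)[OF l]]] by blast
 thus thesis using that b(1) d by blast
qed

lemma II_iso_twist:
 assumes l: "vd l j" and b: "b < e" and d: "int (2 * m) dvd j + int (r * b) - j'"
 shows "rep_iso E (II (twist b l) j') (II l j)"
proof -
 have ev: "even (j' - j)"
 proof -
  have "(2::int) dvd int (2 * m)" by simp
  hence "even (j + int (r * b) - j')" using d dvd_trans by blast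
  thus ?thesis using r(2) by simp
 qed
 note l' = twist_vd[OF l ev,of b]
 have "(\<Sum>c<e. if int (2 * m) dvd j + int (r * c) - j' then CH.ip (twist b l) (twist c l) else 0) = (\<Sum>c<e. if c = b then CH.ip (twist b l) (twist c l) else 0)"
 proof (intro sum.cong refl)
  fix c assume c: "c : {..<e}"
  have "int (2 * m) dvd j + int (r * c) - j' \<longleftrightarrow> c = b"
  proof
   assume "int (2 * m) dvd j + int (r * c) - j'"
   hence "int (2 * m) dvd (j + int (r * c) - j') - (j + int (r * b) - j')" using d by (rule dvd_diff)
   hence "int r * int e dvd int r * (int c - int b)" by (simp add: r(1)[symmetric] right_diff_distrib)
   hence "int e dvd int c - int b" using r(3) by simp
   hence "int c mod int e = int b mod int e" by (simp add: mod_eq_dvd_iff)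
   thus "c = b" using b c by (simp flip: zmod_int)
  qed (use d in simp)
  thus "(if int (2 * m) dvd j + int (r * c) - j' then CH.ip (twist b l) (twist c l) else 0) = (if c = b then CH.ip (twist b l) (twist c l) else 0)" by simp
 qed
 also have "... = CH.ip (twist b l) (twist b l)" using b by simp
 also have "... = of_nat (card H)" using orth[OF l' l'] rep_iso_refl[OF vdD(3)[OF l'] LH.is_group] by simp
 finally have "CE.ip (II (twist b l) j') (II l j) ~= 0"
  unfolding ip_II[OF vdD(2)[OF l'] vdD(2)[OF l]] using card_nonzero by simp
 thus ?thesis using II_orth[OF l' l] by simp
qed

section \<open>Every irreducible representation of the given weight is induced\<close>

text \<open>By Schur's lemma \<open>\<zeta>\<^bsub>2m\<^esub>\<close> acts by a scalar on any irreducible constituent of the restriction to \<open>\<mu>\<^bsub>2m\<^esub> H\<close>, which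
therefore stays irreducible over \<open>H\<close>; Frobenius reciprocity embeds the given representation into the induced one.\<close>

theorem II_exhaust:
 assumes irr: "irreducible_rep E La" and w: "CE.weighted La"
 obtains l j where "vd l j" "rep_iso E (II l j) La"
proof -
 let ?R = "(fst La,%x. snd La (s x))"
 have Lar: "(fst La,snd La) : reps E" using w by (simp add: CE.weighted_def)
 note rr = repsD[OF Lar X.E.is_group]
 have n0: "fst La > 0" using irreducible_repD(2)[of E "fst La" "snd La"] irr by simp
 have R: "?R : reps (lin_group MH)"
 proof (rule repsI[OF LMH.is_group])
  show "snd La (s \<one>\<^bsub>lin_group MH\<^esub>) = 1\<^sub>m (fst La)" using rr(4) by (simp add: s_one)
  fix x assume "x : carrier (lin_group MH)"
  hence x: "x : MH" by simp
  show "snd La (s x) : carrier_mat (fst La) (fst La)" by (rule rr(2)[OF s_closed[OF MH_M[OF x]]])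
  fix y assume "y : carrier (lin_group MH)"
  hence y: "y : MH" by simp
  show "snd La (s (x \<otimes>\<^bsub>lin_group MH\<^esub> y)) = snd La (s x) * snd La (s y)"
   using rr(3)[OF s_closed[OF MH_M[OF x]] s_closed[OF MH_M[OF y]]] s_mult_MH[OF MH_M[OF x] y] by simp
 qed
 note Rw = CM_weighted[OF R]
 obtain Ls where Ls: "!!L. L : set Ls ==> irreducible_rep (lin_group MH) L" "rep_iso (lin_group MH) ?R (direct_sum_rep Ls)"
  using CM.maschke[OF Rw] by metis
 have "fst (direct_sum_rep Ls) = fst La" using Ls(2) by (auto simp: rep_iso_def split: prod.splits)
 hence "Ls ~= []" using n0 by (auto simp: direct_sum_rep_def)
 then obtain mm where mmL: "mm : set Ls" by (cases Ls) auto
 have mm: "irreducible_rep (lin_group MH) mm" by (rule Ls(1)[OF mmL])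
 note mmr = irreducible_reps[OF mm]
 have mmR: "(fst mm,snd mm) : reps (lin_group MH)" using mmr by simp
 note rm = repsD[OF mmR LMH.is_group]
 have ipn: "CM.ip mm ?R ~= 0"
 proof -
  have "mm : set (filter (%L. L : iso_class (lin_group MH) mm) Ls)" using mmL iso_class_self[OF mmr LMH.is_group] by simp
  hence "length (filter (%L. L : iso_class (lin_group MH) mm) Ls) ~= 0" by (metis length_0_conv empty_iff list.set(1))
  thus ?thesis using CM.ip_count[OF mm CM_weighted[OF mmr] Rw Ls] CM.card_S by simp
 qed
 \<comment> \<open>This central element acts by a scalar, which is a power of \<open>\<zeta>\<^bsub>2m\<^esub>\<close>.\<close>
 define z where "z = el 1 (I2::'k mat)"
 have zM: "z : MH" using MH_el[OF G1_one,of 1] H_one by (simp add: z_def)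
 obtain \<theta> where \<theta>: "snd mm z = \<theta> \<cdot>\<^sub>m 1\<^sub>m (fst mm)"
 proof (rule schur_scalar[OF LMH.is_group,of "fst mm" "snd mm" "snd mm z"])
  show "irreducible_rep (lin_group MH) (fst mm,snd mm)" using mm by simp
  show "snd mm z : carrier_mat (fst mm) (fst mm)" using rm(2)[of z] zM by simp
  fix x assume "x : carrier (lin_group MH)"
  hence x: "x : MH" by simp
  have "x * z = z * x" using M_carrier[OF MH_M[OF x]]
   by (simp add: z_def el_def mult_smult_assoc_mat[of _ 2 2 _ 2] mult_smult_distrib[of _ 2 2 _ 2])
  thus "snd mm x * snd mm z = snd mm z * snd mm x" using rm(3)[of x z] rm(3)[of z x] x zM by simp
 qed
 have zi: "el i (I2) : MH" for i using MH_el[OF G1_one,of i] H_one by simp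
 have pow: "snd mm (el i (I2)) = \<theta> ^ i \<cdot>\<^sub>m 1\<^sub>m (fst mm)" for i
 proof (induction i)
  case 0
  thus ?case using rm(4) by (simp add: el_0 one_smult_mat)
 next
  case (Suc i)
  have "el (Suc i) (I2) = z * el i (I2)" using el_mult[OF G1_one G1_one,of 1 i] by (simp add: z_def)
  hence "snd mm (el (Suc i) (I2)) = snd mm z * snd mm (el i (I2))" using rm(3)[of z "el i (I2)"] zM zi by simp
  thus ?case unfolding Suc \<theta>
   by (simp add: mult_smult_assoc_mat[of _ "fst mm" "fst mm" _ "fst mm"] smult_smult_mat)
 qed
 have mm0: "fst mm > 0" using irreducible_repD(2)[of "lin_group MH" "fst mm" "snd mm"] mm by simp
 have "el (2 * m) (I2) = I2" by (simp add: el_def zz(1) one_smult_mat)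
 hence "\<theta> ^ (2 * m) \<cdot>\<^sub>m 1\<^sub>m (fst mm) = 1\<^sub>m (fst mm)" using pow[of "2 * m"] rm(4) by simp
 hence "(\<theta> ^ (2 * m) \<cdot>\<^sub>m 1\<^sub>m (fst mm)) $$ (0,0) = 1\<^sub>m (fst mm) $$ (0,0)" by simp
 hence "\<theta> ^ (2 * m) = 1" using mm0 by simp
 then obtain j0 where j0: "\<theta> = zz ^ j0" using zz(4) by blast
 have eli: "snd mm (el i h) = \<theta> ^ i \<cdot>\<^sub>m snd mm h" if h: "h : H" for i h
 proof -
  have "el i h = el i (I2) * h" using el_mult[OF G1_one H_G1[OF h],of i 0] H_carrier[OF h] by (simp add: el_0)
  moreover have cm: "snd mm h : carrier_mat (fst mm) (fst mm)" using rm(2)[of h] H_MH[OF h] by simp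
  ultimately show ?thesis using rm(3)[of "el i (I2)" h] zi H_MH[OF h] left_mult_one_mat[OF cm]
   by (simp add: pow mult_smult_assoc_mat[OF one_carrier_mat cm])
 qed
 have lr: "(fst mm,snd mm) : reps (lin_group H)"
  by (rule repsI[OF LH.is_group]) (use rm H_MH in auto)
 have irrH: "irreducible_rep (lin_group H) mm"
 proof -
  have "W = {0\<^sub>v (fst mm)} \<or> W = carrier_vec (fst mm)"
   if W: "subspace class_ring W (module_vec TYPE('k) (fst mm))" and inv: "ALL g:H. ALL w:W. snd mm g *\<^sub>v w : W" for W
  proof (rule irreducible_repD(3)[of "lin_group MH" "fst mm" "snd mm",OF _ W])
   show "irreducible_rep (lin_group MH) (fst mm,snd mm)" using mm by simp
   fix g w assume "g : carrier (lin_group MH)" and w: "w : W"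
   then obtain i h where g: "h : H" "g = el i h" using MH_cases[of g] by auto
   have cm: "snd mm h : carrier_mat (fst mm) (fst mm)" using rm(2)[of h] H_MH[OF g(1)] by simp
   have wc: "w : carrier_vec (fst mm)" using subspaceD(1)[OF W] w by blast
   have "snd mm g *\<^sub>v w = \<theta> ^ i \<cdot>\<^sub>v (snd mm h *\<^sub>v w)" unfolding g(2) eli[OF g(1)] using cm wc by (intro eq_vecI) (auto simp: scalar_prod_def sum_distrib_left mult.assoc)
   thus "snd mm g *\<^sub>v w : W" using subspaceD(4)[OF W] inv g(1) w by simp
  qed
  note Wf = this
  have "irreducible_rep (lin_group H) (fst mm,snd mm)"
   unfolding irreducible_rep_def prod.case
  proof (intro conjI allI impI)
   show "(fst mm,snd mm) : reps (lin_group H)" "0 < fst mm" by (rule lr,rule mm0)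
   fix W assume "VectorSpace.subspace class_ring W (module_vec TYPE('k) (fst mm))" "ALL g:carrier (lin_group H). ALL w:W. snd mm g *\<^sub>v w : W"
   thus "W = {0\<^sub>v (fst mm)} \<or> W = carrier_vec (fst mm)" by (intro Wf) simp_all
  qed
  thus ?thesis by simp
 qed
 have "scalar (-1) = el m (I2)" by (simp add: el_def zz_m scalar_def)
 hence "snd mm (scalar (-1)) = \<theta> ^ m \<cdot>\<^sub>m 1\<^sub>m (fst mm)" using pow[of m] by simp
 moreover have "\<theta> ^ m = (-1) powi int j0" unfolding j0 by (simp add: power_mult[symmetric] mult.commute[of j0]) (simp add: power_mult zz_m)
 ultimately have v: "vd mm (int j0)" using irrH lr by (simp add: vd_def par_def)
 have "CE.ip (II mm (int j0)) La = of_nat e * CM.ip (lift mm (int j0)) ?R"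
  unfolding II_def by (rule frobenius[OF lift_reps[OF vdD(2)[OF v]] w])
 also have "CM.ip (lift mm (int j0)) ?R = CM.ip mm ?R"
 proof (rule CM.ip_cong_trace)
  fix x assume "x : carrier (lin_group MH)"
  then obtain i h where x: "h : H" "x = el i h" using MH_cases[of x] by auto
  show "trace (snd (lift mm (int j0)) x) = trace (snd mm x)" unfolding x(2) lift_el[OF vdD(2)[OF v] x(1)] eli[OF x(1)] j0 by simp
 qed simp
 finally have "CE.ip (II mm (int j0)) La ~= 0" using ipn card_nonzero by simp
 hence "rep_iso E (II mm (int j0)) La"
  using CE.orthogonality[OF II_irreducible[OF v] II_weighted[OF vdD(2)[OF v]] irr w] by (simp split: if_splits)
 thus thesis using that v by blast
qed

end

section \<open>The isomorphism of quivers\<close>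

text \<open>When the orbits are the fibres of a surjective morphism onto \<open>T\<close> along which arrows lift with any prescribed end,
the isomorphism sends a vertex or an arrow of \<open>T\<close> to its fibre.\<close>

lemma quotient_digraph_iso:
 fixes T::"('a,'b) pre_digraph" and Q::"('c,'d) pre_digraph"
 assumes wfT: "wf_digraph T"
  and wfQ: "!!x. x : arcs Q ==> tail Q x : verts Q" "!!x. x : arcs Q ==> head Q x : verts Q"
  and surj: "Ph ` verts Q = verts T" "Ps ` arcs Q = arcs T"
  and orbits: "!!x. x : verts Q ==> cyclic_orbit (verts Q) F x = {y : verts Q. Ph y = Ph x}"
   "!!x. x : arcs Q ==> cyclic_orbit (arcs Q) F' x = {y : arcs Q. Ps y = Ps x}"
  and comm: "!!x. x : arcs Q ==> Ph (tail Q x) = tail T (Ps x)" "!!x. x : arcs Q ==> Ph (head Q x) = head T (Ps x)"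
  and lift: "!!x y. x : arcs Q ==> y : verts Q ==> Ph y = Ph (tail Q x) ==> EX x':arcs Q. Ps x' = Ps x & tail Q x' = y"
   "!!x y. x : arcs Q ==> y : verts Q ==> Ph y = Ph (head Q x) ==> EX x':arcs Q. Ps x' = Ps x & head Q x' = y"
 shows "digraph_iso T (quotient_quiver Q F F')"
proof -
 define hom where "hom = \<lparr>iso_verts = (%v. {y : verts Q. Ph y = v}),iso_arcs = (%a. {x : arcs Q. Ps x = a}),
  iso_head = image (head Q),iso_tail = image (tail Q)\<rparr>"
 have "pre_digraph.digraph_isomorphism T hom"
  unfolding pre_digraph.digraph_isomorphism_def
 proof (intro conjI ballI wfT)
  show "inj_on (iso_verts hom) (verts T)"
  proof (rule inj_onI)
   fix v w assume v: "v : verts T" and eq: "iso_verts hom v = iso_verts hom w"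
   have "v : Ph ` verts Q" using v by (simp only: surj(1))
   then obtain y where y: "y : verts Q" "Ph y = v" by blast
   hence "y : iso_verts hom w" unfolding eq[symmetric] by (simp add: hom_def)
   thus "v = w" using y by (simp add: hom_def)
  qed
  show "inj_on (iso_arcs hom) (arcs T)"
  proof (rule inj_onI)
   fix v w assume v: "v : arcs T" and eq: "iso_arcs hom v = iso_arcs hom w"
   have "v : Ps ` arcs Q" using v by (simp only: surj(2))
   then obtain y where y: "y : arcs Q" "Ps y = v" by blast
   hence "y : iso_arcs hom w" unfolding eq[symmetric] by (simp add: hom_def)
   thus "v = w" using y by (simp add: hom_def)
  qed
  fix a assume "a : arcs T"
  hence "a : Ps ` arcs Q" by (simp only: surj(2))
  then obtain x where x: "x : arcs Q" "a = Ps x" by blast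
  have "{y : verts Q. Ph y = tail T a} = tail Q ` {x' : arcs Q. Ps x' = a}"
  proof (rule subset_antisym; rule subsetI)
   fix y assume "y : {y : verts Q. Ph y = tail T a}"
   hence "y : verts Q" "Ph y = Ph (tail Q x)" using comm(1)[OF x(1)] x(2) by simp_all
   thus "y : tail Q ` {x' : arcs Q. Ps x' = a}" using lift(1)[OF x(1)] x(2) by fastforce
  next
   fix y assume "y : tail Q ` {x' : arcs Q. Ps x' = a}"
   then obtain x' where "x' : arcs Q" "Ps x' = a" "y = tail Q x'" by blast
   thus "y : {y : verts Q. Ph y = tail T a}" using wfQ(1)[of x'] comm(1)[of x'] by simp
  qed
  thus "iso_verts hom (tail T a) = iso_tail hom (iso_arcs hom a)" by (simp add: hom_def)
  have "{y : verts Q. Ph y = head T a} = head Q ` {x' : arcs Q. Ps x' = a}"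
  proof (rule subset_antisym; rule subsetI)
   fix y assume "y : {y : verts Q. Ph y = head T a}"
   hence "y : verts Q" "Ph y = Ph (head Q x)" using comm(2)[OF x(1)] x(2) by simp_all
   thus "y : head Q ` {x' : arcs Q. Ps x' = a}" using lift(2)[OF x(1)] x(2) by fastforce
  next
   fix y assume "y : head Q ` {x' : arcs Q. Ps x' = a}"
   then obtain x' where "x' : arcs Q" "Ps x' = a" "y = head Q x'" by blast
   thus "y : {y : verts Q. Ph y = head T a}" using wfQ(2)[of x'] comm(2)[of x'] by simp
  qed
  thus "iso_verts hom (head T a) = iso_head hom (iso_arcs hom a)" by (simp add: hom_def)
 qed
 moreover have "quotient_quiver Q F F' = app_iso hom T"
 proof -
  have "cyclic_orbit (verts Q) F ` verts Q = iso_verts hom ` verts T"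
   unfolding surj(1)[symmetric] image_image by (rule image_cong) (simp_all add: hom_def orbits)
  moreover have "cyclic_orbit (arcs Q) F' ` arcs Q = iso_arcs hom ` arcs T"
   unfolding surj(2)[symmetric] image_image by (rule image_cong) (simp_all add: hom_def orbits)
  ultimately show ?thesis by (simp add: quotient_quiver_def app_iso_def hom_def)
 qed
 ultimately show ?thesis unfolding digraph_iso_def by blast
qed

lemma map_prod_power:
 fixes f::"'a => 'a" and g::"'b => 'b"
 shows "(map_prod f g ^^ n) (x,y) = ((f ^^ n) x,(g ^^ n) y)"
 by (induction n) (simp_all only: funpow.simps id_apply comp_apply map_prod_simp)

lemma shift_power: "(shift a ^^ n) j = j + int n * a"
 by (induction n) (auto simp: shift_def algebra_simps)

context mckay_setting
begin

abbreviation cE where "cE L \<equiv> iso_class E L"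
abbreviation Q where "Q \<equiv> Z_Delta_ev H"
abbreviation TM where "TM \<equiv> twisted_McK E io pj"
abbreviation mH where "mH ph l \<equiv> multiplicity_in (lin_group H) ph (tensor_rep l (2,%h. h))"
abbreviation mE where "mE al L \<equiv> multiplicity_in E al (tensor_rep L (2,pj))"

text \<open>By Schur's lemma \<open>-1\<close> acts by a scalar, whose square is \<open>1\<close>.\<close>

lemma parity_cases:
 assumes l: "irreducible_rep (lin_group H) l"
 shows "par l 0 \<or> par l 1"
proof -
 note lr = irreducible_reps[OF l]
 note R = repsH[OF lr]
 have n0: "fst l > 0" using irreducible_repD(2)[of "lin_group H" "fst l" "snd l"] l by simp
 obtain c where c: "snd l (scalar (-1)) = c \<cdot>\<^sub>m 1\<^sub>m (fst l)"
 proof (rule schur_scalar[OF LH.is_group,of "fst l" "snd l" "snd l (scalar (-1))"])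
  show "irreducible_rep (lin_group H) (fst l,snd l)" using l by simp
  show "snd l (scalar (-1)) : carrier_mat (fst l) (fst l)" by (rule R(1)[OF minus_one_H])
  fix g assume "g : carrier (lin_group H)"
  hence g: "g : H" by simp
  have "g * scalar (-1) = scalar (-1) * g" using H_carrier[OF g] by (simp add: scalar_mult)
  thus "snd l g * snd l (scalar (-1)) = snd l (scalar (-1)) * snd l g" using R(2)[OF g minus_one_H] R(2)[OF minus_one_H g] by simp
 qed
 have "scalar (-1) * scalar (-1) = (I2::'k mat)" by (simp add: scalar_mult) (simp add: scalar_def smult_smult_mat one_smult_mat)
 hence "(c \<cdot>\<^sub>m 1\<^sub>m (fst l)) * (c \<cdot>\<^sub>m 1\<^sub>m (fst l)) = 1\<^sub>m (fst l)" using R(2)[OF minus_one_H minus_one_H] R(3) c by simp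
 hence "(c * c) \<cdot>\<^sub>m 1\<^sub>m (fst l) = 1\<^sub>m (fst l)"
  by (simp add: mult_smult_assoc_mat[of _ "fst l" "fst l" _ "fst l"] smult_smult_mat)
 hence "((c * c) \<cdot>\<^sub>m 1\<^sub>m (fst l)) $$ (0,0) = 1\<^sub>m (fst l) $$ (0,0)" by simp
 hence "c * c = 1" using n0 by simp
 hence "c = 1 \<or> c = -1" by (simp add: square_eq_1_iff)
 thus ?thesis using c lr by (auto simp: par_def)
qed

lemma vd_parity: "vd l j ==> vd l j' \<longleftrightarrow> even (j' - j)"
proof -
 assume l: "vd l j"
 have n0: "fst l > 0" using irreducible_repD(2)[of "lin_group H" "fst l" "snd l"] vdD(1)[OF l] by simp
 have "((-1) powi j \<cdot>\<^sub>m 1\<^sub>m (fst l) = (-1) powi j' \<cdot>\<^sub>m (1\<^sub>m (fst l)::'k mat)) \<longleftrightarrow> (-1::'k) powi j = (-1) powi j'"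
 proof
  assume "(-1) powi j \<cdot>\<^sub>m 1\<^sub>m (fst l) = (-1) powi j' \<cdot>\<^sub>m (1\<^sub>m (fst l)::'k mat)"
  hence "((-1) powi j \<cdot>\<^sub>m (1\<^sub>m (fst l)::'k mat)) $$ (0,0) = ((-1) powi j' \<cdot>\<^sub>m 1\<^sub>m (fst l)) $$ (0,0)" by simp
  thus "(-1::'k) powi j = (-1) powi j'" using n0 by simp
 qed simp
 moreover have "(-1::'k) powi j = (-1) powi j' \<longleftrightarrow> even (j' - j)" by (auto simp: power_int_minus_left)
 ultimately show ?thesis using l by (simp add: vd_def par_def)
qed

lemma Irr_vd: "ph : Irr (lin_group H) \<longleftrightarrow> (EX l j. ph = cH l & vd l j)"
proof
 assume "ph : Irr (lin_group H)"
 then obtain l where l: "irreducible_rep (lin_group H) l" "ph = cH l" by (auto simp: Irr_def)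
 thus "EX l j. ph = cH l & vd l j" using parity_cases[OF l(1)] unfolding vd_def by blast
next
 assume "EX l j. ph = cH l & vd l j"
 thus "ph : Irr (lin_group H)" unfolding Irr_def vd_def by blast
qed

lemma even_vertex_iff: "vd l j ==> even_vertex (cH l) \<longleftrightarrow> even j"
proof
 assume l: "vd l j" and ev: "even_vertex (cH l)"
 have "snd l (scalar (-1)) = 1\<^sub>m (fst l)"
  using ev iso_class_self[OF vdD(3)[OF l] LH.is_group] by (auto simp: even_vertex_def case_prod_beta)
 hence "vd l 0" using vdD[OF l] by (simp add: vd_def par_def one_smult_mat)
 thus "even j" using vd_parity[of l 0 j] l by simp
next
 assume l: "vd l j" and "even j"
 hence "vd l 0" using vd_parity[OF l,of 0] by simp
 hence e: "snd l (scalar (-1)) = 1\<^sub>m (fst l)" by (simp add: vd_def par_def one_smult_mat)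
 show "even_vertex (cH l)"
  unfolding even_vertex_def
 proof (intro ballI,clarify)
  fix n si assume "(n,si) : cH l"
  hence s: "(n,si) : reps (lin_group H)" "rep_iso (lin_group H) l (n,si)" by (auto simp: iso_class_def)
  obtain P where P: "n = fst l" "P : carrier (GL n)" "!!g. g : H ==> P * snd l g = si g * P" using s(2) by (auto simp: rep_iso_def case_prod_beta)
  obtain R where R: "R : carrier (GL n)" "P * R = 1\<^sub>m n" using GL_inverse[OF P(2)] by blast
  have sc: "si (scalar (-1)) : carrier_mat n n" using repsD(2)[OF s(1) LH.is_group] minus_one_H by simp
  have "si (scalar (-1)) * P = P" using P(3)[OF minus_one_H] e P(1) GL_carrier_mat[OF P(2)] by simp
  hence "si (scalar (-1)) * (P * R) = P * R"
   using assoc_mult_mat[OF sc GL_carrier_mat[OF P(2)] GL_carrier_mat[OF R(1)]] by simp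
  thus "si (scalar (-1)) = 1\<^sub>m n" using sc by (simp add: R(2))
 qed
qed

lemma verts_Q: "(j,ph) : verts Q \<longleftrightarrow> (EX l. ph = cH l & vd l j)"
proof -
 have "(j,ph) : verts Q \<longleftrightarrow> ph : Irr (lin_group H) & (even j \<longleftrightarrow> even_vertex ph)"
  by (auto simp: Z_Delta_ev_def Delta_def McK_def)
 also have "... \<longleftrightarrow> (EX l. ph = cH l & vd l j)"
 proof
  assume a: "ph : Irr (lin_group H) & (even j \<longleftrightarrow> even_vertex ph)"
  then obtain l j' where l: "ph = cH l" "vd l j'" using Irr_vd by blast
  hence "vd l j" using a even_vertex_iff[OF l(2)] vd_parity[OF l(2),of j] by simp
  thus "EX l. ph = cH l & vd l j" using l by blast
 next
  assume "EX l. ph = cH l & vd l j"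
  then obtain l where "ph = cH l" "vd l j" by blast
  thus "ph : Irr (lin_group H) & (even j \<longleftrightarrow> even_vertex ph)" using Irr_vd[of ph] even_vertex_iff[of l j] by blast
 qed
 finally show ?thesis .
qed

lemma CH_mult_cong:
 assumes l: "l : reps (lin_group H)" and L: "L : cH l" and l': "irreducible_rep (lin_group H) l'"
 shows "mH (cH l') L = mH (cH l') l"
proof -
 have Lr: "L : reps (lin_group H)" and i: "rep_iso (lin_group H) l L" using L by (auto simp: iso_class_def)
 have "CH.ip l' (tensor_rep L (2,%h. h)) = CH.ip l' (tensor_rep l (2,%h. h))"
 proof (rule CH.ip_cong_trace)
  fix g assume g: "g : carrier (lin_group H)"
  show "trace (snd (tensor_rep L (2,%h. h)) g) = trace (snd (tensor_rep l (2,%h. h)) g)"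
   using tensor_trace[OF LH.is_group Lr VH_reps g] tensor_trace[OF LH.is_group l VH_reps g] rep_iso_trace[OF LH.is_group l Lr i g] by simp
 qed simp
 moreover have "of_nat (mH (cH l') L) * of_nat (card H) = CH.ip l' (tensor_rep L (2,%h. h))"
  by (rule CH.multiplicity_ip[OF l' CH_weighted[OF irreducible_reps[OF l']] CH_weighted[OF tensor_reps[OF LH.is_group Lr VH_reps]]])
 moreover have "of_nat (mH (cH l') l) * of_nat (card H) = CH.ip l' (tensor_rep l (2,%h. h))"
  by (rule CH.multiplicity_ip[OF l' CH_weighted[OF irreducible_reps[OF l']] CH_weighted[OF tensor_reps[OF LH.is_group l VH_reps]]])
 ultimately have "(of_nat (mH (cH l') L)::'k) = of_nat (mH (cH l') l)" using card_nonzero(3) by (metis mult_right_cancel)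
 thus ?thesis by (simp only: of_nat_eq_iff)
qed

lemma CE_mult_cong:
 assumes l: "CE.weighted La" and L: "L : cE La" and l': "irreducible_rep E Th" "CE.weighted Th"
 shows "mE (cE Th) L = mE (cE Th) La"
proof -
 have Lar: "La : reps E" using l by (simp add: CE.weighted_def)
 have Lr: "L : reps E" and i: "rep_iso E La L" using L by (auto simp: iso_class_def)
 have Lw: "CE.weighted L" by (rule CE.weighted_iso[OF l Lr i])
 have "CE.ip Th (tensor_rep L (2,pj)) = CE.ip Th (tensor_rep La (2,pj))"
 proof (rule CE.ip_cong_trace)
  fix g assume g: "g : carrier E"
  show "trace (snd (tensor_rep L (2,pj)) g) = trace (snd (tensor_rep La (2,pj)) g)"
   using tensor_trace[OF X.E.is_group Lr V_reps g] tensor_trace[OF X.E.is_group Lar V_reps g] rep_iso_trace[OF X.E.is_group Lar Lr i g] by simp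
 qed simp
 moreover note CE.multiplicity_ip[OF l' tensor_weighted[OF Lw]] CE.multiplicity_ip[OF l' tensor_weighted[OF l]]
 ultimately have "(of_nat (mE (cE Th) L)::'k) = of_nat (mE (cE Th) La)" using CE.card_S by (metis mult_right_cancel)
 thus ?thesis by (simp only: of_nat_eq_iff)
qed

lemma arcs_Q:
 assumes l: "vd l j" and l': "vd l' (j + 1)"
 shows "(j,(cH l,cH l',i)) : arcs Q \<longleftrightarrow> i < mE (cE (II l' (j + 1))) (II l j)"
proof -
 have v: "(j,cH l) : verts Q" "(j + 1,cH l') : verts Q" using verts_Q[of j "cH l"] verts_Q[of "j + 1" "cH l'"] l l' by blast+
 have "(j,(cH l,cH l',i)) : arcs Q \<longleftrightarrow> (EX L:cH l. i < mH (cH l') L)"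
  using v by (auto simp: Z_Delta_ev_def Delta_def McK_def prod_quiver_def Z_quiver_def)
 also have "... \<longleftrightarrow> i < mH (cH l') l"
 proof
  assume "EX L:cH l. i < mH (cH l') L"
  then obtain L where L: "L : cH l" "i < mH (cH l') L" by blast
  thus "i < mH (cH l') l" using CH_mult_cong[OF vdD(3)[OF l] L(1) vdD(1)[OF l']] by simp
 next
  assume "i < mH (cH l') l"
  thus "EX L:cH l. i < mH (cH l') L" using iso_class_self[OF vdD(3)[OF l] LH.is_group] by blast
 qed
 finally show ?thesis unfolding II_mult[OF l' l] .
qed

lemma arcs_Q_verts:
 assumes "(j,(ph,ph',i)) : arcs Q"
 shows "(j,ph) : verts Q" "(j + 1,ph') : verts Q"
 using assms by (auto simp: Z_Delta_ev_def Delta_def McK_def prod_quiver_def Z_quiver_def)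

lemma tail_head_Q: "tail Q (j,(ph,ph',i)) = (j,ph)" "head Q (j,(ph,ph',i)) = (j + 1,ph')"
 by (simp_all add: Z_Delta_ev_def Delta_def McK_def prod_quiver_def Z_quiver_def)

lemma verts_TM: "al : verts TM \<longleftrightarrow> (EX l j. vd l j & al = cE (II l j))"
proof -
 have "al : verts TM \<longleftrightarrow> al : Irr E & (ALL (n,si):al. ALL a:carrier kstar. si (io a) = a \<cdot>\<^sub>m 1\<^sub>m n)"
  by (auto simp: twisted_McK_def)
 also have "... \<longleftrightarrow> (EX l j. vd l j & al = cE (II l j))"
 proof
  assume a: "al : Irr E & (ALL (n,si):al. ALL a:carrier kstar. si (io a) = a \<cdot>\<^sub>m 1\<^sub>m n)"
  then obtain L where L: "irreducible_rep E L" "al = cE L" by (auto simp: Irr_def)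
  note Lr = irreducible_reps[OF L(1)]
  have "ALL a:carrier kstar. snd L (io a) = a \<cdot>\<^sub>m 1\<^sub>m (fst L)"
   using a iso_class_self[OF Lr X.E.is_group] L(2) by (auto simp: case_prod_beta)
  hence w: "CE.weighted L" using Lr co_iota by (auto simp: CE.weighted_def carrier_kstar)
  obtain l j where l: "vd l j" "rep_iso E (II l j) L" using II_exhaust[OF L(1) w] by blast
  hence "cE (II l j) = cE L" using iso_class_eq_iff[OF X.E.is_group II_reps[OF vdD(2)[OF l(1)]] Lr] by blast
  thus "EX l j. vd l j & al = cE (II l j)" using l(1) L(2) by metis
 next
  assume "EX l j. vd l j & al = cE (II l j)"
  then obtain l j where l: "vd l j" "al = cE (II l j)" by blast
  have "si (io a) = a \<cdot>\<^sub>m 1\<^sub>m n" if s: "(n,si) : al" and a: "a : carrier kstar" for n si a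
  proof -
   have "CE.weighted (n,si)" using CE.weighted_iso[OF II_weighted[OF vdD(2)[OF l(1)]],of "(n,si)"] s by (simp add: l(2) iso_class_def)
   thus ?thesis using a co_iota by (simp add: CE.weighted_def carrier_kstar)
  qed
  thus "al : Irr E & (ALL (n,si):al. ALL a:carrier kstar. si (io a) = a \<cdot>\<^sub>m 1\<^sub>m n)"
   using II_irreducible[OF l(1)] l(2) by (auto simp: Irr_def)
 qed
 finally show ?thesis .
qed

lemma arcs_TM_gen: "(al,be,i) : arcs TM \<longleftrightarrow> al : verts TM & be : verts TM & (EX L:al. i < mE be L)"
 by (auto simp: twisted_McK_def McK_def)

lemma arcs_TM:
 assumes l: "vd l j" and l': "vd l' j'"
 shows "(cE (II l j),cE (II l' j'),i) : arcs TM \<longleftrightarrow> i < mE (cE (II l' j')) (II l j)"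
proof -
 note w = II_weighted[OF vdD(2)[OF l]] II_weighted[OF vdD(2)[OF l']]
 have "cE (II l j) : verts TM" "cE (II l' j') : verts TM"
  using verts_TM[of "cE (II l j)"] verts_TM[of "cE (II l' j')"] l l' by blast+
 hence "(cE (II l j),cE (II l' j'),i) : arcs TM \<longleftrightarrow> (EX L:cE (II l j). i < mE (cE (II l' j')) L)"
  using arcs_TM_gen[of "cE (II l j)" "cE (II l' j')" i] by blast
 also have "... \<longleftrightarrow> i < mE (cE (II l' j')) (II l j)"
 proof
  assume "EX L:cE (II l j). i < mE (cE (II l' j')) L"
  then obtain L where L: "L : cE (II l j)" "i < mE (cE (II l' j')) L" by blast
  thus "i < mE (cE (II l' j')) (II l j)" using CE_mult_cong[OF w(1) L(1) II_irreducible[OF l'] w(2)] by simp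
 next
  assume "i < mE (cE (II l' j')) (II l j)"
  thus "EX L:cE (II l j). i < mE (cE (II l' j')) L" using iso_class_self[OF II_reps[OF vdD(2)[OF l]] X.E.is_group] by blast
 qed
 finally show ?thesis .
qed

lemma tail_head_TM: "tail TM (al,be,i) = al" "head TM (al,be,i) = be"
 by (simp_all add: twisted_McK_def McK_def)

lemma wf_TM: "wf_digraph TM"
proof
 fix a assume a: "a : arcs TM"
 obtain al be i where "a = (al,be,i)" by (metis surj_pair)
 thus "tail TM a : verts TM" "head TM a : verts TM" using a arcs_TM_gen tail_head_TM by auto
qed

text \<open>The covering \<open>(\<int> \<times> \<Delta>\<^sub>H)\<^sup>e\<^sup>v \<rightarrow> McK\<^sub>\<eta>(G)\<close> on vertices; the class of the induced representation depends only
on that of \<open>l\<close>.\<close>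

definition Phi::"int \<times> ('k mat,'k) rep set => ('e,'k) rep set" where
 "Phi x = cE (II (SOME l. snd x = cH l & vd l (fst x)) (fst x))"

definition Psi::"int \<times> ('k mat,'k) mckay_arrow => ('e,'k) mckay_arrow" where
 "Psi = (%(j,ph,ph',i). (Phi (j,ph),Phi (j + 1,ph'),i))"

lemma Phi_eq: "vd l j ==> Phi (j,cH l) = cE (II l j)"
proof -
 assume l: "vd l j"
 define l' where "l' = (SOME l'. cH l = cH l' & vd l' j)"
 have l': "cH l = cH l'" "vd l' j" using someI[of "%l'. cH l = cH l' & vd l' j" l] l unfolding l'_def by blast+
 have "rep_iso (lin_group H) l l'" using iso_class_eq_iff[OF LH.is_group vdD(3)[OF l] vdD(3)[OF l'(2)]] l'(1) by blast
 hence "cE (II l j) = cE (II l' j)"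
  using iso_class_eq_iff[OF X.E.is_group II_reps[OF vdD(2)[OF l]] II_reps[OF vdD(2)[OF l'(2)]]] II_cong[OF l l'(2)] by blast
 thus ?thesis by (simp add: Phi_def l'_def)
qed

lemma dvd_shift: "int (2 * m) dvd int r * k \<longleftrightarrow> int e dvd k"
proof -
 have "int (2 * m) = int r * int e" by (simp flip: r(1))
 thus ?thesis using r(3) by simp
qed

text \<open>Every translate of \<open>j\<close> by a multiple of \<open>2m/e\<close> occurs in a given class of induced representations.\<close>

lemma shift_rep:
 assumes l: "vd l j" and k: "j' = j + int r * k"
 obtains l' where "vd l' j'" "cE (II l' j') = cE (II l j)" "cH l' = cH (twist (nat (k mod int e)) l)"
proof -
 define b where "b = nat (k mod int e)"
 have bk: "int b = k mod int e" using e(1) by (simp add: b_def)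
 have b: "b < e" using e(1) by (simp add: b_def nat_less_iff)
 have "j + int (r * b) - j' = int r * (int b - k)" by (simp add: k algebra_simps)
 moreover have "int e dvd int b - k" unfolding bk by (simp add: mod_eq_dvd_iff[symmetric])
 ultimately have d: "int (2 * m) dvd j + int (r * b) - j'" using dvd_shift by simp
 have v: "vd (twist b l) j'" by (rule twist_vd[OF l]) (use r(2) k in simp)
 have "cE (II (twist b l) j') = cE (II l j)"
  using iso_class_eq_iff[OF X.E.is_group II_reps[OF vdD(2)[OF v]] II_reps[OF vdD(2)[OF l]]] II_iso_twist[OF l b d] by blast
 thus thesis using that[OF v] b_def by blast
qed

text \<open>The condition on the integers says that the shift is a multiple of \<open>2m/e\<close>, and the twist is the same multiple of
\<open>\<rho>\<close> because \<open>\<rho>\<^sup>e\<close> is conjugation with the central element \<open>-1\<close>.\<close>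

lemma Phi_eqD:
 assumes l: "vd l j" and l': "vd l' j'" and eq: "cE (II l' j') = cE (II l j)"
 shows "EX k. j' = j + int r * k" "j' = j + int (n * r) ==> cH l' = cH (twist n l)"
proof -
 have i: "rep_iso E (II l' j') (II l j)"
  using iso_class_eq_iff[OF X.E.is_group II_reps[OF vdD(2)[OF l']] II_reps[OF vdD(2)[OF l]]] eq by blast
 obtain b where b: "b < e" "int (2 * m) dvd j + int (r * b) - j'" "cH l' = cH (twist b l)" using II_iso_imp[OF l' l i] by blast
 obtain c where c: "j + int (r * b) - j' = int (2 * m) * c" using b(2) by blast
 have "int (2 * m) = int r * int e" by (simp flip: r(1))
 hence "j' = j + int r * (int b - int e * c)" using c by (simp add: algebra_simps)
 thus "EX k. j' = j + int r * k" by blast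
 assume j': "j' = j + int (n * r)"
 have "j + int (r * b) - j' = int r * (int b - int n)" by (simp add: j' algebra_simps)
 hence "int e dvd int b - int n" using b(2) dvd_shift by simp
 hence "int b mod int e = int n mod int e" by (simp add: mod_eq_dvd_iff)
 hence "b mod e = n mod e" by (simp flip: zmod_int)
 thus "cH l' = cH (twist n l)" unfolding b(3) by (rule twist_class_cong[OF vdD(3)[OF l]])
qed

abbreviation FV where "FV \<equiv> map_prod (shift (2 * int m div int e)) (conj_verts H g1)"
abbreviation FA where "FA \<equiv> map_prod (shift (2 * int m div int e)) (conj_arcs H g1)"

lemma shift_r: "2 * int m div int e = int r" by (simp add: r_def zdiv_int)

lemma FV_power: "l : reps (lin_group H) ==> (FV ^^ n) (j,cH l) = (j + int (n * r),cH (twist n l))"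
 by (simp add: map_prod_power shift_power shift_r conj_verts_power)

lemma conj_arcs_power: "(conj_arcs H g1 ^^ n) (ph,ph',i) = ((conj_verts H g1 ^^ n) ph,(conj_verts H g1 ^^ n) ph',i)"
 by (induction n) (auto simp: conj_arcs_def)

lemma FA_power: "l : reps (lin_group H) ==> l' : reps (lin_group H) ==>
  (FA ^^ n) (j,cH l,cH l',i) = (j + int (n * r),cH (twist n l),cH (twist n l'),i)"
 by (simp add: map_prod_power shift_power shift_r conj_arcs_power conj_verts_power)

lemma FV_Phi:
 assumes l: "vd l j"
 shows "Phi (j + int (n * r),cH (twist n l)) = Phi (j,cH l)"
proof -
 obtain l' where l': "vd l' (j + int (n * r))" "cE (II l' (j + int (n * r))) = cE (II l j)" "cH l' = cH (twist (nat (int n mod int e)) l)"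
  by (rule shift_rep[OF l,of "j + int (n * r)" "int n"]) (simp_all add: mult.commute)
 have "nat (int n mod int e) = n mod e" by (simp flip: zmod_int)
 hence "cH l' = cH (twist n l)" using l'(3) twist_class_cong[OF vdD(3)[OF l],of "n mod e" n] by simp
 thus ?thesis using Phi_eq[OF l'(1)] Phi_eq[OF l] l'(2) by simp
qed

lemma int_shift_cases:
 assumes "j' = j + int r * k"
 obtains n where "j' = j + int (n * r)" | n where "j = j' + int (n * r)"
proof (cases "k >= 0")
 case True
 hence "j' = j + int (nat k * r)" using assms by (simp add: mult.commute)
 thus thesis using that(1) by blast
next
 case False
 hence "j = j' + int (nat (- k) * r)" using assms by (simp add: algebra_simps)
 thus thesis using that(2) by blast
qed

theorem twisted_McK_iso: "digraph_iso TM (quotient_quiver Q FV FA)"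
proof (rule quotient_digraph_iso[where Ph = Phi and Ps = Psi])
 show "wf_digraph TM" by (rule wf_TM)
 have arc_cases: "EX l l' j i. x = (j,cH l,cH l',i) & vd l j & vd l' (j + 1) & i < mE (cE (II l' (j + 1))) (II l j)" if x: "x : arcs Q" for x
 proof -
  obtain j ph ph' i where c: "x = (j,ph,ph',i)" by (metis surj_pair)
  obtain l l' where l: "ph = cH l" "vd l j" "ph' = cH l'" "vd l' (j + 1)"
   using arcs_Q_verts[OF x[unfolded c]] verts_Q[of j ph] verts_Q[of "j + 1" ph'] by blast
  thus ?thesis using arcs_Q[OF l(2,4),of i] x c by blast
 qed
 have vert_cases: "EX l j. x = (j,cH l) & vd l j" if "x : verts Q" for x
  using that verts_Q[of "fst x" "snd x"] by (cases x) auto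
 have Psi_eq: "Psi (j,cH l,cH l',i) = (cE (II l j),cE (II l' (j + 1)),i)" if "vd l j" "vd l' (j + 1)" for j l l' i
  using Phi_eq[OF that(1)] Phi_eq[OF that(2)] by (simp add: Psi_def)
 have same_mult: "mE (cE (II l2' (j' + 1))) (II l' j') = mE (cE (II l2 (j + 1))) (II l j)"
  if "vd l j" "vd l2 (j + 1)" "vd l' j'" "vd l2' (j' + 1)" "cE (II l' j') = cE (II l j)" "cE (II l2' (j' + 1)) = cE (II l2 (j + 1))"
  for l l2 l' l2' j j'
  using CE_mult_cong[OF II_weighted[OF vdD(2)[OF that(1)]] _ II_irreducible[OF that(2)] II_weighted[OF vdD(2)[OF that(2)]],of "II l' j'"]
   iso_class_self[OF II_reps[OF vdD(2)[OF that(3)]] X.E.is_group] that(5,6) by simp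
 show "tail Q x : verts Q" "head Q x : verts Q" if x: "x : arcs Q" for x
 proof -
  obtain j ph ph' i where c: "x = (j,ph,ph',i)" by (metis surj_pair)
  show "tail Q x : verts Q" "head Q x : verts Q" using arcs_Q_verts[OF x[unfolded c]] unfolding c tail_head_Q .
 qed
 show "Phi (tail Q x) = tail TM (Psi x)" "Phi (head Q x) = head TM (Psi x)" if "x : arcs Q" for x
  using arc_cases[OF that] by (auto simp: tail_head_Q tail_head_TM Psi_def)
 show "Phi ` verts Q = verts TM"
 proof (rule subset_antisym; rule subsetI)
  fix al assume "al : Phi ` verts Q"
  then obtain l j where "vd l j" "al = Phi (j,cH l)" using vert_cases by blast
  thus "al : verts TM" using Phi_eq[of l j] verts_TM[of al] by blast
 next
  fix al assume "al : verts TM"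
  then obtain l j where l: "vd l j" "al = cE (II l j)" using verts_TM[of al] by blast
  have "(j,cH l) : verts Q" using verts_Q[of j "cH l"] l(1) by blast
  moreover have "al = Phi (j,cH l)" using Phi_eq[OF l(1)] l(2) by simp
  ultimately show "al : Phi ` verts Q" by (rule rev_image_eqI)
 qed
 show "Psi ` arcs Q = arcs TM"
 proof (rule subset_antisym; rule subsetI)
  fix a assume "a : Psi ` arcs Q"
  then obtain x where x: "x : arcs Q" "a = Psi x" by blast
  obtain l l' j i where c: "x = (j,cH l,cH l',i)" "vd l j" "vd l' (j + 1)" "i < mE (cE (II l' (j + 1))) (II l j)" using arc_cases[OF x(1)] by blast
  show "a : arcs TM" unfolding x(2) c(1) Psi_eq[OF c(2,3)] arcs_TM[OF c(2,3)] by (rule c(4))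
 next
  fix a assume a: "a : arcs TM"
  obtain al be i where ca: "a = (al,be,i)" by (metis surj_pair)
  obtain l j l2 j2 where l: "vd l j" "al = cE (II l j)" and l2: "vd l2 j2" "be = cE (II l2 j2)"
   using a arcs_TM_gen[of al be i] verts_TM[of al] verts_TM[of be] unfolding ca by blast
  have i: "i < mE be (II l j)" using a arcs_TM[OF l(1) l2(1),of i] unfolding ca l(2) l2(2) by blast
  have mu: "of_nat (mE be (II l j)) * of_nat (card (s ` M)) = CE.ip (II l2 j2) (tensor_rep (II l j) (2,pj))"
   unfolding l2(2) by (rule CE.multiplicity_ip[OF II_irreducible[OF l2(1)] II_weighted[OF vdD(2)[OF l2(1)]] tensor_weighted[OF II_weighted[OF vdD(2)[OF l(1)]]]])
  have "CE.ip (II l2 j2) (tensor_rep (II l j) (2,pj)) ~= 0"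
   unfolding mu[symmetric] using i CE.card_S by simp
  hence nz: "(\<Sum>b<e. if int (2 * m) dvd (j + 1) + int (r * b) - j2 then \<Sum>h\<in>H. trace (snd l2 (gi h)) * (trace (snd (twist b l) h) * trace h) else 0) ~= 0"
   unfolding ip_tensor_sum[OF vdD(2)[OF l2(1)] vdD(2)[OF l(1)]] by auto
  have "EX b. int (2 * m) dvd (j + 1) + int (r * b) - j2"
  proof (rule ccontr)
   assume "~?thesis"
   hence "(\<Sum>b<e. if int (2 * m) dvd (j + 1) + int (r * b) - j2 then \<Sum>h\<in>H. trace (snd l2 (gi h)) * (trace (snd (twist b l) h) * trace h) else 0) = 0"
    by (intro sum.neutral) simp
   thus False using nz by contradiction
  qed
  then obtain b c where "(j + 1) + int (r * b) - j2 = int (2 * m) * c" by blast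
  moreover have "int (2 * m) = int r * int e" by (simp flip: r(1))
  ultimately have j1: "j + 1 = j2 + int r * (int e * c - int b)" by (simp add: algebra_simps)
  obtain l' where l': "vd l' (j + 1)" "cE (II l' (j + 1)) = cE (II l2 j2)" "cH l' = cH (twist (nat ((int e * c - int b) mod int e)) l2)" by (rule shift_rep[OF l2(1) j1])
  have "(j,cH l,cH l',i) : arcs Q" unfolding arcs_Q[OF l(1) l'(1)] l'(2) using i l2(2) by simp
  moreover have "a = Psi (j,cH l,cH l',i)" unfolding Psi_eq[OF l(1) l'(1)] ca l(2) l2(2) l'(2) ..
  ultimately show "a : Psi ` arcs Q" by (rule rev_image_eqI)
 qed
 show "cyclic_orbit (verts Q) FV x = {y : verts Q. Phi y = Phi x}" if x: "x : verts Q" for x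
 proof (rule subset_antisym; rule subsetI)
  obtain l j where l: "x = (j,cH l)" "vd l j" using vert_cases[OF x] by blast
  fix y assume "y : cyclic_orbit (verts Q) FV x"
  then obtain n where y: "y : verts Q" "(FV ^^ n) x = y \<or> (FV ^^ n) y = x" by (auto simp: cyclic_orbit_def)
  obtain l' j' where l': "y = (j',cH l')" "vd l' j'" using vert_cases[OF y(1)] by blast
  show "y : {y : verts Q. Phi y = Phi x}"
   using y FV_power[OF vdD(3)[OF l(2)],of n j] FV_power[OF vdD(3)[OF l'(2)],of n j'] FV_Phi[OF l(2),of n] FV_Phi[OF l'(2),of n]
   unfolding l(1) l'(1) by auto
 next
  obtain l j where l: "x = (j,cH l)" "vd l j" using vert_cases[OF x] by blast
  fix y assume "y : {y : verts Q. Phi y = Phi x}"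
  hence y: "y : verts Q" "Phi y = Phi x" by auto
  obtain l' j' where l': "y = (j',cH l')" "vd l' j'" using vert_cases[OF y(1)] by blast
  have eq: "cE (II l' j') = cE (II l j)" using y(2) Phi_eq[OF l(2)] Phi_eq[OF l'(2)] l(1) l'(1) by simp
  obtain k where k: "j' = j + int r * k" using Phi_eqD(1)[OF l(2) l'(2) eq] by blast
  have "EX n. (FV ^^ n) x = y \<or> (FV ^^ n) y = x"
  proof (rule int_shift_cases[OF k])
   fix n assume n: "j' = j + int (n * r)"
   have "(FV ^^ n) x = y" unfolding l(1) l'(1) FV_power[OF vdD(3)[OF l(2)]] Phi_eqD(2)[OF l(2) l'(2) eq n] n ..
   thus ?thesis by blast
  next
   fix n assume n: "j = j' + int (n * r)"
   have "(FV ^^ n) y = x" unfolding l(1) l'(1) FV_power[OF vdD(3)[OF l'(2)]] Phi_eqD(2)[OF l'(2) l(2) eq[symmetric] n] n ..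
   thus ?thesis by blast
  qed
  thus "y : cyclic_orbit (verts Q) FV x" using y(1) by (simp add: cyclic_orbit_def)
 qed
 show "cyclic_orbit (arcs Q) FA x = {y : arcs Q. Psi y = Psi x}" if x: "x : arcs Q" for x
 proof (rule subset_antisym; rule subsetI)
  obtain l l2 j i where l: "x = (j,cH l,cH l2,i)" "vd l j" "vd l2 (j + 1)" using arc_cases[OF x] by blast
  fix y assume "y : cyclic_orbit (arcs Q) FA x"
  then obtain n where y: "y : arcs Q" "(FA ^^ n) x = y \<or> (FA ^^ n) y = x" by (auto simp: cyclic_orbit_def)
  obtain l' l2' j' i' where l': "y = (j',cH l',cH l2',i')" "vd l' j'" "vd l2' (j' + 1)" using arc_cases[OF y(1)] by blast
  have P: "Psi ((FA ^^ n) (j,cH l,cH l2,i)) = Psi (j,cH l,cH l2,i)" if "vd l j" "vd l2 (j + 1)" for l l2 j i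
   using FV_Phi[OF that(1),of n] FV_Phi[OF that(2),of n] FA_power[OF vdD(3)[OF that(1)] vdD(3)[OF that(2)],of n j i] by (simp add: Psi_def ac_simps)
  show "y : {y : arcs Q. Psi y = Psi x}" using y P[OF l(2,3),of i] P[OF l'(2,3),of i'] l(1) l'(1) by auto
 next
  obtain l l2 j i where l: "x = (j,cH l,cH l2,i)" "vd l j" "vd l2 (j + 1)" using arc_cases[OF x] by blast
  fix y assume "y : {y : arcs Q. Psi y = Psi x}"
  hence y: "y : arcs Q" "Psi y = Psi x" by auto
  obtain l' l2' j' i' where l': "y = (j',cH l',cH l2',i')" "vd l' j'" "vd l2' (j' + 1)" using arc_cases[OF y(1)] by blast
  have eq: "cE (II l' j') = cE (II l j)" "cE (II l2' (j' + 1)) = cE (II l2 (j + 1))" "i' = i"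
   using y(2) Psi_eq[OF l(2,3)] Psi_eq[OF l'(2,3)] unfolding l(1) l'(1) by auto
  obtain k where k: "j' = j + int r * k" using Phi_eqD(1)[OF l(2) l'(2) eq(1)] by blast
  have "EX n. (FA ^^ n) x = y \<or> (FA ^^ n) y = x"
  proof (rule int_shift_cases[OF k])
   fix n assume n: "j' = j + int (n * r)"
   hence n1: "j' + 1 = (j + 1) + int (n * r)" by simp
   have "(FA ^^ n) x = y"
    unfolding l(1) l'(1) FA_power[OF vdD(3)[OF l(2)] vdD(3)[OF l(3)]] Phi_eqD(2)[OF l(2) l'(2) eq(1) n] Phi_eqD(2)[OF l(3) l'(3) eq(2) n1] n eq(3) ..
   thus ?thesis by blast
  next
   fix n assume n: "j = j' + int (n * r)"
   hence n1: "j + 1 = (j' + 1) + int (n * r)" by simp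
   have "(FA ^^ n) y = x"
    unfolding l(1) l'(1) FA_power[OF vdD(3)[OF l'(2)] vdD(3)[OF l'(3)]] Phi_eqD(2)[OF l'(2) l(2) eq(1)[symmetric] n] Phi_eqD(2)[OF l'(3) l(3) eq(2)[symmetric] n1] n eq(3) ..
   thus ?thesis by blast
  qed
  thus "y : cyclic_orbit (arcs Q) FA x" using y(1) by (simp add: cyclic_orbit_def)
 qed
 show "EX x':arcs Q. Psi x' = Psi x & tail Q x' = y" if x: "x : arcs Q" and y: "y : verts Q" and eq: "Phi y = Phi (tail Q x)" for x y
 proof -
  obtain l l2 j i where l: "x = (j,cH l,cH l2,i)" "vd l j" "vd l2 (j + 1)" "i < mE (cE (II l2 (j + 1))) (II l j)" using arc_cases[OF x] by blast
  obtain l' j' where l': "y = (j',cH l')" "vd l' j'" using vert_cases[OF y] by blast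
  have eq1: "cE (II l' j') = cE (II l j)" using eq Phi_eq[OF l(2)] Phi_eq[OF l'(2)] by (simp add: l(1) l'(1) tail_head_Q)
  obtain k where k: "j' = j + int r * k" using Phi_eqD(1)[OF l(2) l'(2) eq1] by blast
  hence k1: "j' + 1 = (j + 1) + int r * k" by simp
  obtain l2' where l2': "vd l2' (j' + 1)" "cE (II l2' (j' + 1)) = cE (II l2 (j + 1))" "cH l2' = cH (twist (nat (k mod int e)) l2)" by (rule shift_rep[OF l(3) k1])
  have "(j',cH l',cH l2',i) : arcs Q"
   unfolding arcs_Q[OF l'(2) l2'(1)] same_mult[OF l(2,3) l'(2) l2'(1) eq1 l2'(2)] by (rule l(4))
  moreover have "Psi (j',cH l',cH l2',i) = Psi x" unfolding l(1) Psi_eq[OF l(2,3)] Psi_eq[OF l'(2) l2'(1)] eq1 l2'(2) ..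
  ultimately show ?thesis using l'(1) tail_head_Q by metis
 qed
 show "EX x':arcs Q. Psi x' = Psi x & head Q x' = y" if x: "x : arcs Q" and y: "y : verts Q" and eq: "Phi y = Phi (head Q x)" for x y
 proof -
  obtain l l2 j i where l: "x = (j,cH l,cH l2,i)" "vd l j" "vd l2 (j + 1)" "i < mE (cE (II l2 (j + 1))) (II l j)" using arc_cases[OF x] by blast
  obtain l2' j2 where l2': "y = (j2,cH l2')" "vd l2' j2" using vert_cases[OF y] by blast
  define j' where "j' = j2 - 1"
  have j2: "j2 = j' + 1" by (simp add: j'_def)
  note v2 = l2'(2)[unfolded j2]
  have eq1: "cE (II l2' (j' + 1)) = cE (II l2 (j + 1))" using eq Phi_eq[OF l(3)] Phi_eq[OF v2] by (simp add: l(1) l2'(1) tail_head_Q j2)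
  obtain k where "j' + 1 = j + 1 + int r * k" using Phi_eqD(1)[OF l(3) v2 eq1] by blast
  hence k: "j' = j + int r * k" by simp
  obtain l' where l': "vd l' j'" "cE (II l' j') = cE (II l j)" "cH l' = cH (twist (nat (k mod int e)) l)" by (rule shift_rep[OF l(2) k])
  have "(j',cH l',cH l2',i) : arcs Q"
   unfolding arcs_Q[OF l'(1) v2] same_mult[OF l(2,3) l'(1) v2 l'(2) eq1] by (rule l(4))
  moreover have "Psi (j',cH l',cH l2',i) = Psi x" unfolding l(1) Psi_eq[OF l(2,3)] Psi_eq[OF l'(1) v2] eq1 l'(2) ..
  ultimately show ?thesis using l2'(1) tail_head_Q j2 by metis
 qed
qed

end

lemma group_dual_group:
 assumes G: "group G"
 shows "group (dual_group G::('a => 'k::field) monoid)"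
proof (rule groupI)
 interpret G: group G by fact
 let ?D = "dual_group G::('a => 'k) monoid"
 have D: "f : carrier ?D \<longleftrightarrow> (ALL x:carrier G. f x ~= 0) & (ALL x:carrier G. ALL y:carrier G. f (x \<otimes>\<^bsub>G\<^esub> y) = f x * f y) & f : extensional (carrier G)" for f
  by (auto simp: Hom_group_def hom_def carrier_kstar)
 have m: "(f \<otimes>\<^bsub>?D\<^esub> g) x = f x * g x" if "x : carrier G" for f g x using that by (simp add: Hom_group_def)
 have me: "f \<otimes>\<^bsub>?D\<^esub> g : extensional (carrier G)" for f g by (simp add: Hom_group_def)
 have o: "\<one>\<^bsub>?D\<^esub> = (\<lambda>x\<in>carrier G. 1)" by (simp add: Hom_group_def)
 show "\<one>\<^bsub>?D\<^esub> : carrier ?D" unfolding D o by simp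
 fix f assume f: "f : carrier ?D"
 show "\<one>\<^bsub>?D\<^esub> \<otimes>\<^bsub>?D\<^esub> f = f"
  by (rule extensionalityI[of _ "carrier G"]) (use f D in "auto simp: me m o")
 show "EX g:carrier ?D. g \<otimes>\<^bsub>?D\<^esub> f = \<one>\<^bsub>?D\<^esub>"
 proof (rule bexI[of _ "\<lambda>x\<in>carrier G. inverse (f x)"])
  show "(\<lambda>x\<in>carrier G. inverse (f x)) : carrier ?D" using f unfolding D by simp
  show "(\<lambda>x\<in>carrier G. inverse (f x)) \<otimes>\<^bsub>?D\<^esub> f = \<one>\<^bsub>?D\<^esub>"
   by (rule extensionalityI[of _ "carrier G"]) (use f[unfolded D] in "auto simp: me m o")
 qed
 fix g assume g: "g : carrier ?D"
 show "f \<otimes>\<^bsub>?D\<^esub> g : carrier ?D"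
  unfolding D using f[unfolded D] g[unfolded D] by (simp add: m me mult_ac)
 fix h assume h: "h : carrier ?D"
 show "f \<otimes>\<^bsub>?D\<^esub> g \<otimes>\<^bsub>?D\<^esub> h = f \<otimes>\<^bsub>?D\<^esub> (g \<otimes>\<^bsub>?D\<^esub> h)"
  by (rule extensionalityI[of _ "carrier G"]) (simp_all add: m me mult.assoc)
qed

lemma dual_group_pow:
 fixes f::"'a => 'k::field"
 shows "x : carrier G ==> (f [^]\<^bsub>dual_group G\<^esub> (n::nat)) x = f x ^ n"
proof (induction n)
 case 0
 thus ?case by (simp add: Hom_group_def)
next
 case (Suc n)
 thus ?case by (simp add: Hom_group_def)
qed

lemma pow_mat_lin_group: "A : carrier_mat 2 2 ==> A ^\<^sub>m n = A [^]\<^bsub>lin_group K\<^esub> (n::nat)"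
 by (induction n) (auto simp: nat_pow_def)

lemma (in mu_setting) twisted_quiver:
 fixes E::"'e monoid"
 assumes et: "et : carrier (Hom_group A B)" and g1: "g1 : G1"
  and ch: "ch = character_of ze m G1 et" and e: "e = group.ord (dual_group (lin_group G1)) ch"
  and K: "K = kernel (lin_group G1) kstar ch"
  and chg1: "ch g1 = ze e" and g1e: "g1 ^\<^sub>m e = scalar (- 1)"
  and E: "central_extension (lin_group M) E io pj"
  and cls: "extension_class (lin_group M) E io pj = class_of_hom ze m G1 et"
 shows "digraph_iso (twisted_McK E io pj)
  (quotient_quiver (Z_Delta_ev K) (map_prod (shift (2 * int m div int e)) (conj_verts K g1))
    (map_prod (shift (2 * int m div int e)) (conj_arcs K g1)))"
proof -
 have chi: "chi et = ch" by (simp add: chi_def ch)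
 note good = chi_good[OF et,unfolded chi]
 interpret D: group "dual_group (lin_group G1)::('k mat => 'k) monoid" by (rule group_dual_group[OF L.is_group])
 have chD: "ch : carrier (dual_group (lin_group G1))"
  using good(2) goodD(1,2)[OF good(1)] by (auto simp: Hom_group_def hom_def carrier_kstar)
 have pow1: "ch [^]\<^bsub>dual_group (lin_group G1)\<^esub> n = \<one>\<^bsub>dual_group (lin_group G1)\<^esub> \<longleftrightarrow> (ALL g:G1. ch g ^ n = 1)" for n::nat
 proof
  assume a: "ch [^]\<^bsub>dual_group (lin_group G1)\<^esub> n = \<one>\<^bsub>dual_group (lin_group G1)\<^esub>"
  show "ALL g:G1. ch g ^ n = 1"
  proof
   fix g assume g: "g : G1"
   show "ch g ^ n = 1" using fun_cong[OF a,of g] dual_group_pow[of g "lin_group G1" ch n] g by (simp add: Hom_group_def)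
  qed
 next
  assume a: "ALL g:G1. ch g ^ n = 1"
  have x: "ch [^]\<^bsub>dual_group (lin_group G1)\<^esub> n : carrier (dual_group (lin_group G1))" using D.nat_pow_closed[OF chD] .
  show "ch [^]\<^bsub>dual_group (lin_group G1)\<^esub> n = \<one>\<^bsub>dual_group (lin_group G1)\<^esub>"
  proof (rule extensionalityI[of _ G1])
   show "ch [^]\<^bsub>dual_group (lin_group G1)\<^esub> n : extensional G1" using x by (simp add: Hom_group_def)
   show "\<one>\<^bsub>dual_group (lin_group G1)\<^esub> : extensional G1" by (simp add: Hom_group_def)
   fix g assume g: "g : G1"
   show "(ch [^]\<^bsub>dual_group (lin_group G1)\<^esub> n) g = \<one>\<^bsub>dual_group (lin_group G1)\<^esub> g"
    using dual_group_pow[of g "lin_group G1" ch n] g a by (simp add: Hom_group_def)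
  qed
 qed
 have ord: "(ALL g:G1. ch g ^ n = 1) \<longleftrightarrow> e dvd n" for n
  using D.pow_eq_id[OF chD,of n] pow1[of n] e by simp
 have em: "e dvd m" using ord[of m] goodD(4)[OF good(1)] by blast
 have e0: "e > 0" using em m by (metis dvd_0_left_iff neq0_conv)
 have che: "ch g ^ e = 1" if "g : G1" for g using ord[of e] that by simp
 have ccE: "cc ch : extension_class (lin_group M) E io pj"
 proof -
  interpret C: comm_group "cocycle_group (lin_group M)::('k mat \<times> 'k mat => 'k) monoid" by (rule cocycle_comm_group[OF LM.is_group])
  show ?thesis unfolding cls class_of_hom_eq[OF et] chi
   by (rule C.rcos_self[OF cc_cocycle[OF good(1)] coboundaries_subgroup[OF LM.is_group]])
 qed
 obtain s where s: "s : M \<rightarrow> carrier E" "ALL x:M. pj (s x) = x" "ALL x:M. ALL y:M. s x \<otimes>\<^bsub>E\<^esub> s y = io (cc ch (x,y)) \<otimes>\<^bsub>E\<^esub> s (x * y)"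
  using ccE by (auto simp: extension_class_def)
 interpret X: central_ext "lin_group M" E io pj by (rule central_ext.intro[OF E LM.is_group])
 have g1p: "g1 [^]\<^bsub>lin_group G1\<^esub> e = scalar (- 1)" using g1e pow_mat_lin_group[OF G1_carrier[OF g1]] by metis
 interpret K: mckay_setting ze m G1 E io pj ch s g1 e
 proof (intro mckay_setting.intro mckay_setting_axioms.intro mu_setting_axioms X.central_ext_axioms)
  show "good ch" by (rule good(1))
 qed (use s e0 em che g1 chg1 g1p in auto)
 have "K = K.H" unfolding K K.H_def kernel_def by simp
 thus ?thesis using K.twisted_McK_iso by simp
qed

theorem proposition6p1:
  fixes \<zeta> :: "nat \<Rightarrow> 'k::{alg_closed_field, field_char_0}"
    and m :: nat
    and G1 :: "'k mat set"
  assumes "compatible_generators \<zeta>"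
    and "m > 0"
    and "subgroup G1 (GL 2)" and "G1 \<subseteq> SL 2" and "finite G1"
    and "\<not> comm_group (lin_group G1)"
  shows "class_of_hom \<zeta> m G1
           \<in> iso (Hom_group (roots_group m) (dual_group (lin_group G1 Mod minus_one_group)))
                 (H2 (lin_group (mu_G1 m G1)))
    \<and> (\<forall>\<eta> \<in> carrier (Hom_group (roots_group m) (dual_group (lin_group G1 Mod minus_one_group))).
        \<forall>g1 \<in> G1. \<forall>\<chi> e H. \<forall>(E :: 'e monoid) \<iota> \<pi>.
          \<chi> = character_of \<zeta> m G1 \<eta> \<longrightarrow>
          e = group.ord (dual_group (lin_group G1)) \<chi> \<longrightarrow>
          H = kernel (lin_group G1) kstar \<chi> \<longrightarrow>
          \<chi> g1 = \<zeta> e \<longrightarrow>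
          g1 ^\<^sub>m e = scalar (- 1) \<longrightarrow>
          central_extension (lin_group (mu_G1 m G1)) E \<iota> \<pi> \<longrightarrow>
          extension_class (lin_group (mu_G1 m G1)) E \<iota> \<pi> = class_of_hom \<zeta> m G1 \<eta> \<longrightarrow>
          digraph_iso
            (twisted_McK E \<iota> \<pi>)
            (quotient_quiver (Z_Delta_ev H)
              (map_prod (shift (2 * int m div int e)) (conj_verts H g1))
              (map_prod (shift (2 * int m div int e)) (conj_arcs H g1))))"
proof -
  interpret mu_setting \<zeta> m G1 by (rule mu_setting.intro) (rule assms)+
  show ?thesis using class_of_hom_iso twisted_quiver by blast
qed

end
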